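(* Let $G$ be a ring network and let $\sigma$ be a finite-support prior that the agents have on $n$. If the protocol "Knowledge Sharing in a Ring" (described in the context) is an equilibrium for $2$-Knowledge Sharing in $G$, then the algorithm "Coloring in a Ring" (described in the context) is an equilibrium for Coloring in $G$.
   Context: **Network and agents.** The network is a bidirectional ring with $n$ nodes ($n$ always denotes the actual number of nodes). Each node is an agent with unlimited computational power. Agents communicate over edges in synchronous rounds and all start at round $0$. Initially each agent knows its own id and private input (including its preference), but not those of other agents. Private information comes from a finite set, and each agent's prior over the private information of the others is uniform. The agents do not know $n$ but know a prior $\sigma$ on $\mathbb{N}$ with $n\sim\sigma$. The prior $\sigma$ has *finite support* if $\{x:\Pr[n=x]>0\}\subseteq[\alpha,\beta]$ for some $\alpha,\beta\in\mathbb{N}$. **Outputs and utilities.** Agent $a$ outputs $o_a$ ($\bot$ means it aborts). Output vectors are $O=(o_1,\dots,o_n)\in\Theta=\Theta_L\sqcup\Theta_E$, where $\Theta_L$ is the set of legal and $\Theta_E$ the set of erroneous output vectors. Each agent $a$ has a single preferred output value $p_a$ and utility $u_a(O)=1$ if $o_a=p_a$ and $O\in\Theta_L$, and $u_a(O)=0$ otherwise. An agent that detects that another agent deviated outputs $\bot$, which makes the output erroneous. **Equilibrium.** For a step $s$ (the entire operation of an agent in one round) of agent $a$ at round $r$ of an execution, $\mathbb{E}_{s,r}[u_a]=\sum_{O\in\Theta}x_O(s,r)u_a(O)$, where $x_O(s,r)$ is the probability, estimated by $a$ at round $r$, that $O$ is output if $a$ takes step $s$ and all other agents follow the algorithm.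 An algorithm $\Lambda$ whose next step at round $r$ is $s(r)$ is a (distributed) equilibrium if for every agent $a$, every round $r$ of every possible execution in which all steps up to round $r$ were according to $\Lambda$, and every deviating step $\bar s$: $\mathbb{E}_{s(r),r}[u_a]\ge \mathbb{E}_{\bar s,r}[u_a]$. Only a single agent deviates (no coalitions). **Duplication (Sybil attack).** A deviating agent may pretend to be $d$ agents, by simulating $d$ imaginary agents with fake ids and distributing its edges among them. The other agents then execute the algorithm as if on the enlarged ring, of size $n'=n+d-1$. Fake id collisions are disregarded. The cheater still produces a single output, and legality is judged on the output vector of the $n$ real agents. Duplication takes place only during the initial phase in which ids and ring size are learned. If $n'=d+n-1>\beta$, the duplication is detected and the output is erroneous. **Coloring.** $O\in\Theta_L$ iff $o_a\ne\bot$ for all $a$ and $o_a\neq o_b$ for every edge $(a,b)$. Each agent $a$ prefers a specific color $p_a$; there are at least $3$ possible colors. **$2$-Knowledge Sharing.** Each agent $a$ has a private input $i_a$; all agents have the same function $q$ with $|\mathrm{range}(q)|=2$, and the output space is known to all agents. An output vector is legal iff all agents output the same value $\neq\bot$. The output is correct if every agent outputs $q(I)$, with $I$ the inputs of all agents. The function $q$ satisfies the Full Knowledge property: for any number $m$ of inputs, any $1\le j\le m$ and any fixed $(x_1,\dots,x_{j-1},x_{j+1},\dots,x_m)$, the number $|\{x_j : q(x_1,\dots,x_m)=y\}|$ is the same for every $y$ in the range of $q$ (inputs being uniform). Each agent $a$ prefers a certain output value $p_a$. **Secret-Transmit$(i_a,r,b)$.** Agent $a$ selects a random number $R_a$ and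 sets $X_a=R_a\oplus i_a$. It sends $R_a$ clockwise and $X_a$ counter-clockwise, each being forwarded until it reaches the agent just before $b$. At round $r-1$ the two neighbors of $b$ simultaneously send these two values to $b$, so $b$ learns $i_a$ at round $r$. **Protocol "Knowledge Sharing in a Ring"** (with a global orientation). (1) All agents execute Wake-Up, a preliminary phase after which every agent knows the ids of all agents and the size $n'$ of the ring (possibly including duplicated agents). (2) For each agent $a$ let $b^1_a$ be the clockwise neighbor of $a$ and $b^2_a$ the agent at distance $\lfloor n'/2\rfloor$ counter-clockwise from $a$. (3) Each agent $a$ simultaneously performs Secret-Transmit$(i_a,n',b^1_a)$ and Secret-Transmit$(i_a,n',b^2_a)$. (4) At round $n'+1$ each agent sends its input around the ring. (5) At round $2n'$ each agent outputs $q(I)$. **Algorithm "Coloring in a Ring".** (1) Every agent sends its id to both neighbors. (2) Every id is forwarded in the other direction until all agents know the vector of ids around the ring and its length $n'$ (which may include duplicates). This vector is sent across the ring for validation; an agent finding an inconsistency outputs $\bot$. The orientation of the ring is set to be from the agent with the highest id towards its neighbor with the lowest id. (3) Every agent sends its preference $p_a$ to both neighbors. (4) Preferences are forwarded until all agents know the vector $\vec p$ of all preferences. (5) $\vec p$ is sent across the ring again; an agent finding an inconsistency outputs $\bot$. (6) If $n'$ is odd and all agents have the same preferred color: every agent $a$ sends a random integer $w_a\in[0,n'-1]$ in the direction of the orientation; these are forwarded until all agents know all of them; the vector of all $w_a$ is sent across the ring, and an agent finding an inconsistency outputs $\bot$ and aborts. The "sink" $s$ is the agent with the $w$-th largest id,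 where $w=(\sum_a w_a)\bmod n'$. (7) The agents flip a shared coin with result $b\in\{0,1\}$, using the protocol "Knowledge Sharing in a Ring" with each agent's input a random bit and $q(I)=\sum_{i\in I} i \bmod 2$. (8) (Notation.) Let $C$ denote a (maximal) group of consecutive agents with the same preferred color, excluding $s$ if a sink exists, with members $c_1,\dots,c_{|C|}$ in the order of the orientation. If $C$ is the entire ring, $c_1$ is the agent with maximum id. (9) For every group $C$, each agent $c_i$ with $i\bmod 2=b$ (except $s$, if there is a sink) sets its output to its preferred color and sends it to its neighbors. An agent with no neighbor preferring its color (i.e. $c_1$ of a group with $|C|=1$) also outputs its preferred color in this round. (10) All agents that have not yet output a color set their output to the minimum available color and send it to their neighbors, except for: the sink $s$ if it exists, and the last agent $c_{|C|}$ of every group $C$. (11) For every group $C$, the agent $c_{|C|}$, if it has not yet set its output, sets it to the minimum available color and sends it to its neighbors. (12) If a sink $s$ exists, it sets its output to the minimal available color. *)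

theory Defs
  imports "HOL-Probability.Probability"
begin

section \<open>Agents on a synchronous ring\<close>

text \<open>Each agent sends one message per round over each of its two edges; \<open>Silent\<close> is the
  absence of a message.\<close>

datatype msg =
    Silent
  | Id nat
  | Ids "nat list"
  | Val nat
  | Vals "nat list"
  | Shares "nat option" "nat option"

text \<open>A step: the random numbers drawn, the output if it is set in this round
  (\<open>Some None\<close> is the output \<open>\<bottom>\<close>, \<open>Some (Some c)\<close> the output \<open>c\<close>),
  and the messages sent clockwise and counter-clockwise.\<close>

datatype action =
  Act (coins: "nat list") (decide: "nat option option") (to_cw: msg) (to_ccw: msg)

text \<open>All that an agent knows at round \<open>r\<close>: its id, its private information, and for each round
  \<open>k < r\<close> its own step together with the messages that reach it at round \<open>k + 1\<close>, first the one
  from its counter-clockwise neighbour, then the one from its clockwise neighbour.\<close>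

datatype 'p view = View (own_id: nat) (priv: 'p) (hist: "(action \<times> msg \<times> msg) list")

type_synonym 'p strategy = "'p view \<Rightarrow> action pmf"

primrec independent :: "'a pmf list \<Rightarrow> 'a list pmf" where
  "independent [] = return_pmf []"
| "independent (p # ps) = bind_pmf p (\<lambda>x. map_pmf (\<lambda>xs. x # xs) (independent ps))"

text \<open>A configuration lists the views of the real agents in clockwise order.\<close>

definition deliver :: "'p view list \<Rightarrow> action list \<Rightarrow> 'p view list" where
  "deliver vs as = (let n = length vs in
     map (\<lambda>i. View (own_id (vs ! i)) (priv (vs ! i))
            (hist (vs ! i) @
              [(as ! i, to_cw (as ! ((i + n - 1) mod n)), to_ccw (as ! ((i + 1) mod n)))]))
       [0..<n])"

text \<open>Agent \<open>0\<close> uses \<open>D\<close>, all other agents use \<open>A\<close>. The messages of agent \<open>0\<close> are unrestricted, so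
  a Sybil attack needs no separate notion: simulating \<open>d\<close> agents between its two edges is one of
  the things that \<open>D\<close> can do.\<close>

definition one_round :: "'p strategy \<Rightarrow> 'p strategy \<Rightarrow> 'p view list \<Rightarrow> 'p view list pmf" where
  "one_round D A vs = map_pmf (deliver vs) (independent (D (hd vs) # map A (tl vs)))"

primrec exec :: "'p strategy \<Rightarrow> 'p strategy \<Rightarrow> nat \<Rightarrow> 'p view list \<Rightarrow> 'p view list pmf" where
  "exec D A 0 vs = return_pmf vs"
| "exec D A (Suc k) vs = bind_pmf (one_round D A vs) (exec D A k)"

text \<open>The output of an agent is the first one that it sets; \<open>None\<close> stands for \<open>\<bottom>\<close> and also for
  an agent that has set no output.\<close>

definition decided :: "(action \<times> msg \<times> msg) list \<Rightarrow> bool" where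
  "decided h \<longleftrightarrow> (\<exists>e\<in>set h. decide (fst e) \<noteq> None)"

definition final_output :: "'p view \<Rightarrow> nat option" where
  "final_output v = (case find (\<lambda>e. decide (fst e) \<noteq> None) (hist v) of
       None \<Rightarrow> None
     | Some e \<Rightarrow> the (decide (fst e)))"


section \<open>Expected utility and equilibrium\<close>

text \<open>The prior: the size of the ring has distribution \<open>\<sigma>\<close>, the ids are distinct elements of
  \<open>ID\<close>, the private information of each agent is an element of \<open>P\<close>, both uniform.\<close>

definition prior :: "nat set \<Rightarrow> 'p set \<Rightarrow> nat pmf \<Rightarrow> 'p view list pmf" where
  "prior ID P \<sigma> =
     bind_pmf \<sigma> (\<lambda>n.
     bind_pmf (pmf_of_set {xs. length xs = n \<and> distinct xs \<and> set xs \<subseteq> ID}) (\<lambda>xs.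
     bind_pmf (pmf_of_set {ps. length ps = n \<and> set ps \<subseteq> P}) (\<lambda>ps.
     return_pmf (map2 (\<lambda>x p. View x p []) xs ps))))"

definition honest_run :: "nat set \<Rightarrow> 'p set \<Rightarrow> nat pmf \<Rightarrow> 'p strategy \<Rightarrow> nat \<Rightarrow> 'p view list pmf" where
  "honest_run ID P \<sigma> A r = bind_pmf (prior ID P \<sigma>) (exec A A r)"

text \<open>What agent \<open>0\<close> believes about the configuration at round \<open>r\<close>, its own view being \<open>h\<close>.\<close>

definition belief ::
    "nat set \<Rightarrow> 'p set \<Rightarrow> nat pmf \<Rightarrow> 'p strategy \<Rightarrow> nat \<Rightarrow> 'p view \<Rightarrow> 'p view list pmf" where
  "belief ID P \<sigma> A r h = cond_pmf (honest_run ID P \<sigma> A r) {vs. hd vs = h}"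

text \<open>The distribution \<open>O \<mapsto> x\<^sub>O\<close> of the output vector of the real agents as estimated by agent
  \<open>0\<close> at round \<open>r\<close>, if it acts according to \<open>D\<close> from round \<open>r\<close> on; outputs are read off \<open>T\<close> rounds
  later.\<close>

definition output_dist ::
    "nat set \<Rightarrow> 'p set \<Rightarrow> nat pmf \<Rightarrow> 'p strategy \<Rightarrow> nat \<Rightarrow> 'p view \<Rightarrow> 'p strategy \<Rightarrow> nat
      \<Rightarrow> nat option list pmf" where
  "output_dist ID P \<sigma> A r h D T =
     map_pmf (map final_output) (bind_pmf (belief ID P \<sigma> A r h) (exec D A T))"

definition utility :: "(nat option list \<Rightarrow> bool) \<Rightarrow> nat \<Rightarrow> nat option list \<Rightarrow> real" where
  "utility legal p os = (if hd os = Some p \<and> legal os then 1 else 0)"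

definition expected_utility ::
    "(nat option list \<Rightarrow> bool) \<Rightarrow> nat \<Rightarrow> nat option list pmf \<Rightarrow> real" where
  "expected_utility legal p X = measure_pmf.expectation X (utility legal p)"

fun msg_ids :: "msg \<Rightarrow> nat set" where
  "msg_ids (Id x) = {x}"
| "msg_ids (Ids xs) = set xs"
| "msg_ids _ = {}"

definition known_ids :: "'p view \<Rightarrow> nat set" where
  "known_ids v = insert (own_id v) (\<Union>(a, m, m')\<in>set (hist v). msg_ids m \<union> msg_ids m')"

text \<open>Collisions of fake ids with ids of real agents are disregarded: an id used by the deviating
  agent is one that it knows already or a fake one, and fake ids lie outside \<open>ID\<close>.\<close>

definition no_collision :: "nat set \<Rightarrow> 'p strategy \<Rightarrow> bool" where
  "no_collision ID D \<longleftrightarrow>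
     (\<forall>v. \<forall>a\<in>set_pmf (D v). (msg_ids (to_cw a) \<union> msg_ids (to_ccw a)) \<inter> ID \<subseteq> known_ids v)"

text \<open>\<open>A\<close> is an equilibrium in the ring of \<open>N\<close> nodes: at no round \<open>r\<close> of an execution of \<open>A\<close> in this
  ring an agent gains by a deviating step. Every agent is agent \<open>0\<close> in its own coordinates. \<open>D\<close> is
  the deviating step at round \<open>r\<close> together with the agent's own behaviour afterwards, which a Sybil
  attack requires to be arbitrary as well. The agent does not know \<open>N\<close>: only the views \<open>h\<close> are
  those of the ring of \<open>N\<close> nodes, the expectation is over all sizes.\<close>

definition equilibrium ::
    "nat set \<Rightarrow> 'p set \<Rightarrow> nat pmf \<Rightarrow> (nat option list \<Rightarrow> bool) \<Rightarrow> ('p \<Rightarrow> nat) \<Rightarrow> 'p strategy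
      \<Rightarrow> nat \<Rightarrow> bool" where
  "equilibrium ID P \<sigma> legal pref A N \<longleftrightarrow>
     (\<forall>r h D. (\<exists>vs\<in>set_pmf (honest_run ID P \<sigma> A r). length vs = N \<and> hd vs = h) \<longrightarrow>
        no_collision ID D \<longrightarrow>
        (\<forall>\<^sub>F T in sequentially.
           expected_utility legal (pref (priv h)) (output_dist ID P \<sigma> A r h D T)
         \<le> expected_utility legal (pref (priv h)) (output_dist ID P \<sigma> A r h A T)))"


section \<open>Building blocks of the protocols\<close>

definition from_ccw :: "(action \<times> msg \<times> msg) list \<Rightarrow> nat \<Rightarrow> msg" where
  "from_ccw h k = (if 1 \<le> k \<and> k \<le> length h then fst (snd (h ! (k - 1))) else Silent)"

definition from_cw :: "(action \<times> msg \<times> msg) list \<Rightarrow> nat \<Rightarrow> msg" where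
  "from_cw h k = (if 1 \<le> k \<and> k \<le> length h then snd (snd (h ! (k - 1))) else Silent)"

fun id_of :: "msg \<Rightarrow> nat" where
  "id_of (Id x) = x"
| "id_of _ = 0"

fun val :: "msg \<Rightarrow> nat" where
  "val (Val x) = x"
| "val _ = 0"

definition idle :: action where
  "idle = Act [] None Silent Silent"

definition abort :: action where
  "abort = Act [] (Some None) Silent Silent"

text \<open>In a pair of outgoing messages the first one goes to the front (the next agent in the
  direction of the orientation) and the second one to the back; \<open>fwd\<close> tells whether the front is
  the clockwise neighbour.\<close>

definition send :: "bool \<Rightarrow> nat list \<Rightarrow> msg \<times> msg \<Rightarrow> action" where
  "send fwd cs mm = (if fwd then Act cs None (fst mm) (snd mm) else Act cs None (snd mm) (fst mm))"

text \<open>Random numbers drawn at round \<open>t\<close> and remembered afterwards.\<close>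

definition draw_at :: "(action \<times> msg \<times> msg) list \<Rightarrow> nat \<Rightarrow> nat list pmf \<Rightarrow> nat list pmf" where
  "draw_at h t X = (if length h = t then X else return_pmf (coins (fst (h ! t))))"

definition drawn :: "(action \<times> msg \<times> msg) list \<Rightarrow> nat \<Rightarrow> nat list \<Rightarrow> nat list" where
  "drawn h t cs = (if length h = t then cs else [])"

text \<open>In what follows \<open>B k\<close> and \<open>F k\<close> are the messages that arrive from the back and from the front
  at step \<open>k\<close> of a phase; the phases are shifted to their starting round by \<open>after\<close>.

  In a flood all agents send a message both ways and forward what they get, so at step \<open>k\<close> the
  messages of the agents at distance \<open>k\<close> arrive. In a ring of \<open>m\<close> agents it is complete at step
  \<open>m - 1\<close>, each message having come from both sides.\<close>

definition after :: "nat \<Rightarrow> (nat \<Rightarrow> msg) \<Rightarrow> nat \<Rightarrow> msg" where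
  "after t G k = G (t + k)"

definition flood :: "msg \<Rightarrow> (nat \<Rightarrow> msg) \<Rightarrow> (nat \<Rightarrow> msg) \<Rightarrow> nat \<Rightarrow> msg \<times> msg" where
  "flood M B F s = (if s = 0 then (M, M) else (B s, F s))"

definition flood_ok :: "nat \<Rightarrow> msg set \<Rightarrow> (nat \<Rightarrow> msg) \<Rightarrow> (nat \<Rightarrow> msg) \<Rightarrow> bool" where
  "flood_ok m X B F \<longleftrightarrow> (\<forall>k\<in>{1..<m}. B k \<in> X \<and> B k = F (m - k))"

text \<open>Validation of a vector that has been sent across the ring.\<close>

definition agree :: "nat \<Rightarrow> msg \<Rightarrow> (nat \<Rightarrow> msg) \<Rightarrow> (nat \<Rightarrow> msg) \<Rightarrow> bool" where
  "agree m M B F \<longleftrightarrow> (\<forall>k\<in>{1..<m}. B k = M \<and> F k = M)"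

text \<open>The vector, in the common numbering of the ring, of the own value of agent \<open>j\<close> and the values
  \<open>g k\<close> of the agents that are \<open>k\<close> steps in front of it.\<close>

definition arrange :: "nat \<Rightarrow> nat \<Rightarrow> nat \<Rightarrow> (nat \<Rightarrow> nat) \<Rightarrow> nat list" where
  "arrange m j y g =
     map (\<lambda>i. let k = (i + m - j) mod m in if k = 0 then y else g k) [0..<m]"

definition index_of :: "nat list \<Rightarrow> nat \<Rightarrow> nat" where
  "index_of xs x = (LEAST i. xs ! i = x)"


section \<open>Wake-Up\<close>

text \<open>The ids are flooded. An agent has seen the whole ring when its own id comes back, at round
  \<open>m\<close> if the ring seems to have \<open>m\<close> nodes. The vector of ids is then sent across the ring in
  rounds \<open>m, \<dots>, 2 * m - 2\<close>, so that the next phase starts at round \<open>2 * m - 1\<close>.\<close>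

definition returned :: "nat \<Rightarrow> (action \<times> msg \<times> msg) list \<Rightarrow> nat \<Rightarrow> bool" where
  "returned x h k \<longleftrightarrow> from_ccw h k = Id x \<or> from_cw h k = Id x"

definition ring_size :: "nat \<Rightarrow> (action \<times> msg \<times> msg) list \<Rightarrow> nat option" where
  "ring_size x h =
     (if \<exists>k. returned x h k then Some (LEAST k. returned x h k) else None)"

definition cw_ids :: "nat \<Rightarrow> (action \<times> msg \<times> msg) list \<Rightarrow> nat \<Rightarrow> nat list" where
  "cw_ids x h m = x # map (\<lambda>k. id_of (from_cw h k)) [1..<m]"

definition ids_ok :: "nat \<Rightarrow> (action \<times> msg \<times> msg) list \<Rightarrow> nat \<Rightarrow> bool" where
  "ids_ok x h m \<longleftrightarrow> flood_ok m (range Id) (from_ccw h) (from_cw h)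
     \<and> from_ccw h m = Id x \<and> from_cw h m = Id x \<and> distinct (cw_ids x h m)"

text \<open>The numbering of the ring starts at the agent with the highest id.\<close>

definition from_max :: "nat list \<Rightarrow> nat list" where
  "from_max xs = rotate (index_of xs (Max (set xs))) xs"

text \<open>If the own id has not come back by round \<open>\<beta>\<close>, the ring seems to have more than \<open>\<beta>\<close>
  nodes and a duplication is detected.\<close>

definition learn_ids :: "nat \<Rightarrow> nat \<Rightarrow> (action \<times> msg \<times> msg) list \<Rightarrow> action" where
  "learn_ids \<beta> x h =
     (if length h < \<beta> then send True [] (flood (Id x) (from_ccw h) (from_cw h) (length h))
      else abort)"


section \<open>Knowledge Sharing in a Ring\<close>

fun share1 :: "msg \<Rightarrow> nat option" where
  "share1 (Shares a b) = a"
| "share1 _ = None"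

fun share2 :: "msg \<Rightarrow> nat option" where
  "share2 (Shares a b) = b"
| "share2 _ = None"

text \<open>Secret-Transmit, in one of the two directions, to a target at distance \<open>d\<close> in that direction.
  At step \<open>k\<close> the share of the agent at distance \<open>k\<close> arrives, as long as \<open>k < d\<close>; the share from
  distance \<open>d - 1\<close> is kept until step \<open>m - 1\<close> and then sent to its target. \<open>G\<close> are the arriving
  messages, \<open>Y\<close> is the agent's own share.\<close>

definition carried :: "(msg \<Rightarrow> nat option) \<Rightarrow> nat \<Rightarrow> (nat \<Rightarrow> msg) \<Rightarrow> nat \<Rightarrow> nat option" where
  "carried sh Y G k = (if k = 0 then Some Y else sh (G k))"

definition transmit ::
    "nat \<Rightarrow> nat \<Rightarrow> (msg \<Rightarrow> nat option) \<Rightarrow> nat \<Rightarrow> (nat \<Rightarrow> msg) \<Rightarrow> nat \<Rightarrow> nat option" where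
  "transmit m d sh Y G s =
     (if s + 1 < d then carried sh Y G s
      else if s + 1 = m then carried sh Y G (d - 1)
      else None)"

definition due :: "nat \<Rightarrow> nat \<Rightarrow> nat \<Rightarrow> bool" where
  "due m d k \<longleftrightarrow> k < d \<or> k = m"

text \<open>The target \<open>b\<^sup>1\<close> is at distance \<open>1\<close> in front, \<open>b\<^sup>2\<close> is at distance \<open>m div 2\<close> in the
  back, that is, at distance \<open>m - m div 2\<close> in front.\<close>

definition dist2 :: "nat \<Rightarrow> nat" where
  "dist2 m = m - m div 2"

text \<open>The messages sent at step \<open>s\<close> by an agent with input \<open>y\<close> and random number \<open>R\<close>. \<open>R\<close> goes to
  the front and \<open>X = R \<oplus> y\<close> to the back, where \<open>R\<close> and \<open>X\<close> belong to the agent: the two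
  transmissions use the same ones. At step \<open>m + 1\<close> the inputs are sent around the ring.\<close>

definition sharing_step ::
    "nat \<Rightarrow> nat \<Rightarrow> nat \<Rightarrow> (nat \<Rightarrow> msg) \<Rightarrow> (nat \<Rightarrow> msg) \<Rightarrow> nat \<Rightarrow> msg \<times> msg" where
  "sharing_step m y R B F s =
     (let X = Bit_Operations.xor R y in
      if s < m then
        (Shares (transmit m 1 share1 R B s) (transmit m (dist2 m) share2 R B s),
         Shares (transmit m (m - 1) share1 X F s) (transmit m (m - dist2 m) share2 X F s))
      else if s = m then (Silent, Silent)
      else flood (Val y) (after (m + 1) B) (after (m + 1) F) (s - (m + 1)))"

definition shares_ok :: "nat \<Rightarrow> nat \<Rightarrow> nat \<Rightarrow> nat \<Rightarrow> (nat \<Rightarrow> msg) \<Rightarrow> bool" where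
  "shares_ok bits m d1 d2 G \<longleftrightarrow>
     (\<forall>k\<in>{1..m}. \<exists>a b. G k = Shares a b
        \<and> (a \<noteq> None \<longleftrightarrow> due m d1 k) \<and> (b \<noteq> None \<longleftrightarrow> due m d2 k)
        \<and> set_option a \<union> set_option b \<subseteq> {..<2 ^ bits})"

definition learned :: "nat \<Rightarrow> (msg \<Rightarrow> nat option) \<Rightarrow> (nat \<Rightarrow> msg) \<Rightarrow> (nat \<Rightarrow> msg) \<Rightarrow> nat" where
  "learned m sh B F = Bit_Operations.xor (the (sh (B m))) (the (sh (F m)))"

text \<open>The checks of an agent at the end, step \<open>2 * m\<close>: all messages are as expected, each input has
  come with the same value from both sides, and the two secrets learned at step \<open>m\<close> agree with the
  inputs sent afterwards.\<close>

definition sharing_ok :: "nat \<Rightarrow> nat set \<Rightarrow> nat \<Rightarrow> (nat \<Rightarrow> msg) \<Rightarrow> (nat \<Rightarrow> msg) \<Rightarrow> bool" where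
  "sharing_ok bits S m B F \<longleftrightarrow>
     shares_ok bits m 1 (dist2 m) B
   \<and> shares_ok bits m (m - 1) (m - dist2 m) F
   \<and> B (m + 1) = Silent \<and> F (m + 1) = Silent
   \<and> flood_ok m (Val ` S) (after (m + 1) B) (after (m + 1) F)
   \<and> val (after (m + 1) B 1) = learned m share1 B F
   \<and> val (after (m + 1) B (dist2 m)) = learned m share2 B F"

definition shared_inputs :: "nat \<Rightarrow> nat \<Rightarrow> nat \<Rightarrow> (nat \<Rightarrow> msg) \<Rightarrow> nat list" where
  "shared_inputs m j y F = arrange m j y (\<lambda>k. val (after (m + 1) F k))"

text \<open>The protocol with the global orientation of the ring. The private information of an agent is
  its input and its preferred output value; inputs are elements of \<open>S\<close> and have \<open>bits\<close> bits. The
  arguments of \<open>q\<close> are ordered clockwise from the agent with the highest id.\<close>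

definition sharing_protocol ::
    "nat \<Rightarrow> nat \<Rightarrow> nat set \<Rightarrow> (nat list \<Rightarrow> nat) \<Rightarrow> (nat \<times> nat) strategy" where
  "sharing_protocol \<beta> bits S q v =
     (let x = own_id v; y = fst (priv v); h = hist v; t = length h;
          B = from_ccw h; F = from_cw h in
      if decided h then return_pmf idle else
      case ring_size x h of
        None \<Rightarrow> return_pmf (learn_ids \<beta> x h)
      | Some m \<Rightarrow>
         (let V = from_max (cw_ids x h m); j = index_of V x;
              t1 = 2 * m - 1; t2 = t1 + 2 * m in
          if \<not> (ids_ok x h m
               \<and> (t \<ge> t1 \<longrightarrow> agree m (Ids V) (after m B) (after m F))
               \<and> (t \<ge> t2 \<longrightarrow> sharing_ok bits S m (after t1 B) (after t1 F)))
          then return_pmf abort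
          else if t < t1 then
            return_pmf (send True [] (flood (Ids V) (after m B) (after m F) (t - m)))
          else if t < t2 then
            bind_pmf (draw_at h t1 (map_pmf (\<lambda>R. [R]) (pmf_of_set {..<2 ^ bits}))) (\<lambda>cs.
              return_pmf (send True (drawn h t1 cs)
                (sharing_step m y (cs ! 0) (after t1 B) (after t1 F) (t - t1))))
          else return_pmf
            (Act [] (Some (Some (q (shared_inputs m j y (after t1 F))))) Silent Silent)))"

definition output_space :: "nat set \<Rightarrow> (nat list \<Rightarrow> nat) \<Rightarrow> nat set" where
  "output_space S q = q ` {xs. xs \<noteq> [] \<and> set xs \<subseteq> S}"

definition full_knowledge :: "nat set \<Rightarrow> (nat list \<Rightarrow> nat) \<Rightarrow> bool" where
  "full_knowledge S q \<longleftrightarrow>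
     (\<forall>xs j. set xs \<subseteq> S \<and> j < length xs \<longrightarrow>
        (\<forall>z\<in>output_space S q. \<forall>z'\<in>output_space S q.
           card {a \<in> S. q (xs[j := a]) = z} = card {a \<in> S. q (xs[j := a]) = z'}))"

definition sharing_legal :: "nat option list \<Rightarrow> bool" where
  "sharing_legal os \<longleftrightarrow> (\<exists>z. \<forall>i<length os. os ! i = Some z)"

text \<open>Equilibrium for \<open>2\<close>-Knowledge Sharing, whatever the function \<open>q\<close>. A finite set of inputs is
  encoded by numbers.\<close>

definition sharing_equilibrium :: "nat set \<Rightarrow> nat pmf \<Rightarrow> nat \<Rightarrow> nat \<Rightarrow> bool" where
  "sharing_equilibrium ID \<sigma> \<beta> N \<longleftrightarrow>
     (\<forall>bits S q. S \<noteq> {} \<and> S \<subseteq> {..<2 ^ bits} \<and> card (output_space S q) = 2 \<and> full_knowledge S q \<longrightarrow>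
        equilibrium ID (S \<times> output_space S q) \<sigma> sharing_legal snd (sharing_protocol \<beta> bits S q) N)"


section \<open>Coloring in a Ring\<close>

text \<open>The clockwise direction is only a name for one of the two edges here: the algorithm treats
  them alike until the orientation is set.\<close>

definition oriented_cw :: "nat list \<Rightarrow> bool" where
  "oriented_cw xs \<longleftrightarrow> (let V = from_max xs in V ! 1 < last V)"

definition oriented_ids :: "nat list \<Rightarrow> nat list" where
  "oriented_ids xs = from_max (if oriented_cw xs then xs else rev xs)"

text \<open>The groups \<open>C\<close>. \<open>ps\<close> are the preferences in the numbering along the orientation, where \<open>0\<close> is
  the agent with the highest id, and \<open>s\<close> is the sink, if any.\<close>

definition first_in_group :: "nat list \<Rightarrow> nat option \<Rightarrow> nat \<Rightarrow> bool" where
  "first_in_group ps s i \<longleftrightarrow> (let m = length ps; i' = (i + m - 1) mod m in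
     ps ! i' \<noteq> ps ! i \<or> s = Some i' \<or> (s = None \<and> (\<forall>c\<in>set ps. c = ps ! i) \<and> i = 0))"

definition last_in_group :: "nat list \<Rightarrow> nat option \<Rightarrow> nat \<Rightarrow> bool" where
  "last_in_group ps s i \<longleftrightarrow> (let i' = (i + 1) mod length ps in
     first_in_group ps s i' \<or> s = Some i')"

text \<open>The number \<open>l\<close> such that agent \<open>i\<close> is the member \<open>c\<^sub>l\<close> of its group.\<close>

definition position :: "nat list \<Rightarrow> nat option \<Rightarrow> nat \<Rightarrow> nat" where
  "position ps s i = (let m = length ps in
     Suc (LEAST k. first_in_group ps s ((i + m - k) mod m)))"

text \<open>The round, counted from the end of the coin flip with result \<open>b\<close>, at which agent \<open>i\<close> sets its
  output.\<close>

definition turn :: "nat list \<Rightarrow> nat option \<Rightarrow> nat \<Rightarrow> nat \<Rightarrow> nat" where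
  "turn ps s b i =
     (if s = Some i then 3
      else if position ps s i mod 2 = b \<or> (first_in_group ps s i \<and> last_in_group ps s i) then 0
      else if last_in_group ps s i then 2
      else 1)"

text \<open>The messages \<open>G\<close> that announce the output of neighbour \<open>i\<close> have been as expected up to step
  \<open>s\<close>.\<close>

definition announced_ok ::
    "nat \<Rightarrow> nat list \<Rightarrow> nat option \<Rightarrow> nat \<Rightarrow> nat \<Rightarrow> (nat \<Rightarrow> msg) \<Rightarrow> nat \<Rightarrow> bool" where
  "announced_ok ncol ps sk b i G s \<longleftrightarrow>
     (\<forall>k\<in>{1..s}. if turn ps sk b i = k - 1
        then G k \<in> (if k = 1 then {Val (ps ! i)} else Val ` {..<ncol})
        else G k = Silent)"

definition min_available :: "nat \<Rightarrow> (nat \<Rightarrow> msg) \<Rightarrow> (nat \<Rightarrow> msg) \<Rightarrow> nat \<Rightarrow> nat" where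
  "min_available ncol B F s =
     Min ({..<ncol} - {c. \<exists>k\<in>{1..s}. B k = Val c \<or> F k = Val c})"

text \<open>The vectors and parameters that an agent, having seen a ring of \<open>m\<close> nodes, computes from its
  view. The entry of the view at round \<open>t\<close> is available only at later rounds; the algorithm uses
  each of these values only once the phases it depends on are complete.\<close>

definition col_ids :: "nat view \<Rightarrow> nat \<Rightarrow> nat list" where
  "col_ids v m = oriented_ids (cw_ids (own_id v) (hist v) m)"

definition col_cw :: "nat view \<Rightarrow> nat \<Rightarrow> bool" where
  "col_cw v m = oriented_cw (cw_ids (own_id v) (hist v) m)"

definition col_back :: "nat view \<Rightarrow> nat \<Rightarrow> nat \<Rightarrow> msg" where
  "col_back v m = (if col_cw v m then from_ccw (hist v) else from_cw (hist v))"

definition col_front :: "nat view \<Rightarrow> nat \<Rightarrow> nat \<Rightarrow> msg" where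
  "col_front v m = (if col_cw v m then from_cw (hist v) else from_ccw (hist v))"

definition col_index :: "nat view \<Rightarrow> nat \<Rightarrow> nat" where
  "col_index v m = index_of (col_ids v m) (own_id v)"

text \<open>Starting rounds of the phases: flooding and validating the preferences, flooding and
  validating the numbers \<open>w\<close> (if a sink is needed), coin flip, coloring.\<close>

definition col_t1 :: "nat \<Rightarrow> nat" where "col_t1 m = 2 * m - 1"
definition col_t2 :: "nat \<Rightarrow> nat" where "col_t2 m = col_t1 m + (m - 1)"
definition col_t3 :: "nat \<Rightarrow> nat" where "col_t3 m = col_t2 m + (m - 1)"
definition col_t4 :: "nat \<Rightarrow> nat" where "col_t4 m = col_t3 m + (m - 1)"

definition col_prefs :: "nat view \<Rightarrow> nat \<Rightarrow> nat list" where
  "col_prefs v m = arrange m (col_index v m) (priv v)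
     (\<lambda>k. val (after (col_t1 m) (col_front v m) k))"

definition col_needs_sink :: "nat view \<Rightarrow> nat \<Rightarrow> bool" where
  "col_needs_sink v m \<longleftrightarrow> odd m \<and> (\<forall>c\<in>set (col_prefs v m). c = priv v)"

definition col_t5 :: "nat view \<Rightarrow> nat \<Rightarrow> nat" where
  "col_t5 v m = (if col_needs_sink v m then col_t4 m + (m - 1) else col_t3 m)"

definition col_t6 :: "nat view \<Rightarrow> nat \<Rightarrow> nat" where
  "col_t6 v m = col_t5 v m + 2 * m"

definition col_coins :: "nat view \<Rightarrow> nat \<Rightarrow> nat list" where
  "col_coins v t = coins (fst (hist v ! t))"

text \<open>The numbers \<open>w\<close> travel in the direction of the orientation only, so the one of the agent \<open>k\<close>
  steps in front arrives from the back at step \<open>m - k\<close>.\<close>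

definition col_weights :: "nat view \<Rightarrow> nat \<Rightarrow> nat list" where
  "col_weights v m = arrange m (col_index v m) (col_coins v (col_t3 m) ! 0)
     (\<lambda>k. val (after (col_t3 m) (col_back v m) (m - k)))"

text \<open>The sink has the \<open>w\<close>-th largest id, counted from \<open>0\<close> as \<open>w\<close> ranges over
  \<open>0, \<dots>, m - 1\<close>.\<close>

definition col_sink :: "nat view \<Rightarrow> nat \<Rightarrow> nat option" where
  "col_sink v m =
     (if col_needs_sink v m
      then Some (index_of (col_ids v m)
             (rev (sort (col_ids v m)) ! (sum_list (col_weights v m) mod m)))
      else None)"

definition parity :: "nat list \<Rightarrow> nat" where
  "parity xs = sum_list xs mod 2"

definition col_coin :: "nat view \<Rightarrow> nat \<Rightarrow> nat" where
  "col_coin v m = parity (shared_inputs m (col_index v m) (col_coins v (col_t5 v m) ! 0)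
     (after (col_t5 v m) (col_front v m)))"

definition col_ok :: "nat \<Rightarrow> nat view \<Rightarrow> nat \<Rightarrow> bool" where
  "col_ok ncol v m \<longleftrightarrow>
     (let t = length (hist v); B = col_back v m; F = col_front v m; j = col_index v m;
          ps = col_prefs v m; sk = col_sink v m; b = col_coin v m;
          t1 = col_t1 m; t2 = col_t2 m; t3 = col_t3 m; t4 = col_t4 m;
          t5 = col_t5 v m; t6 = col_t6 v m in
      ids_ok (own_id v) (hist v) m
    \<and> (t \<ge> t1 \<longrightarrow> agree m (Ids (col_ids v m)) (after m B) (after m F))
    \<and> (t \<ge> t2 \<longrightarrow> flood_ok m (Val ` {..<ncol}) (after t1 B) (after t1 F))
    \<and> (t \<ge> t3 \<longrightarrow> agree m (Vals ps) (after t2 B) (after t2 F))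
    \<and> (t \<ge> t4 \<and> col_needs_sink v m \<longrightarrow>
         (\<forall>k\<in>{1..<m}. after t3 B k \<in> Val ` {..<m} \<and> after t3 F k = Silent))
    \<and> (t \<ge> t5 \<and> col_needs_sink v m \<longrightarrow>
         agree m (Vals (col_weights v m)) (after t4 B) (after t4 F))
    \<and> (t \<ge> t6 \<longrightarrow> sharing_ok 1 {0, 1} m (after t5 B) (after t5 F)
         \<and> announced_ok ncol ps sk b ((j + m - 1) mod m) (after t6 B) (t - t6)
         \<and> announced_ok ncol ps sk b ((j + 1) mod m) (after t6 F) (t - t6)))"

definition coloring_algorithm :: "nat \<Rightarrow> nat \<Rightarrow> nat strategy" where
  "coloring_algorithm \<beta> ncol v =
     (let x = own_id v; p = priv v; h = hist v; t = length h in
      if decided h then return_pmf idle else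
      case ring_size x h of
        None \<Rightarrow> return_pmf (learn_ids \<beta> x h)
      | Some m \<Rightarrow>
         (let fwd = col_cw v m; B = col_back v m; F = col_front v m;
              t1 = col_t1 m; t2 = col_t2 m; t3 = col_t3 m; t4 = col_t4 m;
              t5 = col_t5 v m; t6 = col_t6 v m in
          if \<not> col_ok ncol v m then return_pmf abort
          else if t < t1 then
            return_pmf (send fwd [] (flood (Ids (col_ids v m)) (after m B) (after m F) (t - m)))
          else if t < t2 then
            return_pmf (send fwd [] (flood (Val p) (after t1 B) (after t1 F) (t - t1)))
          else if t < t3 then
            return_pmf (send fwd [] (flood (Vals (col_prefs v m)) (after t2 B) (after t2 F) (t - t2)))
          else if col_needs_sink v m \<and> t < t4 then
            bind_pmf (draw_at h t3 (map_pmf (\<lambda>w. [w]) (pmf_of_set {..<m}))) (\<lambda>cs.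
              return_pmf (send fwd (drawn h t3 cs)
                (fst (flood (Val (cs ! 0)) (after t3 B) (after t3 F) (t - t3)), Silent)))
          else if col_needs_sink v m \<and> t < t5 then
            return_pmf (send fwd [] (flood (Vals (col_weights v m)) (after t4 B) (after t4 F) (t - t4)))
          else if t < t6 then
            bind_pmf (draw_at h t5 (map_pmf (\<lambda>(i, R). [i, R]) (pmf_of_set ({0, 1} \<times> {0, 1})))) (\<lambda>cs.
              return_pmf (send fwd (drawn h t5 cs)
                (sharing_step m (cs ! 0) (cs ! 1) (after t5 B) (after t5 F) (t - t5))))
          else if t - t6 = turn (col_prefs v m) (col_sink v m) (col_coin v m) (col_index v m) then
            (let c = (if t = t6 then p else min_available ncol (after t6 B) (after t6 F) (t - t6))
             in return_pmf (Act [] (Some (Some c)) (Val c) (Val c)))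
          else return_pmf idle))"

definition coloring_legal :: "nat option list \<Rightarrow> bool" where
  "coloring_legal os \<longleftrightarrow>
     (\<forall>i<length os. os ! i \<noteq> None \<and> os ! i \<noteq> os ! ((i + 1) mod length os))"

text \<open>The private information of an agent is its preferred color.\<close>

definition coloring_equilibrium :: "nat set \<Rightarrow> nat pmf \<Rightarrow> nat \<Rightarrow> nat \<Rightarrow> nat \<Rightarrow> bool" where
  "coloring_equilibrium ID \<sigma> \<beta> ncol N \<longleftrightarrow>
     equilibrium ID {..<ncol} \<sigma> coloring_legal (\<lambda>p. p) (coloring_algorithm \<beta> ncol) N"

end

theory Submission
  imports Defs
begin

text \<open>Averaging over random tapes, it suffices to bound deterministic deviations. Let \<open>m\<close> be the
  apparent size of the ring and \<open>d = m - n + 1\<close> the number of positions played by the deviating agent.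

  An agent that is honest in round \<open>0\<close> has sent one id both ways, hence \<open>m = n\<close>. Of two neighbours with
  the same preference, neither of which is the sink, one gets its color in the first output round,
  and which one is decided by the coin. Until all the shares of the coin have arrived, flipping both
  the input bit and the random number of the next agent changes the coin but nothing that the
  deviating agent sees, so that it wins on at most one of two paired tapes, whereas the honest agent
  wins on at least one. Once the coin is fixed, a deviation wins only if the algorithm does. Before
  the choice of a sink, a rotation of the number drawn by one other agent similarly shows that the
  probability of becoming the sink is at least \<open>1/n\<close>.

  A deviation in round \<open>0\<close> controls the coin only if \<open>d \<ge> n\<close>; if \<open>d < n\<close>, it wins with probability at
  most \<open>1/2\<close> by the same pairing. Played against Knowledge Sharing with the parity of random bits, the
  same deviation followed by fake agents that are honest, but for one input fixed at the last moment,
  obtains each of the two outputs with certainty if \<open>d \<ge> n\<close> and both together with total probability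
  \<open>1\<close> if \<open>d < n\<close>. Since an honest agent obtains the two with total probability at most \<open>1\<close>, the
  equilibrium there gives \<open>2 P(d \<ge> n) + P(d < n) \<le> 1\<close>, which bounds the probability of winning at
  coloring by \<open>1/2\<close>, the least that an honest agent gets.\<close>

text \<open>Deviations are arbitrary strategies, so there are no fake agents to start from. They are
  recovered from the checks: if agents \<open>1, ..., n - 1\<close> all end with a color, the
  messages of agent \<open>0\<close> are those of consecutive positions with definite ids,
  preferences, numbers and inputs. Runs in which an agent aborts are never won, and of a won run
  only this is used: no neighbour of agent \<open>0\<close> outputs its color, which depends on the
  algorithm alone. Multiplying by the probability of the view at round \<open>r\<close> turns
  conditional expectations into numbers of tapes, so that pairing and rotation become bijections of
  a finite set. The bound \<open>1/2\<close> for an honest agent fails if \<open>n\<close> is odd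
  and all preferences agree, as it may be the sink; it holds in the mean over the preferences of the
  others. Therefore round \<open>0\<close> is treated in the mean, later rounds ring by ring. For a
  given deviation the gain in round \<open>0\<close> is bounded by a quantity that depends only on
  \<open>n\<close> and the ids, which have the same prior in both games; this allows the equilibrium
  of one game to be used in the other.\<close>

section \<open>Groups of equal preference and the order of the outputs\<close>

text \<open>The situation left by the choice of a sink: a ring with a single preferred color is cut
  at an agent if its length is odd, and stays closed if it is even. So no closed group of odd length
  occurs, the only place where the parity of \<open>position\<close> could fail to
  alternate.\<close>

definition valid_sink :: "nat list => nat option => bool" where
 "valid_sink ps sk \<longleftrightarrow>
   (case sk of None => (\<forall>c\<in>set ps. \<forall>c'\<in>set ps. c = c') \<longrightarrow> even (length ps)
   | Some s => s < length ps \<and> (\<forall>c\<in>set ps. \<forall>c'\<in>set ps. c = c') \<and> odd (length ps))"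

lemma all_equal_cyclic:
 assumes step: "\<And>i. i < m ==> f ((i + 1) mod m) = f i" and "i < (m::nat)" "j < m"
 shows "f i = f j"
proof -
 have "f k = f 0" if "k < m" for k
  using that
 proof (induction k)
  case (Suc k)
  thus ?case using step[of k] by auto
 qed simp
 thus ?thesis using assms by metis
qed

lemma mod_pred_succ: "((j + 1) mod m + m - 1) mod m = j" if "j < m" for j m :: nat
 using that by (cases "j + 1 = m") auto

lemma mod_succ_pred: "((j + m - 1) mod m + 1) mod m = j" if "j < m" for j m :: nat
 using that by (cases j) auto

lemma mod_succ_neq: "(j + 1) mod m \<noteq> j" if "j < m" "2 \<le> m" for j m :: nat
 using that by (cases "j + 1 = m") auto

lemma mod_pred_neq: "(j + m - 1) mod m \<noteq> j" if "j < m" "2 \<le> m" for j m :: nat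
 using that by (cases j) auto

lemma mod_add_diff_cancel:
 assumes "i < m" "j < (m::nat)"
 shows "(i + m - (i + m - j) mod m) mod m = j"
proof (cases "j \<le> i")
 case True
 hence "i + m - j = (i - j) + m" using assms by auto
 hence "(i + m - j) mod m = (i - j) mod m" by (simp only: mod_add_self2)
 hence "(i + m - j) mod m = i - j" using assms by simp
 moreover have "i + m - (i - j) = j + m" using True by auto
 ultimately show ?thesis using assms by simp
next
 case False
 hence "(i + m - j) mod m = i + m - j" using assms by auto
 moreover have "i + m - (i + m - j) = j" using False assms by auto
 ultimately show ?thesis using assms by simp
qed

text \<open>If no position starts a group, going back never changes the preference, so all
  preferences agree; but then position \<open>0\<close> starts the group that is the whole ring, or
  the successor of the sink starts one. This makes the \<open>LEAST\<close> in
  \<open>position\<close> meaningful.\<close>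

lemma exists_first_in_group:
 assumes "valid_sink ps sk" "ps \<noteq> []"
 shows "\<exists>j<length ps. first_in_group ps sk j"
proof (rule ccontr)
 assume *: "\<not> ?thesis"
 let ?m = "length ps"
 have m: "?m > 0" using assms by auto
 have eq: "ps ! ((i + ?m - 1) mod ?m) = ps ! i" if "i < ?m" for i
  using * that by (auto simp: first_in_group_def Let_def)
 have "ps ! ((i + 1) mod ?m) = ps ! i" if "i < ?m" for i
 proof -
  have "(i + 1) mod ?m < ?m" using m by simp
  thus ?thesis using eq[of "(i+1) mod ?m"] mod_pred_succ[OF that] by simp
 qed
 hence same: "ps ! i = ps ! j" if "i < ?m" "j < ?m" for i j
  using all_equal_cyclic[of ?m "\<lambda>i. ps ! i", OF _ that] by blast
 show False
 proof (cases sk)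
  case None
  moreover have "\<forall>c\<in>set ps. c = ps ! 0" using same[OF _ m] by (metis in_set_conv_nth)
  ultimately have "first_in_group ps sk 0" by (simp add: first_in_group_def)
  thus False using * m by blast
 next
  case (Some s)
  hence s: "s < ?m" using assms by (auto simp: valid_sink_def)
  have "first_in_group ps sk ((s + 1) mod ?m)"
   using Some mod_pred_succ[OF s] by (simp add: first_in_group_def Let_def)
  thus False using * m by (meson mod_less_divisor)
 qed
qed

lemma exists_first_behind:
 assumes "valid_sink ps sk" "i < length ps"
 shows "\<exists>k<length ps. first_in_group ps sk ((i + length ps - k) mod length ps)"
proof -
 obtain j where j: "j < length ps" "first_in_group ps sk j"
  using exists_first_in_group[OF assms(1)] assms(2) by (metis length_0_conv not_less_zero)
 show ?thesis
  using j assms mod_add_diff_cancel[OF assms(2) j(1)]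
  by (metis length_greater_0_conv list.size(3) mod_less_divisor not_less_zero)
qed

lemma position_first:
 "first_in_group ps sk i ==> i < length ps ==> position ps sk i = 1"
 by (auto simp: position_def Let_def intro!: Least_equality)

lemma position_next:
 assumes v: "valid_sink ps sk" and i: "i < length ps"
  and nf: "\<not> first_in_group ps sk ((i + 1) mod length ps)"
 shows "position ps sk ((i + 1) mod length ps) = Suc (position ps sk i)"
proof -
 let ?m = "length ps"
 let ?i' = "(i + 1) mod ?m"
 let ?P = "\<lambda>k. first_in_group ps sk ((?i' + ?m - k) mod ?m)"
 let ?Q = "\<lambda>k. first_in_group ps sk ((i + ?m - k) mod ?m)"
 have PQ: "?P (Suc k) = ?Q k" if "k < ?m" for k
 proof (cases "i + 1 = ?m")
  case True
  have "i + ?m - k = ?m + (i - k)" using True that by auto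
  hence "(i + ?m - k) mod ?m = (i - k) mod ?m" by (simp only: mod_add_self1)
  moreover have "?i' + ?m - Suc k = i - k" using True by simp
  ultimately show ?thesis by simp
 next
  case False
  thus ?thesis using i by simp
 qed
 obtain k where k: "k < ?m" "?Q k" using exists_first_behind[OF v i] by blast
 have "(LEAST k. ?P (Suc k)) = (LEAST k. ?Q k)"
 proof (rule Least_equality)
  have "(LEAST k. ?Q k) \<le> k" using k by (intro Least_le)
  thus "?P (Suc (LEAST k. ?Q k))" using PQ[of "LEAST k. ?Q k"] LeastI[of ?Q k] k by auto
 next
  fix y assume y: "?P (Suc y)"
  show "(LEAST k. ?Q k) \<le> y"
  proof (cases "y < ?m")
   case True
   thus ?thesis using PQ y by (intro Least_le) auto
  next
   case False
   thus ?thesis using k Least_le[of ?Q k] by auto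
  qed
 qed
 moreover have "(LEAST k. ?P k) = Suc (LEAST k. ?P (Suc k))"
  using nf PQ k i by (intro Least_Suc[of ?P "Suc k"]) auto
 ultimately show ?thesis by (simp add: position_def Let_def)
qed

text \<open>Inside a group the positions are consecutive. Equal neighbours can otherwise only be the
  last and the first agent of a group that is the whole ring, with positions
  \<open>length ps\<close> and \<open>1\<close>; there \<open>valid_sink\<close> makes the length
  even.\<close>

lemma position_parity_next:
 assumes v: "valid_sink ps sk" and i: "i < length ps"
  and same: "ps ! ((i + 1) mod length ps) = ps ! i"
  and ns: "sk \<noteq> Some i"
 shows "position ps sk ((i + 1) mod length ps) mod 2 \<noteq> position ps sk i mod 2"
proof (cases "first_in_group ps sk ((i + 1) mod length ps)")
 case False
 thus ?thesis using position_next[OF v i] by presburger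
next
 case True
 let ?m = "length ps"
 have m: "?m > 0" using i by auto
 have pred: "((i + 1) mod ?m + ?m - 1) mod ?m = i" using mod_pred_succ[OF i] .
 have *: "sk = None" "\<forall>c\<in>set ps. c = ps ! i" "(i + 1) mod ?m = 0"
  using True ns same pred by (auto simp: first_in_group_def Let_def)
 hence i1: "i + 1 = ?m" using i by (metis Suc_eq_plus1 Suc_leI le_neq_implies_less mod_less nat.discI)
 have ev: "even ?m"
 proof -
  have "\<forall>c\<in>set ps. \<forall>c'\<in>set ps. c = c'" using *(2) by metis
  thus ?thesis using v *(1) by (simp add: valid_sink_def)
 qed
 have fi: "first_in_group ps sk j \<longleftrightarrow> j = 0" if "j < ?m" for j
 proof -
  have "ps ! k = ps ! i" if "k < ?m" for k using * that by auto
  moreover have "(j + ?m - 1) mod ?m < ?m" using m by simp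
  ultimately show ?thesis using *(1,2) that unfolding first_in_group_def Let_def by (metis option.distinct(1))
 qed
 have "(LEAST k. first_in_group ps sk ((i + ?m - k) mod ?m)) = ?m - 1"
 proof (rule Least_equality)
  show "first_in_group ps sk ((i + ?m - (?m - 1)) mod ?m)"
   using i1 fi[of 0] m by (auto simp flip: i1)
 next
  fix y assume y: "first_in_group ps sk ((i + ?m - y) mod ?m)"
  show "?m - 1 \<le> y"
  proof (rule ccontr)
   assume "\<not> ?thesis"
   hence "i + ?m - y = ?m + (i - y)" "0 < i - y" "i - y < ?m" using i1 by auto
   hence "(i + ?m - y) mod ?m = (i - y) mod ?m" by (simp only: mod_add_self1)
   hence "(i + ?m - y) mod ?m = i - y" using \<open>i - y < ?m\<close> by simp
   thus False using y fi \<open>0 < i - y\<close> \<open>i - y < ?m\<close> by auto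
  qed
 qed
 hence "position ps sk i = ?m" using m by (simp add: position_def Let_def)
 moreover have "position ps sk ((i + 1) mod ?m) = 1"
  using position_first[OF True] m by simp
 ultimately show ?thesis using ev by presburger
qed

text \<open>The position has the parity of one of the two results; only the sink waits under
  both.\<close>

lemma turn_zero_some_coin:
 assumes "sk \<noteq> Some i" "b < 2" "b' < 2" "b \<noteq> b'"
 shows "turn ps sk b i = 0 \<or> turn ps sk b' i = 0"
proof -
 have "position ps sk i mod 2 = b \<or> position ps sk i mod 2 = b'" using assms by linarith
 thus ?thesis using assms by (auto simp: turn_def)
qed

lemma mod_two_step: "x mod 2 \<noteq> y mod 2 ==> y mod 2 = (z + t) mod 2 ==> x mod 2 = (z + Suc t) mod 2"
 for x y z t :: nat
 by presburger

lemma position_parity_path: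
 assumes v: "valid_sink ps sk" and m: "ps \<noteq> []"
  and path: "\<And>t. t < c ==> ps ! ((q + t) mod length ps) = a \<and> sk \<noteq> Some ((q + t) mod length ps)"
  and t: "t < c"
 shows "position ps sk ((q + t) mod length ps) mod 2 = (position ps sk (q mod length ps) + t) mod 2"
 using t
proof (induction t)
 case (Suc t)
 let ?m = "length ps"
 have e: "((q + t) mod ?m + 1) mod ?m = (q + Suc t) mod ?m" by (simp add: mod_Suc_eq)
 have "position ps sk ((q + Suc t) mod ?m) mod 2 \<noteq> position ps sk ((q + t) mod ?m) mod 2"
  using position_parity_next[OF v, of "(q + t) mod ?m"] e path[of t] path[of "Suc t"] Suc.prems m
  by (metis Suc_lessD length_greater_0_conv mod_less_divisor)
 moreover have "position ps sk ((q + t) mod ?m) mod 2 = (position ps sk (q mod ?m) + t) mod 2"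
  using Suc by simp
 ultimately show ?case by (rule mod_two_step)
qed simp

lemma mod_two_odd: "x mod 2 = (y + t) mod 2 ==> odd t ==> x mod 2 \<noteq> y mod 2"
 for x y t :: nat
 by presburger

text \<open>The ends of a path with an even number of agents have positions of opposite parity, so
  every coin serves one of them. This is applied to the ring without the sink and to the ring
  without the deviating agent, where both ends are neighbours of the agent left out.\<close>

lemma turn_zero_path:
 assumes v: "valid_sink ps sk" and m: "ps \<noteq> []"
  and path: "\<And>t. t < c ==> ps ! ((q + t) mod length ps) = a \<and> sk \<noteq> Some ((q + t) mod length ps)"
  and c: "even c" "c > 0" and b: "b < 2"
 shows "turn ps sk b (q mod length ps) = 0 \<or> turn ps sk b ((q + (c - 1)) mod length ps) = 0"
proof -
 have "odd (c - 1)" "c - 1 < c" using c by simp_all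
 hence "position ps sk ((q + (c - 1)) mod length ps) mod 2 \<noteq> position ps sk (q mod length ps) mod 2"
  using mod_two_odd[OF position_parity_path[OF v m path, where t = "c - 1" and c = c]] by blast
 hence "position ps sk ((q + (c - 1)) mod length ps) mod 2 = b \<or> position ps sk (q mod length ps) mod 2 = b"
  using b by linarith
 moreover have "sk \<noteq> Some (q mod length ps)" "sk \<noteq> Some ((q + (c - 1)) mod length ps)"
  using path[of 0] path[of "c - 1"] c(2) by simp_all
 ultimately show ?thesis by (elim disjE) (simp_all only: turn_def if_False if_True simp_thms)
qed

text \<open>The reason why honesty is optimal once the coin is fixed: an agent that is not served in
  the first output round loses its color to a neighbour with the same preference, which is
  served.\<close>

lemma turn_zero_neighbour:
 assumes v: "valid_sink ps sk" and j: "j < length ps" and b: "b < 2" and m3: "length ps \<ge> 3"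
 shows "turn ps sk b j = 0
  \<or> (ps ! ((j + 1) mod length ps) = ps ! j \<and> turn ps sk b ((j + 1) mod length ps) = 0)
  \<or> (ps ! ((j + length ps - 1) mod length ps) = ps ! j \<and> turn ps sk b ((j + length ps - 1) mod length ps) = 0)"
proof -
 let ?m = "length ps"
 define n where "n = (j + 1) mod ?m"
 define p where "p = (j + ?m - 1) mod ?m"
 have np: "n < ?m" "p < ?m" unfolding n_def p_def by (rule mod_less_divisor; use m3 in linarith)+
 have pj: "(p + 1) mod ?m = j" using mod_succ_pred[OF j] by (simp add: p_def)
 have nj: "n \<noteq> j" "p \<noteq> j"
  using mod_succ_neq[OF j] mod_pred_neq[OF j] m3 by (simp_all add: n_def p_def)
 show ?thesis
 proof (cases "sk = Some j")
  case True
  hence same: "\<forall>c\<in>set ps. \<forall>c'\<in>set ps. c = c'" and od: "odd ?m"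
   using v by (auto simp: valid_sink_def)
  hence eq: "ps ! i = ps ! j" if "i < ?m" for i using that j by auto
  have neq: "(j + 1 + t) mod ?m \<noteq> j" if "t < ?m - 1" for t
  proof
   assume "(j + 1 + t) mod ?m = j"
   moreover have "\<not> j + 1 + t < ?m" using \<open>(j + 1 + t) mod ?m = j\<close> by (auto simp del: One_nat_def)
   ultimately have "j + 1 + t - ?m = j" using j that by (simp add: le_mod_geq)
   thus False using that \<open>\<not> j + 1 + t < ?m\<close> by linarith
  qed
  \<comment> \<open>The agents other than the sink form a path from its successor to its
    predecessor, with an even number of agents since the ring is odd.\<close>
  hence "turn ps sk b ((j + 1) mod ?m) = 0 \<or> turn ps sk b ((j + 1 + (?m - 1 - 1)) mod ?m) = 0"
  proof (intro turn_zero_path[OF v _ _ _ _ b, where a = "ps ! j"])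
   show "ps ! ((j + 1 + t) mod ?m) = ps ! j \<and> sk \<noteq> Some ((j + 1 + t) mod ?m)" if "t < ?m - 1" for t
   proof -
    have "(j + 1 + t) mod ?m < ?m" using m3 by (intro mod_less_divisor) linarith
    hence "ps ! ((j + 1 + t) mod ?m) = ps ! j" by (rule eq)
    moreover have "(j + 1 + t) mod ?m \<noteq> j" using neq that by blast
    ultimately show ?thesis using True by (metis option.inject)
   qed
  qed (use od m3 in auto)
  moreover have "j + 1 + (?m - 1 - 1) = j + ?m - 1" using m3 by linarith
  ultimately have "turn ps sk b n = 0 \<or> turn ps sk b p = 0" by (simp only: n_def p_def)
  thus ?thesis using eq[OF np(1)] eq[OF np(2)] by (auto simp: n_def p_def)
 next
  case False
  show ?thesis
  proof (cases "position ps sk j mod 2 = b \<or> (first_in_group ps sk j \<and> last_in_group ps sk j)")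
   case True
   thus ?thesis using False by (auto simp: turn_def)
  next
   case nt: False
   show ?thesis
   proof (cases "first_in_group ps sk j")
    case True
    hence "\<not> last_in_group ps sk j" using nt by auto
    hence l: "\<not> first_in_group ps sk n" "sk \<noteq> Some n"
     by (auto simp: last_in_group_def n_def Let_def)
    have "(n + ?m - 1) mod ?m = j" using mod_pred_succ[OF j] by (simp add: n_def)
    hence eq: "ps ! n = ps ! j" using l by (auto simp: first_in_group_def Let_def)
    have "position ps sk n mod 2 \<noteq> position ps sk j mod 2"
     using position_parity_next[OF v j] eq False by (simp add: n_def)
    hence "position ps sk n mod 2 = b" using nt b by linarith
    thus ?thesis using l eq by (auto simp: turn_def n_def)
   next
    case nf: False
    hence eq: "ps ! p = ps ! j" "sk \<noteq> Some p" by (auto simp: first_in_group_def Let_def p_def)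
    have "position ps sk j mod 2 \<noteq> position ps sk p mod 2"
     using position_parity_next[OF v np(2)] eq pj by simp
    hence "position ps sk p mod 2 = b" using nt b by linarith
    thus ?thesis using eq by (auto simp: turn_def p_def)
   qed
  qed
 qed
qed

lemma turn_zero_alone:
 assumes "j < length ps" "length ps \<ge> 3" "sk \<noteq> Some j"
  "ps ! ((j + 1) mod length ps) \<noteq> ps ! j"
  "ps ! ((j + length ps - 1) mod length ps) \<noteq> ps ! j"
 shows "turn ps sk b j = 0"
proof -
 have "((j + 1) mod length ps + length ps - 1) mod length ps = j"
  using mod_pred_succ[OF assms(1)] .
 thus ?thesis
  using assms by (auto simp: turn_def first_in_group_def last_in_group_def Let_def)
qed

text \<open>The source of legality: apart from two different preferences output in the first round,
  one of two neighbours has seen the color of the other when it chooses. Within a group the parity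
  alternates. At a border, the first agent of a group never has turn \<open>2\<close> and the last
  one never turn \<open>1\<close>.\<close>

lemma adjacent_turns_distinct:
 assumes v: "valid_sink ps sk" and j: "j < length ps" and b: "b < 2" and m3: "length ps \<ge> 3"
  and eq: "turn ps sk b j = turn ps sk b ((j + 1) mod length ps)"
 shows "turn ps sk b j = 0 \<and> ps ! ((j + 1) mod length ps) \<noteq> ps ! j"
proof -
 let ?m = "length ps"
 define n where "n = (j + 1) mod ?m"
 have nj: "n \<noteq> j" "n < ?m" using mod_succ_neq[OF j] m3 j by (auto simp: n_def intro: mod_less_divisor)
 have pn: "(n + ?m - 1) mod ?m = j" using mod_pred_succ[OF j] by (simp add: n_def)
 have t: "turn ps sk b j = turn ps sk b n" using eq by (simp add: n_def)
 have ns: "sk \<noteq> Some j" "sk \<noteq> Some n"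
  using t nj by (auto simp: turn_def split: if_splits)
 have ll: "last_in_group ps sk j \<longleftrightarrow> first_in_group ps sk n"
  using ns by (auto simp: last_in_group_def n_def Let_def)
 show ?thesis
 proof (cases "ps ! n = ps ! j")
  case True
  have par: "position ps sk n mod 2 \<noteq> position ps sk j mod 2"
   using position_parity_next[OF v j] True ns by (simp add: n_def)
  show ?thesis
  proof (cases "first_in_group ps sk n")
   case fn: True
   hence *: "sk = None" "\<forall>c\<in>set ps. c = ps ! n" "n = 0"
    using pn True ns by (auto simp: first_in_group_def Let_def)
   hence jm: "j = ?m - 1" using n_def j by (cases "j + 1 = ?m") auto
   have "\<not> first_in_group ps sk i" if "i < ?m" "i \<noteq> 0" for i
   proof -
    have "(i + ?m - 1) mod ?m < ?m" using that by (intro mod_less_divisor) auto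
    moreover have "ps ! k = ps ! n" if "k < ?m" for k using * that by auto
    ultimately show ?thesis using *(1) that unfolding first_in_group_def Let_def
     by (metis option.distinct(1))
   qed
   hence "\<not> first_in_group ps sk j" "\<not> first_in_group ps sk 1" using jm m3 by auto
   hence "\<not> last_in_group ps sk n" using * m3 by (auto simp: last_in_group_def Let_def)
   moreover have "position ps sk n mod 2 = b \<or> position ps sk j mod 2 = b" using par b by linarith
   ultimately show ?thesis
    using t ns par fn ll \<open>\<not> first_in_group ps sk j\<close> by (auto simp: turn_def split: if_splits)
  next
   case fn: False
   have "position ps sk n mod 2 = b \<or> position ps sk j mod 2 = b" using par b by linarith
   thus ?thesis
    using t ns par fn ll by (auto simp: turn_def split: if_splits)
  qed
 next
  case False
  hence fn: "first_in_group ps sk n" using pn by (auto simp: first_in_group_def Let_def)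
  thus ?thesis
   using t ns False ll by (auto simp: turn_def n_def split: if_splits)
 qed
qed

lemma turn_le: "turn ps sk b i \<le> 3"
 by (simp add: turn_def)

section \<open>Cyclic index arithmetic\<close>

lemma mod_eq_of_add: "x = y + m ==> x mod m = y mod m" for x y m :: nat
 by simp

lemma mod_add_pred: "0 < s ==> s \<le> m ==> (((j + (m - 1)) mod m) + (m - (s - 1))) mod m = (j + (m - s)) mod m"
 for j m s :: nat
 by (subst mod_add_left_eq, rule mod_eq_of_add) simp

lemma mod_add_succ: "0 < s ==> (((j + 1) mod m) + (s - 1)) mod m = (j + s) mod m"
 for j m s :: nat
 by (subst mod_add_left_eq) simp

lemma sum_mod_shift: "(\<Sum>i<m. f ((i + c) mod m)) = (\<Sum>i<m. f i)" for f :: "nat => 'a::comm_monoid_add"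
proof (rule sum.reindex_bij_witness[of _ "\<lambda>i. (i + (m - c mod m)) mod m" "\<lambda>i. (i + c) mod m"])
 fix i assume "i \<in> {..<m}"
 hence i: "i < m" by simp
 hence cm: "c mod m < m" by (intro mod_less_divisor) linarith
 have "((i + c) mod m + (m - c mod m)) mod m = (i + c mod m + (m - c mod m)) mod m"
  by (metis mod_add_left_eq mod_add_right_eq)
 also have "\<dots> = i" using i cm by simp
 finally show "((i + c) mod m + (m - c mod m)) mod m = i" .
 have "((i + (m - c mod m)) mod m + c) mod m = (i + (m - c mod m) + c mod m) mod m"
  by (metis mod_add_left_eq mod_add_right_eq)
 also have "i + (m - c mod m) + c mod m = i + m" using cm by linarith
 finally show "((i + (m - c mod m)) mod m + c) mod m = i" using i by simp
qed auto

section \<open>Vectors around the ring\<close>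

text \<open>Position \<open>j\<close> has index \<open>(q + j) mod m\<close> in the common
  numbering. The right-hand side does not mention \<open>j\<close>, which is why all agents compute
  the same vector.\<close>

lemma arrange_ring:
 assumes "q < m" "j0 = (q + j) mod m"
 shows "arrange m j0 (y (j mod m)) (\<lambda>k. y ((j + k) mod m)) = map (\<lambda>i. y ((i + (m - q)) mod m)) [0..<m]"
proof -
 have "(let k = (i + m - j0) mod m in if k = 0 then y (j mod m) else y ((j + k) mod m))
   = y ((i + (m - q)) mod m)" if "i < m" for i
 proof -
  have j0: "j0 < m" using assms by auto
  have "(j + (i + m - j0) mod m) mod m = (j + (i + (m - j0))) mod m"
   using j0 by (simp add: mod_add_right_eq)
  also have "\<dots> = (i + (m - q)) mod m"
  proof -
   have "(j + (i + (m - j0)) + q) mod m = (i + (m - j0) + (q + j) mod m) mod m"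
   proof -
    have "j + (i + (m - j0)) + q = i + (m - j0) + (q + j)" by simp
    thus ?thesis by (simp only: mod_add_right_eq)
   qed
   also have "\<dots> = i mod m" using j0 assms(2) by simp
   finally have "(j + (i + (m - j0)) + q + (m - q)) mod m = (i + (m - q)) mod m"
    by (metis mod_add_left_eq)
   moreover have "j + (i + (m - j0)) + q + (m - q) = j + (i + (m - j0)) + m" using assms by simp
   ultimately show ?thesis by simp
  qed
  finally have *: "(j + (i + m - j0) mod m) mod m = (i + (m - q)) mod m" .
  show ?thesis using * by (auto simp: Let_def)
 qed
 thus ?thesis by (auto simp: arrange_def)
qed

lemma arrange_cong:
 assumes "\<And>k. 1 \<le> k ==> k < m ==> g k = g' k"
 shows "arrange m j y g = arrange m j y g'"
proof -
 have "(let k = (i + m - j) mod m in if k = 0 then y else g k) = (let k = (i + m - j) mod m in if k = 0 then y else g' k)"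
  if "i < m" for i
  using assms[of "(i + m - j) mod m"] that by (auto simp: Let_def)
 thus ?thesis by (auto simp: arrange_def)
qed

lemma sum_list_ring:
 "sum_list (map (\<lambda>i. y ((i + c) mod m)) [0..<m]) = (\<Sum>i<m. y i)" for y :: "nat => nat"
 by (simp add: interv_sum_list_conv_sum_set_nat atLeast0LessThan sum_mod_shift)

lemma index_of_nth: "distinct xs ==> i < length xs ==> index_of xs (xs ! i) = i"
 unfolding index_of_def
 by (rule Least_equality) (auto simp: nth_eq_iff_index_eq, metis le_trans nat_le_linear nth_eq_iff_index_eq order.strict_trans1 not_le)

text \<open>Every agent lists the ids starting with its own, so the lists of two agents differ by a
  rotation; the canonical starting point removes it.\<close>

lemma from_max_rotate:
 assumes "distinct xs" "xs \<noteq> []"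
 shows "from_max (rotate k xs) = from_max xs"
proof -
 let ?m = "length xs"
 have m: "?m > 0" using assms by simp
 obtain i where i: "i < ?m" "xs ! i = Max (set xs)"
  using Max_in[of "set xs"] assms by (metis List.finite_set in_set_conv_nth set_empty)
 have a: "index_of xs (Max (set xs)) = i" using index_of_nth[OF assms(1) i(1)] i(2) by simp
 let ?i' = "(i + (?m - k mod ?m)) mod ?m"
 have i': "?i' < ?m" using m by simp
 have km: "k mod ?m < ?m" using m by simp
 have kk: "(k + ?i') mod ?m = i"
 proof -
  have "(k + ?i') mod ?m = (k mod ?m + (i + (?m - k mod ?m))) mod ?m"
   by (metis mod_add_left_eq mod_add_right_eq)
  also have "\<dots> = i" using i km by simp
  finally show ?thesis .
 qed
 have "rotate k xs ! ?i' = xs ! i" using nth_rotate[OF i', of k] kk by (simp add: add.commute)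
 hence "index_of (rotate k xs) (Max (set (rotate k xs))) = ?i'"
  using index_of_nth[of "rotate k xs" ?i'] i i' assms by simp
 hence "from_max (rotate k xs) = rotate ?i' (rotate k xs)" by (simp add: from_max_def)
 also have "\<dots> = rotate ((?i' + k) mod ?m) xs"
  by (metis rotate_rotate rotate_conv_mod)
 also have "\<dots> = rotate i xs" using kk by (simp add: add.commute)
 finally show ?thesis using a by (simp add: from_max_def)
qed

lemma rev_rotate: "rev (rotate k xs) = rotate (length xs - k mod length xs) (rev xs)"
 using arg_cong[OF rotate_rev[of k "rev xs"], of rev] by simp

lemma oriented_cw_rotate:
 assumes "distinct xs" "xs \<noteq> []"
 shows "oriented_cw (rotate k xs) = oriented_cw xs"
 using from_max_rotate[OF assms] by (simp add: oriented_cw_def)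

lemma oriented_ids_rotate:
 assumes "distinct xs" "xs \<noteq> []"
 shows "oriented_ids (rotate k xs) = oriented_ids xs"
 using from_max_rotate[OF assms] from_max_rotate[of "rev xs"] assms
 by (simp add: oriented_ids_def oriented_cw_rotate rev_rotate)

lemma ring_list_rotate:
 "map (\<lambda>k. Y ((i + k) mod m)) [0..<m] = rotate i (map Y [0..<m])"
 by (rule nth_equalityI) (auto simp: nth_rotate add.commute)

lemma from_max_ring:
 assumes "inj_on Y {..<m}" "m > 0"
 obtains q where "q < m" "length (from_max (map Y [0..<m])) = m"
  "\<And>i. i < m ==> from_max (map Y [0..<m]) ! ((q + i) mod m) = Y i"
  "distinct (from_max (map Y [0..<m]))"
proof -
 let ?c = "index_of (map Y [0..<m]) (Max (set (map Y [0..<m])))"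
 \<comment> \<open>The position \<open>?c\<close> with the largest id gets index \<open>0\<close>,
   hence position \<open>0\<close> gets the index \<open>- ?c\<close> modulo
   \<open>m\<close>.\<close>
 define q where "q = (m - ?c mod m) mod m"
 show ?thesis
 proof
  show "q < m" using assms by (simp add: q_def)
  show "length (from_max (map Y [0..<m])) = m" by (simp add: from_max_def)
  show "distinct (from_max (map Y [0..<m]))"
   using assms by (simp add: from_max_def distinct_map lessThan_atLeast0)
  fix i assume i: "i < m"
  have cm: "?c mod m < m" using assms by simp
  have "(?c + (q + i) mod m) mod m = (?c mod m + (m - ?c mod m) + i) mod m"
   unfolding q_def by (metis (no_types, lifting) add.assoc mod_add_left_eq mod_add_right_eq)
  also have "\<dots> = i" using i cm by simp
  finally show "from_max (map Y [0..<m]) ! ((q + i) mod m) = Y i"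
   using assms i by (simp add: from_max_def nth_rotate add.commute)
 qed
qed

section \<open>Sharing around a ring of apparent size \<open>m\<close>\<close>

text \<open>The messages that position \<open>j\<close> sends at step \<open>s\<close> if everybody follows the protocol, with the
 possible exception that the share of \<open>j\<close> for the next position is \<open>R1 j\<close> and the one for the
 position at distance \<open>dist2 m\<close> is \<open>R2 j\<close>.\<close>

definition share_front ::
  "nat => (nat => nat) => (nat => nat) => (nat => nat) => nat => nat => msg" where
 "share_front m R1 R2 y j s =
   (if s < m then
    Shares (if s + 1 = m then Some (R1 j) else None)
     (if s + 1 < dist2 m then Some (R2 ((j + (m - s)) mod m))
      else if s + 1 = m then Some (R2 ((j + (m - (dist2 m - 1))) mod m)) else None)
   else if s = m then Silent
   else Val (y ((j + (m - (s - (m + 1)))) mod m)))"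

definition share_back ::
  "nat => (nat => nat) => (nat => nat) => nat => nat => msg" where
 "share_back m X y j s =
   (if s < m then
    Shares (if s + 1 < m - 1 then Some (X ((j + s) mod m))
        else if s + 1 = m then Some (X ((j + (m - 2)) mod m)) else None)
     (if s + 1 < m - dist2 m then Some (X ((j + s) mod m))
      else if s + 1 = m then Some (X ((j + (m - dist2 m - 1)) mod m)) else None)
   else if s = m then Silent
   else Val (y ((j + (s - (m + 1))) mod m)))"

lemma dist2_bounds: "m \<ge> 3 ==> 2 \<le> dist2 m \<and> dist2 m < m \<and> 1 \<le> m - dist2 m"
 by (auto simp: dist2_def)

lemma share2_share_front:
 assumes "k < dist2 m" "m \<ge> 3"
 shows "share2 (share_front m R1 R2 y j k) = (if k + 1 < dist2 m then Some (R2 ((j + (m - k)) mod m)) else None)"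
 using assms dist2_bounds[OF assms(2)] by (simp add: share_front_def)

lemma share1_share_back:
 assumes "k + 1 < m - 1"
 shows "share1 (share_back m X y j k) = Some (X ((j + k) mod m))"
 using assms by (auto simp: share_back_def)

lemma share2_share_back:
 assumes "k + 1 < m - dist2 m"
 shows "share2 (share_back m X y j k) = Some (X ((j + k) mod m))"
 using assms by (auto simp: share_back_def)

lemma share_last:
 assumes "m \<ge> 3"
 shows "share_front m R1 R2 y j (m - 1) = Shares (Some (R1 j)) (Some (R2 ((j + (m - (dist2 m - 1))) mod m)))"
  "share_back m X y j (m - 1) = Shares (Some (X ((j + (m - 2)) mod m))) (Some (X ((j + (m - dist2 m - 1)) mod m)))"
 using assms dist2_bounds[OF assms] by (auto simp: share_front_def share_back_def)

lemma flooded_share: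
 assumes k: "1 \<le> k" "k < m"
 shows "share_front m R1 R2 y ((j + (m - 1)) mod m) (m + 1 + k - 1) = Val (y ((j + (m - k)) mod m))"
  and "share_back m X y ((j + 1) mod m) (m + 1 + k - 1) = Val (y ((j + k) mod m))"
proof -
 have "\<not> m + 1 + k - 1 < m" "m + 1 + k - 1 \<noteq> m" "m + 1 + k - 1 - (m + 1) = k - 1" "0 < k" "k \<le> m"
  using k by auto
 thus "share_front m R1 R2 y ((j + (m - 1)) mod m) (m + 1 + k - 1) = Val (y ((j + (m - k)) mod m))"
  and "share_back m X y ((j + 1) mod m) (m + 1 + k - 1) = Val (y ((j + k) mod m))"
  using mod_add_pred[of k m j] mod_add_succ[of k j m]
  by (simp_all only: share_front_def share_back_def if_False simp_thms)
qed

text \<open>One step of the induction by which the two tables describe an execution. Consistency of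
  \<open>R1\<close>, \<open>R2\<close> and \<open>X\<close> is required at \<open>j\<close> only:
  elsewhere they may contradict each other, as those of a cheating position do.\<close>

lemma sharing_step_ring:
 assumes m: "m \<ge> 3" and j: "j < m" and s: "s < 2 * m"
  and B: "\<And>k. 1 \<le> k ==> k \<le> s ==> B k = share_front m R1 R2 y ((j + (m - 1)) mod m) (k - 1)"
  and F: "\<And>k. 1 \<le> k ==> k \<le> s ==> F k = share_back m X y ((j + 1) mod m) (k - 1)"
  and own: "R1 j = R" "R2 j = R" "X j = xor R (y j)"
 shows "sharing_step m (y j) R B F s = (share_front m R1 R2 y j s, share_back m X y j s)"
proof -
 note d = dist2_bounds[OF m]
 have cB: "carried share2 R B k = Some (R2 ((j + (m - k)) mod m))" if "k \<le> s" "k < dist2 m" for k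
 proof (cases "k = 0")
  case False
  hence "share2 (B k) = Some (R2 (((j + (m - 1)) mod m + (m - (k - 1))) mod m))"
   using that B[of k] share2_share_front[of "k - 1" m] m by simp
  thus ?thesis using False that d mod_add_pred[of k m j] by (simp only: carried_def) simp
 qed (use j own in \<open>simp add: carried_def\<close>)
 have cF1: "carried share1 (xor R (y j)) F k = Some (X ((j + k) mod m))" if "k \<le> s" "k < m - 1" for k
 proof (cases "k = 0")
  case False
  hence "share1 (F k) = Some (X (((j + 1) mod m + (k - 1)) mod m))"
   using that F[of k] share1_share_back[of "k - 1" m] by simp
  thus ?thesis using False mod_add_succ[of k j m] by (simp only: carried_def) simp
 qed (use j own in \<open>simp add: carried_def\<close>)
 have cF2: "carried share2 (xor R (y j)) F k = Some (X ((j + k) mod m))" if "k \<le> s" "k < m - dist2 m" for k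
 proof (cases "k = 0")
  case False
  hence "share2 (F k) = Some (X (((j + 1) mod m + (k - 1)) mod m))"
   using that F[of k] share2_share_back[of "k - 1" m] by simp
  thus ?thesis using False mod_add_succ[of k j m] by (simp only: carried_def) simp
 qed (use j own in \<open>simp add: carried_def\<close>)
 have c0: "carried share1 R B 0 = Some R" by (simp add: carried_def)
 consider "s < m" | "s = m" | "s > m" by linarith
 thus ?thesis
 proof cases
  case 1
  have "transmit m 1 share1 R B s = (if s + 1 = m then Some (R1 j) else None)"
   using c0 own by (simp add: transmit_def)
  moreover have "transmit m (dist2 m) share2 R B s =
    (if s + 1 < dist2 m then Some (R2 ((j + (m - s)) mod m))
     else if s + 1 = m then Some (R2 ((j + (m - (dist2 m - 1))) mod m)) else None)"
   using cB[of s] cB[of "dist2 m - 1"] d by (auto simp only: transmit_def split: if_splits)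
  moreover have "transmit m (m - 1) share1 (xor R (y j)) F s =
    (if s + 1 < m - 1 then Some (X ((j + s) mod m))
     else if s + 1 = m then Some (X ((j + (m - 2)) mod m)) else None)"
   using cF1[of s] cF1[of "m - 2"] m by (simp add: transmit_def numeral_2_eq_2)
  moreover have "transmit m (m - dist2 m) share2 (xor R (y j)) F s =
    (if s + 1 < m - dist2 m then Some (X ((j + s) mod m))
     else if s + 1 = m then Some (X ((j + (m - dist2 m - 1)) mod m)) else None)"
   using cF2[of s] cF2[of "m - dist2 m - 1"] d by (auto simp: transmit_def)
  ultimately show ?thesis
   using 1 by (simp only: sharing_step_def share_front_def share_back_def Let_def if_True)
 next
  case 2
  thus ?thesis by (simp add: sharing_step_def share_front_def share_back_def Let_def)
 next
  case 3
  define \<sigma> where "\<sigma> = s - (m + 1)"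
  have \<sigma>: "s = m + 1 + \<sigma>" "\<sigma> < m" using 3 s by (auto simp: \<sigma>_def)
  have st: "sharing_step m (y j) R B F s = flood (Val (y j)) (after (m + 1) B) (after (m + 1) F) \<sigma>"
   using \<sigma>(1) by (simp add: sharing_step_def Let_def)
  show ?thesis
  proof (cases "\<sigma> = 0")
   case True
   thus ?thesis unfolding st using \<sigma>(1) j by (simp add: share_front_def share_back_def flood_def)
  next
   case False
   hence k: "1 \<le> \<sigma>" "1 \<le> s" using \<sigma> by auto
   have q: "\<not> s < m" "s \<noteq> m" "s - (m + 1) = \<sigma>" "m + 1 + \<sigma> = s" using \<sigma> by auto
   have "B s = Val (y ((j + (m - \<sigma>)) mod m))" "F s = Val (y ((j + \<sigma>) mod m))"
    using B[OF k(2) order_refl] F[OF k(2) order_refl] flooded_share[OF k(1) \<sigma>(2)]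
    by (simp_all only: \<sigma>(1))
   thus ?thesis using False q
    by (simp only: st flood_def after_def share_front_def share_back_def if_False)
  qed
 qed
qed

text \<open>Position \<open>j\<close> tests exactly two secrets, that of its predecessor through
  \<open>R1\<close> and that of the position \<open>dist2 m\<close> behind it through
  \<open>R2\<close>. This leaves room for a position that is inconsistent only towards a tester that
  is itself fake.\<close>

lemma sharing_ok_ring:
 assumes m: "m \<ge> 3" and j: "j < m"
  and B: "\<And>k. 1 \<le> k ==> k \<le> 2 * m ==> B k = share_front m R1 R2 y ((j + (m - 1)) mod m) (k - 1)"
  and F: "\<And>k. 1 \<le> k ==> k \<le> 2 * m ==> F k = share_back m X y ((j + 1) mod m) (k - 1)"
  and bits: "\<And>i. i < m ==> R1 i < 2 ^ bits \<and> R2 i < 2 ^ bits \<and> X i < 2 ^ bits \<and> y i \<in> S"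
  and s1: "xor (R1 ((j + (m - 1)) mod m)) (X ((j + (m - 1)) mod m)) = y ((j + (m - 1)) mod m)"
  and s2: "xor (R2 ((j + (m - dist2 m)) mod m)) (X ((j + (m - dist2 m)) mod m)) = y ((j + (m - dist2 m)) mod m)"
 shows "sharing_ok bits S m B F"
proof -
 note d = dist2_bounds[OF m]
 have lt: "i mod m < m" for i using m by simp
 have e2: "((j + 1) mod m + (m - 2)) mod m = (j + (m - 1)) mod m"
  using mod_add_succ[of "m - 1" j m] m by (simp add: numeral_2_eq_2)
 have e3: "((j + 1) mod m + (m - dist2 m - 1)) mod m = (j + (m - dist2 m)) mod m"
  using mod_add_succ[of "m - dist2 m" j m] d by simp
 have e4: "((j + (m - 1)) mod m + (m - (dist2 m - 1))) mod m = (j + (m - dist2 m)) mod m"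
  using mod_add_pred[of "dist2 m" m j] d by simp
 have fl: "B (m + 1 + k) = Val (y ((j + (m - k)) mod m))" "F (m + 1 + k) = Val (y ((j + k) mod m))"
  if "1 \<le> k" "k < m" for k
 proof -
  have "1 \<le> m + 1 + k" "m + 1 + k \<le> 2 * m" using that by auto
  thus "B (m + 1 + k) = Val (y ((j + (m - k)) mod m))" "F (m + 1 + k) = Val (y ((j + k) mod m))"
   using flooded_share[OF that] B[of "m + 1 + k"] F[of "m + 1 + k"] by (simp_all only:)
 qed
 have Bm: "B m = Shares (Some (R1 ((j + (m - 1)) mod m))) (Some (R2 ((j + (m - dist2 m)) mod m)))"
  using B[of m] m by (simp only: share_last(1)[OF m] e4)
 have Fm: "F m = Shares (Some (X ((j + (m - 1)) mod m))) (Some (X ((j + (m - dist2 m)) mod m)))"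
  using F[of m] m by (simp only: share_last(2)[OF m] e2 e3)
 have 1: "shares_ok bits m 1 (dist2 m) B"
  unfolding shares_ok_def
 proof
  fix k assume "k \<in> {1..m}"
  thus "\<exists>a b. B k = Shares a b \<and> (a \<noteq> None \<longleftrightarrow> due m 1 k) \<and> (b \<noteq> None \<longleftrightarrow> due m (dist2 m) k)
    \<and> set_option a \<union> set_option b \<subseteq> {..<2 ^ bits}"
   using B[of k] bits lt d m by (cases k) (auto simp: share_front_def due_def)
 qed
 have 2: "shares_ok bits m (m - 1) (m - dist2 m) F"
  unfolding shares_ok_def
 proof
  fix k assume k: "k \<in> {1..m}"
  define a where "a = (if k < m - 1 then Some (X (((j + 1) mod m + (k - 1)) mod m))
   else if k = m then Some (X (((j + 1) mod m + (m - 2)) mod m)) else None)"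
  define b where "b = (if k < m - dist2 m then Some (X (((j + 1) mod m + (k - 1)) mod m))
   else if k = m then Some (X (((j + 1) mod m + (m - dist2 m - 1)) mod m)) else None)"
  have "k - 1 < m" "k - 1 + 1 = k" using k by auto
  hence "F k = Shares a b" using F[of k] k by (simp only: share_back_def a_def b_def if_True)
  moreover have "(a \<noteq> None \<longleftrightarrow> due m (m - 1) k)" "(b \<noteq> None \<longleftrightarrow> due m (m - dist2 m) k)"
   by (auto simp: a_def b_def due_def)
  moreover have "X (i mod m) < 2 ^ bits" for i using bits lt by blast
  hence "set_option a \<union> set_option b \<subseteq> {..<2 ^ bits}" by (auto simp: a_def b_def)
  ultimately show "\<exists>a b. F k = Shares a b \<and> (a \<noteq> None \<longleftrightarrow> due m (m - 1) k) \<and> (b \<noteq> None \<longleftrightarrow> due m (m - dist2 m) k)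
    \<and> set_option a \<union> set_option b \<subseteq> {..<2 ^ bits}"
   by blast
 qed
 have 3: "flood_ok m (Val ` S) (after (m + 1) B) (after (m + 1) F)"
  unfolding flood_ok_def after_def
 proof
  fix k assume k: "k \<in> {1..<m}"
  thus "B (m + 1 + k) \<in> Val ` S \<and> B (m + 1 + k) = F (m + 1 + (m - k))"
   using fl[of k] fl[of "m - k"] bits lt by auto
 qed
 have "val (after (m + 1) B 1) = learned m share1 B F"
  using fl[of 1] Bm Fm s1 m by (simp add: after_def learned_def)
 moreover have "val (after (m + 1) B (dist2 m)) = learned m share2 B F"
  using fl[of "dist2 m"] Bm Fm s2 d by (simp add: after_def learned_def)
 moreover have "B (m + 1) = Silent" "F (m + 1) = Silent"
  using B[of "m + 1"] F[of "m + 1"] m by (simp_all add: share_front_def share_back_def)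
 ultimately show ?thesis using 1 2 3 by (simp add: sharing_ok_def)
qed

lemma shared_inputs_ring:
 assumes m: "m \<ge> 3" and j: "j < m" and q: "q < m" "j0 = (q + j) mod m"
  and F: "\<And>k. 1 \<le> k ==> k \<le> 2 * m ==> F k = share_back m X y ((j + 1) mod m) (k - 1)"
 shows "shared_inputs m j0 (y j) F = map (\<lambda>i. y ((i + (m - q)) mod m)) [0..<m]"
proof -
 have "F (m + 1 + k) = Val (y ((j + k) mod m))" if "1 \<le> k" "k < m" for k
  using that F[of "m + 1 + k"] mod_add_succ[of k j m]
  by (simp add: share_back_def)
 hence "shared_inputs m j0 (y j) F = arrange m j0 (y (j mod m)) (\<lambda>k. y ((j + k) mod m))"
  using j unfolding shared_inputs_def by (subst arrange_cong[of m _ "\<lambda>k. y ((j + k) mod m)"]) (simp_all add: after_def)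
 thus ?thesis using arrange_ring[OF q] by simp
qed

section \<open>Common numbering and apparent size of the ring\<close>

lemma oriented_ring:
 assumes "inj_on X {..<n}" "0 < n"
 defines "V \<equiv> oriented_ids (map X [0..<n])" and "fwd \<equiv> oriented_cw (map X [0..<n])"
 obtains q where "q < n" "\<And>i. i < n ==> V ! ((if fwd then q + i else q + (n - i)) mod n) = X i"
  "length V = n" "distinct V"
proof (cases fwd)
 case True
 hence "V = from_max (map X [0..<n])" by (simp add: V_def fwd_def oriented_ids_def)
 thus ?thesis using from_max_ring[OF assms(1,2)] that True by metis
next
 case False
 \<comment> \<open>Against the clockwise direction the ring is listed backwards. As
   \<open>rev\<close> sends index \<open>k\<close> to \<open>n - 1 - k\<close> and not to
   \<open>n - k\<close>, the starting index below is shifted by \<open>n - 1\<close>.\<close>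
 define Z where "Z k = X (n - 1 - k)" for k
 have "rev (map X [0..<n]) = map Z [0..<n]" by (rule nth_equalityI) (auto simp: Z_def rev_nth)
 hence V: "V = from_max (map Z [0..<n])" using False by (simp add: V_def fwd_def oriented_ids_def)
 have "inj_on Z {..<n}" using assms(1) by (fastforce simp: Z_def inj_on_def)
 then obtain q where q: "q < n" "length V = n" "\<And>i. i < n ==> V ! ((q + i) mod n) = Z i" "distinct V"
  using from_max_ring[OF _ assms(2), of Z] V by metis
 have "V ! (((q + (n - 1)) mod n + (n - i)) mod n) = X i" if i: "i < n" for i
 proof -
  have "q + (n - 1) + (n - i) = q + (n - 1 - i) + n" using i by linarith
  hence "((q + (n - 1)) mod n + (n - i)) mod n = (q + (n - 1 - i)) mod n"
   by (metis mod_add_left_eq mod_add_self2)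
  thus ?thesis using q(3)[of "n - 1 - i"] i by (simp add: Z_def)
 qed
 moreover have "(q + (n - 1)) mod n < n" using assms(2) by simp
 ultimately show ?thesis using q(2,4) False by (intro that[of "(q + (n - 1)) mod n"]) auto
qed

lemma mod_turn:
 fixes j k m :: nat
 assumes "j < m" "1 \<le> k" "k \<le> m"
 shows "(j + (m - k)) mod m = j \<longleftrightarrow> k = m" "(j + k) mod m = j \<longleftrightarrow> k = m"
proof -
 show "(j + (m - k)) mod m = j \<longleftrightarrow> k = m"
  using assms by (cases "j + (m - k) < m") (auto simp: le_mod_geq)
 show "(j + k) mod m = j \<longleftrightarrow> k = m"
  using assms by (cases "k = m"; cases "j + k < m") (auto simp: le_mod_geq)
qed

text \<open>The ids are distinct, so the own id can arrive at a multiple of \<open>m\<close> only.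
  The equation between sets leaves open which of the two edges is the front, as the orientation is
  not yet set during this phase.\<close>

lemma ring_size_flood:
 assumes V: "distinct V" "length V = m" and j: "j < m" "x = V ! j"
  and arrive: "\<And>k. 1 \<le> k ==> k \<le> m ==> k \<le> length h ==>
   {from_ccw h k, from_cw h k} = {Id (V ! ((j + (m - k)) mod m)), Id (V ! ((j + k) mod m))}"
 shows "ring_size x h = (if m \<le> length h then Some m else None)"
proof -
 have r: "returned x h k \<longleftrightarrow> k = m \<and> m \<le> length h" if "k \<le> m" for k
 proof (cases "1 \<le> k \<and> k \<le> length h")
  case True
  have l: "(j + (m - k)) mod m < length V" "(j + k) mod m < length V" "j < length V" using j V by simp_all
  have "returned x h k \<longleftrightarrow> Id x \<in> {from_ccw h k, from_cw h k}" using True by (auto simp: returned_def)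
  also have "\<dots> \<longleftrightarrow> k = m"
   using arrive[of k] True that mod_turn[OF j(1), of k] l V by (simp add: j(2) nth_eq_iff_index_eq eq_commute[of "V ! j"])
  finally show ?thesis using True by auto
 next
  case False
  thus ?thesis using j by (auto simp: returned_def from_ccw_def from_cw_def)
 qed
 show ?thesis
 proof (cases "m \<le> length h")
  case True
  hence "(LEAST k. returned x h k) = m"
   using r by (intro Least_equality) (auto simp: not_less[symmetric])
  thus ?thesis using True r[of m] by (auto simp: ring_size_def)
 next
  case False
  have "\<not> returned x h k" for k
   using r[of k] False by (cases "k \<le> m") (auto simp: returned_def from_ccw_def from_cw_def)
  thus ?thesis using False by (simp add: ring_size_def)
 qed
qed

text \<open>Agents \<open>1, \<dots>, n - 1\<close> follow a protocol in a ring in which agent \<open>0\<close> plays the role of the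
 \<open>m - n + 1\<close> positions \<open>n, \<dots>, m\<close>, position \<open>m\<close> being \<open>0\<close>. \<open>rt i t\<close> and \<open>lt i t\<close> are the
 messages sent by agent \<open>i\<close> at round \<open>t\<close> to agents \<open>i + 1\<close> and \<open>i - 1\<close>.\<close>

definition claimed :: "nat => nat => (nat => 'a) => (nat => 'a) => nat => 'a" where
 "claimed n m M c p = (if 1 \<le> p \<and> p < n then M p else c ((m - p) mod m))"

text \<open>The value of a fake position \<open>p\<close> leaves agent \<open>0\<close> towards the
  front at step \<open>m - p\<close>, which is where \<open>claimed\<close> reads it (step
  \<open>0\<close> for position \<open>m\<close>, that is \<open>0\<close>). Forwarding carries it
  to all real agents. The comparison of the two directions then forces agent \<open>0\<close> to
  pass on the values of real agents unchanged and to send the same fake values backwards as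
  forwards.\<close>

lemma flood_values:
 fixes rt lt :: "nat => nat => 'a"
 assumes nm: "1 \<le> n" "n \<le> m"
  and rt: "\<And>i s. 1 \<le> i ==> i < n ==> s < m - 1 ==> rt i s = (if s = 0 then M i else rt (i - 1) (s - 1))"
  and lt: "\<And>i s. 1 \<le> i ==> i < n ==> s < m - 1 ==> lt i s = (if s = 0 then M i else lt ((i + 1) mod n) (s - 1))"
  and chk: "\<And>i k. 1 \<le> i ==> i < n ==> 1 \<le> k ==> k < m ==> rt (i - 1) (k - 1) = lt ((i + 1) mod n) (m - k - 1)"
  and i: "1 \<le> i" "i < n" and k: "1 \<le> k" "k < m"
 shows "rt (i - 1) (k - 1) = claimed n m M (rt 0) ((i + (m - k)) mod m)" (is ?B)
  and "lt ((i + 1) mod n) (k - 1) = claimed n m M (rt 0) ((i + k) mod m)" (is ?F)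
proof -
 have r1: "rt i s = (if s < i then M (i - s) else rt 0 (s - i))" if "i < n" "s < m - 1" for i s
  using that
 proof (induction i arbitrary: s)
  case (Suc i)
  thus ?case using rt[of "Suc i" s] Suc.IH[of "s - 1"] by (cases s) auto
 qed simp
 have l1: "lt i s = M (i + s)" if "1 \<le> i" "i + s < n" for i s
  using that
 proof (induction s arbitrary: i)
  case 0
  thus ?case using lt[of i 0] nm by auto
 next
  case (Suc s)
  thus ?case using lt[of i "Suc s"] Suc.IH[of "Suc i"] nm by auto
 qed
 have B: "rt (i - 1) (k - 1) = claimed n m M (rt 0) ((i + (m - k)) mod m)" if k: "1 \<le> k" "k < m" for k
 proof -
  consider "k < i" | "k = i" | "k > i" by linarith
  thus ?thesis
  proof cases
   case 1
   hence "i + (m - k) = i - k + m" using k by linarith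
   moreover have "(i - k + m) mod m = i - k" using i nm by simp
   ultimately have p: "(i + (m - k)) mod m = i - k" by (simp only:)
   have "k - 1 < i - 1" "i - 1 - (k - 1) = i - k" "1 \<le> i - k" "i - k < n" using 1 k i by linarith+
   thus ?thesis using r1[of "i - 1" "k - 1"] k i p by (simp add: claimed_def)
  next
   case 2
   hence "(i + (m - k)) mod m = 0" using k by simp
   thus ?thesis using 2 r1[of "i - 1" "k - 1"] k i by (simp add: claimed_def)
  next
   case 3
   hence p: "(i + (m - k)) mod m = i + (m - k)" using k by simp
   have e: "m - (i + (m - k)) = k - i" using 3 k by simp
   have "\<not> k - 1 < i - 1" "k - 1 - (i - 1) = k - i" using 3 k i by linarith+
   hence r: "rt (i - 1) (k - 1) = rt 0 (k - i)" using r1[of "i - 1" "k - 1"] k i by simp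
   show ?thesis
   proof (cases "i + (m - k) < n")
    case True
    \<comment> \<open>Here the value of a real agent has come through agent \<open>0\<close>. It has
      also come directly from the other side, and \<open>chk\<close> equates the two.\<close>
    hence "lt ((i + 1) mod n) (m - k - 1) = M (i + (m - k))"
    proof -
     have "i + 1 + (m - k - 1) = i + (m - k)" using k by linarith
     thus ?thesis using l1[of "i + 1" "m - k - 1"] True k by simp
    qed
    thus ?thesis using True p chk[OF i k] i by (simp add: claimed_def)
   next
    case False
    hence "claimed n m M (rt 0) (i + (m - k)) = rt 0 ((k - i) mod m)"
     unfolding claimed_def e by simp
    thus ?thesis using k p r by simp
   qed
  qed
 qed
 show ?B by (rule B[OF k])
 have "rt (i - 1) (m - k - 1) = lt ((i + 1) mod n) (k - 1)" using chk[OF i, of "m - k"] k by simp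
 moreover have "rt (i - 1) (m - k - 1) = claimed n m M (rt 0) ((i + (m - (m - k))) mod m)"
  using B[of "m - k"] k by simp
 ultimately show ?F using k by simp
qed

text \<open>Only the real agents are constrained: they follow the protocol and pass the final
  checks. Agent \<open>0\<close> enters through what it sends and nothing else.\<close>

locale sharing_run =
 fixes n m :: nat and rt lt :: "nat => nat => msg" and y R :: "nat => nat"
 assumes nm: "3 \<le> n" "n \<le> m"
  and step: "\<And>i s. 1 \<le> i ==> i < n ==> s < 2 * m ==>
   (rt i s, lt i s) = sharing_step m (y i) (R i) (\<lambda>k. rt (i - 1) (k - 1)) (\<lambda>k. lt ((i + 1) mod n) (k - 1)) s"
  and ok: "\<And>i. 1 \<le> i ==> i < n ==>
   sharing_ok 1 {0, 1} m (\<lambda>k. rt (i - 1) (k - 1)) (\<lambda>k. lt ((i + 1) mod n) (k - 1))"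
begin

definition input :: "nat => nat" where
 "input = claimed n m y (\<lambda>s. val (rt 0 (m + 1 + s)))"

lemma flooded_inputs:
 assumes i: "1 \<le> i" "i < n" and k: "1 \<le> k" "k < m"
 shows "val (rt (i - 1) (m + k)) = input ((i + (m - k)) mod m)"
  and "val (lt ((i + 1) mod n) (m + k)) = input ((i + k) mod m)"
proof -
 have st: "rt i (m + 1 + s) = (if s = 0 then Val (y i) else rt (i - 1) (m + s)) \<and>
   lt i (m + 1 + s) = (if s = 0 then Val (y i) else lt ((i + 1) mod n) (m + s))"
  if "1 \<le> i" "i < n" "s < m - 1" for i s
  using step[OF that(1,2), of "m + 1 + s"] that
  by (cases s) (auto simp: sharing_step_def flood_def after_def Let_def)
 have chk: "rt (i - 1) (m + k) = lt ((i + 1) mod n) (m + (m - k))"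
  if "1 \<le> i" "i < n" "1 \<le> k" "k < m" for i k
  using ok[of i] that by (auto simp: sharing_ok_def flood_ok_def after_def)
 define rv where "rv i s = val (rt i (m + 1 + s))" for i s
 define lv where "lv i s = val (lt i (m + 1 + s))" for i s
 have "rv i s = (if s = 0 then y i else rv (i - 1) (s - 1))" if "1 \<le> i" "i < n" "s < m - 1" for i s
  using st[OF that] by (cases s) (simp_all add: rv_def)
 moreover have "lv i s = (if s = 0 then y i else lv ((i + 1) mod n) (s - 1))" if "1 \<le> i" "i < n" "s < m - 1" for i s
  using st[OF that] by (cases s) (simp_all add: lv_def)
 moreover have "rv (i - 1) (k - 1) = lv ((i + 1) mod n) (m - k - 1)" if "1 \<le> i" "i < n" "1 \<le> k" "k < m" for i k
 proof -
  have "m + 1 + (k - 1) = m + k" "m + 1 + (m - k - 1) = m + (m - k)" using that by linarith+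
  thus ?thesis using chk[OF that] by (simp only: rv_def lv_def)
 qed
 ultimately have "rv (i - 1) (k - 1) = claimed n m y (rv 0) ((i + (m - k)) mod m)"
  "lv ((i + 1) mod n) (k - 1) = claimed n m y (rv 0) ((i + k) mod m)"
  using flood_values[of n m rv y lv, OF _ _ _ _ _ i k] nm by auto
 moreover have "rv 0 = (\<lambda>s. val (rt 0 (m + 1 + s)))" by (simp add: rv_def fun_eq_iff)
 moreover have "m + 1 + (k - 1) = m + k" using k by linarith
 ultimately show "val (rt (i - 1) (m + k)) = input ((i + (m - k)) mod m)"
  "val (lt ((i + 1) mod n) (m + k)) = input ((i + k) mod m)"
  by (simp_all only: rv_def lv_def input_def)
qed

lemma input_real: "1 \<le> i ==> i < n ==> input i = y i"
 by (simp add: input_def claimed_def)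

lemma shared_inputs_claimed:
 assumes i: "1 \<le> i" "i < n" and q: "q < m" "j0 = (q + i) mod m"
 shows "shared_inputs m j0 (y i) (\<lambda>k. lt ((i + 1) mod n) (k - 1)) = map (\<lambda>p. input ((p + (m - q)) mod m)) [0..<m]"
proof -
 have "val (after (m + 1) (\<lambda>k. lt ((i + 1) mod n) (k - 1)) k) = input ((i + k) mod m)" if "1 \<le> k" "k < m" for k
 proof -
  have "m + 1 + k - 1 = m + k" by simp
  thus ?thesis using flooded_inputs(2)[OF i that] by (simp only: after_def)
 qed
 moreover have "input (i mod m) = y i" using i nm input_real[OF i] by simp
 ultimately have "shared_inputs m j0 (y i) (\<lambda>k. lt ((i + 1) mod n) (k - 1)) = arrange m j0 (input (i mod m)) (\<lambda>k. input ((i + k) mod m))"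
  unfolding shared_inputs_def by (subst arrange_cong[of m _ "\<lambda>k. input ((i + k) mod m)"]) auto
 thus ?thesis using arrange_ring[OF q] by simp
qed

lemma parity_shared:
 assumes i: "1 \<le> i" "i < n" and q: "q < m" "j0 = (q + i) mod m"
 shows "parity (shared_inputs m j0 (y i) (\<lambda>k. lt ((i + 1) mod n) (k - 1))) = (\<Sum>p<m. input p) mod 2"
 unfolding shared_inputs_claimed[OF assms] parity_def sum_list_ring ..

lemma front_early:
 assumes "1 \<le> i" "i < n" "s + 1 < m"
 shows "rt i s = Shares None (if s + 1 < dist2 m then (if s = 0 then Some (R i) else share2 (rt (i - 1) (s - 1))) else None)"
 using step[OF assms(1,2), of s] assms(3) by (simp add: sharing_step_def transmit_def carried_def Let_def)

text \<open>What is delivered at the last step has been kept since step \<open>dist2 m - 1\<close>,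
  when it came from the predecessor, which had sent it one step earlier.\<close>

lemma front_last:
 assumes "1 \<le> i" "i < n"
 shows "share2 (rt i (m - 1)) = share2 (rt (i - 1) (dist2 m - 2))"
proof -
 have "2 \<le> dist2 m" "dist2 m < m" using dist2_bounds[of m] nm by auto
 thus ?thesis
  using step[OF assms, of "m - 1"] nm
  by (simp add: sharing_step_def transmit_def carried_def Let_def numeral_2_eq_2)
qed

text \<open>Inputs and random numbers enter the backward shares only through
  \<open>xor (R i) (y i)\<close>; a simultaneous change of both that preserves it is invisible in
  this direction.\<close>

lemma back_share:
 assumes "1 \<le> i" "i < n" "s < m"
 shows "lt i s = Shares
  (if s + 1 < m - 1 then (if s = 0 then Some (xor (R i) (y i)) else share1 (lt ((i + 1) mod n) (s - 1)))
   else if s + 1 = m then share1 (lt ((i + 1) mod n) (m - 3)) else None)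
  (if s + 1 < m - dist2 m then (if s = 0 then Some (xor (R i) (y i)) else share2 (lt ((i + 1) mod n) (s - 1)))
   else if s + 1 = m then (if m - dist2 m = 1 then Some (xor (R i) (y i)) else share2 (lt ((i + 1) mod n) (m - dist2 m - 2)))
   else None)"
proof -
 have d: "2 \<le> dist2 m" "dist2 m < m" using dist2_bounds[of m] nm by auto
 have "m - 1 - 1 \<noteq> 0" "m - 1 - 1 - 1 = m - 3" "m - dist2 m - 1 = 0 \<longleftrightarrow> m - dist2 m = 1"
  "m - dist2 m - 1 - 1 = m - dist2 m - 2" using nm d by auto
 moreover have "lt i s = snd (sharing_step m (y i) (R i) (\<lambda>k. rt (i - 1) (k - 1)) (\<lambda>k. lt ((i + 1) mod n) (k - 1)) s)"
  using step[OF assms(1,2), of s] assms(3) by (metis snd_conv mult_2 trans_less_add1)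
 ultimately show ?thesis
  using assms(3) by (simp only: sharing_step_def transmit_def carried_def Let_def if_True if_False snd_conv)
qed

end

text \<open>If less than half of the positions are fake, then what agent \<open>0\<close> sees until all shares have
 been sent does not depend on the input of agent \<open>1\<close>, as it has not seen the random number of
 agent \<open>1\<close>; but by then the inputs of the fake positions are fixed.\<close>

locale two_sharing_runs =
 r: sharing_run n m rt lt y R + r': sharing_run n m rt' lt' y' R' for n m rt lt y R rt' lt' y' R' +
 assumes few: "m + 2 \<le> 2 * n"
  and same: "\<And>i. 2 \<le> i ==> i < n ==> y i = y' i \<and> R i = R' i"
  and same1: "xor (R 1) (y 1) = xor (R' 1) (y' 1)"
  and coupled: "\<And>s. s < m ==> (\<And>u. u < s ==> rt (n - 1) u = rt' (n - 1) u \<and> lt 1 u = lt' 1 u)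
   ==> rt 0 s = rt' 0 s \<and> lt 0 s = lt' 0 s"
begin

text \<open>The inequality \<open>dist2 m \<le> n - 1\<close> is what \<open>few\<close> is for: the
  random number of agent \<open>1\<close> is held by agent \<open>dist2 m\<close>, a real one, until
  the last step, and agent \<open>0\<close> does not see it before.\<close>

lemma d2: "2 \<le> dist2 m" "dist2 m < m" "dist2 m \<le> n - 1" "m \<le> 2 * dist2 m"
 using few r.nm dist2_bounds[of m] by (auto simp: dist2_def)

lemma back_same:
 assumes "1 \<le> i" "i < n" "s < m" "\<And>u. u < s ==> lt 0 u = lt' 0 u"
 shows "lt i s = lt' i s"
 using assms
proof (induction s arbitrary: i rule: less_induct)
 case (less s)
 have X: "xor (R i) (y i) = xor (R' i) (y' i)"
  using same[of i] same1 less.prems by (cases "i = 1") auto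
 have nx: "lt ((i + 1) mod n) u = lt' ((i + 1) mod n) u" if "u < s" for u
  using less.IH[of u "(i + 1) mod n"] that less.prems r.nm by (cases "i + 1 = n") auto
 have a: "lt ((i + 1) mod n) (s - 1) = lt' ((i + 1) mod n) (s - 1)" if "s \<noteq> 0"
  using that by (intro nx) linarith
 have b: "lt ((i + 1) mod n) (m - 3) = lt' ((i + 1) mod n) (m - 3)"
  "lt ((i + 1) mod n) (m - dist2 m - 2) = lt' ((i + 1) mod n) (m - dist2 m - 2)" if "s + 1 = m"
  using that d2 r.nm by (intro nx; linarith)+
 have c: "(if s = 0 then z else share1 (lt ((i + 1) mod n) (s - 1))) = (if s = 0 then z else share1 (lt' ((i + 1) mod n) (s - 1)))"
  "(if s = 0 then z else share2 (lt ((i + 1) mod n) (s - 1))) = (if s = 0 then z else share2 (lt' ((i + 1) mod n) (s - 1)))" for z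
  using a by (cases "s = 0"; simp only: if_True if_False simp_thms)+
 show ?case
  unfolding r.back_share[OF less.prems(1-3)] r'.back_share[OF less.prems(1-3)] X
  by (simp only: c b cong: if_cong)
qed

text \<open>The exception is the message that carries the random number of agent \<open>1\<close>:
  agent \<open>i\<close> forwards it at step \<open>i - 1\<close>, and before the last step this
  ends with agent \<open>dist2 m - 1\<close>.\<close>

lemma front_same:
 assumes "1 \<le> i" "i < n" "s + 1 < m" "\<not> (s + 1 = i \<and> i < dist2 m)" "\<And>u. u < s ==> rt 0 u = rt' 0 u"
 shows "rt i s = rt' i s"
 using assms
proof (induction s arbitrary: i)
 case 0
 thus ?case using same[of i] d2 by (auto simp: r.front_early r'.front_early)
next
 case (Suc s)
 have "rt (i - 1) s = rt' (i - 1) s" if "Suc s + 1 < dist2 m"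
 proof (cases "i = 1")
  case False
  thus ?thesis using Suc.prems that by (intro Suc.IH) auto
 qed (use Suc.prems in auto)
 thus ?case using Suc.prems by (simp add: r.front_early r'.front_early)
qed

lemma cheater_same: "s < m ==> rt 0 s = rt' 0 s \<and> lt 0 s = lt' 0 s"
proof (induction s rule: less_induct)
 case (less s)
 show ?case
 proof (rule coupled[OF less.prems], rule conjI)
  fix u assume u: "u < s"
  show "rt (n - 1) u = rt' (n - 1) u"
  proof (rule front_same)
   show "rt 0 v = rt' 0 v" if "v < u" for v using less.IH[of v] that u less.prems by simp
  qed (use u less.prems r.nm d2 in linarith)+
  show "lt 1 u = lt' 1 u"
  proof (rule back_same)
   show "lt 0 v = lt' 0 v" if "v < u" for v using less.IH[of v] that u less.prems by simp
  qed (use u less.prems r.nm d2 in linarith)+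
 qed
qed

text \<open>The secret of position \<open>p\<close> is tested by the position \<open>dist2 m\<close>
  in front of it, which is real since the fake positions do not extend that far. The shares that
  this agent combines are sent by step \<open>m - 1\<close> and agree in both runs; its test ties
  the input announced afterwards to them.\<close>

lemma fake_input_same:
 assumes p: "p = 0 \<or> n \<le> p" "p < m"
 shows "r.input p = r'.input p"
proof -
 define i where "i = (p + dist2 m) mod m"
 \<comment> \<open>Agent \<open>dist2 m + 1\<close> is the one that tests agent \<open>1\<close>.
   The share delivered to it is the one that differs between the runs, so it has to be
   excluded.\<close>
 have i: "1 \<le> i" "i < n" "i \<noteq> dist2 m + 1" "(i + (m - dist2 m)) mod m = p"
 proof -
  have "1 \<le> i \<and> i < n \<and> i \<noteq> dist2 m + 1 \<and> (i + (m - dist2 m)) mod m = p"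
  proof (cases "p = 0")
   case True
   hence "i = dist2 m" "dist2 m + (m - dist2 m) = m" using d2 by (simp_all add: i_def)
   thus ?thesis using True d2 r.nm by simp
  next
   case False
   hence *: "m \<le> p + dist2 m" "p + dist2 m - m < m" "n \<le> p" using p d2 few by linarith+
   hence i: "i = p + dist2 m - m" by (simp add: i_def le_mod_geq)
   have "i + (m - dist2 m) = p" "1 \<le> i" "i < n" "i \<noteq> dist2 m + 1" using i * p d2 few by linarith+
   thus ?thesis using p by simp
  qed
  thus "1 \<le> i" "i < n" "i \<noteq> dist2 m + 1" "(i + (m - dist2 m)) mod m = p" by auto
 qed
 have s: "share2 (rt (i - 1) (m - 1)) = share2 (rt' (i - 1) (m - 1))"
 proof (cases "i = 1")
  case True
  thus ?thesis using cheater_same[of "m - 1"] r.nm by simp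
 next
  case False
  hence e: "share2 (rt (i - 1) (m - 1)) = share2 (rt (i - 2) (dist2 m - 2))"
   "share2 (rt' (i - 1) (m - 1)) = share2 (rt' (i - 2) (dist2 m - 2))"
   using r.front_last[of "i - 1"] r'.front_last[of "i - 1"] i by (simp_all add: numeral_2_eq_2)
  have "rt (i - 2) (dist2 m - 2) = rt' (i - 2) (dist2 m - 2)"
  proof (cases "i = 2")
   case True
   thus ?thesis using cheater_same[of "dist2 m - 2"] d2 by simp
  next
   case False
   show ?thesis
   proof (rule front_same)
    show "rt 0 v = rt' 0 v" if "v < dist2 m - 2" for v using cheater_same[of v] that d2 by linarith
   qed (use False i \<open>i \<noteq> 1\<close> d2 in linarith)+
  qed
  thus ?thesis using e by simp
 qed
 have l: "lt ((i + 1) mod n) (m - 1) = lt' ((i + 1) mod n) (m - 1)"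
 proof (cases "i + 1 = n")
  case True
  thus ?thesis using cheater_same[of "m - 1"] r.nm by simp
 next
  case False
  show ?thesis
  proof (rule back_same)
   show "lt 0 v = lt' 0 v" if "v < m - 1" for v using cheater_same[of v] that by linarith
  qed (use False i r.nm in auto)
 qed
 have "r.input p = xor (the (share2 (rt (i - 1) (m - 1)))) (the (share2 (lt ((i + 1) mod n) (m - 1))))"
  using r.ok[OF i(1,2)] r.flooded_inputs(1)[OF i(1,2), of "dist2 m"] i(4) d2
  by (simp add: sharing_ok_def learned_def after_def)
 moreover have "r'.input p = xor (the (share2 (rt' (i - 1) (m - 1)))) (the (share2 (lt' ((i + 1) mod n) (m - 1))))"
  using r'.ok[OF i(1,2)] r'.flooded_inputs(1)[OF i(1,2), of "dist2 m"] i(4) d2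
  by (simp add: sharing_ok_def learned_def after_def)
 ultimately show ?thesis using s l by simp
qed

lemma sum_inputs: "(\<Sum>p<m. r.input p) + y' 1 = (\<Sum>p<m. r'.input p) + y 1"
proof -
 have eq: "r.input p = r'.input p" if "p < m" "p \<noteq> 1" for p
  using fake_input_same[of p] r.input_real[of p] r'.input_real[of p] same[of p] that
  by (cases "p = 0 \<or> n \<le> p") auto
 have "(\<Sum>p<m. r.input p) = r.input 1 + (\<Sum>p\<in>{..<m} - {1}. r.input p)"
  "(\<Sum>p<m. r'.input p) = r'.input 1 + (\<Sum>p\<in>{..<m} - {1}. r'.input p)"
  using r.nm by (auto intro!: sum.remove)
 moreover have "(\<Sum>p\<in>{..<m} - {1}. r.input p) = (\<Sum>p\<in>{..<m} - {1}. r'.input p)"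
  using eq by (intro sum.cong) auto
 moreover have "r.input 1 = y 1" "r'.input 1 = y' 1" using r.input_real[of 1] r'.input_real[of 1] r.nm by auto
 ultimately show ?thesis by simp
qed

end

text \<open>A cell \<open>(u, i, R)\<close> holds all the randomness that an agent may need in a round: the number for
 the choice of the sink is \<open>u mod m\<close>, the random bit \<open>i\<close> and the random number for its shares \<open>R\<close>.\<close>

definition col_act :: "nat => nat => nat view => nat \<times> nat \<times> nat => action" where
 "col_act \<beta> ncol v c =
   (let x = own_id v; p = priv v; h = hist v; t = length h in
   if decided h then idle else
   case ring_size x h of
    None => learn_ids \<beta> x h
   | Some m =>
     (let fwd = col_cw v m; B = col_back v m; F = col_front v m;
       t1 = col_t1 m; t2 = col_t2 m; t3 = col_t3 m; t4 = col_t4 m;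
       t5 = col_t5 v m; t6 = col_t6 v m in
     if \<not> col_ok ncol v m then abort
     else if t < t1 then send fwd [] (flood (Ids (col_ids v m)) (after m B) (after m F) (t - m))
     else if t < t2 then send fwd [] (flood (Val p) (after t1 B) (after t1 F) (t - t1))
     else if t < t3 then
      send fwd [] (flood (Vals (col_prefs v m)) (after t2 B) (after t2 F) (t - t2))
     else if col_needs_sink v m \<and> t < t4 then
      (let cs = (if t = t3 then [fst c mod m] else coins (fst (h ! t3))) in
       send fwd (drawn h t3 cs)
        (fst (flood (Val (cs ! 0)) (after t3 B) (after t3 F) (t - t3)), Silent))
     else if col_needs_sink v m \<and> t < t5 then
      send fwd [] (flood (Vals (col_weights v m)) (after t4 B) (after t4 F) (t - t4))
     else if t < t6 then
      (let cs = (if t = t5 then [fst (snd c), snd (snd c)] else coins (fst (h ! t5))) in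
       send fwd (drawn h t5 cs)
        (sharing_step m (cs ! 0) (cs ! 1) (after t5 B) (after t5 F) (t - t5)))
     else if t - t6 = turn (col_prefs v m) (col_sink v m) (col_coin v m) (col_index v m) then
      (let c = (if t = t6 then p else min_available ncol (after t6 B) (after t6 F) (t - t6))
       in Act [] (Some (Some c)) (Val c) (Val c))
     else idle))"

section \<open>Runs as tables of actions\<close>

text \<open>A run is given by its table of actions, and the views are derived from the table. Two
  runs can then be compared entry by entry, without reference to the probabilistic
  execution.\<close>

definition trace_hist :: "nat => (nat => nat => action) => nat => nat => (action \<times> msg \<times> msg) list" where
 "trace_hist n act i t =
   map (\<lambda>s. (act i s, to_cw (act ((i + n - 1) mod n) s), to_ccw (act ((i + 1) mod n) s))) [0..<t]"

definition trace_view ::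
  "nat => (nat => nat) => (nat => 'p) => (nat => nat => action) => nat => nat => 'p view" where
 "trace_view n x p act i t = View (x i) (p i) (trace_hist n act i t)"

lemma trace_view_simps [simp]:
 "own_id (trace_view n x p act i t) = x i"
 "priv (trace_view n x p act i t) = p i"
 "hist (trace_view n x p act i t) = trace_hist n act i t"
 by (simp_all add: trace_view_def)

lemma length_trace_hist [simp]: "length (trace_hist n act i t) = t"
 by (simp add: trace_hist_def)

lemma fst_trace_hist: "s < t ==> fst (trace_hist n act i t ! s) = act i s"
 by (simp add: trace_hist_def)

lemma from_ccw_trace:
 "from_ccw (trace_hist n act i t) k = (if 1 \<le> k \<and> k \<le> t then to_cw (act ((i + n - 1) mod n) (k - 1)) else Silent)"
 by (auto simp: from_ccw_def trace_hist_def)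

lemma from_cw_trace:
 "from_cw (trace_hist n act i t) k = (if 1 \<le> k \<and> k \<le> t then to_ccw (act ((i + 1) mod n) (k - 1)) else Silent)"
 by (auto simp: from_cw_def trace_hist_def)

lemma decided_trace: "decided (trace_hist n act i t) \<longleftrightarrow> (\<exists>s<t. decide (act i s) \<noteq> None)"
 by (auto simp: decided_def trace_hist_def)

lemma trace_view_cong:
 assumes "\<And>i s. i < n ==> s < t ==> act i s = act' i s" "i < n"
 shows "trace_view n x p act i t = trace_view n x p act' i t"
proof -
 have "(i + n - 1) mod n < n" "(i + 1) mod n < n" using assms(2) by (auto intro: mod_less_divisor)
 thus ?thesis using assms by (auto simp: trace_view_def trace_hist_def)
qed

lemma final_output_eq:
 "final_output v = Some c \<longleftrightarrow>
   (\<exists>\<theta><length (hist v). decide (fst (hist v ! \<theta>)) = Some (Some c) \<and> (\<forall>s<\<theta>. decide (fst (hist v ! s)) = None))"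
 (is "?L \<longleftrightarrow> ?R")
proof
 assume ?L
 then obtain e where e: "find (\<lambda>e. decide (fst e) \<noteq> None) (hist v) = Some e" "the (decide (fst e)) = Some c"
  by (auto simp: final_output_def split: option.splits)
 from e(1) obtain \<theta> where "\<theta> < length (hist v)" "decide (fst (hist v ! \<theta>)) \<noteq> None" "e = hist v ! \<theta>"
  "\<forall>s<\<theta>. decide (fst (hist v ! s)) = None" by (auto simp: find_Some_iff)
 thus ?R using e(2) by auto
next
 assume ?R
 then obtain \<theta> where t: "\<theta> < length (hist v)" "decide (fst (hist v ! \<theta>)) = Some (Some c)"
  "\<forall>s<\<theta>. decide (fst (hist v ! s)) = None" by blast
 hence "find (\<lambda>e. decide (fst e) \<noteq> None) (hist v) = Some (hist v ! \<theta>)"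
  by (auto simp: find_Some_iff)
 thus ?L using t by (simp add: final_output_def)
qed

lemma final_output_trace:
 "final_output (trace_view n x p act i T) = Some c \<longleftrightarrow>
   (\<exists>\<theta><T. decide (act i \<theta>) = Some (Some c) \<and> (\<forall>s<\<theta>. decide (act i s) = None))"
proof -
 have "(\<forall>s<\<theta>. decide (fst (trace_hist n act i T ! s)) = None) = (\<forall>s<\<theta>. decide (act i s) = None)"
  if "\<theta> < T" for \<theta> using that by (auto simp: fst_trace_hist)
 thus ?thesis unfolding final_output_eq by (auto simp: fst_trace_hist)
qed

lemma returned_trace:
 assumes "t \<le> T"
 shows "returned y (trace_hist n act i t) k \<longleftrightarrow> k \<le> t \<and> returned y (trace_hist n act i T) k"
 using assms by (auto simp: returned_def from_ccw_trace from_cw_trace)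

text \<open>A longer history adds later returns only, so the least one is stable. What an agent
  believed at round \<open>t\<close> can therefore be expressed by its history at the horizon
  \<open>T\<close>.\<close>

lemma ring_size_prefix:
 assumes "ring_size y (trace_hist n act i T) = Some m" "t \<le> T"
 shows "ring_size y (trace_hist n act i t) = (if m \<le> t then Some m else None)"
  and "returned y (trace_hist n act i T) m" "1 \<le> m" "m \<le> T"
  and "k < m ==> \<not> returned y (trace_hist n act i T) k"
proof -
 let ?r = "returned y (trace_hist n act i T)"
 have ex: "\<exists>k. ?r k" and m: "m = (LEAST k. ?r k)"
  using assms by (auto simp: ring_size_def split: if_splits)
 show r: "?r m" unfolding m using ex by (rule LeastI_ex)
 show *: "\<not> ?r k" if "k < m" for k using that unfolding m by (rule not_less_Least)
 show "1 \<le> m" "m \<le> T" using r by (auto simp: returned_def from_ccw_trace from_cw_trace split: if_splits)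
 show "ring_size y (trace_hist n act i t) = (if m \<le> t then Some m else None)"
 proof (cases "m \<le> t")
  case True
  hence "returned y (trace_hist n act i t) m" using r returned_trace[OF assms(2)] by blast
  moreover have "(LEAST k. returned y (trace_hist n act i t) k) = m"
   using calculation * returned_trace[OF assms(2)] by (intro Least_equality) (auto simp: not_less[symmetric])
  ultimately show ?thesis using True by (auto simp: ring_size_def)
 next
  case False
  hence "\<not> returned y (trace_hist n act i t) k" for k
   using * returned_trace[OF assms(2), of y n act i k] by (metis le_trans not_less)
  thus ?thesis using False by (simp add: ring_size_def)
 qed
qed

lemma ring_size_prefix_None:
 assumes "ring_size y (trace_hist n act i T) = None" "t \<le> T"
 shows "ring_size y (trace_hist n act i t) = None"
 using assms returned_trace[OF assms(2)] by (auto simp: ring_size_def split: if_splits)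

section \<open>Stability of the values computed from a view once their phases are complete\<close>

lemma col_t_order:
 "1 < m ==> m < col_t1 m" "col_t1 m \<le> col_t2 m" "col_t2 m \<le> col_t3 m" "col_t3 m \<le> col_t4 m"
 by (auto simp: col_t1_def col_t2_def col_t3_def col_t4_def)

lemma col_t56_order:
 "col_t3 m \<le> col_t5 v m" "col_t5 v m \<le> col_t6 v m" "col_needs_sink v m ==> col_t4 m \<le> col_t5 v m"
 by (auto simp: col_t4_def col_t5_def col_t6_def)

context
 fixes n :: nat and x p :: "nat => nat" and act :: "nat => nat => action" and i t T m :: nat
 assumes tT: "t \<le> T" and mt: "m \<le> t"
begin

lemma cw_ids_prefix: "cw_ids (x i) (trace_hist n act i t) m = cw_ids (x i) (trace_hist n act i T) m"
 using tT mt by (auto simp: cw_ids_def from_cw_trace)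

lemma col_ids_prefix: "col_ids (trace_view n x p act i t) m = col_ids (trace_view n x p act i T) m" "col_cw (trace_view n x p act i t) m = col_cw (trace_view n x p act i T) m" "col_index (trace_view n x p act i t) m = col_index (trace_view n x p act i T) m"
 using cw_ids_prefix by (simp_all add: col_ids_def col_cw_def col_index_def)

lemma col_back_prefix: "k \<le> t ==> col_back (trace_view n x p act i t) m k = col_back (trace_view n x p act i T) m k"
 using tT cw_ids_prefix by (auto simp: col_back_def col_cw_def from_cw_trace from_ccw_trace)

lemma col_front_prefix: "k \<le> t ==> col_front (trace_view n x p act i t) m k = col_front (trace_view n x p act i T) m k"
 using tT cw_ids_prefix by (auto simp: col_front_def col_cw_def from_cw_trace from_ccw_trace)

lemma col_prefs_prefix: "col_t2 m \<le> t ==> col_prefs (trace_view n x p act i t) m = col_prefs (trace_view n x p act i T) m"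
 unfolding col_prefs_def col_ids_prefix
 by (simp, rule arrange_cong) (auto simp: after_def col_t2_def intro!: arg_cong[of _ _ val] col_front_prefix)

lemma col_needs_sink_prefix: "col_t2 m \<le> t ==> col_needs_sink (trace_view n x p act i t) m = col_needs_sink (trace_view n x p act i T) m"
 by (simp add: col_needs_sink_def col_prefs_prefix)

lemma col_t56_prefix:
 assumes "col_t2 m \<le> t"
 shows "col_t5 (trace_view n x p act i t) m = col_t5 (trace_view n x p act i T) m" "col_t6 (trace_view n x p act i t) m = col_t6 (trace_view n x p act i T) m"
 using col_needs_sink_prefix[OF assms] by (simp_all add: col_t5_def col_t6_def)

lemma col_weights_prefix: "col_t4 m \<le> t ==> 1 < m ==> col_weights (trace_view n x p act i t) m = col_weights (trace_view n x p act i T) m"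
proof -
 assume *: "col_t4 m \<le> t" "1 < m"
 hence "col_coins (trace_view n x p act i t) (col_t3 m) = col_coins (trace_view n x p act i T) (col_t3 m)"
  using tT by (simp add: col_coins_def fst_trace_hist col_t4_def)
 thus ?thesis
  unfolding col_weights_def col_ids_prefix using *
  by (simp, intro arrange_cong) (auto simp: after_def col_t4_def intro!: arg_cong[of _ _ val] col_back_prefix)
qed

lemma col_sink_prefix: "1 < m ==> col_t5 (trace_view n x p act i T) m \<le> t ==> col_sink (trace_view n x p act i t) m = col_sink (trace_view n x p act i T) m"
proof -
 assume *: "1 < m" "col_t5 (trace_view n x p act i T) m \<le> t"
 have t2: "col_t2 m \<le> t" using col_t_order(3)[of m] col_t56_order(1)[of m "trace_view n x p act i T"] * by linarith
 show ?thesis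
 proof (cases "col_needs_sink (trace_view n x p act i T) m")
  case True
  hence "col_t4 m \<le> t" using col_t56_order(3)[of "trace_view n x p act i T" m] * by linarith
  thus ?thesis using col_needs_sink_prefix[OF t2] col_ids_prefix col_weights_prefix *
   by (simp add: col_sink_def)
 qed (use col_needs_sink_prefix[OF t2] in \<open>simp add: col_sink_def\<close>)
qed

lemma col_coin_prefix: "1 < m ==> col_t6 (trace_view n x p act i T) m \<le> t ==> col_coin (trace_view n x p act i t) m = col_coin (trace_view n x p act i T) m"
proof -
 assume *: "1 < m" "col_t6 (trace_view n x p act i T) m \<le> t"
 have t2: "col_t2 m \<le> t" using col_t_order(3)[of m] col_t56_order(1)[of m "trace_view n x p act i T"] col_t56_order(2)[of "trace_view n x p act i T" m] * by linarith
 have t5: "col_t5 (trace_view n x p act i T) m < t" using * by (simp add: col_t6_def)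
 hence c: "col_coins (trace_view n x p act i t) (col_t5 (trace_view n x p act i T) m) = col_coins (trace_view n x p act i T) (col_t5 (trace_view n x p act i T) m)"
  using tT by (simp add: col_coins_def fst_trace_hist)
 show ?thesis
  unfolding col_coin_def shared_inputs_def col_ids_prefix col_t56_prefix[OF t2] c using *
  by (simp, intro arg_cong[of _ _ parity] arrange_cong)
   (auto simp: after_def col_t6_def intro!: arg_cong[of _ _ val] col_front_prefix)
qed

end

lemma less_eq_False: "b \<le> a ==> (a < b) = False" for a b :: nat
 by simp

lemma flood_cong: "B s = B' s ==> F s = F' s ==> flood M B F s = flood M B' F' s"
 by (simp add: flood_def)

lemma flood_ok_cong:
 assumes "\<And>k. 1 \<le> k ==> k < m ==> B k = B' k \<and> F k = F' k"
 shows "flood_ok m X B F = flood_ok m X B' F'"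
 using assms by (auto simp: flood_ok_def)

lemma agree_cong:
 assumes "\<And>k. 1 \<le> k ==> k < m ==> B k = B' k \<and> F k = F' k"
 shows "agree m X B F = agree m X B' F'"
 using assms by (auto simp: agree_def)

lemma dist2_le: "0 < m ==> 1 \<le> dist2 m \<and> dist2 m \<le> m"
 by (auto simp: dist2_def)

lemma transmit_cong:
 assumes "\<And>k. k \<le> s ==> B k = B' k" "d \<le> m"
 shows "transmit m d sh Y B s = transmit m d sh Y B' s"
 using assms by (auto simp: transmit_def carried_def)

lemma sharing_step_cong:
 assumes "\<And>k. k \<le> s ==> B k = B' k" "\<And>k. k \<le> s ==> F k = F' k" "1 \<le> m"
 shows "sharing_step m y R B F s = sharing_step m y R B' F' s"
proof -
 have d: "dist2 m \<le> m" "m - 1 \<le> m" "m - dist2 m \<le> m" using dist2_le[of m] assms(3) by auto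
 show ?thesis
  unfolding sharing_step_def Let_def
  using transmit_cong[of s B B', OF assms(1) assms(3)] transmit_cong[of s B B', OF assms(1) d(1)]
   transmit_cong[of s F F', OF assms(2) d(2)] transmit_cong[of s F F', OF assms(2) d(3)]
   assms(1)[of s] assms(2)[of s] by (simp add: flood_def after_def)
qed

lemma sharing_ok_cong:
 assumes "\<And>k. k \<le> 2 * m ==> B k = B' k" "\<And>k. k \<le> 2 * m ==> F k = F' k" "3 \<le> m"
 shows "sharing_ok bits S m B F = sharing_ok bits S m B' F'"
proof -
 have d: "dist2 m < m" using dist2_bounds[OF assms(3)] by simp
 have "shares_ok bits m d1 d2 B = shares_ok bits m d1 d2 B'" "shares_ok bits m d1 d2 F = shares_ok bits m d1 d2 F'" for d1 d2
  using assms(1,2) by (auto simp: shares_ok_def)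
 moreover have "flood_ok m X (after (m + 1) B) (after (m + 1) F) = flood_ok m X (after (m + 1) B') (after (m + 1) F')" for X
  using assms(1,2) by (intro flood_ok_cong) (auto simp: after_def)
 moreover have "B (m + 1) = B' (m + 1)" "F (m + 1) = F' (m + 1)" "B m = B' m" "F m = F' m"
  "B (m + 1 + 1) = B' (m + 1 + 1)" "B (m + 1 + dist2 m) = B' (m + 1 + dist2 m)"
  using assms(3) d by (intro assms(1,2); linarith)+
 ultimately show ?thesis
  by (simp only: sharing_ok_def learned_def after_def)
qed

lemma decide_send [simp]: "decide (send fwd cs mm) = None" "coins (send fwd cs mm) = cs"
 by (simp_all add: send_def)

lemma decide_consts [simp]: "decide idle = None" "decide abort = Some None" "coins idle = []"
 by (simp_all add: idle_def abort_def)

section \<open>An agent that follows the coloring algorithm and gets a color\<close>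

text \<open>\<open>cell t\<close> is the randomness of round \<open>t\<close>. As the first output
  is a color and not an abort, every check up to the round of this output has succeeded; this is the
  only source of information about the messages that arrive.\<close>

locale colored_agent_base =
 fixes \<beta> ncol n :: nat and x p :: "nat => nat" and act :: "nat => nat => action" and i T :: nat
  and cell :: "nat => nat \<times> nat \<times> nat"
 assumes honest: "\<And>t. t < T ==> act i t = col_act \<beta> ncol (trace_view n x p act i t) (cell t)"
  and colored: "final_output (trace_view n x p act i T) \<noteq> None"
begin

abbreviation "W \<equiv> trace_view n x p act i T"
abbreviation "H \<equiv> trace_hist n act i T"

definition size :: nat where "size = the (ring_size (x i) H)"
definition fin :: nat where "fin = (LEAST t. decide (act i t) \<noteq> None)"

lemma fin:
 "fin < T" "s < fin ==> decide (act i s) = None" "\<exists>c. decide (act i fin) = Some (Some c)"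
 "final_output W = the (decide (act i fin))"
proof -
 obtain c \<theta> where c: "\<theta> < T" "decide (act i \<theta>) = Some (Some c)" "\<forall>s<\<theta>. decide (act i s) = None" "final_output W = Some c"
  using colored final_output_trace[of n x p act i T] by auto
 have "fin = \<theta>"
  unfolding fin_def using c by (intro Least_equality) (auto simp: not_less[symmetric])
 thus "fin < T" "s < fin ==> decide (act i s) = None" "\<exists>c. decide (act i fin) = Some (Some c)"
  "final_output W = the (decide (act i fin))" using c by auto
qed

lemma not_abort: "t \<le> fin ==> act i t \<noteq> abort"
 using fin(2)[of t] fin(3) by (cases "t = fin") auto

lemma not_decided: "t \<le> fin ==> \<not> decided (trace_hist n act i t)"
 using fin(2) by (auto simp: decided_trace)

lemma before_size:
 assumes "t \<le> fin" "ring_size (x i) (trace_hist n act i t) = None"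
 shows "t < \<beta>" "t < fin" "act i t = send True [] (flood (Id (x i)) (from_ccw H) (from_cw H) t)"
proof -
 have tT: "t < T" using assms fin by linarith
 have e: "act i t = learn_ids \<beta> (x i) (trace_hist n act i t)"
  using honest[OF tT] not_decided[OF assms(1)] assms(2) by (simp add: col_act_def Let_def)
 thus t: "t < \<beta>" using not_abort[OF assms(1)] by (auto simp: learn_ids_def split: if_splits)
 show act: "act i t = send True [] (flood (Id (x i)) (from_ccw H) (from_cw H) t)"
  using e t tT by (auto simp: learn_ids_def from_ccw_trace from_cw_trace intro!: arg_cong[of _ _ "send True []"] flood_cong)
 hence "decide (act i t) = None" by simp
 thus "t < fin" using fin(3) assms(1) by (cases "t = fin") auto
qed

end

text \<open>Both assumptions exclude degenerate apparent sizes: \<open>not_one\<close> the size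
  \<open>1\<close>, and \<open>not_two\<close> the size \<open>2\<close>, for which the own id would
  have to come back from both sides in round \<open>2\<close>.\<close>

locale colored_agent = colored_agent_base +
 assumes not_one: "\<not> returned (x i) H 1"
  and not_two: "from_ccw H 2 \<noteq> Id (x i) \<or> from_cw H 2 \<noteq> Id (x i)"
begin

lemma size_aux: "ring_size (x i) H = Some size" "2 \<le> size" "size \<le> fin" "size \<le> \<beta>"
proof -
 obtain m where m: "ring_size (x i) (trace_hist n act i fin) = Some m"
  using before_size(2)[of fin] by auto
 hence "ring_size (x i) H \<noteq> None"
  using ring_size_prefix_None[of "x i" n act i T fin] fin(1) by auto
 thus r: "ring_size (x i) H = Some size" by (simp add: size_def)
 note R = ring_size_prefix[OF r]
 have R2: "returned (x i) H size" "1 \<le> size" using R(2,3)[of 0] by simp_all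
 show le: "size \<le> fin" using R(1)[of fin] fin(1) m by (auto split: if_splits)
 have "size \<noteq> 1" "1 \<le> size" using R2 not_one by auto
 thus s3: "2 \<le> size" by linarith
 have "ring_size (x i) (trace_hist n act i (size - 1)) = None"
  using R(1)[of "size - 1"] le fin(1) s3 by auto
 hence "size - 1 < \<beta>" using before_size(1)[of "size - 1"] le by simp
 thus "size \<le> \<beta>" by linarith
qed

lemma ring_size_at: "t \<le> T ==> ring_size (x i) (trace_hist n act i t) = (if size \<le> t then Some size else None)"
 using ring_size_prefix(1)[OF size_aux(1)] by simp

lemma wake_up: "t < size ==> act i t = send True [] (flood (Id (x i)) (from_ccw H) (from_cw H) t)"
 using before_size(3)[of t] ring_size_at[of t] size_aux(3) fin(1) by simp

lemma ok_at: "size \<le> t ==> t \<le> fin ==> col_ok ncol (trace_view n x p act i t) size"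
proof (rule ccontr)
 assume *: "size \<le> t" "t \<le> fin" "\<not> col_ok ncol (trace_view n x p act i t) size"
 hence "act i t = abort"
  using honest[of t] not_decided[of t] ring_size_at[of t] fin(1) by (simp add: col_act_def Let_def)
 thus False using not_abort *(2) by simp
qed

lemma ids_ok_H: "ids_ok (x i) H size"
proof -
 have l: "size \<le> fin" "fin \<le> T" using size_aux fin(1) by linarith+
 have 1: "ids_ok (x i) (trace_hist n act i fin) size"
  using ok_at[OF l(1) order_refl] by (simp add: col_ok_def Let_def)
 have "flood_ok size X (from_ccw (trace_hist n act i fin)) (from_cw (trace_hist n act i fin)) = flood_ok size X (from_ccw H) (from_cw H)" for X
  using l by (intro flood_ok_cong) (simp add: from_ccw_trace from_cw_trace)
 moreover have "from_ccw (trace_hist n act i fin) size = from_ccw H size" "from_cw (trace_hist n act i fin) size = from_cw H size"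
  using l by (simp_all add: from_ccw_trace from_cw_trace)
 ultimately show ?thesis
  using 1 unfolding ids_ok_def cw_ids_prefix[OF l(2,1)] by simp
qed

lemma size: "ring_size (x i) H = Some size" "3 \<le> size" "size \<le> fin" "size \<le> \<beta>"
proof -
 have "size \<noteq> 2" using ids_ok_H not_two by (auto simp: ids_ok_def)
 thus "3 \<le> size" using size_aux(2) by linarith
qed (fact size_aux)+

abbreviation "cw \<equiv> col_cw W size"
abbreviation "B \<equiv> col_back W size"
abbreviation "F \<equiv> col_front W size"
abbreviation "t1 \<equiv> col_t1 size"
abbreviation "t2 \<equiv> col_t2 size"
abbreviation "t3 \<equiv> col_t3 size"
abbreviation "t4 \<equiv> col_t4 size"
abbreviation "t5 \<equiv> col_t5 W size"
abbreviation "t6 \<equiv> col_t6 W size"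

lemma t_order: "size < t1" "t1 < t2" "t2 < t3" "t3 < t4" "t3 \<le> t5" "t5 < t6" "col_needs_sink W size ==> t4 < t5"
 "t2 = t1 + (size - 1)" "t3 = t2 + (size - 1)" "t4 = t3 + (size - 1)" "t6 = t5 + 2 * size"
 "col_needs_sink W size ==> t5 = t4 + (size - 1)" "\<not> col_needs_sink W size ==> t5 = t3"
 using size(2) by (auto simp: col_t1_def col_t2_def col_t3_def col_t4_def col_t5_def col_t6_def)

lemma act_ok:
 assumes "size \<le> t" "t \<le> fin"
 shows "act i t = (let v = trace_view n x p act i t; h = trace_hist n act i t; m = size; c = cell t;
    B' = col_back v m; F' = col_front v m in
     if t < t1 then send cw [] (flood (Ids (col_ids W m)) (after m B') (after m F') (t - m))
     else if t < t2 then send cw [] (flood (Val (p i)) (after t1 B') (after t1 F') (t - t1))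
     else if t < t3 then send cw [] (flood (Vals (col_prefs v m)) (after t2 B') (after t2 F') (t - t2))
     else if col_needs_sink v m \<and> t < t4 then
      (let cs = (if t = t3 then [fst c mod m] else coins (fst (h ! t3))) in
       send cw (drawn h t3 cs)
        (fst (flood (Val (cs ! 0)) (after t3 B') (after t3 F') (t - t3)), Silent))
     else if col_needs_sink v m \<and> t < col_t5 v m then
      send cw [] (flood (Vals (col_weights v m)) (after t4 B') (after t4 F') (t - t4))
     else if t < col_t6 v m then
      (let cs = (if t = col_t5 v m then [fst (snd c), snd (snd c)] else coins (fst (h ! col_t5 v m))) in
       send cw (drawn h (col_t5 v m) cs)
        (sharing_step m (cs ! 0) (cs ! 1) (after (col_t5 v m) B') (after (col_t5 v m) F') (t - col_t5 v m)))
     else if t - col_t6 v m = turn (col_prefs v m) (col_sink v m) (col_coin v m) (col_index W m) then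
      (let c = (if t = col_t6 v m then p i else min_available ncol (after (col_t6 v m) B') (after (col_t6 v m) F') (t - col_t6 v m))
       in Act [] (Some (Some c)) (Val c) (Val c))
     else idle)"
proof -
 have tT: "t \<le> T" "t < T" using assms fin by linarith+
 show ?thesis
  unfolding honest[OF tT(2)] using not_decided[OF assms(2)] ring_size_at[OF tT(1)] ok_at[OF assms] assms(1)
  by (simp add: col_act_def col_ids_prefix[OF tT(1) assms(1)] Let_def)
qed

lemma at_prefix:
 assumes "size \<le> t" "t \<le> T"
 shows "k \<le> t ==> col_back (trace_view n x p act i t) size k = B k"
  and "k \<le> t ==> col_front (trace_view n x p act i t) size k = F k"
  and "t2 \<le> t ==> col_prefs (trace_view n x p act i t) size = col_prefs W size"
  and "t2 \<le> t ==> col_needs_sink (trace_view n x p act i t) size = col_needs_sink W size"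
  and "t2 \<le> t ==> col_t5 (trace_view n x p act i t) size = t5"
  and "t2 \<le> t ==> col_t6 (trace_view n x p act i t) size = t6"
  and "t4 \<le> t ==> col_weights (trace_view n x p act i t) size = col_weights W size"
  and "t5 \<le> t ==> col_sink (trace_view n x p act i t) size = col_sink W size"
  and "t6 \<le> t ==> col_coin (trace_view n x p act i t) size = col_coin W size"
 using col_back_prefix[OF assms(2,1)] col_front_prefix[OF assms(2,1)] col_prefs_prefix[OF assms(2,1)]
  col_needs_sink_prefix[OF assms(2,1)] col_t56_prefix[OF assms(2,1)] col_weights_prefix[OF assms(2,1)]
  col_sink_prefix[OF assms(2,1)] col_coin_prefix[OF assms(2,1)] size(2)
 by auto

lemma flood_at:
 assumes "size \<le> t" "t \<le> T" "t0 \<le> t"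
 shows "flood M (after t0 (col_back (trace_view n x p act i t) size)) (after t0 (col_front (trace_view n x p act i t) size)) (t - t0)
  = flood M (after t0 B) (after t0 F) (t - t0)"
 using assms at_prefix(1,2)[OF assms(1,2), of t] by (intro flood_cong) (simp_all add: after_def)

lemma act_ids:
 assumes "size \<le> t" "t < t1" "t \<le> fin"
 shows "act i t = send cw [] (flood (Ids (col_ids W size)) (after size B) (after size F) (t - size))"
proof -
 have "t \<le> T" using assms(3) fin(1) by linarith
 thus ?thesis
  unfolding act_ok[OF assms(1,3)] Let_def using assms(1,2) flood_at[OF assms(1)] by (simp only: if_True)
qed

lemma act_prefs:
 assumes "t1 \<le> t" "t < t2" "t \<le> fin"
 shows "act i t = send cw [] (flood (Val (p i)) (after t1 B) (after t1 F) (t - t1))"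
proof -
 have t: "size \<le> t" "t \<le> T" "(t < t1) = False" by ((rule less_eq_False)?, use assms t_order fin(1) in linarith)+
 thus ?thesis
  unfolding act_ok[OF t(1) assms(3)] Let_def using assms(1,2) flood_at[OF t(1,2)] by (simp only: if_True if_False)
qed

lemma late:
 assumes "t2 \<le> t" "t \<le> fin"
 shows "size \<le> t" "(t < t1) = False" "(t < t2) = False" "t \<le> T"
 by ((rule less_eq_False)?, use assms t_order fin(1) in linarith)+

lemma act_vals:
 assumes "t2 \<le> t" "t < t3" "t \<le> fin"
 shows "act i t = send cw [] (flood (Vals (col_prefs W size)) (after t2 B) (after t2 F) (t - t2))"
proof -
 note l = late[OF assms(1,3)]
 show ?thesis
  unfolding act_ok[OF l(1) assms(3)] Let_def using assms(1,2) flood_at[OF l(1,4)] at_prefix(3)[OF l(1,4) assms(1)] l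
  by (simp only: if_True if_False)
qed

lemma act_weights:
 assumes "t3 \<le> t" "t < t4" "t \<le> fin" "col_needs_sink W size"
 shows "act i t = send cw (if t = t3 then [fst (cell t3) mod size] else [])
  (fst (flood (Val (fst (cell t3) mod size)) (after t3 B) (after t3 F) (t - t3)), Silent)"
proof -
 have *: "act i t = send cw (if t = t3 then cs else []) (fst (flood (Val (cs ! 0)) (after t3 B) (after t3 F) (t - t3)), Silent)"
  if "cs = (if t = t3 then [fst (cell t) mod size] else coins (act i t3))" and t: "t3 \<le> t" "t < t4" "t \<le> fin" for t cs
 proof -
  have t2: "t2 \<le> t" "(t < t3) = False" by ((rule less_eq_False)?, use t t_order in linarith)+
  note l = late[OF t2(1) t(3)]
  have c: "(if t = t3 then [fst (cell t) mod size] else coins (fst (trace_hist n act i t ! t3))) = cs"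
   using that by (auto simp: fst_trace_hist)
  have ns: "(col_needs_sink (trace_view n x p act i t) size \<and> t < t4) = True"
   using at_prefix(4)[OF l(1,4) t2(1)] assms(4) t(2) by simp
  show ?thesis
   unfolding act_ok[OF l(1) t(3)] Let_def c drawn_def length_trace_hist using flood_at[OF l(1,4) t(1)] l t2(2) ns
   by (simp only: if_True if_False)
 qed
 have "t3 \<le> t3" "t3 < t4" "t3 \<le> fin" using assms by linarith+
 hence "act i t3 = send cw (if t3 = t3 then [fst (cell t3) mod size] else [])
   (fst (flood (Val ([fst (cell t3) mod size] ! 0)) (after t3 B) (after t3 F) (t3 - t3)), Silent)"
  by (intro *) simp_all
 hence "coins (act i t3) = [fst (cell t3) mod size]" by simp
 hence "[fst (cell t3) mod size] = (if t = t3 then [fst (cell t) mod size] else coins (act i t3))"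
  by (cases "t = t3") (simp_all only: if_True if_False simp_thms)
 from *[OF this assms(1-3)] show ?thesis unfolding nth_Cons_0 .
qed

lemma act_weight_vals:
 assumes "t4 \<le> t" "t < t5" "t \<le> fin" "col_needs_sink W size"
 shows "act i t = send cw [] (flood (Vals (col_weights W size)) (after t4 B) (after t4 F) (t - t4))"
proof -
 have t2: "t2 \<le> t" "(t < t3) = False" "(t < t4) = False" by ((rule less_eq_False)?, use assms t_order in linarith)+
 note l = late[OF t2(1) assms(3)]
 note a = at_prefix[OF l(1,4)]
 have ns: "(col_needs_sink (trace_view n x p act i t) size \<and> t < col_t5 (trace_view n x p act i t) size) = True"
  using a(4,5) t2(1) assms by simp
 show ?thesis
  unfolding act_ok[OF l(1) assms(3)] Let_def using flood_at[OF l(1,4) assms(1)] a(7)[OF assms(1)] l t2(2,3) ns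
  by (simp only: if_True if_False simp_thms)
qed

lemma after_weights:
 assumes "t5 \<le> t" "t \<le> fin"
 shows "size \<le> t" "t \<le> T" "t2 \<le> t" "(t < t1) = False" "(t < t2) = False" "(t < t3) = False"
  "(col_needs_sink (trace_view n x p act i t) size \<and> t < t4) = False"
  "(col_needs_sink (trace_view n x p act i t) size \<and> t < t5) = False"
  "col_t5 (trace_view n x p act i t) size = t5" "col_t6 (trace_view n x p act i t) size = t6"
proof -
 show t2: "t2 \<le> t" and "(t < t3) = False" by ((rule less_eq_False)?, use assms t_order in linarith)+
 note l = late[OF t2 assms(2)]
 show "size \<le> t" "t \<le> T" "(t < t1) = False" "(t < t2) = False" by (fact l)+
 note a = at_prefix[OF l(1,4)]
 show "(col_needs_sink (trace_view n x p act i t) size \<and> t < t4) = False"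
  using a(4)[OF t2] t_order(7) assms(1) by auto
 show "(col_needs_sink (trace_view n x p act i t) size \<and> t < t5) = False" using assms(1) by auto
 show "col_t5 (trace_view n x p act i t) size = t5" "col_t6 (trace_view n x p act i t) size = t6"
  using a(5,6)[OF t2] by auto
qed

lemma act_coin:
 assumes "t5 \<le> t" "t < t6" "t \<le> fin"
 shows "act i t = send cw (if t = t5 then [fst (snd (cell t5)), snd (snd (cell t5))] else [])
  (sharing_step size (fst (snd (cell t5))) (snd (snd (cell t5))) (after t5 B) (after t5 F) (t - t5))"
proof -
 have *: "act i t = send cw (if t = t5 then cs else []) (sharing_step size (cs ! 0) (cs ! 1) (after t5 B) (after t5 F) (t - t5))"
  if "cs = (if t = t5 then [fst (snd (cell t)), snd (snd (cell t))] else coins (act i t5))" and t: "t5 \<le> t" "t < t6" "t \<le> fin" for t cs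
 proof -
  note l = after_weights[OF t(1,3)]
  have s: "sharing_step size y R (after t5 (col_back (trace_view n x p act i t) size)) (after t5 (col_front (trace_view n x p act i t) size)) (t - t5)
   = sharing_step size y R (after t5 B) (after t5 F) (t - t5)" for y R
   using t at_prefix(1,2)[OF l(1,2)] size(2) by (intro sharing_step_cong) (auto simp: after_def)
  have c: "(if t = t5 then [fst (snd (cell t)), snd (snd (cell t))] else coins (fst (trace_hist n act i t ! t5))) = cs"
   using that by (auto simp: fst_trace_hist)
  show ?thesis
   unfolding act_ok[OF l(1) t(3)] Let_def drawn_def length_trace_hist l(9,10) c s using l(4-8) t(2)
   by (simp only: if_True if_False)
 qed
 have "t5 \<le> t5" "t5 < t6" "t5 \<le> fin" using assms by linarith+
 hence "act i t5 = send cw (if t5 = t5 then [fst (snd (cell t5)), snd (snd (cell t5))] else [])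
   (sharing_step size ([fst (snd (cell t5)), snd (snd (cell t5))] ! 0) ([fst (snd (cell t5)), snd (snd (cell t5))] ! 1)
    (after t5 B) (after t5 F) (t5 - t5))"
  by (intro *) simp_all
 hence "coins (act i t5) = [fst (snd (cell t5)), snd (snd (cell t5))]" by simp
 hence "[fst (snd (cell t5)), snd (snd (cell t5))] =
   (if t = t5 then [fst (snd (cell t)), snd (snd (cell t))] else coins (act i t5))"
  by (cases "t = t5") (simp_all only: if_True if_False simp_thms)
 from *[OF this assms] show ?thesis unfolding nth_Cons_0 One_nat_def nth_Cons_Suc .
qed

text \<open>Before \<open>t6\<close> an agent that does not abort only sends messages.\<close>

lemma fin_late: "t6 \<le> fin"
proof (rule ccontr)
 assume *: "\<not> ?thesis"
 have "decide (act i fin) = None"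
 proof -
  consider "fin < t1" | "t1 \<le> fin" "fin < t2" | "t2 \<le> fin" "fin < t3" | "t3 \<le> fin" "fin < t4" "col_needs_sink W size"
   | "t4 \<le> fin" "fin < t5" "col_needs_sink W size" | "t5 \<le> fin" "fin < t6"
  proof (cases "col_needs_sink W size")
   case True
   thus ?thesis using * that t_order(7) by linarith
  next
   case False
   thus ?thesis using * that t_order(13) by linarith
  qed
  thus ?thesis
  proof cases
   case 1
   thus ?thesis using act_ids[OF size(3)] by simp
  next
   case 2
   thus ?thesis using act_prefs by simp
  next
   case 3
   thus ?thesis using act_vals by simp
  next
   case 4
   thus ?thesis using act_weights[of fin] by simp
  next
   case 5
   thus ?thesis using act_weight_vals by simp
  next
   case 6
   thus ?thesis using act_coin[of fin] by simp
  qed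
 qed
 thus False using fin(3) by simp
qed

lemma turn_zero_output:
 assumes "turn (col_prefs W size) (col_sink W size) (col_coin W size) (col_index W size) = 0"
 shows "final_output W = Some (p i)"
proof -
 have t5: "t5 \<le> t6" "(t6 < t6) = False" using t_order(6) by auto
 note l = after_weights[OF t5(1) fin_late]
 note a = at_prefix[OF l(1,2)]
 have "act i t6 = Act [] (Some (Some (p i))) (Val (p i)) (Val (p i))"
  unfolding act_ok[OF l(1) fin_late] Let_def l(9,10) a(3)[OF l(3)] a(8)[OF t5(1)] a(9)[OF order_refl]
  using l(4-8) t5(2) assms by (simp only: if_False if_True diff_self_eq_0 simp_thms)
 hence d: "decide (act i t6) = Some (Some (p i))" by simp
 hence "fin = t6" using fin(2)[of t6] fin_late by (cases "t6 < fin") auto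
 thus ?thesis using d fin(4) by simp
qed

lemma checks:
 "flood_ok size (Val ` {..<ncol}) (after t1 B) (after t1 F)"
 "col_needs_sink W size ==> agree size (Vals (col_weights W size)) (after t4 B) (after t4 F)"
 "sharing_ok 1 {0, 1} size (after t5 B) (after t5 F)"
proof -
 have t5: "t5 \<le> fin" using fin_late t_order by linarith
 note l = after_weights[OF t5 order_refl]
 note a = at_prefix[OF l(1,2)]
 have th: "t1 \<le> fin" "t6 \<le> fin" using l(4) fin_late by auto
 note k = ok_at[OF l(1) order_refl, unfolded col_ok_def Let_def trace_view_simps length_trace_hist l(9,10) a(4)[OF l(3)]]
 have 1: "flood_ok size (Val ` {..<ncol}) (after t1 (col_back (trace_view n x p act i fin) size)) (after t1 (col_front (trace_view n x p act i fin) size))"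
  "col_needs_sink W size ==> agree size (Vals (col_weights (trace_view n x p act i fin) size))
    (after t4 (col_back (trace_view n x p act i fin) size)) (after t4 (col_front (trace_view n x p act i fin) size))"
  "sharing_ok 1 {0, 1} size (after t5 (col_back (trace_view n x p act i fin) size)) (after t5 (col_front (trace_view n x p act i fin) size))"
  using k th l(3) t5 by blast+
 have "flood_ok size X (after t1 (col_back (trace_view n x p act i fin) size)) (after t1 (col_front (trace_view n x p act i fin) size))
   = flood_ok size X (after t1 B) (after t1 F)" for X
  using l(3) t_order(8) a(1,2) by (intro flood_ok_cong) (simp add: after_def)
 thus "flood_ok size (Val ` {..<ncol}) (after t1 B) (after t1 F)" using 1(1) by simp
 have "sharing_ok bits S size (after t5 (col_back (trace_view n x p act i fin) size)) (after t5 (col_front (trace_view n x p act i fin) size))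
   = sharing_ok bits S size (after t5 B) (after t5 F)" for bits S
  using th(2) t_order(11) a(1,2) size(2) by (intro sharing_ok_cong) (simp_all add: after_def)
 thus "sharing_ok 1 {0, 1} size (after t5 B) (after t5 F)" using 1(3) by simp
 show "agree size (Vals (col_weights W size)) (after t4 B) (after t4 F)" if ns: "col_needs_sink W size"
 proof -
  have t4: "t4 \<le> fin" "t5 = t4 + (size - 1)" using t5 t_order(7,12) ns by linarith+
  have "agree size X (after t4 (col_back (trace_view n x p act i fin) size)) (after t4 (col_front (trace_view n x p act i fin) size))
   = agree size X (after t4 B) (after t4 F)" for X
   using t5 t4 a(1,2) by (intro agree_cong) (simp add: after_def)
  thus ?thesis using 1(2)[OF ns] a(7)[OF t4(1)] by simp
 qed
qed

end

section \<open>Runs of the coloring algorithm in which agents \<open>1, \<dots>, n - 1\<close> get a color\<close>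

text \<open>The situation in which agent \<open>0\<close> has a chance to win. For deviations in
  round \<open>0\<close>, \<open>no_steal\<close> will come from \<open>no_collision\<close>: at
  that time agent \<open>0\<close> knows no id of \<open>ID\<close> except its own.\<close>

locale coloring_run =
 fixes \<beta> ncol n :: nat and x p :: "nat => nat" and act :: "nat => nat => action" and T :: nat
  and cell :: "nat => nat => nat \<times> nat \<times> nat"
 assumes n3: "3 \<le> n"
  and inj: "inj_on x {..<n}"
  and honest: "\<And>i t. 1 \<le> i ==> i < n ==> t < T ==> act i t = col_act \<beta> ncol (trace_view n x p act i t) (cell i t)"
  and colored: "\<And>i. 1 \<le> i ==> i < n ==> final_output (trace_view n x p act i T) \<noteq> None"
  and no_steal: "\<And>i. 1 \<le> i ==> i < n ==> to_cw (act 0 0) \<noteq> Id (x i) \<and> to_ccw (act 0 0) \<noteq> Id (x i)"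
begin

lemma base: "1 \<le> i ==> i < n ==> colored_agent_base \<beta> ncol n x p act i T (cell i)"
 using honest colored by unfold_locales auto

abbreviation "H i \<equiv> trace_hist n act i T"
abbreviation "W i \<equiv> trace_view n x p act i T"
abbreviation "sz i \<equiv> colored_agent_base.size n x act i T"
abbreviation "fin i \<equiv> colored_agent_base.fin act i"

lemma mod_neighbours:
 assumes "1 \<le> i" "i < n"
 shows "(i + n - 1) mod n = i - 1"
 using assms by (simp add: mod_if)

lemma ring_size_early: "k < 1 ==> ring_size y (trace_hist n act i k) = None"
 by (auto simp: ring_size_def returned_def from_ccw_trace from_cw_trace)

lemma act_0: "1 \<le> i ==> i < n ==> act i 0 = Act [] None (Id (x i)) (Id (x i))"
 using colored_agent_base.before_size(3)[OF base, of i 0] ring_size_early[of 0]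
 by (simp add: send_def flood_def)

lemma T2: "1 < T"
proof (rule ccontr)
 assume "\<not> 1 < T"
 hence "fin 1 = 0" using colored_agent_base.fin(1)[OF base[of 1]] n3 by simp
 thus False using colored_agent_base.fin(3)[OF base[of 1]] act_0[of 1] n3 by simp
qed

lemma x_eq: "i < n ==> j < n ==> x i = x j \<longleftrightarrow> i = j"
 using inj by (auto simp: inj_on_def)

lemma first_messages:
 assumes "1 \<le> i" "i < n"
 shows "j < n ==> j \<noteq> i ==> to_cw (act j 0) \<noteq> Id (x i)" "j < n ==> j \<noteq> i ==> to_ccw (act j 0) \<noteq> Id (x i)"
 using act_0[of j] no_steal[OF assms] x_eq[of i j] assms by (cases "j = 0"; auto)+

lemma not_one:
 assumes "1 \<le> i" "i < n"
 shows "\<not> returned (x i) (H i) 1"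
proof -
 have "i - 1 < n" "i - 1 \<noteq> i" "(i + 1) mod n < n" "(i + 1) mod n \<noteq> i"
  using assms n3 mod_succ_neq[of i n] by auto
 hence "to_cw (act (i - 1) 0) \<noteq> Id (x i)" "to_ccw (act ((i + 1) mod n) 0) \<noteq> Id (x i)"
  using first_messages[OF assms] by blast+
 thus ?thesis using mod_neighbours[OF assms] by (simp add: returned_def from_ccw_trace from_cw_trace)
qed

lemma act_1:
 assumes "1 \<le> i" "i < n"
 shows "act i 1 = Act [] None (to_cw (act (i - 1) 0)) (to_ccw (act ((i + 1) mod n) 0))"
proof -
 have "ring_size (x i) (trace_hist n act i 1) = None"
  using not_one[OF assms] T2 returned_trace[of 1 T "x i" n act i]
  by (auto simp: ring_size_def returned_def from_ccw_trace from_cw_trace split: if_splits)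
 moreover have "1 \<le> fin i"
 proof (rule ccontr)
  assume "\<not> ?thesis"
  hence "fin i = 0" by simp
  thus False using colored_agent_base.fin(3)[OF base[OF assms]] act_0[OF assms] by simp
 qed
 ultimately have "act i 1 = send True [] (flood (Id (x i)) (from_ccw (H i)) (from_cw (H i)) 1)"
  using colored_agent_base.before_size(3)[OF base[OF assms]] by blast
 thus ?thesis using T2 mod_neighbours[OF assms]
  by (simp add: flood_def send_def from_ccw_trace from_cw_trace)
qed

text \<open>\<open>no_steal\<close> controls agent \<open>0\<close> in round \<open>0\<close> only.
  So each agent looks at the side from which a real agent sends in round \<open>1\<close>: agent
  \<open>1\<close> at its clockwise side, the others at the counter-clockwise one.\<close>

lemma not_two:
 assumes "1 \<le> i" "i < n"
 shows "from_ccw (H i) 2 \<noteq> Id (x i) \<or> from_cw (H i) 2 \<noteq> Id (x i)"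
proof (cases "i = 1")
 case True
 hence "from_cw (H i) 2 = to_ccw (act (3 mod n) 0)"
  using T2 act_1[of 2] n3 by (simp add: from_cw_trace numeral_3_eq_3 numeral_2_eq_2)
 moreover have "3 mod n \<noteq> 1" "3 mod n < n" using n3 by (cases "n = 3"; simp)+
 ultimately show ?thesis using first_messages(2)[OF assms, of "3 mod n"] True by simp
next
 case False
 hence "from_ccw (H i) 2 = to_cw (act (i - 2) 0)"
  using T2 act_1[of "i - 1"] assms n3 mod_neighbours[OF assms]
  by (simp add: from_ccw_trace numeral_2_eq_2)
 thus ?thesis using first_messages(1)[OF assms, of "i - 2"] False assms by simp
qed

lemma agent: "1 \<le> i ==> i < n ==> colored_agent \<beta> ncol n x p act i T (cell i)"
 using base not_one not_two by (simp add: colored_agent_def colored_agent_axioms_def)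

lemmas size = colored_agent.size[OF agent]

definition m where "m = sz 1"

lemma message_to:
 assumes "1 \<le> i" "i < n" "1 \<le> k" "k \<le> T"
 shows "from_ccw (H i) k = to_cw (act (i - 1) (k - 1))" "from_cw (H i) k = to_ccw (act ((i + 1) mod n) (k - 1))"
 using assms mod_neighbours[OF assms(1,2)] by (simp_all add: from_ccw_trace from_cw_trace)

lemma ids_ok_facts:
 assumes "1 \<le> i" "i < n"
 shows "1 \<le> k ==> k < sz i ==> from_ccw (H i) k \<in> range Id \<and> from_ccw (H i) k = from_cw (H i) (sz i - k)"
  and "from_ccw (H i) (sz i) = Id (x i)" "from_cw (H i) (sz i) = Id (x i)"
  and "distinct (cw_ids (x i) (H i) (sz i))"
proof -
 have *: "\<forall>k\<in>{1..<sz i}. from_ccw (H i) k \<in> range Id \<and> from_ccw (H i) k = from_cw (H i) (sz i - k)"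
  "from_ccw (H i) (sz i) = Id (x i)" "from_cw (H i) (sz i) = Id (x i)" "distinct (cw_ids (x i) (H i) (sz i))"
  using colored_agent.ids_ok_H[OF agent[OF assms]] unfolding ids_ok_def flood_ok_def by blast+
 show "from_ccw (H i) k \<in> range Id \<and> from_ccw (H i) k = from_cw (H i) (sz i - k)" if "1 \<le> k" "k < sz i"
 proof -
  have "k \<in> {1..<sz i}" using that by simp
  thus ?thesis using *(1) by blast
 qed
 show "from_ccw (H i) (sz i) = Id (x i)" "from_cw (H i) (sz i) = Id (x i)" "distinct (cw_ids (x i) (H i) (sz i))"
  by (fact *)+
qed

lemma act_at_size:
 assumes "1 \<le> i" "i < n"
 shows "\<exists>V. to_cw (act i (sz i)) = Ids V \<and> to_ccw (act i (sz i)) = Ids V"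
 using colored_agent.act_ids[OF agent[OF assms], of "sz i"] colored_agent.t_order(1)[OF agent[OF assms]] size[OF assms]
 by (auto simp: send_def flood_def)

text \<open>The neighbour that sees the smaller ring starts to send an \<open>Ids\<close> message
  while the other one still expects an \<open>Id\<close> message, and the check of the latter
  fails.\<close>

lemma size_next: "1 \<le> i ==> i + 1 < n ==> sz (i + 1) = sz i"
proof (rule ccontr)
 assume i: "1 \<le> i" "i + 1 < n" and "sz (i + 1) \<noteq> sz i"
 have no: False if "1 \<le> j" "j < n" "k < sz j" "from_ccw (H j) (k + 1) = Ids V \<or> from_cw (H j) (k + 1) = Ids V" for j k V
 proof (cases "k + 1 = sz j")
  case True
  thus ?thesis using ids_ok_facts(2,3)[OF that(1,2)] that(4) by auto
 next
  case False
  hence k: "1 \<le> k + 1" "k + 1 < sz j" "1 \<le> sz j - (k + 1)" "sz j - (k + 1) < sz j" "sz j - (sz j - (k + 1)) = k + 1"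
   using that(3) by linarith+
  have "from_ccw (H j) (k + 1) \<in> range Id" "from_cw (H j) (k + 1) \<in> range Id"
   using ids_ok_facts(1)[OF that(1,2) k(1,2)] ids_ok_facts(1)[OF that(1,2) k(3,4)] k(5) by metis+
  thus ?thesis using that(4) by auto
 qed
 have le: "sz j < T" if "1 \<le> j" "j < n" for j
  using size(3)[OF that] colored_agent_base.fin(1)[OF base[OF that]] by simp
 consider "sz i < sz (i + 1)" | "sz (i + 1) < sz i" using \<open>sz (i + 1) \<noteq> sz i\<close> by linarith
 thus False
 proof cases
  case 1
  thus False
   using no[of "i + 1" "sz i"] act_at_size[of i] message_to(1)[of "i + 1" "sz i + 1"] i le[of i] by auto
 next
  case 2
  thus False
   using no[of i "sz (i + 1)"] act_at_size[of "i + 1"] message_to(2)[of i "sz (i + 1) + 1"] i le[of "i + 1"] by auto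
 qed
qed

lemma size_eq: "1 \<le> i ==> i < n ==> sz i = m"
proof (induction i rule: nat_induct_at_least)
 case (Suc i)
 thus ?case using size_next[of i] by simp
qed (simp add: m_def)

lemma m3: "3 \<le> m" "m \<le> \<beta>" using size(2,4)[of 1] n3 by (simp_all add: m_def)

lemma m_less: "m < T"
 using size(3)[of 1] colored_agent_base.fin(1)[OF base[of 1]] n3 by (simp add: m_def)

lemma wake_up_step:
 assumes "1 \<le> i" "i < n" "s < m"
 shows "to_cw (act i s) = (if s = 0 then Id (x i) else to_cw (act (i - 1) (s - 1)))"
  "to_ccw (act i s) = (if s = 0 then Id (x i) else to_ccw (act ((i + 1) mod n) (s - 1)))"
proof -
 have "act i s = send True [] (flood (Id (x i)) (from_ccw (H i)) (from_cw (H i)) s)"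
  using colored_agent.wake_up[OF agent[OF assms(1,2)], of s] size_eq[OF assms(1,2)] assms by simp
 thus "to_cw (act i s) = (if s = 0 then Id (x i) else to_cw (act (i - 1) (s - 1)))"
  "to_ccw (act i s) = (if s = 0 then Id (x i) else to_ccw (act ((i + 1) mod n) (s - 1)))"
  using message_to[OF assms(1,2), of s] m_less assms by (auto simp: send_def flood_def)
qed

lemma returned_id:
 assumes "1 \<le> i" "i < n"
 shows "to_cw (act (i - 1) (m - 1)) = Id (x i)" "to_ccw (act ((i + 1) mod n) (m - 1)) = Id (x i)"
 using ids_ok_facts(2,3)[OF assms] message_to[OF assms, of m] m3 m_less size_eq[OF assms] by auto

lemma id_check:
 assumes "1 \<le> i" "i < n" "1 \<le> k" "k < m"
 shows "to_cw (act (i - 1) (k - 1)) = to_ccw (act ((i + 1) mod n) (m - k - 1))" "to_cw (act (i - 1) (k - 1)) \<in> range Id"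
proof -
 have "1 \<le> m - k" "m - k \<le> T" "k \<le> T" using assms(4) m_less by linarith+
 thus "to_cw (act (i - 1) (k - 1)) = to_ccw (act ((i + 1) mod n) (m - k - 1))" "to_cw (act (i - 1) (k - 1)) \<in> range Id"
  using ids_ok_facts(1)[OF assms(1,2,3)] message_to(1)[OF assms(1,2,3)] message_to(2)[OF assms(1,2), of "m - k"]
   size_eq[OF assms(1,2)] assms(4) by metis+
qed

text \<open>If \<open>m < n\<close>, the id that reaches agent \<open>1\<close> from the clockwise
  side at round \<open>m - 1\<close> is that of agent \<open>m\<close>, untouched by agent
  \<open>0\<close>. The check of agent \<open>1\<close> identifies it with the first message of
  agent \<open>0\<close>, against \<open>no_steal\<close>.\<close>

lemma n_le_m: "n \<le> m"
proof (rule ccontr)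
 assume "\<not> ?thesis"
 hence mn: "m < n" by simp
 have l: "to_ccw (act i s) = Id (x (i + s))" if "1 \<le> i" "i + s < n" "s < m" for i s
  using that
 proof (induction s arbitrary: i)
  case 0
  thus ?case using wake_up_step(2)[of i 0] by simp
 next
  case (Suc s)
  thus ?case using wake_up_step(2)[of i "Suc s"] Suc.IH[of "Suc i"] by simp
 qed
 have "to_cw (act 0 0) = to_ccw (act (2 mod n) (m - 2))"
  using id_check(1)[of 1 1] n3 m3 by (simp add: numeral_2_eq_2)
 moreover have "2 + (m - 2) = m" using m3 by linarith
 hence "to_ccw (act (2 mod n) (m - 2)) = Id (x m)" using l[of 2 "m - 2"] n3 m3 mn by simp
 ultimately show False using no_steal[of m] m3 mn by simp
qed

definition Y :: "nat => nat" where
 "Y j = id_of (claimed n m (\<lambda>i. Id (x i)) (\<lambda>s. to_cw (act 0 s)) j)"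

lemma id_flood:
 assumes "1 \<le> i" "i < n" "1 \<le> k" "k < m"
 shows "to_cw (act (i - 1) (k - 1)) = Id (Y ((i + (m - k)) mod m))" "to_ccw (act ((i + 1) mod n) (k - 1)) = Id (Y ((i + k) mod m))"
proof -
 have h: "to_cw (act i s) = (if s = 0 then Id (x i) else to_cw (act (i - 1) (s - 1)))"
  "to_ccw (act i s) = (if s = 0 then Id (x i) else to_ccw (act ((i + 1) mod n) (s - 1)))"
  if "1 \<le> i" "i < n" "s < m - 1" for i s
  using wake_up_step[OF that(1,2)] that(3) by (meson diff_le_self le_trans less_le_trans)+
 have n1: "1 \<le> n" using n3 by simp
 note fl = flood_values[of n m "\<lambda>i s. to_cw (act i s)" "\<lambda>i. Id (x i)" "\<lambda>i s. to_ccw (act i s)", OF n1 n_le_m h(1) h(2) id_check(1) assms(1,2)]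
 have a: "to_cw (act (i - 1) (k - 1)) = claimed n m (\<lambda>i. Id (x i)) (\<lambda>s. to_cw (act 0 s)) ((i + (m - k)) mod m)"
  "to_ccw (act ((i + 1) mod n) (k - 1)) = claimed n m (\<lambda>i. Id (x i)) (\<lambda>s. to_cw (act 0 s)) ((i + k) mod m)"
  if "1 \<le> k" "k < m" for k
  using fl that by blast+
 show "to_cw (act (i - 1) (k - 1)) = Id (Y ((i + (m - k)) mod m))"
  using a(1)[OF assms(3,4)] id_check(2)[OF assms] by (auto simp: Y_def)
 have "1 \<le> m - k" "m - k < m" "m - (m - k) - 1 = k - 1" using assms(3,4) by linarith+
 hence "to_ccw (act ((i + 1) mod n) (k - 1)) \<in> range Id"
  using id_check[OF assms(1,2), of "m - k"] by metis
 thus "to_ccw (act ((i + 1) mod n) (k - 1)) = Id (Y ((i + k) mod m))"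
  using a(2)[OF assms(3,4)] by (auto simp: Y_def)
qed

lemma Y_real: "1 \<le> i ==> i < n ==> Y i = x i"
 by (simp add: Y_def claimed_def)

text \<open>Beyond \<open>id_flood\<close> this includes the messages sent to agent \<open>0\<close>
  and the last step. The replay of a deviation in the other game needs all of them. In the second
  part \<open>i = n\<close> stands for agent \<open>0\<close>.\<close>

lemma id_messages:
 assumes "t < m"
 shows "i < n ==> to_cw (act i t) = Id (Y ((i + (m - t)) mod m))"
  and "1 \<le> i ==> i \<le> n ==> to_ccw (act (i mod n) t) = Id (Y ((i + t) mod m))"
proof -
 have nm: "n \<le> m" "3 \<le> n" by (fact n_le_m n3)+
 show "to_cw (act i t) = Id (Y ((i + (m - t)) mod m))" if i: "i < n"
 proof (cases "i + 1 < n \<or> t = 0 \<and> 1 \<le> i")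
  case True
  show ?thesis
  proof (cases "t = 0 \<and> 1 \<le> i")
   case True
   thus ?thesis using wake_up_step(1)[of i 0] i nm Y_real[of i] by simp
  next
   case False
   hence i1: "i + 1 < n" using \<open>i + 1 < n \<or> t = 0 \<and> 1 \<le> i\<close> by blast
   show ?thesis
   proof (cases "t + 1 = m")
    case True
    hence "i + (m - t) = i + 1" by linarith
    thus ?thesis using returned_id(1)[of "i + 1"] True Y_real[of "i + 1"] i1 nm
     by (auto simp flip: True)
   next
    case False
    have "i + 1 + (m - (t + 1)) = i + (m - t)" using assms by linarith
    thus ?thesis using id_flood(1)[of "i + 1" "t + 1"] i1 False assms by simp
   qed
  qed
 next
  case False
  hence i1: "i + 1 = n" "t \<noteq> 0" using i nm by auto
  hence "to_cw (act i t) = to_cw (act (i - 1) (t - 1))" using wake_up_step(1)[of i t] assms nm by simp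
  thus ?thesis using id_flood(1)[of i t] i1 assms nm by simp
 qed
 show "to_ccw (act (i mod n) t) = Id (Y ((i + t) mod m))" if i: "1 \<le> i" "i \<le> n"
 proof (cases "i = 1")
  case True
  show ?thesis
  proof (cases "t = 0")
   case True
   thus ?thesis using wake_up_step(2)[of 1 0] \<open>i = 1\<close> nm Y_real[of 1] by simp
  next
   case False
   thus ?thesis using wake_up_step(2)[of 1 t] id_flood(2)[of 1 t] \<open>i = 1\<close> nm assms by simp
  qed
 next
  case False
  hence j: "1 \<le> i - 1" "i - 1 < n" "i - 1 + 1 = i" using i by auto
  show ?thesis
  proof (cases "t + 1 = m")
   case True
   hence "i + t = i - 1 + m" using j by linarith
   moreover have "(i - 1) mod m = i - 1" by (rule mod_less) (use j nm in linarith)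
   hence "(i - 1 + m) mod m = i - 1" by (simp only: mod_add_self2)
   ultimately have "(i + t) mod m = i - 1" by (simp only:)
   thus ?thesis using returned_id(2)[OF j(1,2)] True Y_real[OF j(1,2)] j(3) by (auto simp flip: True)
  next
   case False
   have "i - 1 + (t + 1) = i + t" using j by linarith
   thus ?thesis using id_flood(2)[OF j(1,2), of "t + 1"] j(3) False assms by simp
  qed
 qed
qed

lemma cw_ids_eq:
 assumes "1 \<le> i" "i < n"
 shows "cw_ids (x i) (H i) m = rotate i (map Y [0..<m])"
proof -
 have "map (\<lambda>k. id_of (from_cw (H i) k)) [1..<m] = map (\<lambda>k. Y ((i + k) mod m)) [1..<m]"
  using message_to(2)[OF assms] id_flood(2)[OF assms] m_less by (intro map_cong) auto
 moreover have "x i = Y ((i + 0) mod m)" using Y_real[OF assms] assms n_le_m by simp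
 ultimately have "cw_ids (x i) (H i) m = map (\<lambda>k. Y ((i + k) mod m)) (0 # [1..<m])" by (simp add: cw_ids_def)
 also have "0 # [1..<m] = [0..<m]" using m3 by (simp add: upt_conv_Cons)
 finally show ?thesis by (simp only: ring_list_rotate)
qed

lemma Y_inj: "inj_on Y {..<m}"
 using ids_ok_facts(4)[of 1] size_eq[of 1] n3 cw_ids_eq[of 1] by (simp add: distinct_map lessThan_atLeast0)

definition fwd where "fwd = oriented_cw (map Y [0..<m])"
definition V where "V = oriented_ids (map Y [0..<m])"

lemma Ylist: "distinct (map Y [0..<m])" "map Y [0..<m] \<noteq> []"
 using Y_inj m3 by (auto simp: distinct_map lessThan_atLeast0)

lemma orientation:
 assumes "1 \<le> i" "i < n"
 shows "col_cw (W i) m = fwd" "col_ids (W i) m = V"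
 using cw_ids_eq[OF assms] oriented_cw_rotate[OF Ylist] oriented_ids_rotate[OF Ylist]
 by (simp_all add: col_cw_def col_ids_def fwd_def V_def)

text \<open>Renames the agents along the orientation: if it is counter-clockwise, by the reflection
  that fixes agent \<open>0\<close> and maps the real agents \<open>1, ..., n - 1\<close> onto
  themselves. Afterwards only one orientation has to be considered.\<close>

definition ag :: "nat => nat" where
 "ag i = (if fwd then i else (n - i) mod n)"

lemma ag: "1 \<le> i ==> i < n ==> 1 \<le> ag i \<and> ag i < n" "ag 0 = 0" "i < n ==> ag (ag i) = i"
 by (auto simp: ag_def mod_if)

lemma exists_start:
 "\<exists>q<m. \<forall>i. 1 \<le> i \<and> i < n \<longrightarrow> V ! ((q + i) mod m) = x (ag i)"
 and V_props: "length V = m" "distinct V"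
proof -
 have m0: "0 < m" using m3 by simp
 obtain q where q: "q < m" "\<And>i. i < m ==> V ! ((if fwd then q + i else q + (m - i)) mod m) = Y i" "length V = m" "distinct V"
  using oriented_ring[OF Y_inj m0] unfolding V_def fwd_def by blast
 \<comment> \<open>The agents are reflected by \<open>n - i\<close>, but positions in the apparent
   ring by \<open>m - i\<close>; the difference \<open>m - n\<close> goes into the starting
   index.\<close>
 define q' where "q' = (if fwd then q else (q + (m - n)) mod m)"
 have "V ! ((q' + i) mod m) = x (ag i)" if i: "1 \<le> i" "i < n" for i
 proof (cases fwd)
  case True
  thus ?thesis using q(2)[of i] i n_le_m Y_real[OF i] by (simp add: q'_def ag_def)
 next
  case False
  have "q + (m - n) + i = q + (m - (n - i))" using i n_le_m by linarith
  thus ?thesis using q(2)[of "n - i"] i n_le_m Y_real[of "n - i"] False by (simp add: q'_def ag_def mod_add_left_eq)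
 qed
 moreover have "q' < m" using q(1) m0 by (simp add: q'_def)
 ultimately show "\<exists>q<m. \<forall>i. 1 \<le> i \<and> i < n \<longrightarrow> V ! ((q + i) mod m) = x (ag i)" by blast
 show "length V = m" "distinct V" by (rule q)+
qed

text \<open>The choice depends on \<open>n\<close>, \<open>m\<close>, \<open>V\<close>,
  \<open>x\<close> and \<open>ag\<close> only, so two runs with the same values of these have
  literally the same \<open>q\<close>.\<close>

definition q where "q = (SOME q. q < m \<and> (\<forall>i. 1 \<le> i \<and> i < n \<longrightarrow> V ! ((q + i) mod m) = x (ag i)))"

lemma q: "q < m" "1 \<le> i ==> i < n ==> V ! ((q + i) mod m) = x (ag i)"
proof -
 have "q < m \<and> (\<forall>i. 1 \<le> i \<and> i < n \<longrightarrow> V ! ((q + i) mod m) = x (ag i))"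
  unfolding q_def by (rule someI_ex) (use exists_start in blast)
 thus "q < m" "1 \<le> i ==> i < n ==> V ! ((q + i) mod m) = x (ag i)" by auto
qed

lemma col_index_ag:
 assumes "1 \<le> i" "i < n"
 shows "col_index (W (ag i)) m = (q + i) mod m"
proof -
 have "(q + i) mod m < length V" using V_props m3 by simp
 thus ?thesis
  using index_of_nth[OF V_props(2), of "(q + i) mod m"] q(2)[OF assms] orientation(2)[of "ag i"] ag(1)[OF assms]
  by (simp add: col_index_def)
qed

definition rt :: "nat => nat => msg" where
 "rt i t = (if fwd then to_cw (act (ag i) t) else to_ccw (act (ag i) t))"
definition lt :: "nat => nat => msg" where
 "lt i t = (if fwd then to_ccw (act (ag i) t) else to_cw (act (ag i) t))"

lemma streams:
 assumes "1 \<le> i" "i < n" "1 \<le> k" "k \<le> T"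
 shows "col_back (W (ag i)) m k = rt (i - 1) (k - 1)" "col_front (W (ag i)) m k = lt ((i + 1) mod n) (k - 1)"
proof -
 note a = ag(1)[OF assms(1,2)]
 note c = orientation(1)[of "ag i"] message_to[of "ag i" k]
 have e: "\<not> fwd ==> ag (i - 1) = (ag i + 1) mod n" "\<not> fwd ==> ag ((i + 1) mod n) = ag i - 1"
 proof -
  assume "\<not> fwd"
  hence g: "ag i = n - i" "ag (i - 1) = (n - (i - 1)) mod n" "ag ((i + 1) mod n) = (n - (i + 1) mod n) mod n"
   using assms by (simp_all add: ag_def)
  have "n - (i - 1) = n - i + 1" using assms by linarith
  thus "ag (i - 1) = (ag i + 1) mod n" using g by simp
  show "ag ((i + 1) mod n) = ag i - 1"
  proof (cases "i + 1 = n")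
   case True
   thus ?thesis using g by simp
  next
   case False
   thus ?thesis using g assms by simp
  qed
 qed
 show "col_back (W (ag i)) m k = rt (i - 1) (k - 1)"
 proof (cases fwd)
  case True
  thus ?thesis using c a assms by (simp add: col_back_def rt_def ag_def)
 next
  case False
  thus ?thesis using c a assms e by (simp add: col_back_def rt_def)
 qed
 show "col_front (W (ag i)) m k = lt ((i + 1) mod n) (k - 1)"
 proof (cases fwd)
  case True
  thus ?thesis using c a assms by (simp add: col_front_def lt_def ag_def)
 next
  case False
  thus ?thesis using c a assms e by (simp add: col_front_def lt_def)
 qed
qed

end

lemma sharing_step_cong1:
 assumes "\<And>k. 1 \<le> k ==> k \<le> s ==> B k = B' k" "\<And>k. 1 \<le> k ==> k \<le> s ==> F k = F' k" "1 \<le> m"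
 shows "sharing_step m y R B F s = sharing_step m y R B' F' s"
proof -
 have *: "sharing_step m y R G G' s = sharing_step m y R (G(0 := Silent)) (G'(0 := Silent)) s" for G G'
 proof -
  have "transmit m d sh Z G s = transmit m d sh Z (G(0 := Silent)) s" for d sh Z and G :: "nat => msg"
   by (simp add: transmit_def carried_def)
  moreover have "flood M (after (m + 1) G) (after (m + 1) G') u = flood M (after (m + 1) (G(0 := Silent))) (after (m + 1) (G'(0 := Silent))) u" for M u
   by (simp add: flood_def after_def)
  ultimately show ?thesis by (simp only: sharing_step_def Let_def)
 qed
 show ?thesis
  unfolding *[of B F] *[of B' F'] using assms by (intro sharing_step_cong) auto
qed

lemma sharing_ok_cong1:
 assumes "\<And>k. 1 \<le> k ==> k \<le> 2 * m ==> B k = B' k" "\<And>k. 1 \<le> k ==> k \<le> 2 * m ==> F k = F' k" "3 \<le> m"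
 shows "sharing_ok bits S m B F = sharing_ok bits S m B' F'"
proof -
 have *: "sharing_ok bits S m G G' = sharing_ok bits S m (G(0 := Silent)) (G'(0 := Silent))" for G G'
 proof -
  have "shares_ok bits m d1 d2 G = shares_ok bits m d1 d2 (G(0 := Silent))" for d1 d2 and G :: "nat => msg"
   by (auto simp: shares_ok_def)
  moreover have "flood_ok m X (after (m + 1) G) (after (m + 1) G') = flood_ok m X (after (m + 1) (G(0 := Silent))) (after (m + 1) (G'(0 := Silent)))" for X
   by (auto simp: flood_ok_def after_def)
  ultimately show ?thesis using assms(3) by (simp add: sharing_ok_def learned_def after_def)
 qed
 show ?thesis
  unfolding *[of B F] *[of B' F'] using assms by (intro sharing_ok_cong) auto
qed

context coloring_run
begin

lemma agent_ag: "1 \<le> i ==> i < n ==> colored_agent \<beta> ncol n x p act (ag i) T (cell (ag i))"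
 using agent ag(1) by blast

lemma size_ag: "1 \<le> i ==> i < n ==> sz (ag i) = m"
 using size_eq ag(1) by blast

abbreviation "t1 \<equiv> col_t1 m"
abbreviation "t2 \<equiv> col_t2 m"
abbreviation "t3 \<equiv> col_t3 m"
abbreviation "t4 \<equiv> col_t4 m"

lemma sent:
 assumes "act (ag i) t = send fwd cs mm"
 shows "rt i t = fst mm" "lt i t = snd mm"
 using assms by (auto simp: rt_def lt_def send_def)

lemma times:
 assumes i: "1 \<le> i" "i < n"
 shows "col_t6 (W (ag i)) m \<le> fin (ag i)" "fin (ag i) < T"
 using colored_agent.fin_late[OF agent_ag[OF i]] colored_agent_base.fin(1)[OF base, of "ag i"] size_ag[OF i] ag(1)[OF i]
 by auto

lemma t_order: "m < t1" "t1 < t2" "t2 < t3" "t3 < t4" "t2 = t1 + (m - 1)" "t3 = t2 + (m - 1)" "t4 = t3 + (m - 1)"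
 using m3 by (auto simp: col_t1_def col_t2_def col_t3_def col_t4_def)

lemma t5_order: "t3 \<le> col_t5 v m" "col_t6 v m = col_t5 v m + 2 * m"
 by (auto simp: col_t4_def col_t5_def col_t6_def)

definition P :: "nat => nat" where
 "P = claimed n m (\<lambda>i. p (ag i)) (\<lambda>s. val (rt 0 (t1 + s)))"

lemma P_real: "1 \<le> i ==> i < n ==> P i = p (ag i)"
 by (simp add: P_def claimed_def)

lemma pref_flood:
 assumes i: "1 \<le> i" "i < n" and k: "1 \<le> k" "k < m"
 shows "val (lt ((i + 1) mod n) (t1 + k - 1)) = P ((i + k) mod m)"
proof -
 have st: "rt i (t1 + s) = (if s = 0 then Val (p (ag i)) else rt (i - 1) (t1 + (s - 1))) \<and>
   lt i (t1 + s) = (if s = 0 then Val (p (ag i)) else lt ((i + 1) mod n) (t1 + (s - 1)))"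
  if i: "1 \<le> i" "i < n" and s: "s < m - 1" for i s
 proof -
  have le: "t1 + s < t2" "t1 + s \<le> fin (ag i)" "t1 + s \<le> T"
   using s times[OF i] t_order t5_order[of "W (ag i)"] by linarith+
  have a: "act (ag i) (t1 + s) = send fwd [] (flood (Val (p (ag i))) (after t1 (col_back (W (ag i)) m)) (after t1 (col_front (W (ag i)) m)) s)"
   using colored_agent.act_prefs[OF agent_ag[OF i], of "t1 + s"] le size_ag[OF i] orientation(1)[of "ag i"] ag(1)[OF i] by simp
  show ?thesis
  proof (cases "s = 0")
   case True
   thus ?thesis using sent[OF a] by (simp add: flood_def)
  next
   case False
   hence "t1 + s - 1 = t1 + (s - 1)" by simp
   thus ?thesis using False sent[OF a] streams[OF i, of "t1 + s"] le by (simp add: flood_def after_def)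
  qed
 qed
 have chk: "rt (i - 1) (t1 + (k - 1)) = lt ((i + 1) mod n) (t1 + (m - k - 1))"
  if i: "1 \<le> i" "i < n" and k: "1 \<le> k" "k < m" for i k
 proof -
  have "flood_ok m (Val ` {..<ncol}) (after t1 (col_back (W (ag i)) m)) (after t1 (col_front (W (ag i)) m))"
   using colored_agent.checks(1)[OF agent_ag[OF i]] size_ag[OF i] by simp
  hence "col_back (W (ag i)) m (t1 + k) = col_front (W (ag i)) m (t1 + (m - k))"
   using k unfolding flood_ok_def after_def by auto
  moreover have "t1 + k \<le> T" "t1 + (m - k) \<le> T" "t1 + k - 1 = t1 + (k - 1)" "t1 + (m - k) - 1 = t1 + (m - k - 1)"
   using k times[OF i] t_order t5_order[of "W (ag i)"] by linarith+
  ultimately show ?thesis using streams[OF i, of "t1 + k"] streams[OF i, of "t1 + (m - k)"] k by simp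
 qed
 have n1: "1 \<le> n" using n3 by simp
 have "lt ((i + 1) mod n) (t1 + (k - 1)) = claimed n m (\<lambda>i. Val (p (ag i))) (\<lambda>s. rt 0 (t1 + s)) ((i + k) mod m)"
  using flood_values(2)[of n m "\<lambda>i s. rt i (t1 + s)" "\<lambda>i. Val (p (ag i))" "\<lambda>i s. lt i (t1 + s)", OF n1 n_le_m _ _ _ i k] st chk by blast
 moreover have "t1 + k - 1 = t1 + (k - 1)" using k by simp
 ultimately show ?thesis by (simp add: P_def claimed_def)
qed

definition ps :: "nat list" where
 "ps = map (\<lambda>j. P ((j + (m - q)) mod m)) [0..<m]"

lemma ps_nth:
 assumes "j < m"
 shows "ps ! ((q + j) mod m) = P j"
proof -
 have "(q + j) mod m < m" using assms by simp
 moreover have "((q + j) mod m + (m - q)) mod m = (q + j + (m - q)) mod m" by (simp add: mod_add_left_eq)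
 moreover have "q + j + (m - q) = j + m" using q(1) by simp
 ultimately show ?thesis using assms by (simp add: ps_def)
qed

lemma length_ps: "length ps = m" by (simp add: ps_def)

lemma prefs_eq:
 assumes i: "1 \<le> i" "i < n"
 shows "col_prefs (W (ag i)) m = ps"
proof -
 have "val (after t1 (col_front (W (ag i)) m) k) = P ((i + k) mod m)" if "1 \<le> k" "k < m" for k
 proof -
  have "t1 + k \<le> T" "1 \<le> t1 + k" using that times[OF i] t_order t5_order[of "W (ag i)"] by linarith+
  thus ?thesis using streams(2)[OF i, of "t1 + k"] pref_flood[OF i that] by (simp add: after_def)
 qed
 moreover have "p (ag i) = P (i mod m)" using P_real[OF i] i n_le_m by simp
 ultimately have "col_prefs (W (ag i)) m = arrange m ((q + i) mod m) (P (i mod m)) (\<lambda>k. P ((i + k) mod m))"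
  unfolding col_prefs_def col_index_ag[OF i] by (subst arrange_cong[of m _ "\<lambda>k. P ((i + k) mod m)"]) simp_all
 thus ?thesis using arrange_ring[OF q(1) refl, where y = P and j = i] by (simp add: ps_def)
qed

definition ns :: bool where "ns \<longleftrightarrow> odd m \<and> (\<forall>j<m. P j = P 1)"

lemma set_ps: "set ps = P ` {..<m}"
proof
 show "set ps \<subseteq> P ` {..<m}" using m3 by (auto simp: ps_def)
 show "P ` {..<m} \<subseteq> set ps"
 proof
  fix c assume "c \<in> P ` {..<m}"
  then obtain j where j: "j < m" "c = P j" by auto
  hence "(q + j) mod m < length ps" by (simp add: length_ps)
  thus "c \<in> set ps" using ps_nth[OF j(1)] j(2) by (metis nth_mem)
 qed
qed

lemma all_P:
 assumes "i < m"
 shows "(\<forall>c\<in>set ps. c = P i) \<longleftrightarrow> (\<forall>j<m. P j = P 1)"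
proof
 have m1: "1 < m" using m3 by simp
 show "\<forall>j<m. P j = P 1" if "\<forall>c\<in>set ps. c = P i"
 proof -
  have "P j = P i" if "j < m" for j using \<open>\<forall>c\<in>set ps. c = P i\<close> that unfolding set_ps by blast
  thus ?thesis using m1 by metis
 qed
 show "\<forall>c\<in>set ps. c = P i" if "\<forall>j<m. P j = P 1"
  using that assms unfolding set_ps by auto
qed

lemma needs_sink_eq:
 assumes i: "1 \<le> i" "i < n"
 shows "col_needs_sink (W (ag i)) m \<longleftrightarrow> ns"
proof -
 have "i < m" using i n_le_m by simp
 thus ?thesis
  using P_real[OF i] all_P[of i] by (simp add: col_needs_sink_def prefs_eq[OF i] ns_def)
qed

definition T5 where "T5 = (if ns then t4 + (m - 1) else t3)"

lemma t5_eq: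
 assumes i: "1 \<le> i" "i < n"
 shows "col_t5 (W (ag i)) m = T5" "col_t6 (W (ag i)) m = T5 + 2 * m"
 using needs_sink_eq[OF i] by (simp_all add: col_t5_def col_t6_def T5_def)

lemma T5_order: "t3 \<le> T5" "ns ==> T5 = t4 + (m - 1)" "\<not> ns ==> T5 = t3"
 by (auto simp: T5_def col_t4_def)

lemma late_enough: "1 \<le> i ==> i < n ==> T5 + 2 * m \<le> fin (ag i)" "T5 + 2 * m < T"
 using times t5_eq(2) apply force
 using times[of 1] t5_eq(2)[of 1] n3 by linarith

definition w :: "nat => nat" where "w i = fst (cell (ag i) t3) mod m"

definition Wt :: "nat => nat" where
 "Wt = claimed n m w (\<lambda>s. val (rt 0 (t3 + s)))"

lemma weight_step:
 assumes ns and i: "1 \<le> i" "i < n" and s: "s < m - 1"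
 shows "rt i (t3 + s) = (if s = 0 then Val (w i) else rt (i - 1) (t3 + (s - 1)))" "lt i (t3 + s) = Silent"
proof -
 have le: "t3 + s < t4" "t3 + s \<le> fin (ag i)" "t3 + s \<le> T" "t3 \<le> t3 + s"
  using s late_enough late_enough(1)[OF i] t_order T5_order(2)[OF assms(1)] by linarith+
 have a: "act (ag i) (t3 + s) = send fwd (if s = 0 then [w i] else [])
   (fst (flood (Val (w i)) (after t3 (col_back (W (ag i)) m)) (after t3 (col_front (W (ag i)) m)) s), Silent)"
  using colored_agent.act_weights[OF agent_ag[OF i], of "t3 + s"] le size_ag[OF i] orientation(1)[of "ag i"] ag(1)[OF i]
   needs_sink_eq[OF i] assms(1) by (simp add: w_def)
 show "lt i (t3 + s) = Silent" using sent[OF a] by simp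
 show "rt i (t3 + s) = (if s = 0 then Val (w i) else rt (i - 1) (t3 + (s - 1)))"
 proof (cases "s = 0")
  case False
  hence "t3 + s - 1 = t3 + (s - 1)" by simp
  thus ?thesis using False sent[OF a] streams(1)[OF i, of "t3 + s"] le by (simp add: flood_def after_def)
 qed (use sent[OF a] in \<open>simp add: flood_def\<close>)
qed

lemma weight_messages:
 assumes ns "i < n" "s < m - 1"
 shows "rt i (t3 + s) = (if s < i then Val (w (i - s)) else rt 0 (t3 + (s - i)))"
 using assms(2,3)
proof (induction i arbitrary: s)
 case (Suc i)
 thus ?case using weight_step(1)[OF assms(1), of "Suc i" s] Suc.IH[of "s - 1"] by (cases s) auto
qed simp

lemma weights_step:
 assumes ns and i: "1 \<le> i" "i + 1 < n"
 shows "col_weights (W (ag (i + 1))) m = col_weights (W (ag i)) m"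
proof -
 have i': "i < n" "1 \<le> i + 1" using i by auto
 have le: "t4 \<le> fin (ag i)" "t4 < T5" "t4 + 1 \<le> T"
  using late_enough late_enough(1)[OF i(1) i'(1)] T5_order(2)[OF assms(1)] m3 by linarith+
 have "act (ag i) t4 = send fwd [] (flood (Vals (col_weights (W (ag i)) m)) (after t4 (col_back (W (ag i)) m)) (after t4 (col_front (W (ag i)) m)) 0)"
  using colored_agent.act_weight_vals[OF agent_ag[OF i(1) i'(1)], of t4] le size_ag[OF i(1) i'(1)] orientation(1)[of "ag i"] ag(1)[OF i(1) i'(1)]
   needs_sink_eq[OF i(1) i'(1)] t5_eq(1)[OF i(1) i'(1)] assms(1) by simp
 hence "rt i t4 = Vals (col_weights (W (ag i)) m)" using sent(1) by (simp add: flood_def)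
 moreover have "agree m (Vals (col_weights (W (ag (i + 1))) m)) (after t4 (col_back (W (ag (i + 1))) m)) (after t4 (col_front (W (ag (i + 1))) m))"
  using colored_agent.checks(2)[OF agent_ag[OF i'(2) i(2)]] size_ag[OF i'(2) i(2)] needs_sink_eq[OF i'(2) i(2)] assms(1) by simp
 hence "col_back (W (ag (i + 1))) m (t4 + 1) = Vals (col_weights (W (ag (i + 1))) m)"
 proof -
  assume "agree m (Vals (col_weights (W (ag (i + 1))) m)) (after t4 (col_back (W (ag (i + 1))) m)) (after t4 (col_front (W (ag (i + 1))) m))"
  moreover have "1 \<in> {1..<m}" using m3 by simp
  ultimately show ?thesis unfolding agree_def after_def by blast
 qed
 ultimately show ?thesis using streams(1)[OF i'(2) i(2), of "t4 + 1"] le by simp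
qed

text \<open>The numbers travel in one direction, so there is no second copy to compare with as in
  \<open>flood_values\<close>. Instead the vectors that neighbours exchange must agree, and it
  suffices to compute the one of agent \<open>n - 1\<close>: no number of a real agent passes
  through agent \<open>0\<close> on the way to it.\<close>

lemma weights_eq:
 assumes ns and i: "1 \<le> i" "i < n"
 shows "col_weights (W (ag i)) m = map (\<lambda>j. Wt ((j + (m - q)) mod m)) [0..<m]"
proof -
 have all: "col_weights (W (ag j)) m = col_weights (W (ag 1)) m" if "1 \<le> j" "j < n" for j
  using that
 proof (induction j rule: nat_induct_at_least)
  case (Suc j)
  thus ?case using weights_step[OF assms(1), of j] by simp
 qed simp
 obtain l where n1: "n = l + 1" using n3 by (metis add.commute le_Suc_ex numeral_3_eq_3 plus_1_eq_Suc add_Suc)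
 have l: "1 \<le> l" "l < n" using n3 n1 by auto
 have "val (after t3 (col_back (W (ag l)) m) (m - k)) = Wt ((l + k) mod m)" if k: "1 \<le> k" "k < m" for k
 proof -
  have le: "t3 + (m - k) \<le> T" "1 \<le> t3 + (m - k)" "t3 + (m - k) - 1 = t3 + (m - k - 1)"
   using k late_enough t_order T5_order by linarith+
  have "m - k - 1 < m - 1" "l - 1 < n" using k l by auto
  hence r: "rt (l - 1) (t3 + (m - k - 1)) =
    (if m - k - 1 < l - 1 then Val (w (l - 1 - (m - k - 1))) else rt 0 (t3 + (m - k - 1 - (l - 1))))"
   using weight_messages[OF assms(1)] by blast
  have "val (rt (l - 1) (t3 + (m - k - 1))) = Wt ((l + k) mod m)"
  proof (cases "m - k < l")
   case True
   hence "l + k = l + k - m + m" "l + k - m < m" using l n_le_m k n1 by linarith+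
   hence e: "(l + k) mod m = l + k - m" by (metis mod_add_self2 mod_less)
   have "m - k - 1 < l - 1" "l - 1 - (m - k - 1) = l + k - m" "1 \<le> l + k - m" "l + k - m < n" using True k l n1 n_le_m by linarith+
   thus ?thesis using r e by (simp add: Wt_def claimed_def)
  next
   case False
   have "\<not> m - k - 1 < l - 1" "m - k - 1 - (l - 1) = m - (l + k)" using False k l by linarith+
   hence v: "val (rt (l - 1) (t3 + (m - k - 1))) = val (rt 0 (t3 + (m - (l + k))))" using r by simp
   show ?thesis
   proof (cases "l + k = m")
    case True
    thus ?thesis using v by (simp add: Wt_def claimed_def)
   next
    case F: False
    hence "(l + k) mod m = l + k" "\<not> l + k < n" "(m - (l + k)) mod m = m - (l + k)" using False k n1 by auto
    thus ?thesis using v by (simp add: Wt_def claimed_def)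
   qed
  qed
  thus ?thesis using streams(1)[OF l le(2,1)] le(3) by (simp add: after_def)
 qed
 moreover have "col_coins (W (ag l)) t3 ! 0 = Wt (l mod m)"
 proof -
  have "act (ag l) t3 = send fwd [w l] (fst (flood (Val (w l)) (after t3 (col_back (W (ag l)) m)) (after t3 (col_front (W (ag l)) m)) 0), Silent)"
  proof -
   have "t3 \<le> t3" "t3 < t4" "t3 \<le> fin (ag l)" using late_enough(1)[OF l] t_order T5_order(1) by linarith+
   thus ?thesis
    using colored_agent.act_weights[OF agent_ag[OF l], of t3] size_ag[OF l] orientation(1)[of "ag l"] ag(1)[OF l]
     needs_sink_eq[OF l] assms(1) by (simp add: w_def)
  qed
  moreover have "t3 < T" using late_enough T5_order by linarith
  moreover have "Wt (l mod m) = w l" using l n_le_m by (simp add: Wt_def claimed_def)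
  ultimately show ?thesis by (simp add: col_coins_def fst_trace_hist)
 qed
 ultimately have "col_weights (W (ag l)) m = arrange m ((q + l) mod m) (Wt (l mod m)) (\<lambda>k. Wt ((l + k) mod m))"
  unfolding col_weights_def col_index_ag[OF l] by (subst arrange_cong[of m _ "\<lambda>k. Wt ((l + k) mod m)"]) simp_all
 thus ?thesis using arrange_ring[OF q(1) refl, where y = Wt and j = l] all[OF i] all[OF l] by simp
qed

definition sk :: "nat option" where
 "sk = (if ns then Some (index_of V (rev (sort V) ! ((\<Sum>j<m. Wt j) mod m))) else None)"

lemma sink_eq:
 assumes i: "1 \<le> i" "i < n"
 shows "col_sink (W (ag i)) m = sk"
proof (cases ns)
 case True
 thus ?thesis
  using needs_sink_eq[OF i] orientation(2)[of "ag i"] ag(1)[OF i]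
  unfolding col_sink_def weights_eq[OF True i] sum_list_ring by (simp add: sk_def)
qed (use needs_sink_eq[OF i] in \<open>simp add: col_sink_def sk_def\<close>)

lemma sink_less: "sk = Some s ==> s < m"
proof -
 assume s: "sk = Some s"
 have "rev (sort V) ! ((\<Sum>j<m. Wt j) mod m) \<in> set V"
 proof -
  have "(\<Sum>j<m. Wt j) mod m < length (rev (sort V))" using V_props(1) m3 by simp
  hence "rev (sort V) ! ((\<Sum>j<m. Wt j) mod m) \<in> set (rev (sort V))" by (rule nth_mem)
  thus ?thesis by simp
 qed
 then obtain j where "j < m" "V ! j = rev (sort V) ! ((\<Sum>j<m. Wt j) mod m)"
  using V_props(1) by (metis in_set_conv_nth)
 thus "s < m" using s index_of_nth[OF V_props(2), of j] V_props(1) by (auto simp: sk_def split: if_splits)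
qed

lemma valid_sink: "valid_sink ps sk"
proof -
 have *: "(\<forall>c\<in>set ps. \<forall>c'\<in>set ps. c = c') \<longleftrightarrow> (\<forall>j<m. P j = P 1)"
 proof -
  have "P 1 \<in> set ps" using m3 unfolding set_ps by auto
  hence "(\<forall>c\<in>set ps. \<forall>c'\<in>set ps. c = c') \<longleftrightarrow> (\<forall>c\<in>set ps. c = P 1)" by metis
  thus ?thesis using all_P[of 1] m3 by simp
 qed
 show ?thesis
 proof (cases sk)
  case None
  hence "\<not> ns" by (simp add: sk_def split: if_splits)
  thus ?thesis using None * by (auto simp: valid_sink_def length_ps ns_def)
 next
  case (Some s)
  hence ns by (simp add: sk_def split: if_splits)
  thus ?thesis using Some * sink_less by (simp add: valid_sink_def length_ps ns_def)
 qed
qed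

definition y where "y i = fst (snd (cell (ag i) T5))"
definition R where "R i = snd (snd (cell (ag i) T5))"

lemma coin_action:
 assumes i: "1 \<le> i" "i < n" and s: "s < 2 * m"
 shows "act (ag i) (T5 + s) = send fwd (if s = 0 then [y i, R i] else [])
  (sharing_step m (y i) (R i) (\<lambda>k. rt (i - 1) (T5 + (k - 1))) (\<lambda>k. lt ((i + 1) mod n) (T5 + (k - 1))) s)"
proof -
 have le: "T5 + s < T5 + 2 * m" "T5 + s \<le> fin (ag i)" "T5 + s < T" using s late_enough late_enough(1)[OF i] by linarith+
 have "sharing_step m (y i) (R i) (after T5 (col_back (W (ag i)) m)) (after T5 (col_front (W (ag i)) m)) s
  = sharing_step m (y i) (R i) (\<lambda>k. rt (i - 1) (T5 + (k - 1))) (\<lambda>k. lt ((i + 1) mod n) (T5 + (k - 1))) s"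
 proof (rule sharing_step_cong1)
  fix k assume "1 \<le> k" "k \<le> s"
  hence "1 \<le> T5 + k" "T5 + k \<le> T" "T5 + k - 1 = T5 + (k - 1)" using le by linarith+
  thus "after T5 (col_back (W (ag i)) m) k = rt (i - 1) (T5 + (k - 1))"
   "after T5 (col_front (W (ag i)) m) k = lt ((i + 1) mod n) (T5 + (k - 1))"
   unfolding after_def using streams[OF i, of "T5 + k"] by (simp_all only:)
 qed (use m3 in simp)
 thus ?thesis
  using colored_agent.act_coin[OF agent_ag[OF i], of "T5 + s"] le size_ag[OF i] orientation(1)[of "ag i"] ag(1)[OF i]
   t5_eq[OF i] by (simp add: y_def R_def)
qed

lemma coin_run: "sharing_run n m (\<lambda>i s. rt i (T5 + s)) (\<lambda>i s. lt i (T5 + s)) y R"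
proof
 show "3 \<le> n" "n \<le> m" by (fact n3 n_le_m)+
 fix i assume i: "1 \<le> i" "i < n"
 show "(rt i (T5 + s), lt i (T5 + s)) = sharing_step m (y i) (R i) (\<lambda>k. rt (i - 1) (T5 + (k - 1))) (\<lambda>k. lt ((i + 1) mod n) (T5 + (k - 1))) s"
  if "s < 2 * m" for s
  using sent[OF coin_action[OF i that]] by simp
 have "sharing_ok 1 {0, 1} m (after T5 (col_back (W (ag i)) m)) (after T5 (col_front (W (ag i)) m))
  = sharing_ok 1 {0, 1} m (\<lambda>k. rt (i - 1) (T5 + (k - 1))) (\<lambda>k. lt ((i + 1) mod n) (T5 + (k - 1)))"
 proof (rule sharing_ok_cong1)
  fix k assume "1 \<le> k" "k \<le> 2 * m"
  hence "1 \<le> T5 + k" "T5 + k \<le> T" "T5 + k - 1 = T5 + (k - 1)" using late_enough by linarith+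
  thus "after T5 (col_back (W (ag i)) m) k = rt (i - 1) (T5 + (k - 1))"
   "after T5 (col_front (W (ag i)) m) k = lt ((i + 1) mod n) (T5 + (k - 1))"
   unfolding after_def using streams[OF i, of "T5 + k"] by (simp_all only:)
 qed (use m3 in simp)
 thus "sharing_ok 1 {0, 1} m (\<lambda>k. rt (i - 1) (T5 + (k - 1))) (\<lambda>k. lt ((i + 1) mod n) (T5 + (k - 1)))"
  using colored_agent.checks(3)[OF agent_ag[OF i]] size_ag[OF i] t5_eq(1)[OF i] by simp
qed

definition input where "input = sharing_run.input n m (\<lambda>i s. rt i (T5 + s)) y"
definition coin where "coin = (\<Sum>j<m. input j) mod 2"

lemma coin_eq:
 assumes i: "1 \<le> i" "i < n"
 shows "col_coin (W (ag i)) m = coin"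
proof -
 have "T5 < T" using late_enough by linarith
 hence c: "col_coins (W (ag i)) T5 ! 0 = y i"
  using coin_action[OF i, of 0] m3 by (simp add: col_coins_def fst_trace_hist)
 have "shared_inputs m j (y i) (after T5 (col_front (W (ag i)) m)) = shared_inputs m j (y i) (\<lambda>k. lt ((i + 1) mod n) (T5 + (k - 1)))" for j
  unfolding shared_inputs_def
 proof (rule arrange_cong)
  fix k assume "1 \<le> k" "k < m"
  hence "1 \<le> T5 + (m + 1 + k)" "T5 + (m + 1 + k) \<le> T" "T5 + (m + 1 + k) - 1 = T5 + (m + 1 + k - 1)" using late_enough by linarith+
  thus "val (after (m + 1) (after T5 (col_front (W (ag i)) m)) k) = val (after (m + 1) (\<lambda>k. lt ((i + 1) mod n) (T5 + (k - 1))) k)"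
   using streams(2)[OF i, of "T5 + (m + 1 + k)"] by (simp add: after_def)
 qed
 thus ?thesis
  unfolding col_coin_def t5_eq[OF i] c col_index_ag[OF i]
  using sharing_run.parity_shared[OF coin_run i q(1) refl] by (simp add: coin_def input_def)
qed

lemma turn_zero_output:
 assumes i: "1 \<le> i" "i < n" and "turn ps sk coin ((q + i) mod m) = 0"
 shows "final_output (W (ag i)) = Some (p (ag i))"
 using colored_agent.turn_zero_output[OF agent_ag[OF i]] size_ag[OF i] prefs_eq[OF i] sink_eq[OF i] coin_eq[OF i]
  col_index_ag[OF i] assms(3) by simp

lemma coin_less: "coin < 2" by (simp add: coin_def)

lemma no_coins_early:
 assumes i: "1 \<le> i" "i < n"
 shows "t < t3 ==> coins (act i t) = []" "t < T5 ==> length (coins (act i t)) \<le> 1"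
proof -
 obtain i' where i': "1 \<le> i'" "i' < n" "i = ag i'" using ag i by metis
 note A = agent_ag[OF i'(1,2)] and e = size_ag[OF i'(1,2)]
 have le: "T5 + 2 * m \<le> fin i" using late_enough(1)[OF i'(1,2)] i'(3) by simp
 have 1: "coins (act i t) = []" if t: "t < t3" for t
 proof -
  consider "t < m" | "m \<le> t" "t < t1" | "t1 \<le> t" "t < t2" | "t2 \<le> t" "t < t3" using t by linarith
  thus ?thesis
   using colored_agent.wake_up[OF A, of t] colored_agent.act_ids[OF A, of t] colored_agent.act_prefs[OF A, of t]
    colored_agent.act_vals[OF A, of t] t le T5_order(1) e i'(3) by cases auto
 qed
 show "t < t3 ==> coins (act i t) = []" by (rule 1)
 show "length (coins (act i t)) \<le> 1" if t: "t < T5"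
 proof (cases "t < t3")
  case False
  hence ns using t T5_order by linarith
  hence n: "col_needs_sink (W i) m" "col_t5 (W i) m = T5" using needs_sink_eq[OF i'(1,2)] t5_eq(1)[OF i'(1,2)] i'(3) by simp_all
  show ?thesis
  proof (cases "t < t4")
   case True
   thus ?thesis using colored_agent.act_weights[OF A, of t] False le t e i'(3) n by auto
  next
   case F: False
   thus ?thesis using colored_agent.act_weight_vals[OF A, of t] t le e i'(3) n by auto
  qed
 qed (use 1 in simp)
qed

end

text \<open>The number of recorded coins shows which part of the cell an action reads: nothing, the
  number for the sink, or the bits. So whether an action survives a change of the cell can be read
  off the run itself.\<close>

lemma col_act_cell_cases:
 "(\<forall>c c'. col_act \<beta> ncol v c = col_act \<beta> ncol v c')
  \<or> (\<forall>c. length (coins (col_act \<beta> ncol v c)) = 1) \<and> (\<forall>c c'. fst c = fst c' \<longrightarrow> col_act \<beta> ncol v c = col_act \<beta> ncol v c')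
  \<or> (\<forall>c. length (coins (col_act \<beta> ncol v c)) = 2)"
proof (cases "decided (hist v)")
 case True
 thus ?thesis by (simp add: col_act_def Let_def)
next
 case nd: False
 show ?thesis
 proof (cases "ring_size (own_id v) (hist v)")
  case None
  thus ?thesis by (simp add: col_act_def Let_def)
 next
  case (Some m)
  consider "\<not> col_ok ncol v m \<or> length (hist v) < col_t3 m" | "col_ok ncol v m" "col_t3 m \<le> length (hist v)" by linarith
  thus ?thesis
  proof cases
   case 1
   then consider "\<not> col_ok ncol v m" | "length (hist v) < col_t1 m" | "\<not> length (hist v) < col_t1 m" "length (hist v) < col_t2 m"
    | "\<not> length (hist v) < col_t1 m" "\<not> length (hist v) < col_t2 m" "length (hist v) < col_t3 m" by blast
   thus ?thesis
   proof cases
    case 1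
    thus ?thesis using nd Some by (simp add: col_act_def)
   next
    case 2
    thus ?thesis using nd Some by (intro disjI1) (simp add: col_act_def Let_def)
   next
    case 3
    thus ?thesis using nd Some by (intro disjI1) (simp add: col_act_def Let_def)
   next
    case 4
    thus ?thesis using nd Some by (intro disjI1) (simp add: col_act_def Let_def)
   qed
  next
   case 2
   hence t: "\<not> length (hist v) < col_t1 m" "\<not> length (hist v) < col_t2 m" "\<not> length (hist v) < col_t3 m"
    using col_t_order(2,3)[of m] by linarith+
   note S = nd Some 2(1) t
   consider "col_needs_sink v m" "length (hist v) < col_t4 m"
    | "\<not> (col_needs_sink v m \<and> length (hist v) < col_t4 m)" "col_needs_sink v m \<and> length (hist v) < col_t5 v m"
    | "\<not> (col_needs_sink v m \<and> length (hist v) < col_t4 m)" "\<not> (col_needs_sink v m \<and> length (hist v) < col_t5 v m)"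
    by blast
   thus ?thesis
   proof cases
    case 1
    thus ?thesis
     using S by (cases "length (hist v) = col_t3 m") (simp_all add: col_act_def Let_def drawn_def)
   next
    case 2
    thus ?thesis using S by (intro disjI1) (simp add: col_act_def Let_def)
   next
    case 3
    show ?thesis
    proof (cases "length (hist v) < col_t6 v m \<and> length (hist v) = col_t5 v m")
     case True
     thus ?thesis using S 3(1) by (intro disjI2) (simp add: col_act_def Let_def drawn_def)
    next
     case False
     then consider "length (hist v) < col_t6 v m" "length (hist v) \<noteq> col_t5 v m" | "\<not> length (hist v) < col_t6 v m" by blast
     thus ?thesis
      by cases (use S 3 in \<open>cases "col_needs_sink v m"; intro disjI1; simp add: col_act_def Let_def\<close>)+
    qed
   qed
  qed
 qed
qed

lemma col_act_no_coins: "coins (col_act \<beta> ncol v c) = [] ==> col_act \<beta> ncol v c' = col_act \<beta> ncol v c"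
 using col_act_cell_cases[of \<beta> ncol v] by (metis One_nat_def list.size(3) nat.distinct(1) numeral_2_eq_2)

lemma col_act_short_coins:
 assumes "length (coins (col_act \<beta> ncol v c)) \<le> 1" "fst c' = fst c"
 shows "col_act \<beta> ncol v c' = col_act \<beta> ncol v c"
proof -
 have "length (coins (col_act \<beta> ncol v c)) \<noteq> 2" using assms(1) by linarith
 thus ?thesis using col_act_cell_cases[of \<beta> ncol v] assms(2) by metis
qed

section \<open>What a deviating agent can gain\<close>

context coloring_run
begin

text \<open>The first messages of agent \<open>0\<close> to its two sides are the ids of positions
  \<open>0\<close> and \<open>n\<close> of the apparent ring. If these ids are equal, so are the
  positions, which means \<open>n = m\<close>.\<close>

lemma one_id:
 assumes "to_cw (act 0 0) = Id z" "to_ccw (act 0 0) = Id z"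
 shows "m = n"
proof (rule ccontr)
 assume "m \<noteq> n"
 hence mn: "n < m" using n_le_m by simp
 have "Y 0 = z" using id_messages(1)[of 0 0] assms n3 mn by simp
 moreover have "Y n = z" using id_messages(2)[of 0 n] assms n3 mn by simp
 ultimately have "(0::nat) = n" using inj_onD[OF Y_inj, of 0 n] mn by simp
 thus False using n3 by simp
qed

lemma length_V_index:
 assumes "a < m" "b < m" "index_of V (rev (sort V) ! a) = index_of V (rev (sort V) ! b)"
 shows "a = b"
proof -
 have l: "length (rev (sort V)) = m" "distinct (rev (sort V))" using V_props by simp_all
 have "V ! index_of V z = z" if "z \<in> set V" for z
  using that index_of_nth[OF V_props(2)] by (metis in_set_conv_nth)
 moreover have "rev (sort V) ! c \<in> set V" if "c < m" for c
  using nth_mem[of c "rev (sort V)"] that l(1) by simp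
 ultimately have "rev (sort V) ! a = rev (sort V) ! b" using assms by metis
 thus ?thesis using l assms(1,2) by (simp add: nth_eq_iff_index_eq)
qed

end

text \<open>All that is used of a win of agent \<open>0\<close> besides the colors of the
  others.\<close>

locale winning_run = coloring_run +
 assumes neighbour1: "final_output (trace_view n x p act 1 T) \<noteq> Some (p 0)"
  and neighbour2: "final_output (trace_view n x p act (n - 1) T) \<noteq> Some (p 0)"
begin

lemma ag_end: "i = 1 \<or> i = n - 1 ==> ag i = 1 \<or> ag i = n - 1"
 using n3 by (auto simp: ag_def)

lemma neighbour_turn:
 assumes "i = 1 \<or> i = n - 1" "p (ag i) = p 0"
 shows "turn ps sk coin ((q + i) mod m) \<noteq> 0"
proof
 assume "turn ps sk coin ((q + i) mod m) = 0"
 moreover have "1 \<le> i" "i < n" using assms(1) n3 by auto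
 ultimately have "final_output (W (ag i)) = Some (p 0)" using turn_zero_output[of i] assms(2) by simp
 thus False using ag_end[OF assms(1)] neighbour1 neighbour2 by auto
qed

text \<open>Otherwise agents \<open>1, ..., n - 1\<close> form a path of even length without a sink.
  Its ends are the neighbours of agent \<open>0\<close>, and one of them outputs the color in the
  first round. So at most \<open>n - 1\<close> of the \<open>m\<close> positions are sinks with
  which agent \<open>0\<close> can win.\<close>

lemma sink_is_real:
 assumes "odd n" "\<And>i. 1 \<le> i ==> i < n ==> p i = p 0"
 shows "\<exists>i. 1 \<le> i \<and> i < n \<and> sk = Some ((q + i) mod m)"
proof (rule ccontr)
 assume *: "\<not> ?thesis"
 have e: "q + 1 + t = q + (1 + t)" for t by simp
 have pt: "ps ! ((q + 1 + t) mod length ps) = p 0 \<and> sk \<noteq> Some ((q + 1 + t) mod length ps)" if "t < n - 1" for t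
 proof -
  have t: "1 \<le> 1 + t" "1 + t < n" "1 + t < m" using that n_le_m by linarith+
  hence "sk \<noteq> Some ((q + (1 + t)) mod m)" using * by blast
  moreover have "ps ! ((q + (1 + t)) mod m) = p 0"
   using ps_nth[OF t(3)] P_real[OF t(1,2)] assms(2)[of "ag (1 + t)"] ag(1)[OF t(1,2)] by simp
  ultimately show ?thesis unfolding length_ps e by blast
 qed
 have "ps \<noteq> []" using length_ps m3 by auto
 moreover have "even (n - 1)" "0 < n - 1" using assms(1) n3 by auto
 ultimately have "turn ps sk coin ((q + 1) mod m) = 0 \<or> turn ps sk coin ((q + 1 + (n - 1 - 1)) mod m) = 0"
  using turn_zero_path[OF valid_sink \<open>ps \<noteq> []\<close> pt \<open>even (n - 1)\<close> \<open>0 < n - 1\<close> coin_less] unfolding length_ps by simp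
 moreover have "q + 1 + (n - 1 - 1) = q + (n - 1)" using n3 by linarith
 ultimately have "turn ps sk coin ((q + 1) mod m) = 0 \<or> turn ps sk coin ((q + (n - 1)) mod m) = 0" by (simp only:)
 moreover have "p (ag 1) = p 0" "p (ag (n - 1)) = p 0" using assms(2) ag(1)[of 1] ag(1)[of "n - 1"] n3 by auto
 ultimately show False using neighbour_turn[of 1] neighbour_turn[of "n - 1"] by blast
qed

text \<open>If position \<open>0\<close> had to wait, a neighbour with the same preference would
  output the color in the first round. Hence where a deviation wins with a given coin and sink, the
  algorithm would have won as well.\<close>

lemma own_turn:
 assumes "m = n" "P 0 = p 0"
 shows "turn ps sk coin q = 0"
proof -
 have m: "(q + m - 1) mod m = (q + (n - 1)) mod m" using assms(1) n3 by (simp add: algebra_simps)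
 have p0: "ps ! q = p 0" using ps_nth[of 0] assms m3 q(1) by simp
 have a: "ps ! ((q + i) mod m) = p (ag i)" if "1 \<le> i" "i < n" for i
  using ps_nth[of i] P_real[OF that] that n_le_m by simp
 have "q < length ps" "3 \<le> length ps" using q(1) m3 by (simp_all add: length_ps)
 from turn_zero_neighbour[OF valid_sink this(1) coin_less this(2)]
 show ?thesis
  unfolding length_ps m p0 using neighbour_turn[of 1] neighbour_turn[of "n - 1"] a[of 1] a[of "n - 1"] n3 by auto
qed

end

text \<open>Up to round \<open>\<kappa>\<close> agent \<open>0\<close> acts by a common rule in both
  runs. For one deviation on two tapes \<open>\<kappa>\<close> is the horizon; for a deviating and
  an honest run on one tape it is the round of the deviation.\<close>

locale two_coloring_runs =
 a: coloring_run \<beta> ncol n x p act T cell + b: coloring_run \<beta> ncol n x p act' T cell'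
 for \<beta> ncol n x p act T cell act' cell' +
 fixes \<kappa> :: nat
 assumes \<kappa>: "\<kappa> \<le> T"
  and coupled: "\<And>t. t < \<kappa> ==> trace_view n x p act 0 t = trace_view n x p act' 0 t ==> act 0 t = act' 0 t"
begin

lemma same_until:
 assumes "\<And>i t. 1 \<le> i ==> i < n ==> t < \<tau> ==>
   cell' i t = cell i t \<or> coins (act i t) = [] \<or> fst (cell' i t) = fst (cell i t) \<and> length (coins (act i t)) \<le> 1"
  and "\<tau> \<le> \<kappa>"
 shows "t < \<tau> ==> i < n ==> act i t = act' i t"
proof (induction t arbitrary: i rule: less_induct)
 case (less t)
 have v: "trace_view n x p act j t = trace_view n x p act' j t" if "j < n" for j
  using less.IH less.prems that by (intro trace_view_cong) auto
 have t: "t < \<kappa>" "t < T" using less.prems assms(2) \<kappa> by auto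
 show ?case
 proof (cases "i = 0")
  case True
  thus ?thesis using coupled[OF t(1)] v[of 0] less.prems by simp
 next
  case False
  hence i: "1 \<le> i" "i < n" using less.prems by auto
  have "act i t = col_act \<beta> ncol (trace_view n x p act i t) (cell i t)"
   "act' i t = col_act \<beta> ncol (trace_view n x p act i t) (cell' i t)"
   using a.honest[OF i t(2)] b.honest[OF i t(2)] v[OF i(2)] by simp_all
  thus ?thesis
   using assms(1)[OF i less.prems(1)] col_act_no_coins[of \<beta> ncol "trace_view n x p act i t" "cell i t" "cell' i t"]
    col_act_short_coins[of \<beta> ncol "trace_view n x p act i t" "cell i t" "cell' i t"] by metis
 qed
qed

lemma early_same: "a.t3 \<le> \<kappa> ==> t < a.t3 ==> i < n ==> act i t = act' i t"
 using same_until[of a.t3] a.no_coins_early(1) by blast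

context
 assumes early: "a.t3 \<le> \<kappa>"
begin

lemma m_same: "b.m = a.m"
proof -
 have one: "1 \<le> (1::nat)" "1 < n" using a.n3 by auto
 have h: "trace_hist n act' 1 a.m = trace_hist n act 1 a.m"
  using trace_view_cong[of n a.m act act' 1 x p] early_same[OF early] a.t_order a.n3 by (simp add: trace_view_def)
 have "ring_size (x 1) (trace_hist n act 1 a.m) = Some a.m"
  using colored_agent.ring_size_at[OF a.agent[OF one], of a.m] a.size_eq[OF one] a.m_less by simp
 hence "ring_size (x 1) (trace_hist n act' 1 a.m) = Some a.m" using h by simp
 thus ?thesis
  using colored_agent.ring_size_at[OF b.agent[OF one], of a.m] b.size_eq[OF one] a.m_less by (auto split: if_splits)
qed

lemma Ylist_same: "map b.Y [0..<b.m] = map a.Y [0..<a.m]"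
proof -
 have "b.Y j = a.Y j" for j
 proof -
  have "(a.m - j) mod a.m < a.t3" using a.m3 a.t_order by (meson less_trans mod_less_divisor order.strict_trans2 zero_less_numeral)
  thus ?thesis using early_same[OF early, of _ 0] a.n3 by (simp add: a.Y_def b.Y_def claimed_def m_same)
 qed
 thus ?thesis by (simp add: m_same)
qed

lemma geometry_same: "b.fwd = a.fwd" "b.V = a.V" "b.ag = a.ag" "b.q = a.q"
proof -
 show f: "b.fwd = a.fwd" and V: "b.V = a.V"
  using Ylist_same by (simp_all add: a.fwd_def b.fwd_def a.V_def b.V_def)
 show ag: "b.ag = a.ag" by (simp add: fun_eq_iff a.ag_def b.ag_def f)
 show "b.q = a.q" by (simp add: a.q_def b.q_def m_same V ag)
qed

lemma stream_same:
 assumes "act (a.ag i) t = act' (a.ag i) t"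
 shows "b.rt i t = a.rt i t" "b.lt i t = a.lt i t"
 using assms by (simp_all add: a.rt_def b.rt_def a.lt_def b.lt_def geometry_same)

lemma P_same: "j < a.m ==> b.P j = a.P j"
proof -
 assume j: "j < a.m"
 have "b.rt 0 (a.t1 + (a.m - j) mod a.m) = a.rt 0 (a.t1 + (a.m - j) mod a.m)" if "\<not> (1 \<le> j \<and> j < n)"
 proof (rule stream_same, rule early_same[OF early])
  have "(a.m - j) mod a.m < a.m - 1"
   using that j a.n3 a.n_le_m by (cases "j = 0") auto
  thus "a.t1 + (a.m - j) mod a.m < a.t3" using a.t_order by linarith
 qed (use a.ag(2) a.n3 in auto)
 thus ?thesis by (auto simp: a.P_def b.P_def claimed_def m_same geometry_same)
qed

lemma ps_same: "b.ps = a.ps" "b.ns = a.ns" "b.T5 = a.T5"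
proof -
 show "b.ps = a.ps" using P_same a.m3 by (simp add: a.ps_def b.ps_def m_same geometry_same)
 show ns: "b.ns = a.ns" using P_same P_same[of 1] a.m3 by (auto simp: a.ns_def b.ns_def m_same)
 show "b.T5 = a.T5" by (simp add: a.T5_def b.T5_def ns m_same)
qed

text \<open>The numbers of the fake positions \<open>n, ..., m\<close> leave agent \<open>0\<close>
  in steps \<open>m - n, ..., 0\<close>, which explains the range of \<open>s\<close>.\<close>

lemma sk_same:
 assumes "\<And>s. s \<le> a.m - n ==> act 0 (a.t3 + s) = act' 0 (a.t3 + s)"
  and "\<And>i. 1 \<le> i ==> i < n ==> fst (cell' i a.t3) = fst (cell i a.t3)"
 shows "b.sk = a.sk"
proof -
 have "b.Wt j = a.Wt j" if "j < a.m" for j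
 proof (cases "1 \<le> j \<and> j < n")
  case True
  thus ?thesis using assms(2)[of "a.ag j"] a.ag(1)[of j]
   by (simp add: a.Wt_def b.Wt_def claimed_def a.w_def b.w_def geometry_same m_same)
 next
  case False
  hence "(a.m - j) mod a.m \<le> a.m - n" using that by (cases "j = 0") auto
  hence "b.rt 0 (a.t3 + (a.m - j) mod a.m) = a.rt 0 (a.t3 + (a.m - j) mod a.m)"
   using assms(1) a.ag(2) by (intro stream_same) simp
  thus ?thesis using False by (auto simp: a.Wt_def b.Wt_def claimed_def m_same)
 qed
 hence "(\<Sum>j<a.m. b.Wt j) = (\<Sum>j<a.m. a.Wt j)" by (intro sum.cong) auto
 thus ?thesis by (simp add: a.sk_def b.sk_def ps_same geometry_same m_same)
qed

lemma view_0_same: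
 assumes "\<And>s. s < t ==> act 0 s = act' 0 s" "\<And>s. s < t ==> a.rt (n - 1) s = b.rt (n - 1) s \<and> a.lt 1 s = b.lt 1 s"
 shows "trace_view n x p act 0 t = trace_view n x p act' 0 t"
proof -
 have "to_cw (act (n - 1) s) = to_cw (act' (n - 1) s) \<and> to_ccw (act 1 s) = to_ccw (act' 1 s)" if "s < t" for s
 proof (cases a.fwd)
  case True
  hence "a.ag (n - 1) = n - 1" "a.ag 1 = 1" by (auto simp: a.ag_def)
  thus ?thesis using assms(2)[OF that] True by (simp add: a.rt_def b.rt_def a.lt_def b.lt_def geometry_same)
 next
  case False
  hence "a.ag (n - 1) = 1" "a.ag 1 = n - 1" using a.n3 by (auto simp: a.ag_def)
  thus ?thesis using assms(2)[OF that] False by (simp add: a.rt_def b.rt_def a.lt_def b.lt_def geometry_same)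
 qed
 thus ?thesis using assms(1) a.n3 by (auto simp: trace_view_def trace_hist_def)
qed

text \<open>The number of agent \<open>1\<close> enters the view of agent \<open>0\<close> after
  \<open>n - 1\<close> hops, whereas the last fake number is sent at step \<open>m - n\<close>; by
  \<open>few\<close> this is earlier.\<close>

lemma view_0_weights_same:
 assumes ns: a.ns and few: "a.m + 2 \<le> 2 * n" and \<kappa>': "a.t3 + (a.m - n) < \<kappa>"
  and cells: "\<And>i. 1 \<le> i ==> i < n ==> i \<noteq> a.ag 1 ==> fst (cell' i a.t3) = fst (cell i a.t3)"
 shows "s \<le> a.m - n ==> act 0 (a.t3 + s) = act' 0 (a.t3 + s)"
proof (induction s rule: less_induct)
 case (less s)
 have in_same: "a.rt (n - 1) u = b.rt (n - 1) u \<and> a.lt 1 u = b.lt 1 u" if u: "u < a.t3 + s" for u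
 proof (cases "u < a.t3")
  case True
  thus ?thesis
   using stream_same[of "n - 1" u] stream_same[of 1 u] early_same[OF early True] a.ag(1)[of 1] a.ag(1)[of "n - 1"] a.n3
   by simp
 next
  case False
  define k where "k = u - a.t3"
  have k: "u = a.t3 + k" "k < s" "k < a.m - 1" "k < n - 1" "2 \<le> n - 1 - k"
   using False u less.prems few a.n_le_m by (auto simp: k_def)
  have "a.ag (n - 1 - k) \<noteq> a.ag 1" using a.ag(3)[of 1] a.ag(3)[of "n - 1 - k"] k a.n3
   by (metis One_nat_def Suc_n_not_le_n diff_le_self leD less_le_trans linorder_not_less numeral_2_eq_2 zero_less_diff diff_less)
  hence "a.w (n - 1 - k) = b.w (n - 1 - k)"
   using cells[of "a.ag (n - 1 - k)"] a.ag(1)[of "n - 1 - k"] k by (simp add: a.w_def b.w_def geometry_same m_same)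
  moreover have "a.rt (n - 1) (a.t3 + k) = Val (a.w (n - 1 - k))" "b.rt (n - 1) (a.t3 + k) = Val (b.w (n - 1 - k))"
   using a.weight_messages[OF ns, of "n - 1" k] b.weight_messages[of "n - 1" k] ns k a.n3 by (simp_all add: ps_same m_same)
  moreover have "a.lt 1 (a.t3 + k) = Silent" "b.lt 1 (a.t3 + k) = Silent"
   using a.weight_step(2)[OF ns, of 1 k] b.weight_step(2)[of 1 k] ns k a.n3 by (simp_all add: ps_same m_same)
  ultimately show ?thesis using k(1) by simp
 qed
 have "act 0 u = act' 0 u" if "u < a.t3 + s" for u
 proof (cases "u < a.t3")
  case True
  thus ?thesis using early_same[OF early True, of 0] a.n3 by simp
 next
  case False
  thus ?thesis using less.IH[of "u - a.t3"] that less.prems by simp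
 qed
 hence "trace_view n x p act 0 (a.t3 + s) = trace_view n x p act' 0 (a.t3 + s)"
  using in_same by (intro view_0_same) auto
 thus ?case using coupled[of "a.t3 + s"] less.prems \<kappa>' by simp
qed

text \<open>Agent \<open>0\<close> fixes the numbers of the fake positions before it has seen the one of agent \<open>1\<close>.\<close>

lemma weights_shift:
 assumes ns: a.ns and few: "a.m + 2 \<le> 2 * n" and \<kappa>': "a.t3 + (a.m - n) < \<kappa>"
  and cells: "\<And>i. 1 \<le> i ==> i < n ==> i \<noteq> a.ag 1 ==> fst (cell' i a.t3) = fst (cell i a.t3)"
 shows "(\<Sum>j<a.m. b.Wt j) + a.w 1 = (\<Sum>j<a.m. a.Wt j) + b.w 1"
proof -
 have eq: "b.Wt j = a.Wt j" if "j < a.m" "j \<noteq> 1" for j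
 proof (cases "1 \<le> j \<and> j < n")
  case True
  hence "a.ag j \<noteq> a.ag 1" using a.ag(3)[of j] a.ag(3)[of 1] that(2) by (metis a.n3 less_le_trans one_less_numeral_iff semiring_norm(77))
  thus ?thesis using cells[of "a.ag j"] a.ag(1)[of j] True
   by (simp add: a.Wt_def b.Wt_def claimed_def a.w_def b.w_def geometry_same m_same)
 next
  case False
  hence "(a.m - j) mod a.m \<le> a.m - n" using that by (cases "j = 0") auto
  hence "b.rt 0 (a.t3 + (a.m - j) mod a.m) = a.rt 0 (a.t3 + (a.m - j) mod a.m)"
   using view_0_weights_same[OF assms] a.ag(2) by (intro stream_same) simp
  thus ?thesis using False by (auto simp: a.Wt_def b.Wt_def claimed_def m_same)
 qed
 have r: "(\<Sum>j<a.m. f j) = f 1 + (\<Sum>j\<in>{..<a.m} - {1}. f j)" for f :: "nat => nat"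
  using a.m3 by (intro sum.remove) auto
 have "(\<Sum>j\<in>{..<a.m} - {1}. b.Wt j) = (\<Sum>j\<in>{..<a.m} - {1}. a.Wt j)" using eq by (intro sum.cong) auto
 moreover have "a.Wt 1 = a.w 1" "b.Wt 1 = b.w 1" using a.n3 by (simp_all add: a.Wt_def b.Wt_def claimed_def)
 ultimately show ?thesis using r[of a.Wt] r[of b.Wt] by linarith
qed

end

end

text \<open>Two runs that differ at most in the random bits of agent \<open>1\<close>, where the value that travels
 backwards is the same in both.\<close>

locale coin_flip_runs = two_coloring_runs +
 assumes few: "a.m + 2 \<le> 2 * n"
  and long: "a.T5 + a.m \<le> \<kappa>"
  and cells: "\<And>i t. 1 \<le> i ==> i < n ==> i \<noteq> a.ag 1 ==> cell' i t = cell i t"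
  and cell1: "\<And>t. fst (cell' (a.ag 1) t) = fst (cell (a.ag 1) t)
    \<and> xor (snd (snd (cell' (a.ag 1) t))) (fst (snd (cell' (a.ag 1) t))) = xor (snd (snd (cell (a.ag 1) t))) (fst (snd (cell (a.ag 1) t)))"
begin

lemma early: "a.t3 \<le> \<kappa>" using long a.T5_order(1) by linarith

lemma same_before_coin: "t < a.T5 ==> i < n ==> act i t = act' i t"
proof (rule same_until[of a.T5])
 fix i t assume "1 \<le> i" "i < n" "t < a.T5"
 thus "cell' i t = cell i t \<or> coins (act i t) = [] \<or> fst (cell' i t) = fst (cell i t) \<and> length (coins (act i t)) \<le> 1"
  using cells[of i t] cell1[of t] a.no_coins_early(2)[of i t] by blast
qed (use long in auto)

lemma fst_cell: "1 \<le> i ==> i < n ==> fst (cell' i t) = fst (cell i t)"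
 using cells[of i t] cell1[of t] by (cases "i = a.ag 1") auto

lemma sink_same: "b.sk = a.sk"
proof (cases a.ns)
 case True
 hence "a.t3 + s < a.T5" if "s \<le> a.m - n" for s
  using that a.T5_order(2) a.t_order a.n3 by linarith
 thus ?thesis using same_before_coin[of _ 0] a.n3 fst_cell by (intro sk_same[OF early]) auto
qed (use ps_same[OF early] in \<open>simp add: a.sk_def b.sk_def\<close>)

lemma coin_steps: "act 0 (a.T5 + s) = act' 0 (a.T5 + s)"
 if "s < a.m" "\<And>u. u < s ==> a.rt (n - 1) (a.T5 + u) = b.rt (n - 1) (a.T5 + u) \<and> a.lt 1 (a.T5 + u) = b.lt 1 (a.T5 + u)"
 using that
proof (induction s rule: less_induct)
 case (less s)
 have "a.rt (n - 1) u = b.rt (n - 1) u \<and> a.lt 1 u = b.lt 1 u" if u: "u < a.T5 + s" for u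
 proof (cases "u < a.T5")
  case True
  thus ?thesis
   using stream_same[OF early, of "n - 1" u] stream_same[OF early, of 1 u] same_before_coin[OF True] a.ag(1)[of 1] a.ag(1)[of "n - 1"] a.n3
   by simp
 next
  case False
  thus ?thesis using less.prems(2)[of "u - a.T5"] u by simp
 qed
 moreover have "act 0 u = act' 0 u" if "u < a.T5 + s" for u
 proof (cases "u < a.T5")
  case True
  thus ?thesis using same_before_coin[OF True, of 0] a.n3 by simp
 next
  case False
  thus ?thesis using less.IH[of "u - a.T5"] that less.prems by simp
 qed
 ultimately have "trace_view n x p act 0 (a.T5 + s) = trace_view n x p act' 0 (a.T5 + s)"
  by (intro view_0_same[OF early]) auto
 thus ?case using coupled[of "a.T5 + s"] less.prems long by simp
qed

sublocale coins: two_sharing_runs n a.m "\<lambda>i s. a.rt i (a.T5 + s)" "\<lambda>i s. a.lt i (a.T5 + s)" a.y a.R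
 "\<lambda>i s. b.rt i (a.T5 + s)" "\<lambda>i s. b.lt i (a.T5 + s)" b.y b.R
proof (intro two_sharing_runs.intro two_sharing_runs_axioms.intro)
 show "sharing_run n a.m (\<lambda>i s. a.rt i (a.T5 + s)) (\<lambda>i s. a.lt i (a.T5 + s)) a.y a.R" by (rule a.coin_run)
 show "sharing_run n a.m (\<lambda>i s. b.rt i (a.T5 + s)) (\<lambda>i s. b.lt i (a.T5 + s)) b.y b.R"
  using b.coin_run ps_same(3)[OF early] m_same[OF early] by simp
 show "a.m + 2 \<le> 2 * n" by (rule few)
 show "a.y i = b.y i \<and> a.R i = b.R i" if "2 \<le> i" "i < n" for i
 proof -
  have "a.ag i \<noteq> a.ag 1" using a.ag(3)[of i] a.ag(3)[of 1] that by auto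
  thus ?thesis using cells[of "a.ag i"] a.ag(1)[of i] that
   by (simp add: a.y_def b.y_def a.R_def b.R_def geometry_same[OF early] ps_same[OF early])
 qed
 show "xor (a.R 1) (a.y 1) = xor (b.R 1) (b.y 1)"
  using cell1[of a.T5] by (simp add: a.y_def b.y_def a.R_def b.R_def geometry_same[OF early] ps_same[OF early])
 show "a.rt 0 (a.T5 + s) = b.rt 0 (a.T5 + s) \<and> a.lt 0 (a.T5 + s) = b.lt 0 (a.T5 + s)"
  if "s < a.m" "\<And>u. u < s ==> a.rt (n - 1) (a.T5 + u) = b.rt (n - 1) (a.T5 + u) \<and> a.lt 1 (a.T5 + u) = b.lt 1 (a.T5 + u)" for s
  using stream_same[OF early, of 0 "a.T5 + s"] coin_steps[OF that] a.ag(2) by simp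
qed

lemma inputs_sum: "(\<Sum>j<a.m. a.input j) + b.y 1 = (\<Sum>j<a.m. b.input j) + a.y 1"
 using coins.sum_inputs by (simp add: a.input_def b.input_def ps_same[OF early] m_same[OF early])

lemma incoming_coin_same:
 assumes "u + 1 < a.m"
 shows "a.rt (n - 1) (a.T5 + u) = b.rt (n - 1) (a.T5 + u) \<and> a.lt 1 (a.T5 + u) = b.lt 1 (a.T5 + u)"
proof
 show "a.rt (n - 1) (a.T5 + u) = b.rt (n - 1) (a.T5 + u)"
 proof (rule coins.front_same)
  show "a.rt 0 (a.T5 + v) = b.rt 0 (a.T5 + v)" if "v < u" for v using coins.cheater_same[of v] that assms by simp
 qed (use assms a.n3 coins.d2 in linarith)+
 show "a.lt 1 (a.T5 + u) = b.lt 1 (a.T5 + u)"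
 proof (rule coins.back_same)
  show "a.lt 0 (a.T5 + v) = b.lt 0 (a.T5 + v)" if "v < u" for v using coins.cheater_same[of v] that assms by simp
 qed (use assms a.n3 in linarith)+
qed

text \<open>The first messages to agent \<open>0\<close> in which the two runs may differ are those
  of step \<open>m - 1\<close> of the coin flip, and these enter its view at round
  \<open>T5 + m\<close>.\<close>

lemma view_0_until_secret:
 assumes "t < a.T5 + a.m"
 shows "trace_view n x p act 0 t = trace_view n x p act' 0 t"
proof (rule view_0_same[OF early])
 fix s assume s: "s < t"
 show "act 0 s = act' 0 s"
 proof (cases "s < a.T5")
  case True
  thus ?thesis using same_before_coin[OF True, of 0] a.n3 by simp
 next
  case False
  thus ?thesis using coin_steps[of "s - a.T5"] incoming_coin_same s assms by simp
 qed
 show "a.rt (n - 1) s = b.rt (n - 1) s \<and> a.lt 1 s = b.lt 1 s"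
 proof (cases "s < a.T5")
  case True
  thus ?thesis
   using stream_same[OF early, of "n - 1" s] stream_same[OF early, of 1 s] same_before_coin[OF True] a.ag(1)[of 1] a.ag(1)[of "n - 1"] a.n3
   by simp
 next
  case False
  thus ?thesis using incoming_coin_same[of "s - a.T5"] s assms by simp
 qed
qed

end

section \<open>The coloring algorithm without deviation\<close>

text \<open>The honest execution is written down explicitly as the table \<open>hact\<close> and
  verified to reproduce itself under the algorithm. Such a table is unique, so it is the execution,
  and the outputs can be read off.\<close>

locale honest_coloring =
 fixes \<beta> ncol n :: nat and x p :: "nat => nat" and cell :: "nat => nat => nat \<times> nat \<times> nat"
 assumes n3: "3 \<le> n" and n_le: "n \<le> \<beta>"
  and inj: "inj_on x {..<n}"
  and pref: "\<And>i. i < n ==> p i < ncol"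
  and colors: "3 \<le> ncol"
  and bits: "\<And>i t. i < n ==> fst (snd (cell i t)) \<in> {0, 1} \<and> snd (snd (cell i t)) \<in> {0, 1}"
begin

definition fwd where "fwd = oriented_cw (map x [0..<n])"
definition V where "V = oriented_ids (map x [0..<n])"

lemma Xlist: "distinct (map x [0..<n])" "map x [0..<n] \<noteq> []"
 using inj n3 by (auto simp: distinct_map lessThan_atLeast0)

lemma exists_start:
 "\<exists>q<n. \<forall>i<n. V ! ((if fwd then q + i else q + (n - i)) mod n) = x i"
 and V_props: "length V = n" "distinct V"
 using oriented_ring[OF inj] n3 unfolding V_def fwd_def by (metis less_le_trans zero_less_numeral)+

definition q where "q = (SOME q. q < n \<and> (\<forall>i<n. V ! ((if fwd then q + i else q + (n - i)) mod n) = x i))"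
definition pos where "pos i = (if fwd then q + i else q + (n - i)) mod n"

lemma q_less: "q < n" and V_pos: "i < n ==> V ! pos i = x i"
proof -
 have "q < n \<and> (\<forall>i<n. V ! ((if fwd then q + i else q + (n - i)) mod n) = x i)"
  unfolding q_def by (rule someI_ex) (use exists_start in blast)
 thus "q < n" "i < n ==> V ! pos i = x i" by (auto simp: pos_def)
qed

lemma pos_less: "pos i < n" using n3 by (simp add: pos_def)

lemma pos_inj: "inj_on pos {..<n}"
 using inj V_pos by (metis (no_types, lifting) inj_on_def lessThan_iff)

lemma pos_surj: "pos ` {..<n} = {..<n}"
 using pos_inj pos_less by (intro endo_inj_surj) auto

lemma index_pos: "i < n ==> index_of V (x i) = pos i"
 using index_of_nth[OF V_props(2), of "pos i"] V_pos V_props(1) pos_less by simp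

lemma pos_add: "i < n ==> k \<le> n ==> pos ((i + k) mod n) = (pos i + (if fwd then k else n - k)) mod n"
proof -
 assume i: "i < n" and k: "k \<le> n"
 show ?thesis
 proof (cases fwd)
  case True
  thus ?thesis by (simp add: pos_def mod_add_left_eq mod_add_right_eq add.assoc)
 next
  case False
  have "(q + (n - (i + k) mod n)) mod n = (q + (n - i) + (n - k)) mod n"
  proof (cases "i + k < n")
   case True
   hence "q + (n - i) + (n - k) = q + (n - (i + k)) + n" by linarith
   thus ?thesis using True by (simp only: mod_add_self2 mod_less)
  next
   case F: False
   hence "(i + k) mod n = i + k - n \<or> i + k = 2 * n" using i k by (simp add: le_mod_geq)
   hence e: "(i + k) mod n = i + k - n" using i k by auto
   have "q + (n - (i + k - n)) = q + (n - i) + (n - k)" using F i k by linarith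
   thus ?thesis by (simp only: e)
  qed
  thus ?thesis using False by (simp add: pos_def mod_add_left_eq)
 qed
qed

lemma pos_next: "i < n ==> pos ((i + 1) mod n) = (if fwd then (pos i + 1) mod n else (pos i + (n - 1)) mod n)"
 using pos_add[of i 1] n3 by simp

lemma pos_prev: "i < n ==> pos ((i + n - 1) mod n) = (if fwd then (pos i + (n - 1)) mod n else (pos i + 1) mod n)"
proof -
 assume i: "i < n"
 have "i + n - 1 = i + (n - 1)" "n - (n - 1) = 1" using n3 by auto
 thus ?thesis using pos_add[OF i, of "n - 1"] by simp
qed

definition agt where "agt j = the_inv_into {..<n} pos j"

lemma agt: "j < n ==> agt j < n" "j < n ==> pos (agt j) = j" "i < n ==> agt (pos i) = i"
 using pos_inj pos_surj the_inv_into_into[OF pos_inj, of j "{..<n}"] f_the_inv_into_f[OF pos_inj, of j] the_inv_into_f_f[OF pos_inj, of i]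
 by (auto simp: agt_def)

definition P where "P j = p (agt j)"
definition ps where "ps = map P [0..<n]"
definition ns where "ns \<longleftrightarrow> odd n \<and> (\<forall>j<n. P j = P 0)"

abbreviation "t1 \<equiv> col_t1 n"
abbreviation "t2 \<equiv> col_t2 n"
abbreviation "t3 \<equiv> col_t3 n"
abbreviation "t4 \<equiv> col_t4 n"

definition t5 where "t5 = (if ns then t4 + (n - 1) else t3)"
definition t6 where "t6 = t5 + 2 * n"
definition w where "w j = fst (cell (agt j) t3) mod n"
definition wl where "wl = map w [0..<n]"
definition sk where "sk = (if ns then Some (index_of V (rev (sort V) ! (sum_list wl mod n))) else None)"
definition y where "y j = fst (snd (cell (agt j) t5))"
definition R where "R j = snd (snd (cell (agt j) t5))"
definition X where "X j = xor (R j) (y j)"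
definition coin where "coin = (\<Sum>j<n. y j) mod 2"
definition tn where "tn j = turn ps sk coin j"

text \<open>A color depends on those of the neighbours with an earlier turn. The stages turn this
  into a recursion on the round; \<open>color_eq\<close> eliminates them again.\<close>

primrec stage_color :: "nat => nat => nat" where
 "stage_color 0 j = P j"
| "stage_color (Suc s) j = (if tn j \<le> s then stage_color s j
   else Min ({..<ncol} - {stage_color s j' | j'. (j' = (j + (n - 1)) mod n \<or> j' = (j + 1) mod n) \<and> tn j' \<le> s}))"

definition color where "color j = stage_color (tn j) j"

lemma stage_color_final: "tn j \<le> s ==> stage_color s j = color j"
proof (induction s)
 case (Suc s)
 thus ?case by (cases "tn j = Suc s") (auto simp: color_def)
qed (auto simp: color_def)

definition taken where
 "taken s j = {color j' | j'. (j' = (j + (n - 1)) mod n \<or> j' = (j + 1) mod n) \<and> tn j' < s}"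

lemma color_eq: "color j = (if tn j = 0 then P j else Min ({..<ncol} - taken (tn j) j))"
proof (cases "tn j")
 case (Suc s)
 have "{stage_color s j' | j'. (j' = (j + (n - 1)) mod n \<or> j' = (j + 1) mod n) \<and> tn j' \<le> s} = taken (Suc s) j"
  unfolding taken_def using stage_color_final by (auto simp: less_Suc_eq_le) metis+
 hence "stage_color (Suc s) j = Min ({..<ncol} - taken (Suc s) j)" using Suc by (simp only: stage_color.simps) simp
 thus ?thesis using Suc by (simp add: color_def)
qed (simp add: color_def)

lemma taken_finite: "finite (taken s j)" "card (taken s j) \<le> 2"
proof -
 have s: "taken s j \<subseteq> {color ((j + (n - 1)) mod n), color ((j + 1) mod n)}" by (auto simp: taken_def)
 thus "finite (taken s j)" by (rule finite_subset) simp
 have "card (taken s j) \<le> card {color ((j + (n - 1)) mod n), color ((j + 1) mod n)}"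
  using s by (intro card_mono) auto
 also have "\<dots> \<le> 2" by (simp add: card_insert_if)
 finally show "card (taken s j) \<le> 2" .
qed

text \<open>Two neighbours can block at most two of the at least three colors.\<close>

lemma Min_available: "Min ({..<ncol} - taken s j) \<in> {..<ncol} - taken s j"
proof (rule Min_in)
 have "card {..<ncol} - card (taken s j) \<le> card ({..<ncol} - taken s j)"
  using taken_finite by (intro diff_card_le_card_Diff)
 moreover have "card {..<ncol} = ncol" by simp
 ultimately have "card ({..<ncol} - taken s j) \<noteq> 0" using taken_finite(2)[of s j] colors by linarith
 thus "{..<ncol} - taken s j \<noteq> {}" by (metis card.empty)
qed simp

lemma color_less: "j < n ==> color j < ncol"
 using Min_available[of "tn j" j] pref[OF agt(1), of j] color_eq[of j] by (cases "tn j = 0") (auto simp: P_def)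

lemma length_ps: "length ps = n" by (simp add: ps_def)
lemma ps_nth: "j < n ==> ps ! j = P j" by (simp add: ps_def)

lemma set_ps: "set ps = P ` {..<n}" by (auto simp: ps_def)

lemma all_P:
 assumes "i < n"
 shows "(\<forall>c\<in>set ps. c = P i) \<longleftrightarrow> (\<forall>j<n. P j = P 0)"
proof
 have n0: "0 < n" using n3 by simp
 show "\<forall>j<n. P j = P 0" if "\<forall>c\<in>set ps. c = P i"
 proof -
  have "P j = P i" if "j < n" for j using \<open>\<forall>c\<in>set ps. c = P i\<close> that unfolding set_ps by blast
  thus ?thesis using n0 by metis
 qed
 show "\<forall>c\<in>set ps. c = P i" if "\<forall>j<n. P j = P 0"
  using that assms unfolding set_ps by (metis imageE lessThan_iff)
qed

lemma valid_sink: "valid_sink ps sk"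
proof -
 have *: "(\<forall>c\<in>set ps. \<forall>c'\<in>set ps. c = c') \<longleftrightarrow> (\<forall>j<n. P j = P 0)"
 proof -
  have "P 0 \<in> set ps" using n3 unfolding set_ps by auto
  hence "(\<forall>c\<in>set ps. \<forall>c'\<in>set ps. c = c') \<longleftrightarrow> (\<forall>c\<in>set ps. c = P 0)" by metis
  thus ?thesis using all_P[of 0] n3 by simp
 qed
 show ?thesis
 proof (cases ns)
  case True
  have "sum_list wl mod n < length (rev (sort V))" using V_props(1) n3 by simp
  hence "rev (sort V) ! (sum_list wl mod n) \<in> set (rev (sort V))" by (rule nth_mem)
  then obtain j where "j < n" "V ! j = rev (sort V) ! (sum_list wl mod n)"
   using V_props(1) by (metis in_set_conv_nth set_rev set_sort)
  hence "index_of V (rev (sort V) ! (sum_list wl mod n)) < n" using index_of_nth[OF V_props(2), of j] V_props(1) by auto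
  moreover have "odd n" "\<forall>c\<in>set ps. \<forall>c'\<in>set ps. c = c'" using * True unfolding ns_def by blast+
  ultimately show ?thesis unfolding valid_sink_def sk_def if_P[OF True] length_ps option.case by blast
 next
  case False
  hence "(\<forall>c\<in>set ps. \<forall>c'\<in>set ps. c = c') \<longrightarrow> even n" using * unfolding ns_def by blast
  thus ?thesis unfolding valid_sink_def sk_def if_not_P[OF False] length_ps option.case .
 qed
qed

lemma coin_less: "coin < 2" by (simp add: coin_def)

lemma colors_differ:
 assumes "j < n"
 shows "color j \<noteq> color ((j + 1) mod n)"
proof -
 have j1: "(j + 1) mod n < n" using n3 by simp
 have bk: "((j + 1) mod n + (n - 1)) mod n = j"
  using mod_pred_succ[OF assms] n3 by (simp add: algebra_simps)
 consider "tn j < tn ((j + 1) mod n)" | "tn ((j + 1) mod n) < tn j" | "tn j = tn ((j + 1) mod n)" by linarith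
 thus ?thesis
 proof cases
  case 1
  hence "color j \<in> taken (tn ((j + 1) mod n)) ((j + 1) mod n)" using bk by (auto simp: taken_def)
  thus ?thesis using 1 color_eq[of "(j + 1) mod n"] Min_available[of "tn ((j + 1) mod n)" "(j + 1) mod n"] by auto
 next
  case 2
  hence "color ((j + 1) mod n) \<in> taken (tn j) j" by (auto simp: taken_def)
  thus ?thesis using 2 color_eq[of j] Min_available[of "tn j" j] by auto
 next
  case 3
  hence "turn ps sk coin j = turn ps sk coin ((j + 1) mod length ps)" by (simp add: tn_def length_ps)
  hence "tn j = 0" "P ((j + 1) mod n) \<noteq> P j"
   using adjacent_turns_distinct[OF valid_sink _ coin_less, of j] assms n3 ps_nth[OF assms] ps_nth[OF j1] by (auto simp: length_ps tn_def)
  thus ?thesis using 3 color_eq[of j] color_eq[of "(j + 1) mod n"] by simp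
 qed
qed

text \<open>The messages of position \<open>j\<close> to the front, as \<open>bm\<close> are those
  to the back. \<open>Bs\<close> and \<open>Fs\<close> below are the corresponding incoming
  messages, counted by the round of their arrival.\<close>

definition fm :: "nat => nat => msg" where
 "fm j t =
  (if t < n then Id (V ! ((j + (n - t)) mod n))
   else if t < t1 then Ids V
   else if t < t2 then Val (P ((j + (n - (t - t1))) mod n))
   else if t < t3 then Vals ps
   else if ns \<and> t < t4 then Val (w ((j + (n - (t - t3))) mod n))
   else if ns \<and> t < t5 then Vals wl
   else if t < t6 then share_front n R R y j (t - t5)
   else if t - t6 = tn j then Val (color j) else Silent)"

definition bm :: "nat => nat => msg" where
 "bm j t =
  (if t < n then Id (V ! ((j + t) mod n))
   else if t < t1 then Ids V
   else if t < t2 then Val (P ((j + (t - t1)) mod n))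
   else if t < t3 then Vals ps
   else if ns \<and> t < t4 then Silent
   else if ns \<and> t < t5 then Vals wl
   else if t < t6 then share_back n X y j (t - t5)
   else if t - t6 = tn j then Val (color j) else Silent)"

definition drawn_coins :: "nat => nat => nat list" where
 "drawn_coins j t = (if ns \<and> t = t3 then [w j] else if t = t5 then [y j, R j] else [])"

definition hact :: "nat => nat => action" where
 "hact i t = (let j = pos i; d = (if t = t6 + tn j then Some (Some (color j)) else None) in
   if fwd then Act (drawn_coins j t) d (fm j t) (bm j t) else Act (drawn_coins j t) d (bm j t) (fm j t))"

lemma t_order: "n < t1" "t1 < t2" "t2 < t3" "t3 < t4" "t3 \<le> t5" "t5 < t6" "ns ==> t4 < t5"
 "t1 = n + (n - 1)" "t2 = t1 + (n - 1)" "t3 = t2 + (n - 1)" "t4 = t3 + (n - 1)" "t6 = t5 + 2 * n"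
 "ns ==> t5 = t4 + (n - 1)" "\<not> ns ==> t5 = t3"
 using n3 by (auto simp: col_t1_def col_t2_def col_t3_def col_t4_def t5_def t6_def)

lemma final_hact:
 assumes "t6 + 3 < T"
 shows "final_output (trace_view n x p hact i T) = Some (color (pos i))"
proof -
 have "tn (pos i) \<le> 3" using turn_le by (simp add: tn_def)
 thus ?thesis
  unfolding final_output_trace using assms
  by (intro exI[of _ "t6 + tn (pos i)"]) (auto simp: hact_def Let_def)
qed

definition Bs :: "nat => nat => msg" where "Bs j k = fm ((j + (n - 1)) mod n) (k - 1)"
definition Fs :: "nat => nat => msg" where "Fs j k = bm ((j + 1) mod n) (k - 1)"

lemma from_hact:
 assumes "i < n" "1 \<le> k" "k \<le> t"
 shows "from_ccw (trace_hist n hact i t) k = (if fwd then Bs (pos i) k else Fs (pos i) k)"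
  and "from_cw (trace_hist n hact i t) k = (if fwd then Fs (pos i) k else Bs (pos i) k)"
 using assms pos_prev[OF assms(1)] pos_next[OF assms(1)]
 by (simp_all add: from_ccw_trace from_cw_trace hact_def Let_def Bs_def Fs_def)

lemma phase_ids: "s < n ==> fm j s = Id (V ! ((j + (n - s)) mod n))" "s < n ==> bm j s = Id (V ! ((j + s) mod n))"
 by (simp_all add: fm_def bm_def)

lemma phase_id_vectors:
 assumes "s < n - 1"
 shows "fm j (n + s) = Ids V" "bm j (n + s) = Ids V"
proof -
 have "\<not> n + s < n" "n + s < t1" using assms t_order(8) by linarith+
 thus "fm j (n + s) = Ids V" "bm j (n + s) = Ids V" by (simp_all add: fm_def bm_def)
qed

lemma phase_prefs:
 assumes "s < n - 1"
 shows "fm j (t1 + s) = Val (P ((j + (n - s)) mod n))" "bm j (t1 + s) = Val (P ((j + s) mod n))"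
proof -
 have "\<not> t1 + s < n" "\<not> t1 + s < t1" "t1 + s < t2" using assms t_order(1,9) by linarith+
 thus "fm j (t1 + s) = Val (P ((j + (n - s)) mod n))" "bm j (t1 + s) = Val (P ((j + s) mod n))"
  by (simp_all add: fm_def bm_def)
qed

lemma phase_vectors:
 assumes "s < n - 1"
 shows "fm j (t2 + s) = Vals ps" "bm j (t2 + s) = Vals ps"
proof -
 have "\<not> t2 + s < n" "\<not> t2 + s < t1" "\<not> t2 + s < t2" "t2 + s < t3" using assms t_order(1,2,10) by linarith+
 thus "fm j (t2 + s) = Vals ps" "bm j (t2 + s) = Vals ps" by (simp_all add: fm_def bm_def)
qed

lemma phase_weights:
 assumes "s < n - 1" ns
 shows "fm j (t3 + s) = Val (w ((j + (n - s)) mod n))" "bm j (t3 + s) = Silent"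
proof -
 have "\<not> t3 + s < n" "\<not> t3 + s < t1" "\<not> t3 + s < t2" "\<not> t3 + s < t3" "t3 + s < t4" using assms t_order(1,2,3,11) by linarith+
 thus "fm j (t3 + s) = Val (w ((j + (n - s)) mod n))" "bm j (t3 + s) = Silent"
  using assms(2) by (simp_all add: fm_def bm_def)
qed

lemma phase_weight_vectors:
 assumes "s < n - 1" ns
 shows "fm j (t4 + s) = Vals wl" "bm j (t4 + s) = Vals wl"
proof -
 have "\<not> t4 + s < n" "\<not> t4 + s < t1" "\<not> t4 + s < t2" "\<not> t4 + s < t3" "\<not> t4 + s < t4" "t4 + s < t5"
  using assms t_order(1-4) t_order(13)[OF assms(2)] by linarith+
 thus "fm j (t4 + s) = Vals wl" "bm j (t4 + s) = Vals wl" using assms(2) by (simp_all add: fm_def bm_def)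
qed

lemma not_before_t5:
 assumes "t5 \<le> t"
 shows "\<not> t < n" "\<not> t < t1" "\<not> t < t2" "\<not> t < t3" "(ns \<and> t < t4) = False" "(ns \<and> t < t5) = False"
proof -
 show "\<not> t < n" "\<not> t < t1" "\<not> t < t2" "\<not> t < t3" using assms t_order(1-5) by linarith+
 show "(ns \<and> t < t4) = False" "(ns \<and> t < t5) = False" using assms t_order(7) by auto
qed

lemma phase_coin:
 assumes "s < 2 * n"
 shows "fm j (t5 + s) = share_front n R R y j s" "bm j (t5 + s) = share_back n X y j s"
proof -
 have "t5 + s < t6" using assms t_order(12) by linarith
 thus "fm j (t5 + s) = share_front n R R y j s" "bm j (t5 + s) = share_back n X y j s"
  unfolding fm_def bm_def by (simp_all only: not_before_t5[OF le_add1] if_False if_True add_diff_cancel_left')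
qed

lemma phase_color:
 "fm j (t6 + s) = (if s = tn j then Val (color j) else Silent)"
 "bm j (t6 + s) = (if s = tn j then Val (color j) else Silent)"
proof -
 have "t5 \<le> t6 + s" "\<not> t6 + s < t6" using t_order(6) by linarith+
 thus "fm j (t6 + s) = (if s = tn j then Val (color j) else Silent)"
  "bm j (t6 + s) = (if s = tn j then Val (color j) else Silent)"
  unfolding fm_def bm_def by (simp_all only: not_before_t5 if_False add_diff_cancel_left')
qed

lemma mod_pred_shift: "s < n ==> ((j + (n - 1)) mod n + (n - s)) mod n = (j + (n - Suc s)) mod n"
 using mod_add_pred[of "Suc s" n j] by simp

lemma mod_succ_shift: "((j + 1) mod n + s) mod n = (j + Suc s) mod n"
 using mod_add_succ[of "Suc s" j n] by simp

lemma ids_in: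
 assumes "1 \<le> k" "k \<le> n"
 shows "Bs j k = Id (V ! ((j + (n - k)) mod n))" "Fs j k = Id (V ! ((j + k) mod n))"
proof -
 obtain s where s: "k = Suc s" "s < n" using assms by (cases k) auto
 thus "Bs j k = Id (V ! ((j + (n - k)) mod n))" "Fs j k = Id (V ! ((j + k) mod n))"
  by (simp_all only: Bs_def Fs_def diff_Suc_1 phase_ids mod_pred_shift mod_succ_shift)
qed

lemma agree_in:
 assumes "1 \<le> k" "k < n"
 shows "Bs j (n + k) = Ids V" "Fs j (n + k) = Ids V" "Bs j (t2 + k) = Vals ps" "Fs j (t2 + k) = Vals ps"
  "ns ==> Bs j (t4 + k) = Vals wl" "ns ==> Fs j (t4 + k) = Vals wl"
proof -
 obtain s where s: "k = Suc s" "s < n - 1" using assms by (cases k) auto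
 have "n + k - 1 = n + s" "t2 + k - 1 = t2 + s" "t4 + k - 1 = t4 + s" using s by simp_all
 thus "Bs j (n + k) = Ids V" "Fs j (n + k) = Ids V" "Bs j (t2 + k) = Vals ps" "Fs j (t2 + k) = Vals ps"
  "ns ==> Bs j (t4 + k) = Vals wl" "ns ==> Fs j (t4 + k) = Vals wl"
  using s by (simp_all only: Bs_def Fs_def phase_id_vectors phase_vectors phase_weight_vectors)
qed

lemma prefs_in:
 assumes "1 \<le> k" "k < n"
 shows "Bs j (t1 + k) = Val (P ((j + (n - k)) mod n))" "Fs j (t1 + k) = Val (P ((j + k) mod n))"
proof -
 obtain s where s: "k = Suc s" "s < n - 1" "s < n" using assms by (cases k) auto
 have "t1 + k - 1 = t1 + s" using s by simp
 thus "Bs j (t1 + k) = Val (P ((j + (n - k)) mod n))" "Fs j (t1 + k) = Val (P ((j + k) mod n))"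
  using s by (simp_all only: Bs_def Fs_def phase_prefs mod_pred_shift mod_succ_shift)
qed

lemma weights_in:
 assumes "1 \<le> k" "k < n" ns
 shows "Bs j (t3 + k) = Val (w ((j + (n - k)) mod n))" "Fs j (t3 + k) = Silent"
proof -
 obtain s where s: "k = Suc s" "s < n - 1" "s < n" using assms by (cases k) auto
 have "t3 + k - 1 = t3 + s" using s by simp
 thus "Bs j (t3 + k) = Val (w ((j + (n - k)) mod n))" "Fs j (t3 + k) = Silent"
  using s assms(3) by (simp_all only: Bs_def Fs_def phase_weights mod_pred_shift mod_succ_shift)
qed

lemma shares_in:
 assumes "1 \<le> k" "k \<le> 2 * n"
 shows "Bs j (t5 + k) = share_front n R R y ((j + (n - 1)) mod n) (k - 1)" "Fs j (t5 + k) = share_back n X y ((j + 1) mod n) (k - 1)"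
proof -
 have "t5 + k - 1 = t5 + (k - 1)" "k - 1 < 2 * n" using assms by linarith+
 thus "Bs j (t5 + k) = share_front n R R y ((j + (n - 1)) mod n) (k - 1)" "Fs j (t5 + k) = share_back n X y ((j + 1) mod n) (k - 1)"
  by (simp_all only: Bs_def Fs_def phase_coin)
qed

lemma colors_in:
 assumes "1 \<le> k"
 shows "Bs j (t6 + k) = (if k - 1 = tn ((j + (n - 1)) mod n) then Val (color ((j + (n - 1)) mod n)) else Silent)"
  "Fs j (t6 + k) = (if k - 1 = tn ((j + 1) mod n) then Val (color ((j + 1) mod n)) else Silent)"
proof -
 have "t6 + k - 1 = t6 + (k - 1)" using assms by linarith
 thus "Bs j (t6 + k) = (if k - 1 = tn ((j + (n - 1)) mod n) then Val (color ((j + (n - 1)) mod n)) else Silent)"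
  "Fs j (t6 + k) = (if k - 1 = tn ((j + 1) mod n) then Val (color ((j + 1) mod n)) else Silent)"
  by (simp_all only: Bs_def Fs_def phase_color)
qed

context
 fixes i t assumes i: "i < n" and t: "t \<le> t6 + tn (pos i)"
begin

abbreviation "j \<equiv> pos i"
abbreviation "v \<equiv> trace_view n x p hact i t"
abbreviation "h \<equiv> trace_hist n hact i t"

lemma not_decided_h: "\<not> decided h"
 using t by (auto simp: decided_trace hact_def Let_def)

lemma ring_size_h: "ring_size (x i) h = (if n \<le> t then Some n else None)"
proof -
 have "{from_ccw h k, from_cw h k} = {Id (V ! ((j + (n - k)) mod n)), Id (V ! ((j + k) mod n))}" if k: "1 \<le> k" "k \<le> n" "k \<le> length h" for k
  using from_hact[OF i k(1), of t] ids_in[OF k(1,2), of j] k(3) by (cases fwd) auto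
 thus ?thesis using ring_size_flood[of V n j "x i" h] V_props V_pos[OF i] pos_less[of i] by simp
qed

context
 assumes nt: "n \<le> t"
begin

lemma cw_ids_h: "cw_ids (x i) h n = rotate i (map x [0..<n])"
proof -
 have "id_of (from_cw h k) = x ((i + k) mod n)" if k: "1 \<le> k" "k < n" for k
 proof -
  have kk: "k \<le> n" "k \<le> t" using k nt by linarith+
  have "(i + k) mod n < n" using n3 by simp
  hence V: "V ! pos ((i + k) mod n) = x ((i + k) mod n)" by (rule V_pos)
  show ?thesis
   using from_hact(2)[OF i k(1) kk(2)] ids_in[OF k(1) kk(1), of j] V pos_add[OF i kk(1)] by (cases fwd) simp_all
 qed
 hence "map (\<lambda>k. id_of (from_cw h k)) [1..<n] = map (\<lambda>k. x ((i + k) mod n)) [1..<n]" by (intro map_cong) auto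
 moreover have "x i = x ((i + 0) mod n)" using i by simp
 ultimately have "cw_ids (x i) h n = map (\<lambda>k. x ((i + k) mod n)) (0 # [1..<n])" by (simp add: cw_ids_def)
 also have "0 # [1..<n] = [0..<n]" using n3 by (simp add: upt_conv_Cons)
 finally show ?thesis by (simp only: ring_list_rotate)
qed

lemma geometry_h: "col_cw v n = fwd" "col_ids v n = V" "col_index v n = j"
 using cw_ids_h oriented_cw_rotate[OF Xlist] oriented_ids_rotate[OF Xlist] index_pos[OF i]
 by (simp_all add: col_cw_def col_ids_def col_index_def fwd_def V_def)

lemma streams_h: "1 \<le> k ==> k \<le> t ==> col_back v n k = Bs j k" "1 \<le> k ==> k \<le> t ==> col_front v n k = Fs j k"
 using from_hact[OF i, of k t] geometry_h(1) by (simp_all add: col_back_def col_front_def)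

lemma flood_h:
 assumes "t0 \<le> t" "1 \<le> t0"
 shows "flood M (after t0 (col_back v n)) (after t0 (col_front v n)) (t - t0) = (if t = t0 then (M, M) else (Bs j t, Fs j t))"
 using streams_h[of t] assms nt n3 by (simp add: flood_def after_def)

lemma constant_streams:
 assumes "t0 \<le> t" "1 \<le> t0" "\<And>k. 1 \<le> k ==> t0 + k \<le> t ==> k < n ==> Bs j (t0 + k) = M \<and> Fs j (t0 + k) = M"
 shows "t - t0 < n ==> flood M (after t0 (col_back v n)) (after t0 (col_front v n)) (t - t0) = (M, M)"
  and "t0 + (n - 1) \<le> t ==> agree n M (after t0 (col_back v n)) (after t0 (col_front v n))"
proof -
 show "flood M (after t0 (col_back v n)) (after t0 (col_front v n)) (t - t0) = (M, M)" if "t - t0 < n"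
  using flood_h[OF assms(1,2)] assms(1) assms(3)[of "t - t0"] that by (cases "t = t0") auto
 show "agree n M (after t0 (col_back v n)) (after t0 (col_front v n))" if "t0 + (n - 1) \<le> t"
  unfolding agree_def after_def
 proof
  fix k assume "k \<in> {1..<n}"
  hence k: "1 \<le> k" "k < n" "t0 + k \<le> t" "1 \<le> t0 + k" using that by auto
  thus "col_back v n (t0 + k) = M \<and> col_front v n (t0 + k) = M" using streams_h[OF k(4,3)] assms(3) by simp
 qed
qed

lemma color_streams:
 assumes "t6 \<le> t" "1 \<le> k" "k \<le> t - t6"
 shows "after t6 (col_back v n) k = (if k - 1 = tn ((j + (n - 1)) mod n) then Val (color ((j + (n - 1)) mod n)) else Silent)"
  and "after t6 (col_front v n) k = (if k - 1 = tn ((j + 1) mod n) then Val (color ((j + 1) mod n)) else Silent)"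
proof -
 have "1 \<le> t6 + k" "t6 + k \<le> t" using assms by linarith+
 thus "after t6 (col_back v n) k = (if k - 1 = tn ((j + (n - 1)) mod n) then Val (color ((j + (n - 1)) mod n)) else Silent)"
  "after t6 (col_front v n) k = (if k - 1 = tn ((j + 1) mod n) then Val (color ((j + 1) mod n)) else Silent)"
  using streams_h[of "t6 + k"] colors_in[OF assms(2)] unfolding after_def by (simp_all only:)
qed

lemma prefs_h: "t2 \<le> t ==> col_prefs v n = ps"
proof -
 assume t2: "t2 \<le> t"
 have "val (after t1 (col_front v n) k) = P ((j + k) mod n)" if k: "1 \<le> k" "k < n" for k
 proof -
  have "1 \<le> t1 + k" "t1 + k \<le> t" using k t2 t_order(9) by linarith+
  thus ?thesis using streams_h(2)[of "t1 + k"] prefs_in(2)[OF k] by (simp add: after_def)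
 qed
 moreover have "p i = P (j mod n)" using agt(3)[OF i] pos_less[of i] by (simp add: P_def)
 ultimately have "col_prefs v n = arrange n j (P (j mod n)) (\<lambda>k. P ((j + k) mod n))"
  unfolding col_prefs_def geometry_h trace_view_simps by (subst arrange_cong[of n _ "\<lambda>k. P ((j + k) mod n)"]) simp_all
 also have "\<dots> = map (\<lambda>k. P ((k + (n - 0)) mod n)) [0..<n]"
  using arrange_ring[of 0 n j j P] pos_less[of i] n3 by simp
 also have "\<dots> = ps" by (simp add: ps_def)
 finally show ?thesis .
qed

lemma own_P: "P j = p i" using agt(3)[OF i] by (simp add: P_def)

lemma needs_sink_h: "t2 \<le> t ==> col_needs_sink v n = ns"
proof -
 assume "t2 \<le> t"
 hence "col_needs_sink v n \<longleftrightarrow> odd n \<and> (\<forall>c\<in>set ps. c = P j)"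
  unfolding col_needs_sink_def using prefs_h own_P by simp
 thus ?thesis using all_P[OF pos_less, of i] by (simp only: ns_def)
qed

lemma t5_h: "t2 \<le> t ==> col_t5 v n = t5" "t2 \<le> t ==> col_t6 v n = t6"
 using needs_sink_h by (simp_all add: col_t5_def col_t6_def t5_def t6_def)

lemma coins_h: "s < t ==> coins (fst (h ! s)) = drawn_coins j s"
 by (simp add: fst_trace_hist hact_def Let_def)

lemma weights_h: "ns ==> t4 \<le> t ==> col_weights v n = wl"
proof -
 assume a: ns "t4 \<le> t"
 have "val (after t3 (col_back v n) (n - k)) = w ((j + k) mod n)" if k: "1 \<le> k" "k < n" for k
 proof -
  have "1 \<le> t3 + (n - k)" "t3 + (n - k) \<le> t" "1 \<le> n - k" "n - k < n" "n - (n - k) = k" using k a t_order(11) by linarith+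
  thus ?thesis using streams_h(1)[of "t3 + (n - k)"] weights_in(1)[of "n - k" j] a by (simp add: after_def)
 qed
 moreover have "col_coins v t3 ! 0 = w (j mod n)"
  using coins_h[of t3] a t_order(4) pos_less[of i] by (simp add: col_coins_def drawn_coins_def)
 ultimately have "col_weights v n = arrange n j (w (j mod n)) (\<lambda>k. w ((j + k) mod n))"
  unfolding col_weights_def geometry_h by (subst arrange_cong[of n _ "\<lambda>k. w ((j + k) mod n)"]) simp_all
 also have "\<dots> = map (\<lambda>k. w ((k + (n - 0)) mod n)) [0..<n]"
  using arrange_ring[of 0 n j j w] pos_less[of i] n3 by simp
 also have "\<dots> = wl" by (simp add: wl_def)
 finally show ?thesis .
qed

lemma sink_h: "t5 \<le> t ==> col_sink v n = sk"
proof -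
 assume a: "t5 \<le> t"
 have t2: "t2 \<le> t" using a t_order by linarith
 show ?thesis
 proof (cases ns)
  case True
  hence "t4 \<le> t" using a t_order(7) by linarith
  thus ?thesis using weights_h True needs_sink_h[OF t2] geometry_h by (simp add: col_sink_def sk_def)
 qed (use needs_sink_h[OF t2] in \<open>simp add: col_sink_def sk_def\<close>)
qed

lemma t3_t5: "ns ==> t5 \<noteq> t3" by (drule t_order(7)) (use t_order(4) in linarith)

lemma drawn_t5: "drawn_coins j t5 = [y j, R j]"
 using t3_t5 by (simp add: drawn_coins_def)

lemma coin_h: "t6 \<le> t ==> col_coin v n = coin"
proof -
 assume a: "t6 \<le> t"
 have t2: "t2 \<le> t" and "t5 < t" using a t_order by linarith+
 hence c: "col_coins v t5 ! 0 = y j" using coins_h[of t5] drawn_t5 by (simp add: col_coins_def)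
 have "shared_inputs n j (y j) (after t5 (col_front v n)) = shared_inputs n j (y j) (\<lambda>k. share_back n X y ((j + 1) mod n) (k - 1))"
  unfolding shared_inputs_def
 proof (rule arrange_cong)
  fix k assume "1 \<le> k" "k < n"
  hence "1 \<le> t5 + (n + 1 + k)" "t5 + (n + 1 + k) \<le> t" "1 \<le> n + 1 + k" "n + 1 + k \<le> 2 * n" using a t_order(12) by linarith+
  thus "val (after (n + 1) (after t5 (col_front v n)) k) = val (after (n + 1) (\<lambda>k. share_back n X y ((j + 1) mod n) (k - 1)) k)"
   using streams_h(2)[of "t5 + (n + 1 + k)"] shares_in(2)[of "n + 1 + k" j] unfolding after_def by (simp only:)
 qed
 also have "\<dots> = map (\<lambda>k. y ((k + (n - 0)) mod n)) [0..<n]"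
  using n3 pos_less[of i] by (intro shared_inputs_ring[where X = X]) auto
 finally show ?thesis
  unfolding col_coin_def t5_h[OF t2] geometry_h c parity_def by (simp only: coin_def sum_list_ring)
qed

lemma XR: "k < n ==> R k < 2 \<and> y k \<in> {0, 1} \<and> X k < 2"
 using bits[OF agt(1), of k t5] by (auto simp: R_def y_def X_def)

lemma col_ok_h: "col_ok ncol v n"
proof -
 have bk: "(j + n - 1) mod n = (j + (n - 1)) mod n" using n3 by simp
 have nr: "(j + 1) mod n < n" "(j + (n - 1)) mod n < n" using n3 by simp_all
 have 1: "ids_ok (x i) h n"
 proof -
  have "distinct (cw_ids (x i) h n)" using cw_ids_h Xlist(1) by simp
  moreover have "from_ccw h k \<in> range Id \<and> from_ccw h k = from_cw h (n - k)" if k: "1 \<le> k" "k < n" for k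
  proof -
   have "1 \<le> n - k" "n - k \<le> n" "k \<le> n" "k \<le> t" "n - k \<le> t" "n - (n - k) = k" using k nt by linarith+
   thus ?thesis using from_hact[OF i, of k t] from_hact[OF i, of "n - k" t] ids_in[of k j] ids_in[of "n - k" j] k(1)
    by (cases fwd) simp_all
  qed
  moreover have "from_ccw h n = Id (x i)" "from_cw h n = Id (x i)"
   using from_hact[OF i, of n t] ids_in[of n j] nt n3 V_pos[OF i] pos_less[of i] by (cases fwd; simp)+
  ultimately show ?thesis unfolding ids_ok_def flood_ok_def by (metis atLeastLessThan_iff)
 qed
 have 2: "t1 \<le> t \<longrightarrow> agree n (Ids V) (after n (col_back v n)) (after n (col_front v n))"
  using agree_in(1,2) nt n3 t_order(8) by (intro impI constant_streams(2)) auto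
 have 3: "t2 \<le> t \<longrightarrow> flood_ok n (Val ` {..<ncol}) (after t1 (col_back v n)) (after t1 (col_front v n))"
 proof
  assume a: "t2 \<le> t"
  show "flood_ok n (Val ` {..<ncol}) (after t1 (col_back v n)) (after t1 (col_front v n))"
   unfolding flood_ok_def after_def
  proof
   fix k assume "k \<in> {1..<n}"
   hence k: "1 \<le> k" "k < n" by auto
   hence le: "1 \<le> t1 + k" "t1 + k \<le> t" "1 \<le> t1 + (n - k)" "t1 + (n - k) \<le> t" "1 \<le> n - k" "n - k < n" using a t_order(9) by linarith+
   have "P ((j + (n - k)) mod n) < ncol" using pref[OF agt(1)[of "(j + (n - k)) mod n"]] n3 by (simp add: P_def)
   thus "col_back v n (t1 + k) \<in> Val ` {..<ncol} \<and> col_back v n (t1 + k) = col_front v n (t1 + (n - k))"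
    using streams_h(1)[OF le(1,2)] streams_h(2)[OF le(3,4)] prefs_in(1)[OF k] prefs_in(2)[OF le(5,6)] by simp
  qed
 qed
 have 4: "t3 \<le> t \<longrightarrow> agree n (Vals (col_prefs v n)) (after t2 (col_back v n)) (after t2 (col_front v n))"
 proof
  assume a: "t3 \<le> t"
  hence t2: "t2 \<le> t" "1 \<le> t2" using t_order by linarith+
  show "agree n (Vals (col_prefs v n)) (after t2 (col_back v n)) (after t2 (col_front v n))"
   unfolding prefs_h[OF t2(1)] using agree_in(3,4) a t_order(10) by (intro constant_streams(2) t2) auto
 qed
 have 5: "t4 \<le> t \<and> col_needs_sink v n \<longrightarrow> (\<forall>k\<in>{1..<n}. after t3 (col_back v n) k \<in> Val ` {..<n} \<and> after t3 (col_front v n) k = Silent)"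
 proof (intro impI ballI)
  fix k assume a: "t4 \<le> t \<and> col_needs_sink v n" and k: "k \<in> {1..<n}"
  hence t2: "t2 \<le> t" using t_order by linarith
  hence ns using a needs_sink_h by simp
  moreover have "1 \<le> t3 + k" "t3 + k \<le> t" using a k t_order(11) by auto
  ultimately show "after t3 (col_back v n) k \<in> Val ` {..<n} \<and> after t3 (col_front v n) k = Silent"
   using streams_h[of "t3 + k"] weights_in[of k j] k n3 by (auto simp: after_def w_def)
 qed
 have 6: "t5 \<le> t \<and> col_needs_sink v n \<longrightarrow> agree n (Vals (col_weights v n)) (after t4 (col_back v n)) (after t4 (col_front v n))"
 proof
  assume a: "t5 \<le> t \<and> col_needs_sink v n"
  hence t2: "t2 \<le> t" using t_order by linarith
  hence ns: ns using a needs_sink_h by simp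
  hence t4: "t4 \<le> t" "1 \<le> t4" using a t_order(1-4,7) by linarith+
  show "agree n (Vals (col_weights v n)) (after t4 (col_back v n)) (after t4 (col_front v n))"
   unfolding weights_h[OF ns t4(1)] using agree_in(5,6)[OF _ _ ns] a t_order(13)[OF ns] by (intro constant_streams(2) t4) auto
 qed
 have 7: "sharing_ok 1 {0, 1} n (after t5 (col_back v n)) (after t5 (col_front v n))" if a: "t6 \<le> t"
 proof (rule sharing_ok_ring[OF n3 pos_less])
  fix k assume k: "1 \<le> k" "k \<le> 2 * n"
  hence "1 \<le> t5 + k" "t5 + k \<le> t" using a t_order(12) by linarith+
  thus "after t5 (col_back v n) k = share_front n R R y ((pos i + (n - 1)) mod n) (k - 1)"
   "after t5 (col_front v n) k = share_back n X y ((pos i + 1) mod n) (k - 1)"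
   using streams_h[of "t5 + k"] shares_in[OF k] unfolding after_def by (simp_all only:)
 next
  fix k assume "k < n"
  thus "R k < 2 ^ 1 \<and> R k < 2 ^ 1 \<and> X k < 2 ^ 1 \<and> y k \<in> {0, 1}" using XR by simp
 qed (simp_all add: X_def flip: xor.assoc)
 have 8: "announced_ok ncol ps sk coin ((j + n - 1) mod n) (after t6 (col_back v n)) (t - t6)
   \<and> announced_ok ncol ps sk coin ((j + 1) mod n) (after t6 (col_front v n)) (t - t6)" if a: "t6 \<le> t"
 proof -
  have g: "announced_ok ncol ps sk coin l G u" if "l < n" "\<And>k. 1 \<le> k ==> k \<le> u ==> G k = (if k - 1 = tn l then Val (color l) else Silent)" for l G u
   unfolding announced_ok_def
  proof
   fix k assume "k \<in> {1..u}"
   hence k: "1 \<le> k" "k \<le> u" by auto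
   show "if turn ps sk coin l = k - 1 then G k \<in> (if k = 1 then {Val (ps ! l)} else Val ` {..<ncol}) else G k = Silent"
    using that(2)[OF k] color_less[OF that(1)] color_eq[of l] ps_nth[OF that(1)] k by (auto simp: tn_def)
  qed
  show ?thesis unfolding bk using g[OF nr(2)] g[OF nr(1)] color_streams[OF a] by blast
 qed
 show ?thesis
  unfolding col_ok_def Let_def trace_view_simps length_trace_hist geometry_h
 proof (intro conjI)
  show "col_t6 v n \<le> t \<longrightarrow> sharing_ok 1 {0, 1} n (after (col_t5 v n) (col_back v n)) (after (col_t5 v n) (col_front v n)) \<and>
   announced_ok ncol (col_prefs v n) (col_sink v n) (col_coin v n) ((j + n - 1) mod n) (after (col_t6 v n) (col_back v n)) (t - col_t6 v n) \<and>
   announced_ok ncol (col_prefs v n) (col_sink v n) (col_coin v n) ((j + 1) mod n) (after (col_t6 v n) (col_front v n)) (t - col_t6 v n)"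
  proof
   assume a: "col_t6 v n \<le> t"
   have "t3 \<le> col_t5 v n" "col_t5 v n \<le> col_t6 v n" by (rule col_t56_order)+
   hence t2: "t2 \<le> t" using a t_order by linarith
   hence t6: "t6 \<le> t" using a t5_h(2) by simp
   hence t5: "t5 \<le> t" using t_order(6) by linarith
   show "sharing_ok 1 {0, 1} n (after (col_t5 v n) (col_back v n)) (after (col_t5 v n) (col_front v n)) \<and>
    announced_ok ncol (col_prefs v n) (col_sink v n) (col_coin v n) ((j + n - 1) mod n) (after (col_t6 v n) (col_back v n)) (t - col_t6 v n) \<and>
    announced_ok ncol (col_prefs v n) (col_sink v n) (col_coin v n) ((j + 1) mod n) (after (col_t6 v n) (col_front v n)) (t - col_t6 v n)"
    unfolding t5_h[OF t2] prefs_h[OF t2] sink_h[OF t5] coin_h[OF t6] using 7[OF t6] 8[OF t6] by blast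
  qed
  show "col_t5 v n \<le> t \<and> col_needs_sink v n \<longrightarrow> agree n (Vals (col_weights v n)) (after t4 (col_back v n)) (after t4 (col_front v n))"
  proof
   assume a: "col_t5 v n \<le> t \<and> col_needs_sink v n"
   have "t3 \<le> col_t5 v n" by (rule col_t56_order)
   hence "t2 \<le> t" using a t_order by linarith
   thus "agree n (Vals (col_weights v n)) (after t4 (col_back v n)) (after t4 (col_front v n))" using 6 a t5_h by simp
  qed
 qed (fact 1 2 3 4 5)+
qed

lemma hact_undecided:
 assumes "t \<noteq> t6 + tn j" "drawn_coins j t = cs" "fm j t = a" "bm j t = b"
 shows "hact i t = send fwd cs (a, b)"
 using assms by (simp add: hact_def Let_def send_def)

lemma act_late: "col_act \<beta> ncol v (cell i t) = hact i t"
proof -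
 have nd: "\<not> decided h" by (rule not_decided_h)
 have rs: "ring_size (x i) h = Some n" using ring_size_h nt by simp
 note S = nd rs col_ok_h geometry_h
 have c0: "drawn_coins j t = []" if "t < t3 \<or> t \<noteq> t3 \<and> t \<noteq> t5" using that t_order(5) by (auto simp: drawn_coins_def)
 have tb: "t \<noteq> t6 + tn j" if "t < t6" using that by simp
 have t3le: "t3 < t6" using t_order by linarith
 consider "t < t1" | "t1 \<le> t" "t < t2" | "t2 \<le> t" "t < t3" | "t3 \<le> t" "t < t4" ns | "t4 \<le> t" "t < t5" ns
  | "t5 \<le> t" "t < t6" | "t6 \<le> t"
 proof (cases ns)
  case True
  thus ?thesis using that t_order(7) by linarith
 next
  case False
  thus ?thesis using that t_order(14) by linarith
 qed
 thus ?thesis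
 proof cases
  case 1
  have "col_act \<beta> ncol v (cell i t) = send fwd [] (flood (Ids V) (after n (col_back v n)) (after n (col_front v n)) (t - n))"
   using S 1 by (simp add: col_act_def Let_def)
  also have "\<dots> = send fwd [] (Ids V, Ids V)"
   using constant_streams(1)[of n "Ids V"] agree_in(1,2) nt n3 1 t_order(8) by simp
  also have "\<dots> = hact i t"
  proof (rule hact_undecided[symmetric])
   show "t \<noteq> t6 + tn j" "drawn_coins j t = []" using 1 t_order(2,3) t3le by (intro tb c0; linarith)+
   show "fm j t = Ids V" "bm j t = Ids V" using phase_id_vectors[of "t - n" j] 1 nt t_order(8) by simp_all
  qed
  finally show ?thesis .
 next
  case 2
  hence le: "t - t1 < n - 1" "t1 + (t - t1) = t" "\<not> t < t1" "1 \<le> t1" using t_order(1,9) n3 by linarith+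
  have "col_act \<beta> ncol v (cell i t) = send fwd [] (flood (Val (p i)) (after t1 (col_back v n)) (after t1 (col_front v n)) (t - t1))"
   using S 2 le by (simp add: col_act_def Let_def)
  also have "\<dots> = send fwd [] (fm j t, bm j t)"
  proof (cases "t = t1")
   case True
   thus ?thesis using flood_h[of t1 "Val (p i)"] 2 le(4) phase_prefs[of 0 j] own_P pos_less[of i] n3 by simp
  next
   case False
   hence "1 \<le> t - t1" "t - t1 < n" using 2 le by linarith+
   hence "Bs j t = fm j t" "Fs j t = bm j t" using prefs_in[of "t - t1" j] phase_prefs[of "t - t1" j] le by simp_all
   thus ?thesis using flood_h[of t1 "Val (p i)"] 2 le False by simp
  qed
  also have "\<dots> = hact i t"
  proof (rule hact_undecided[symmetric])
   show "t \<noteq> t6 + tn j" "drawn_coins j t = []" using 2 t_order(3) t3le by (intro tb c0; linarith)+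
  qed (rule refl)+
  finally show ?thesis .
 next
  case 3
  hence le: "t - t2 < n - 1" "t2 + (t - t2) = t" "\<not> t < t1" "\<not> t < t2" "1 \<le> t2" using t_order(1,2,10) n3 by linarith+
  have "col_act \<beta> ncol v (cell i t) = send fwd [] (flood (Vals ps) (after t2 (col_back v n)) (after t2 (col_front v n)) (t - t2))"
   using S 3 le prefs_h by (simp add: col_act_def Let_def)
  also have "\<dots> = send fwd [] (Vals ps, Vals ps)"
   using constant_streams(1)[of t2 "Vals ps"] agree_in(3,4) 3 le by simp
  also have "\<dots> = hact i t"
  proof (rule sym, rule hact_undecided)
   show "fm j t = Vals ps" "bm j t = Vals ps" using phase_vectors[of "t - t2" j] le by simp_all
   show "t \<noteq> t6 + tn j" "drawn_coins j t = []" using 3 t3le by (intro tb c0; linarith)+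
  qed
  finally show ?thesis .
 next
  case 4
  hence le: "t - t3 < n - 1" "t3 + (t - t3) = t" "\<not> t < t1" "\<not> t < t2" "\<not> t < t3" "1 \<le> t3" "t2 \<le> t" using t_order(1,2,3,11) n3 by linarith+
  have ns: "col_needs_sink v n" using needs_sink_h[OF le(7)] 4 by simp
  have w: "w j = fst (cell i t3) mod n" using agt(3)[OF i] by (simp add: w_def)
  define cs where "cs = (if t = t3 then [fst (cell i t) mod n] else coins (fst (h ! t3)))"
  have cs: "cs = [w j]" using coins_h[of t3] 4 w by (auto simp: cs_def drawn_coins_def)
  have "col_act \<beta> ncol v (cell i t) = send fwd (drawn h t3 cs) (fst (flood (Val (cs ! 0)) (after t3 (col_back v n)) (after t3 (col_front v n)) (t - t3)), Silent)"
   using S 4(2) le ns unfolding cs_def by (simp add: col_act_def Let_def)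
  also have "\<dots> = send fwd (drawn_coins j t) (fm j t, bm j t)"
  proof (cases "t = t3")
   case True
   thus ?thesis
    using flood_h[of t3 "Val (w j)"] 4 le(6) phase_weights[of 0 j] pos_less[of i] n3 cs by (simp add: drawn_def drawn_coins_def)
  next
   case False
   hence "1 \<le> t - t3" "t - t3 < n" using 4 le by linarith+
   hence "Bs j t = fm j t" "bm j t = Silent" using weights_in[of "t - t3" j] phase_weights[of "t - t3" j] le 4 by simp_all
   moreover have "drawn_coins j t = []" using False 4(2) t_order(7)[OF 4(3)] by (intro c0) linarith
   ultimately show ?thesis using flood_h[of t3 "Val (w j)"] 4 le False cs by (simp add: drawn_def)
  qed
  also have "\<dots> = hact i t"
  proof (rule hact_undecided[symmetric])
   show "t \<noteq> t6 + tn j" using 4 t_order(6) t_order(7)[OF 4(3)] by (intro tb) linarith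
  qed (rule refl)+
  finally show ?thesis .
 next
  case 5
  hence le: "t - t4 < n - 1" "t4 + (t - t4) = t" "\<not> t < t1" "\<not> t < t2" "\<not> t < t3" "\<not> t < t4" "1 \<le> t4" "t2 \<le> t"
   using t_order(1,2,3,4) t_order(13)[OF 5(3)] n3 by linarith+
  have ns: "col_needs_sink v n" using needs_sink_h[OF le(8)] 5 by simp
  have "col_act \<beta> ncol v (cell i t) = send fwd [] (flood (Vals wl) (after t4 (col_back v n)) (after t4 (col_front v n)) (t - t4))"
   using S 5 le ns weights_h t5_h[OF le(8)] by (simp add: col_act_def Let_def)
  also have "\<dots> = send fwd [] (Vals wl, Vals wl)"
   using constant_streams(1)[of t4 "Vals wl"] agree_in(5,6)[OF _ _ 5(3)] 5 le by simp
  also have "\<dots> = hact i t"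
  proof (rule sym, rule hact_undecided)
   show "fm j t = Vals wl" "bm j t = Vals wl" using phase_weight_vectors[of "t - t4" j] le 5 by simp_all
   show "drawn_coins j t = []" using 5 t_order(4) by (intro c0) linarith
   show "t \<noteq> t6 + tn j" using 5 t_order(6) by (intro tb) linarith
  qed
  finally show ?thesis .
 next
  case 6
  hence le: "t - t5 < 2 * n" "t5 + (t - t5) = t" "\<not> t < t1" "\<not> t < t2" "\<not> t < t3" "t2 \<le> t" using t_order(1-5,12) n3 by linarith+
  have ns: "\<not> (col_needs_sink v n \<and> t < t4)" "\<not> (col_needs_sink v n \<and> t < t5)"
   using needs_sink_h[OF le(6)] 6 t_order(7) by auto
  have yR: "y j = fst (snd (cell i t5))" "R j = snd (snd (cell i t5))" using agt(3)[OF i] by (simp_all add: y_def R_def)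
  define cs where "cs = (if t = t5 then [fst (snd (cell i t)), snd (snd (cell i t))] else coins (fst (h ! t5)))"
  have cs: "cs = [y j, R j]" using coins_h[of t5] 6 yR drawn_t5 by (auto simp: cs_def)
  have dr: "drawn h t5 cs = drawn_coins j t"
  proof (cases "t = t5")
   case True
   thus ?thesis using cs drawn_t5 by (simp add: drawn_def)
  next
   case False
   hence "drawn_coins j t = []" using 6(1) t_order(5) by (intro c0) linarith
   thus ?thesis using False by (simp add: drawn_def)
  qed
  have "col_act \<beta> ncol v (cell i t) = send fwd (drawn h t5 cs) (sharing_step n (cs ! 0) (cs ! 1) (after t5 (col_back v n)) (after t5 (col_front v n)) (t - t5))"
   using S 6(2) le ns t5_h[OF le(6)] unfolding cs_def by (cases "col_needs_sink v n") (simp_all add: col_act_def Let_def)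
  also have "sharing_step n (cs ! 0) (cs ! 1) (after t5 (col_back v n)) (after t5 (col_front v n)) (t - t5)
    = sharing_step n (y j) (R j) (\<lambda>k. share_front n R R y ((j + (n - 1)) mod n) (k - 1)) (\<lambda>k. share_back n X y ((j + 1) mod n) (k - 1)) (t - t5)"
   unfolding cs nth_Cons_0 One_nat_def nth_Cons_Suc
  proof (rule sharing_step_cong1)
   fix k assume "1 \<le> k" "k \<le> t - t5"
   hence "1 \<le> t5 + k" "t5 + k \<le> t" "1 \<le> k" "k \<le> 2 * n" using le by linarith+
   thus "after t5 (col_back v n) k = share_front n R R y ((j + (n - Suc 0)) mod n) (k - Suc 0)"
    "after t5 (col_front v n) k = share_back n X y ((j + Suc 0) mod n) (k - Suc 0)"
    using streams_h[of "t5 + k"] shares_in[of k j] unfolding after_def One_nat_def by (simp_all only:)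
  qed (use n3 in simp)
  also have "\<dots> = (share_front n R R y j (t - t5), share_back n X y j (t - t5))"
   by (rule sharing_step_ring[OF n3 pos_less le(1)]) (rule refl X_def)+
  also have "\<dots> = (fm j t, bm j t)" using phase_coin[OF le(1), of j] le(2) by simp
  also have "send fwd (drawn h t5 cs) (fm j t, bm j t) = hact i t"
  proof (rule hact_undecided[symmetric])
   show "t \<noteq> t6 + tn j" using 6 by (intro tb)
   show "drawn_coins j t = drawn h t5 cs" using dr by simp
  qed (rule refl)+
  finally show ?thesis .
 next
  case 7
  have le: "\<not> t < t1" "\<not> t < t2" "\<not> t < t3" "t2 \<le> t" "t5 \<le> t" "\<not> t < t6" "t6 + (t - t6) = t" using 7 t_order(1-6) by linarith+
  have ns: "\<not> (col_needs_sink v n \<and> t < t4)" "\<not> (col_needs_sink v n \<and> t < t5)"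
   using needs_sink_h[OF le(4)] le t_order(7) by auto
  have dc: "drawn_coins j t = []" using 7 t3le t_order(6) by (intro c0) linarith
  define c where "c = (if t = t6 then p i else min_available ncol (after t6 (col_back v n)) (after t6 (col_front v n)) (t - t6))"
  have e: "col_act \<beta> ncol v (cell i t) = (if t - t6 = tn j then Act [] (Some (Some c)) (Val c) (Val c) else idle)"
   using S le ns t5_h[OF le(4)] prefs_h[OF le(4)] sink_h[OF le(5)] coin_h[OF 7] unfolding c_def tn_def
   by (cases "col_needs_sink v n") (simp_all add: col_act_def Let_def)
  show ?thesis
  proof (cases "t - t6 = tn j")
   case True
   have "c = color j"
   proof (cases "t = t6")
    case True
    thus ?thesis using \<open>t - t6 = tn j\<close> color_eq[of j] own_P by (simp add: c_def)
   next
    case False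
    \<comment> \<open>An announcement made at turn \<open>l\<close> arrives at step
      \<open>l + 1\<close>, so what has arrived when position \<open>j\<close> chooses comes exactly
      from the neighbours with smaller turn.\<close>
    have "{c. \<exists>k\<in>{1..t - t6}. after t6 (col_back v n) k = Val c \<or> after t6 (col_front v n) k = Val c} = taken (tn j) j"
    proof -
     note s = color_streams[OF 7]
     show ?thesis
     proof (intro set_eqI iffI)
      fix d assume "d \<in> {c. \<exists>k\<in>{1..t - t6}. after t6 (col_back v n) k = Val c \<or> after t6 (col_front v n) k = Val c}"
      then obtain k where k: "1 \<le> k" "k \<le> t - t6" and "after t6 (col_back v n) k = Val d \<or> after t6 (col_front v n) k = Val d" by auto
      hence "k - 1 = tn ((j + (n - 1)) mod n) \<and> d = color ((j + (n - 1)) mod n) \<or> k - 1 = tn ((j + 1) mod n) \<and> d = color ((j + 1) mod n)"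
       using s[OF k] by (auto split: if_splits)
      moreover have "k - 1 < tn j" using k True by linarith
      ultimately show "d \<in> taken (tn j) j" unfolding taken_def by auto
     next
      fix d assume "d \<in> taken (tn j) j"
      then obtain l where l: "l = (j + (n - 1)) mod n \<or> l = (j + 1) mod n" "tn l < tn j" "d = color l" by (auto simp: taken_def)
      have k: "1 \<le> tn l + 1" "tn l + 1 \<le> t - t6" using l(2) True by linarith+
      hence "after t6 (col_back v n) (tn l + 1) = Val d \<or> after t6 (col_front v n) (tn l + 1) = Val d" using s[OF k] l by auto
      thus "d \<in> {c. \<exists>k\<in>{1..t - t6}. after t6 (col_back v n) k = Val c \<or> after t6 (col_front v n) k = Val c}" using k by auto
     qed
    qed
    moreover have "tn j \<noteq> 0" using False True 7 by linarith
    ultimately show ?thesis using False True color_eq[of j] by (simp add: c_def min_available_def)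
   qed
   thus ?thesis using e True dc phase_color[of j "t - t6"] le(7) by (simp add: hact_def Let_def)
  next
   case False
   thus ?thesis using e dc phase_color[of j "t - t6"] le(7) by (auto simp: hact_def Let_def idle_def)
  qed
 qed
qed

end

lemma act_early: "t < n ==> col_act \<beta> ncol v (cell i t) = hact i t"
proof -
 assume tn: "t < n"
 have lt: "t < t3" "t < t5" "t < t6" using tn t_order by linarith+
 have "ring_size (x i) h = None" using ring_size_h tn by simp
 hence "col_act \<beta> ncol v (cell i t) = send True [] (flood (Id (x i)) (from_ccw h) (from_cw h) t)"
  using not_decided_h tn n_le by (simp add: col_act_def learn_ids_def Let_def)
 also have "\<dots> = hact i t"
 proof -
  have "drawn_coins j t = []" using lt by (simp add: drawn_coins_def)
  moreover have "from_ccw h t = (if fwd then fm j t else bm j t)" "from_cw h t = (if fwd then bm j t else fm j t)" if "1 \<le> t"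
   using from_hact[OF i that order_refl] ids_in[OF that, of j] phase_ids[OF tn, of j] tn by (cases fwd; simp)+
  moreover have "fm j 0 = Id (x i)" "bm j 0 = Id (x i)" using phase_ids[of 0 j] n3 V_pos[OF i] pos_less[of i] by simp_all
  ultimately show ?thesis using lt by (cases "t = 0") (auto simp: hact_def Let_def send_def flood_def)
 qed
 finally show ?thesis .
qed

end

lemma act_hact:
 assumes "i < n"
 shows "col_act \<beta> ncol (trace_view n x p hact i t) (cell i t) = hact i t"
proof (cases "t \<le> t6 + tn (pos i)")
 case True
 thus ?thesis using act_late[OF assms True] act_early[OF assms True] by (meson not_le)
next
 case False
 hence "decided (trace_hist n hact i t)"
  unfolding decided_trace by (intro exI[of _ "t6 + tn (pos i)"]) (auto simp: hact_def Let_def)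
 hence "col_act \<beta> ncol (trace_view n x p hact i t) (cell i t) = idle" by (simp add: col_act_def Let_def)
 moreover have le: "t5 < t" "t3 < t" "t6 + (t - t6) = t" "t - t6 \<noteq> tn (pos i)" using False t_order by linarith+
 hence "drawn_coins (pos i) t = []" by (simp add: drawn_coins_def)
 ultimately show ?thesis using phase_color[of "pos i" "t - t6"] le False by (auto simp: hact_def Let_def idle_def)
qed

end

section \<open>A deviation from Knowledge Sharing\<close>

definition sharing_act :: "nat => nat => nat set => (nat list => nat) => (nat \<times> nat) view => nat => action" where
 "sharing_act \<beta> bits S q v c =
   (let x = own_id v; y = fst (priv v); h = hist v; t = length h;
     B = from_ccw h; F = from_cw h in
   if decided h then idle else
   case ring_size x h of
    None => learn_ids \<beta> x h
   | Some m =>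
     (let V = from_max (cw_ids x h m); j = index_of V x;
       t1 = 2 * m - 1; t2 = t1 + 2 * m in
     if \<not> (ids_ok x h m
        \<and> (t \<ge> t1 \<longrightarrow> agree m (Ids V) (after m B) (after m F))
        \<and> (t \<ge> t2 \<longrightarrow> sharing_ok bits S m (after t1 B) (after t1 F)))
     then abort
     else if t < t1 then send True [] (flood (Ids V) (after m B) (after m F) (t - m))
     else if t < t2 then
      (let cs = (if t = t1 then [c] else coins (fst (h ! t1))) in
       send True (drawn h t1 cs) (sharing_step m y (cs ! 0) (after t1 B) (after t1 F) (t - t1)))
     else Act [] (Some (Some (q (shared_inputs m j y (after t1 F))))) Silent Silent))"

lemma sharing_act_cell:
 assumes "ring_size (own_id v) (hist v) = Some m" "length (hist v) \<noteq> 2 * m - 1"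
 shows "sharing_act \<beta> bits S q v c = sharing_act \<beta> bits S q v c'"
 unfolding sharing_act_def Let_def assms(1) option.case using assms(2) by (simp only: if_False)

text \<open>The deviating agent plays the deviation \<open>f\<close> from the coloring algorithm until the ids and
 the ring size are known, and then the fake agents that this has introduced. All of them have input
 and random number \<open>0\<close>, except that the input of the last one is chosen at the last moment such
 that the outcome is \<open>z\<close>, if the fake agents are sufficiently many.\<close>

definition replay :: "(nat view => action) => nat => nat => (msg \<times> msg) list => (action \<times> msg \<times> msg) list" where
 "replay f x0 p0 ins = foldl (\<lambda>h io. h @ [(f (View x0 p0 h), io)]) [] ins"

definition fake_value :: "nat => nat => (nat => nat) => nat => nat" where
 "fake_value n y0 g k = (if 1 \<le> k \<and> k < n then g k else if k = 0 then y0 else 0)"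

definition cheat :: "(nat view => action) => nat => nat => (nat \<times> nat) view => action" where
 "cheat f p0 z v =
   (let h = hist v; t = length h; d = (if t = 0 then Some (Some z) else None) in
   if \<not> (\<exists>k<t. to_cw (fst (h ! k)) = from_cw h 1) then
    (let a = f (View (own_id v) p0 (replay f (own_id v) p0 (map snd h))) in Act [] d (to_cw a) (to_ccw a))
   else
    (let m = Suc (LEAST k. to_cw (fst (h ! k)) = from_cw h 1);
       n = (LEAST k. 1 \<le> k \<and> from_cw h k = to_ccw (fst (h ! 0)));
       V = from_max (map (\<lambda>k. id_of (to_cw (fst (h ! (m - 1 - k))))) [0..<m]);
       t1 = 2 * m - 1;
       R = (\<lambda>k. the (share2 (from_ccw h (t1 + (n - k)))));
       X = (\<lambda>k. the (share1 (from_cw h (t1 + k))));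
       y0 = (if m + 1 < 2 * n then 0 else (z + (\<Sum>k\<in>{1..<n}. xor (R k) (X k))) mod 2) in
     if t < t1 then Act [] d (Ids V) (Ids V)
     else if t < t1 + 2 * m then
      Act [] d
       (share_front m (fake_value n y0 R) (fake_value n 0 R) (fake_value n y0 (\<lambda>k. val (from_ccw h (t1 + (m + 1 + (n - k)))))) 0 (t - t1))
       (share_back m (fake_value n 0 X) (fake_value n y0 (\<lambda>k. val (from_cw h (t1 + (m + 1 + k))))) n (t - t1))
     else Act [] d Silent Silent))"

lemma length_replay [simp]: "length (replay f x0 p0 ins) = length ins"
 by (induction ins rule: rev_induct) (simp_all add: replay_def)

lemma replay_snoc: "replay f x0 p0 (ins @ [io]) = replay f x0 p0 ins @ [(f (View x0 p0 (replay f x0 p0 ins)), io)]"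
 by (simp add: replay_def)

lemma replay_eq:
 assumes "\<And>t. t < length ins ==> g t = f (View x0 p0 (map (\<lambda>s. (g s, ins ! s)) [0..<t]))"
 shows "replay f x0 p0 ins = map (\<lambda>s. (g s, ins ! s)) [0..<length ins]"
 using assms
proof (induction ins rule: rev_induct)
 case (snoc io ins)
 have e: "map (\<lambda>s. (g s, (ins @ [io]) ! s)) [0..<t] = map (\<lambda>s. (g s, ins ! s)) [0..<t]" if "t \<le> length ins" for t
  using that by (auto simp: nth_append)
 have "replay f x0 p0 ins = map (\<lambda>s. (g s, ins ! s)) [0..<length ins]"
 proof (rule snoc.IH)
  fix t assume t: "t < length ins"
  hence "g t = f (View x0 p0 (map (\<lambda>s. (g s, (ins @ [io]) ! s)) [0..<t]))" using snoc.prems[of t] by simp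
  thus "g t = f (View x0 p0 (map (\<lambda>s. (g s, ins ! s)) [0..<t]))" unfolding e[OF less_imp_le[OF t]] .
 qed
 thus ?case using snoc.prems[of "length ins"] e[of "length ins"] by (simp add: replay_snoc)
qed (simp add: replay_def)

text \<open>\<open>g\<close> is the first stage of the deviation \<open>f\<close>. The assumptions
  say that it passes for the positions of a ring with ids \<open>Y\<close>; a run of the coloring
  algorithm in which all others get a color supplies them.\<close>

locale sharing_cheat =
 fixes \<beta> n m :: nat and x Y :: "nat => nat" and y R :: "nat => nat" and z p0 :: nat
  and f :: "nat view => action" and g :: "nat => action" and pr :: "nat => nat \<times> nat"
 assumes n3: "3 \<le> n" and nm: "n \<le> m" and m_le: "m \<le> \<beta>"
  and Y_inj: "inj_on Y {..<m}" and Y_real: "\<And>i. 1 \<le> i ==> i < n ==> Y i = x i"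
  and bits: "\<And>i. 1 \<le> i ==> i < n ==> y i \<in> {0, 1} \<and> R i \<in> {0, 1}"
  and z: "z \<in> {0, 1}"
  and g_out: "\<And>t. t < m ==> to_cw (g t) = Id (Y ((m - t) mod m)) \<and> to_ccw (g t) = Id (Y ((n + t) mod m))"
  and g_eq: "\<And>t. t < m ==> g t = f (View (x 0) p0 (map (\<lambda>s. (g s, Id (Y ((n - 1 + (m - s)) mod m)), Id (Y ((1 + s) mod m)))) [0..<t]))"
  and priv_y: "\<And>i. 1 \<le> i ==> i < n ==> fst (pr i) = y i"
begin

text \<open>The case distinction is whether the position \<open>dist2 m\<close> in front of position
  \<open>0\<close> is real. If so, it tests position \<open>0\<close> by a share sent early, and the
  input must be fixed blindly. Otherwise all inputs are known at step \<open>m - 1\<close>, when the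
  share for agent \<open>1\<close> is due.\<close>

definition y0 where "y0 = (if m + 1 < 2 * n then 0 else (z + (\<Sum>k\<in>{1..<n}. y k)) mod 2)"
definition yv where "yv = fake_value n y0 y"
text \<open>The backward value of position \<open>0\<close> is \<open>0\<close>, so its share for
  agent \<open>1\<close> has to be \<open>y0\<close> itself. The share for the other target, in
  \<open>Rv\<close>, is sent in step \<open>0\<close>, before \<open>y0\<close> is known, and stays
  \<open>0\<close>.\<close>

definition R1v where "R1v = fake_value n y0 R"
definition Rv where "Rv = fake_value n 0 R"
definition Xv where "Xv = fake_value n 0 (\<lambda>k. xor (R k) (y k))"
definition V where "V = from_max (map Y [0..<m])"
definition out where "out = (\<Sum>k<m. yv k) mod 2"
definition t1 where "t1 = 2 * m - 1"

definition srt :: "nat => nat => msg" where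
 "srt i t = (if t < m then Id (Y ((i + (m - t)) mod m)) else if t < t1 then Ids V
  else if t < t1 + 2 * m then share_front m R1v Rv yv i (t - t1) else Silent)"
definition slt :: "nat => nat => msg" where
 "slt i t = (if t < m then Id (Y ((i + t) mod m)) else if t < t1 then Ids V
  else if t < t1 + 2 * m then share_back m Xv yv i (t - t1) else Silent)"
definition sact :: "nat => nat => action" where
 "sact i t = (if i = 0 then Act [] (if t = 0 then Some (Some z) else None) (srt 0 t) (slt n t)
   else Act (if t = t1 then [R i] else []) (if t = t1 + 2 * m then Some (Some out) else None) (srt i t) (slt i t))"

lemma m3: "3 \<le> m" using n3 nm by simp

lemma t1: "t1 = m + (m - 1)" "m < t1" using m3 by (auto simp: t1_def)

text \<open>With few fake agents the outcome does not depend on \<open>z\<close>: on each tape it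
  suits exactly one of the two preferences. Otherwise it suits every \<open>z\<close>.\<close>

lemma out_eq: "out = (if m + 1 < 2 * n then (\<Sum>k\<in>{1..<n}. y k) mod 2 else z)"
proof -
 have "(\<Sum>k<m. yv k) = yv 0 + (\<Sum>k\<in>{1..<m}. yv k)"
  using m3 by (simp add: lessThan_atLeast0 sum.atLeast_Suc_lessThan)
 also have "(\<Sum>k\<in>{1..<m}. yv k) = (\<Sum>k\<in>{1..<n}. yv k)"
  using nm by (intro sum.mono_neutral_right) (auto simp: yv_def fake_value_def)
 also have "\<dots> = (\<Sum>k\<in>{1..<n}. y k)" by (intro sum.cong) (auto simp: yv_def fake_value_def)
 finally have "(\<Sum>k<m. yv k) = y0 + (\<Sum>k\<in>{1..<n}. y k)" by (simp add: yv_def fake_value_def)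
 moreover have "((z + s) mod 2 + s) mod 2 = z" for s using z by (auto simp: mod_add_left_eq) presburger+
 ultimately show ?thesis by (simp add: out_def y0_def)
qed

lemma receives:
 assumes "1 \<le> i" "i < n" "1 \<le> k" "k \<le> t"
 shows "from_ccw (trace_hist n sact i t) k = srt (i - 1) (k - 1)" "from_cw (trace_hist n sact i t) k = slt (i + 1) (k - 1)"
proof -
 have "(i + n - 1) mod n = i - 1" using assms by (simp add: mod_if)
 thus "from_ccw (trace_hist n sact i t) k = srt (i - 1) (k - 1)" using assms by (simp add: from_ccw_trace sact_def)
 show "from_cw (trace_hist n sact i t) k = slt (i + 1) (k - 1)"
  using assms by (cases "i + 1 = n") (simp_all add: from_cw_trace sact_def)
qed

lemma cheater_receives:
 assumes "1 \<le> k" "k \<le> t"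
 shows "from_ccw (trace_hist n sact 0 t) k = srt (n - 1) (k - 1)" "from_cw (trace_hist n sact 0 t) k = slt 1 (k - 1)"
 using assms n3 by (simp_all add: from_ccw_trace from_cw_trace sact_def)

lemma mod_pred_shift': "1 \<le> i ==> 1 \<le> k ==> k \<le> m ==> (i - 1 + (m - (k - 1))) mod m = (i + (m - k)) mod m" for i k :: nat
 by (rule arg_cong[of _ _ "\<lambda>a. a mod m"]) simp

lemma ids_in:
 assumes "1 \<le> i" "1 \<le> k" "k \<le> m"
 shows "srt (i - 1) (k - 1) = Id (Y ((i + (m - k)) mod m))" "slt (i + 1) (k - 1) = Id (Y ((i + k) mod m))"
proof -
 have "k - 1 < m" "i + 1 + (k - 1) = i + k" using assms by linarith+
 thus "srt (i - 1) (k - 1) = Id (Y ((i + (m - k)) mod m))" "slt (i + 1) (k - 1) = Id (Y ((i + k) mod m))"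
  using mod_pred_shift'[OF assms] by (simp_all only: srt_def slt_def if_True)
qed

lemma vectors_in:
 assumes "1 \<le> k" "k < m"
 shows "srt i (m + k - 1) = Ids V" "slt i (m + k - 1) = Ids V"
proof -
 have "\<not> m + k - 1 < m" "m + k - 1 < t1" using assms t1 by linarith+
 thus "srt i (m + k - 1) = Ids V" "slt i (m + k - 1) = Ids V" by (simp_all only: srt_def slt_def if_True if_False)
qed

lemma shares_in:
 assumes "1 \<le> k" "k \<le> 2 * m"
 shows "srt i (t1 + k - 1) = share_front m R1v Rv yv i (k - 1)" "slt i (t1 + k - 1) = share_back m Xv yv i (k - 1)"
proof -
 have "\<not> t1 + k - 1 < m" "\<not> t1 + k - 1 < t1" "t1 + k - 1 < t1 + 2 * m" "t1 + k - 1 - t1 = k - 1" using assms t1 by linarith+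
 thus "srt i (t1 + k - 1) = share_front m R1v Rv yv i (k - 1)" "slt i (t1 + k - 1) = share_back m Xv yv i (k - 1)"
  by (simp_all only: srt_def slt_def if_True if_False)
qed

lemma Y_eq: "a < m ==> b < m ==> Y a = Y b \<longleftrightarrow> a = b"
 using Y_inj by (auto simp: inj_on_def)

lemma y0_bit: "y0 \<in> {0, 1}" by (auto simp: y0_def)

lemma vectors_bits: "R1v k < 2 \<and> Rv k < 2 \<and> Xv k < 2 \<and> yv k \<in> {0, 1}"
 using bits[of k] y0_bit by (auto simp: R1v_def Rv_def Xv_def yv_def fake_value_def)

context
 fixes i t assumes i: "1 \<le> i" "i < n" and t: "t \<le> t1 + 2 * m"
begin

abbreviation "v \<equiv> trace_view n x pr sact i t"
abbreviation "h \<equiv> trace_hist n sact i t"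

lemma im: "i < m" using i nm by simp

lemma undecided_h: "\<not> decided h"
 using t i by (auto simp: decided_trace sact_def)

lemma ring_size_h: "ring_size (x i) h = (if m \<le> t then Some m else None)"
proof -
 have "{from_ccw h k, from_cw h k} = {Id (map Y [0..<m] ! ((i + (m - k)) mod m)), Id (map Y [0..<m] ! ((i + k) mod m))}"
  if k: "1 \<le> k" "k \<le> m" "k \<le> length h" for k
  using receives[OF i k(1), of t] ids_in[OF i(1) k(1,2)] k(3) m3 by simp
 moreover have "distinct (map Y [0..<m])" using Y_inj by (simp add: distinct_map lessThan_atLeast0)
 ultimately show ?thesis using ring_size_flood[of "map Y [0..<m]" m i "x i" h] im Y_real[OF i] by simp
qed

lemma sharing_act_early: "t < m ==> sharing_act \<beta> 1 {0, 1} parity v c = sact i t"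
proof -
 assume tm: "t < m"
 have "ring_size (x i) h = None" using ring_size_h tm by simp
 hence "sharing_act \<beta> 1 {0, 1} parity v c = send True [] (flood (Id (x i)) (from_ccw h) (from_cw h) t)"
  using undecided_h tm m_le by (simp add: sharing_act_def learn_ids_def Let_def)
 also have "\<dots> = Act [] None (srt i t) (slt i t)"
 proof (cases "t = 0")
  case True
  thus ?thesis using Y_real[OF i] im tm by (simp add: send_def flood_def srt_def slt_def)
 next
  case False
  hence "1 \<le> t" "t \<le> m" using tm by auto
  thus ?thesis using receives[OF i, of t t] ids_in[OF i(1), of t] tm by (simp add: send_def flood_def srt_def slt_def)
 qed
 also have "\<dots> = sact i t" using i tm t1 by (simp add: sact_def)
 finally show ?thesis .
qed

context
 assumes mt: "m \<le> t"
begin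

lemma cw_ids_h: "from_max (cw_ids (x i) h m) = V"
proof -
 have "map (\<lambda>k. id_of (from_cw h k)) [1..<m] = map (\<lambda>k. Y ((i + k) mod m)) [1..<m]"
  using receives(2)[OF i, of _ t] ids_in(2)[OF i(1)] mt by (intro map_cong) auto
 moreover have "x i = Y ((i + 0) mod m)" using Y_real[OF i] im by simp
 ultimately have "cw_ids (x i) h m = map (\<lambda>k. Y ((i + k) mod m)) (0 # [1..<m])" by (simp add: cw_ids_def)
 also have "0 # [1..<m] = [0..<m]" using m3 by (simp add: upt_conv_Cons)
 finally have "cw_ids (x i) h m = rotate i (map Y [0..<m])" by (simp only: ring_list_rotate)
 moreover have "distinct (map Y [0..<m])" "map Y [0..<m] \<noteq> []" using Y_inj m3 by (auto simp: distinct_map lessThan_atLeast0)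
 ultimately show ?thesis using from_max_rotate by (simp add: V_def)
qed

lemma ids_ok_h: "ids_ok (x i) h m"
proof -
 have "distinct (cw_ids (x i) h m)"
 proof -
  have "distinct (from_max (cw_ids (x i) h m))" using cw_ids_h Y_inj by (simp add: V_def from_max_def distinct_map lessThan_atLeast0)
  thus ?thesis by (simp add: from_max_def)
 qed
 moreover have "from_ccw h k \<in> range Id \<and> from_ccw h k = from_cw h (m - k)" if k: "1 \<le> k" "k < m" for k
 proof -
  have le: "1 \<le> m - k" "m - k \<le> m" "k \<le> m" "k \<le> t" "m - k \<le> t" using k mt by linarith+
  show ?thesis
   using receives(1)[OF i k(1) le(4)] receives(2)[OF i le(1,5)] ids_in(1)[OF i(1) k(1) le(3)] ids_in(2)[OF i(1) le(1,2)] by simp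
 qed
 moreover have "from_ccw h m = Id (x i)" "from_cw h m = Id (x i)"
  using receives[OF i, of m t] ids_in[OF i(1), of m] mt m3 Y_real[OF i] im by simp_all
 ultimately show ?thesis unfolding ids_ok_def flood_ok_def by (metis atLeastLessThan_iff)
qed

lemma agree_h: "t1 \<le> t ==> agree m (Ids V) (after m (from_ccw h)) (after m (from_cw h))"
 unfolding agree_def after_def
proof
 fix k assume a: "t1 \<le> t" and "k \<in> {1..<m}"
 hence k: "1 \<le> k" "k < m" "1 \<le> m + k" "m + k \<le> t" using t1 by auto
 thus "from_ccw h (m + k) = Ids V \<and> from_cw h (m + k) = Ids V"
  using receives[OF i k(3,4)] vectors_in[OF k(1,2)] by simp
qed

lemma share_streams:
 assumes "1 \<le> k" "k \<le> 2 * m" "t1 + k \<le> t"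
 shows "after t1 (from_ccw h) k = share_front m R1v Rv yv ((i + (m - 1)) mod m) (k - 1)"
  "after t1 (from_cw h) k = share_back m Xv yv ((i + 1) mod m) (k - 1)"
proof -
 have "i + (m - 1) = i - 1 + m" using i m3 by linarith
 hence e: "(i + (m - 1)) mod m = i - 1" using im by (metis less_imp_diff_less mod_add_self2 mod_less)
 have b: "share_back m Xv yv ((i + 1) mod m) u = share_back m Xv yv (i + 1) u" for u
  by (simp only: share_back_def mod_add_left_eq)
 have "1 \<le> t1 + k" using assms by simp
 thus "after t1 (from_ccw h) k = share_front m R1v Rv yv ((i + (m - 1)) mod m) (k - 1)"
  "after t1 (from_cw h) k = share_back m Xv yv ((i + 1) mod m) (k - 1)"
  unfolding after_def e b using receives[OF i _ assms(3)] shares_in[OF assms(1,2)] by simp_all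
qed

lemma own_vectors: "R1v i = R i" "Rv i = R i" "Xv i = xor (Rv i) (yv i)" "yv i = y i"
 using i by (auto simp: R1v_def Rv_def Xv_def yv_def fake_value_def)

lemma sharing_ok_h:
 assumes "t1 + 2 * m \<le> t"
 shows "sharing_ok 1 {0, 1} m (after t1 (from_ccw h)) (after t1 (from_cw h))"
proof (rule sharing_ok_ring[OF m3 im])
 note d = dist2_bounds[OF m3]
 have X: "xor (Rv k) (Xv k) = yv k" if "k \<noteq> 0 \<or> y0 = 0" for k
  using that by (auto simp: Rv_def Xv_def yv_def fake_value_def simp flip: xor.assoc)
 have "i + (m - 1) = i - 1 + m" using i m3 by linarith
 hence e: "(i + (m - 1)) mod m = i - 1" using im by (metis less_imp_diff_less mod_add_self2 mod_less)
 show "xor (R1v ((i + (m - 1)) mod m)) (Xv ((i + (m - 1)) mod m)) = yv ((i + (m - 1)) mod m)"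
  unfolding e by (auto simp: R1v_def Xv_def yv_def fake_value_def simp flip: xor.assoc)
 show "xor (Rv ((i + (m - dist2 m)) mod m)) (Xv ((i + (m - dist2 m)) mod m)) = yv ((i + (m - dist2 m)) mod m)"
 proof (rule X)
  \<comment> \<open>The position tested by \<open>i\<close> is \<open>0\<close> only if
    \<open>i = dist2 m\<close>; this agent is real only in the case in which
    \<open>y0 = 0\<close>.\<close>
  show "(i + (m - dist2 m)) mod m \<noteq> 0 \<or> y0 = 0"
  proof (cases "m + 1 < 2 * n")
   case False
   hence "n \<le> dist2 m" by (auto simp: dist2_def)
   hence *: "i + (m - dist2 m) < m" "i + (m - dist2 m) \<noteq> 0" using i d by linarith+
   show ?thesis unfolding mod_less[OF *(1)] using *(2) by blast
  qed (simp add: y0_def)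
 qed
 show "R1v k < 2 ^ 1 \<and> Rv k < 2 ^ 1 \<and> Xv k < 2 ^ 1 \<and> yv k \<in> {0, 1}" for k using vectors_bits[of k] by simp
qed (use share_streams assms in auto)

lemma sharing_act_late:
 assumes c: "c = R i"
 shows "sharing_act \<beta> 1 {0, 1} parity v c = sact i t"
proof -
 have rs: "ring_size (x i) h = Some m" using ring_size_h mt by simp
 have ok: "ids_ok (x i) h m \<and> (t \<ge> t1 \<longrightarrow> agree m (Ids V) (after m (from_ccw h)) (after m (from_cw h)))
   \<and> (t \<ge> t1 + 2 * m \<longrightarrow> sharing_ok 1 {0, 1} m (after t1 (from_ccw h)) (after t1 (from_cw h)))"
  using ids_ok_h agree_h sharing_ok_h by blast
 note S = undecided_h rs cw_ids_h ok t1_def[symmetric]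
 consider "t < t1" | "t1 \<le> t" "t < t1 + 2 * m" | "t = t1 + 2 * m" using t by linarith
 thus ?thesis
 proof cases
  case 1
  have "sharing_act \<beta> 1 {0, 1} parity v c = send True [] (flood (Ids V) (after m (from_ccw h)) (after m (from_cw h)) (t - m))"
   using S 1 by (simp add: sharing_act_def Let_def)
  also have "\<dots> = Act [] None (Ids V) (Ids V)"
  proof (cases "t = m")
   case False
   hence k: "1 \<le> t - m" "t - m < m" "m + (t - m) = t" "1 \<le> t" using 1 mt t1 by linarith+
   thus ?thesis using receives[OF i k(4) order_refl] vectors_in[OF k(1,2)] by (simp add: send_def flood_def after_def)
  qed (simp add: send_def flood_def)
  also have "\<dots> = sact i t" using 1 mt i by (simp add: sact_def srt_def slt_def)
  finally show ?thesis .
 next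
  case 2
  hence le: "\<not> t < t1" "t - t1 < 2 * m" "\<not> t < m" using t1 by linarith+
  define cs where "cs = (if t = t1 then [c] else coins (fst (h ! t1)))"
  have cs: "cs = [R i]" using 2 i c by (auto simp: cs_def fst_trace_hist sact_def)
  have "sharing_act \<beta> 1 {0, 1} parity v c = send True (drawn h t1 cs)
    (sharing_step m (y i) (cs ! 0) (after t1 (from_ccw h)) (after t1 (from_cw h)) (t - t1))"
   using S 2 le priv_y[OF i] unfolding cs_def by (simp add: sharing_act_def Let_def)
  also have "sharing_step m (y i) (cs ! 0) (after t1 (from_ccw h)) (after t1 (from_cw h)) (t - t1)
    = sharing_step m (yv i) (R i) (after t1 (from_ccw h)) (after t1 (from_cw h)) (t - t1)" using cs own_vectors by simp
  also have "\<dots> = (share_front m R1v Rv yv i (t - t1), share_back m Xv yv i (t - t1))"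
  proof (rule sharing_step_ring[OF m3 im le(2)])
   show "after t1 (from_ccw h) k = share_front m R1v Rv yv ((i + (m - 1)) mod m) (k - 1)"
    "after t1 (from_cw h) k = share_back m Xv yv ((i + 1) mod m) (k - 1)" if "1 \<le> k" "k \<le> t - t1" for k
   proof -
    have "k \<le> 2 * m" "t1 + k \<le> t" using that le 2(1) by linarith+
    thus "after t1 (from_ccw h) k = share_front m R1v Rv yv ((i + (m - 1)) mod m) (k - 1)"
     "after t1 (from_cw h) k = share_back m Xv yv ((i + 1) mod m) (k - 1)"
     using share_streams[OF that(1)] by auto
   qed
  qed (use own_vectors in simp_all)
  finally have "sharing_act \<beta> 1 {0, 1} parity v c = Act (if t = t1 then [R i] else []) None
    (share_front m R1v Rv yv i (t - t1)) (share_back m Xv yv i (t - t1))"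
   using cs by (simp add: send_def drawn_def)
  moreover have "sact i t = Act (if t = t1 then [R i] else []) None
    (share_front m R1v Rv yv i (t - t1)) (share_back m Xv yv i (t - t1))"
   using 2 le i by (simp add: sact_def srt_def slt_def)
  ultimately show ?thesis by (simp only:)
 next
  case 3
  have si: "shared_inputs m j (yv i) (after t1 (from_cw h)) = map (\<lambda>k. yv ((k + (m - q)) mod m)) [0..<m]" if "q < m" "j = (q + i) mod m" for q j
   using share_streams(2) 3 that by (intro shared_inputs_ring[OF m3 im, where X = Xv]) auto
  have m0: "0 < m" using m3 by simp
  obtain q where q: "q < m" "length V = m" "\<And>k. k < m ==> V ! ((q + k) mod m) = Y k" "distinct V"
   using from_max_ring[OF Y_inj m0] unfolding V_def by metis
  have "(q + i) mod m < length V" using q(2) m0 by simp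
  hence "index_of V (x i) = (q + i) mod m"
   using index_of_nth[OF q(4), of "(q + i) mod m"] q(3)[OF im] Y_real[OF i] by simp
  hence "parity (shared_inputs m (index_of V (x i)) (y i) (after t1 (from_cw h))) = out"
   using si[OF q(1) refl] own_vectors(4) unfolding parity_def out_def by (simp only: sum_list_ring)
  moreover have "\<not> t < t1" "\<not> t < t1 + 2 * m" using 3 by simp_all
  ultimately have "sharing_act \<beta> 1 {0, 1} parity v c = Act [] (Some (Some out)) Silent Silent"
   using S priv_y[OF i] by (simp add: sharing_act_def Let_def)
  moreover have "sact i t = Act [] (Some (Some out)) Silent Silent"
   using 3 i t1 m3 by (simp add: sact_def srt_def slt_def)
  ultimately show ?thesis by (simp only:)
 qed
qed

end

end

lemma sharing_act_sact:
 assumes i: "1 \<le> i" "i < n" and c: "t = t1 ==> c = R i"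
 shows "sharing_act \<beta> 1 {0, 1} parity (trace_view n x pr sact i t) c = sact i t"
proof (cases "t \<le> t1 + 2 * m")
 case True
 show ?thesis
 proof (cases "m \<le> t")
  case mt: True
  show ?thesis
  proof (cases "t = t1")
   case True
   thus ?thesis using sharing_act_late[OF i \<open>t \<le> t1 + 2 * m\<close> mt] c by simp
  next
   case False
   have "sharing_act \<beta> 1 {0, 1} parity (trace_view n x pr sact i t) c = sharing_act \<beta> 1 {0, 1} parity (trace_view n x pr sact i t) (R i)"
    using False ring_size_h[OF i True] mt unfolding t1_def by (intro sharing_act_cell[of _ m]) simp_all
   thus ?thesis using sharing_act_late[OF i True mt] by simp
  qed
 qed (use sharing_act_early[OF i True] in auto)
next
 case False
 hence "decided (trace_hist n sact i t)"
  using i unfolding decided_trace by (intro exI[of _ "t1 + 2 * m"]) (auto simp: sact_def)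
 hence "sharing_act \<beta> 1 {0, 1} parity (trace_view n x pr sact i t) c = idle" by (simp add: sharing_act_def Let_def)
 thus ?thesis using False i t1 by (auto simp: sact_def srt_def slt_def idle_def)
qed

lemma replay_h:
 assumes "t \<le> m"
 shows "replay f (x 0) p0 (map snd (trace_hist n sact 0 t)) =
  map (\<lambda>s. (g s, Id (Y ((n - 1 + (m - s)) mod m)), Id (Y ((1 + s) mod m)))) [0..<t]"
proof -
 define ins where "ins = map snd (trace_hist n sact 0 t)"
 have "(Suc 0) mod n = 1" "(n - Suc 0) mod n = n - 1" using n3 by simp_all
 hence ins: "ins ! s = (Id (Y ((n - 1 + (m - s)) mod m)), Id (Y ((1 + s) mod m)))" if "s < t" for s
  using that assms n3 by (simp add: ins_def trace_hist_def sact_def srt_def slt_def)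
 have l: "length ins = t" by (simp add: ins_def)
 have "replay f (x 0) p0 ins = map (\<lambda>s. (g s, ins ! s)) [0..<length ins]"
 proof (rule replay_eq)
  fix s assume s: "s < length ins"
  hence "map (\<lambda>u. (g u, ins ! u)) [0..<s] = map (\<lambda>u. (g u, Id (Y ((n - 1 + (m - u)) mod m)), Id (Y ((1 + u) mod m)))) [0..<s]"
   using ins l by (intro map_cong) auto
  moreover have "s < m" using s l assms by simp
  ultimately show "g s = f (View (x 0) p0 (map (\<lambda>u. (g u, ins ! u)) [0..<s]))" using g_eq[of s] by (simp only:)
 qed
 also have "\<dots> = map (\<lambda>s. (g s, Id (Y ((n - 1 + (m - s)) mod m)), Id (Y ((1 + s) mod m)))) [0..<t]"
  using ins l by (intro map_cong) auto
 finally show ?thesis by (simp add: ins_def)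
qed

lemma cheat_early:
 assumes t: "t < m"
 shows "cheat f p0 z (trace_view n x pr sact 0 t) = sact 0 t"
proof -
 have n1: "1 mod m = 1" "1 < m" using m3 by simp_all
 have no: "\<not> (\<exists>k<t. to_cw (fst (trace_hist n sact 0 t ! k)) = from_cw (trace_hist n sact 0 t) 1)"
 proof
  assume "\<exists>k<t. to_cw (fst (trace_hist n sact 0 t ! k)) = from_cw (trace_hist n sact 0 t) 1"
  then obtain k where k: "k < t" "to_cw (sact 0 k) = from_cw (trace_hist n sact 0 t) 1" by (auto simp: fst_trace_hist)
  hence "to_cw (sact 0 k) = slt 1 0" using cheater_receives(2)[of 1 t] by simp
  hence "Y ((m - k) mod m) = Y 1" using k(1) t n1 by (simp add: sact_def srt_def slt_def)
  hence "(m - k) mod m = 1" using Y_eq[of "(m - k) mod m" 1] n1 by simp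
  thus False using k(1) t by (cases "k = 0") auto
 qed
 have "f (View (x 0) p0 (replay f (x 0) p0 (map snd (trace_hist n sact 0 t)))) = g t"
  using replay_h[of t] g_eq[OF t] t by simp
 hence "cheat f p0 z (trace_view n x pr sact 0 t) = Act [] (if t = 0 then Some (Some z) else None) (to_cw (g t)) (to_ccw (g t))"
  using no by (simp add: cheat_def Let_def)
 thus ?thesis using g_out[OF t] t by (simp add: sact_def srt_def slt_def)
qed

text \<open>Lists the entries on which the messages of step \<open>s\<close> depend. The bounds on
  \<open>k\<close> are such that agent \<open>0\<close> has already received these entries.\<close>

lemma share_front_zero_cong:
 assumes s: "s < 2 * m"
  and R1: "s + 1 = m ==> R1 0 = R1' 0"
  and R: "\<And>k. k \<le> s ==> k < dist2 m ==> R2 ((m - k) mod m) = R2' ((m - k) mod m)"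
  and y: "\<And>k. m + 1 + k \<le> s ==> yy ((m - k) mod m) = yy' ((m - k) mod m)"
 shows "share_front m R1 R2 yy 0 s = share_front m R1' R2' yy' 0 s"
proof -
 note d = dist2_bounds[OF m3]
 consider "s < m" | "s = m" | "m < s" by linarith
 thus ?thesis
 proof cases
  case 1
  have "s + 1 = m ==> R2 ((m - (dist2 m - 1)) mod m) = R2' ((m - (dist2 m - 1)) mod m)" using d by (intro R) linarith+
  thus ?thesis using 1 R[of s] R1 by (auto simp: share_front_def)
 next
  case 2
  thus ?thesis by (simp add: share_front_def)
 next
  case 3
  hence "m + 1 + (s - (m + 1)) \<le> s" by linarith
  thus ?thesis using 3 y[of "s - (m + 1)"] by (auto simp: share_front_def)
 qed
qed

lemma share_back_cong:
 assumes s: "s < 2 * m"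
  and X: "\<And>k. k \<le> s ==> k < m - 1 ==> X ((j + k) mod m) = X' ((j + k) mod m)"
  and y: "\<And>k. m + 1 + k \<le> s ==> yy ((j + k) mod m) = yy' ((j + k) mod m)"
 shows "share_back m X yy j s = share_back m X' yy' j s"
proof -
 note d = dist2_bounds[OF m3]
 consider "s < m" | "s = m" | "m < s" by linarith
 thus ?thesis
 proof cases
  case 1
  have "s + 1 = m ==> X ((j + (m - 2)) mod m) = X' ((j + (m - 2)) mod m)"
   "s + 1 = m ==> X ((j + (m - dist2 m - 1)) mod m) = X' ((j + (m - dist2 m - 1)) mod m)" using d by (intro X; linarith)+
  thus ?thesis using 1 X[of s] d by (auto simp: share_back_def)
 next
  case 2
  thus ?thesis by (simp add: share_back_def)
 next
  case 3
  hence "m + 1 + (s - (m + 1)) \<le> s" by linarith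
  thus ?thesis using 3 y[of "s - (m + 1)"] by (auto simp: share_back_def)
 qed
qed

lemma wrap_position:
 assumes "k \<le> m"
 shows "1 \<le> (m - k) mod m \<and> (m - k) mod m < n ==> n - (m - k) mod m \<le> k \<and> m - (m - k) mod m = k"
  and "1 \<le> (n + k) mod m \<and> (n + k) mod m < n ==> (n + k) mod m \<le> k"
proof -
 show "n - (m - k) mod m \<le> k \<and> m - (m - k) mod m = k" if "1 \<le> (m - k) mod m \<and> (m - k) mod m < n"
  using that assms nm by (cases "k = 0") auto
 show "(n + k) mod m \<le> k" if *: "1 \<le> (n + k) mod m \<and> (n + k) mod m < n"
 proof (cases "n + k < m")
  case True
  thus ?thesis using * by simp
 next
  case False
  thus ?thesis using assms nm by (cases "n + k - m < m") (auto simp: le_mod_geq)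
 qed
qed

text \<open>The table \<open>sact\<close> refers to random numbers and inputs of all agents, while
  \<open>cheat\<close> may use its view only. The point is that whatever the table requires at a
  step has arrived before: shares and inputs to be forwarded anyway, and the inputs that determine
  \<open>y0\<close> by step \<open>m - 1\<close>.\<close>

lemma cheat_late:
 assumes t: "m \<le> t"
 shows "cheat f p0 z (trace_view n x pr sact 0 t) = sact 0 t"
proof -
 define h where "h = trace_hist n sact 0 t"
 have n1: "1 mod m = 1" "1 < m" "t \<noteq> 0" using m3 t by auto
 have sent: "to_cw (fst (h ! k)) = Id (Y ((m - k) mod m))" if "k < m" for k
  using that t by (simp add: h_def fst_trace_hist sact_def srt_def)
 have first: "from_cw h 1 = Id (Y 1)" using cheater_receives(2)[of 1 t] n1 by (simp add: h_def slt_def)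
 have last: "to_cw (fst (h ! (m - 1))) = from_cw h 1" using sent[of "m - 1"] first n1 by simp
 have early: "to_cw (fst (h ! k)) \<noteq> from_cw h 1" if "k < m - 1" for k
 proof
  assume "to_cw (fst (h ! k)) = from_cw h 1"
  hence "Y ((m - k) mod m) = Y 1" using sent[of k] first that by simp
  hence "(m - k) mod m = 1" using Y_eq[of "(m - k) mod m" 1] n1 by simp
  thus False using that by (cases "k = 0") auto
 qed
 have ex: "\<exists>k<t. to_cw (fst (h ! k)) = from_cw h 1" using last t n1 by (intro exI[of _ "m - 1"]) auto
 have "(LEAST k. to_cw (fst (h ! k)) = from_cw h 1) = m - 1"
  using last early by (intro Least_equality) (auto simp: not_less[symmetric])
 hence size: "Suc (LEAST k. to_cw (fst (h ! k)) = from_cw h 1) = m" using n1 by simp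
 have in_cw: "from_cw h k = Id (Y (k mod m))" if "1 \<le> k" "k \<le> m" for k
 proof -
  have "k - 1 < m" "1 + (k - 1) = k" "k \<le> t" using that t by linarith+
  thus ?thesis using cheater_receives(2)[OF that(1)] by (simp only: h_def slt_def if_True)
 qed
 have own: "to_ccw (fst (h ! 0)) = Id (Y (n mod m))" using t n1 by (simp add: h_def fst_trace_hist sact_def slt_def)
 have real: "(LEAST k. 1 \<le> k \<and> from_cw h k = to_ccw (fst (h ! 0))) = n"
 proof (rule Least_equality)
  show "1 \<le> n \<and> from_cw h n = to_ccw (fst (h ! 0))" using in_cw[of n] own n3 nm by simp
 next
  fix k assume k: "1 \<le> k \<and> from_cw h k = to_ccw (fst (h ! 0))"
  show "n \<le> k"
  proof (rule ccontr)
   assume "\<not> n \<le> k"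
   hence "k < m" "Y k = Y (n mod m)" using in_cw[of k] own k nm by auto
   moreover have "n mod m < m" using m3 by simp
   ultimately have "k = n mod m" using Y_eq by blast
   thus False using k \<open>\<not> n \<le> k\<close> nm by (cases "n = m") auto
  qed
 qed
 have V: "from_max (map (\<lambda>k. id_of (to_cw (fst (h ! (m - 1 - k))))) [0..<m]) = V"
 proof -
  have "map (\<lambda>k. id_of (to_cw (fst (h ! (m - 1 - k))))) [0..<m] = map (\<lambda>k. Y ((1 + k) mod m)) [0..<m]"
  proof (rule map_cong[OF refl])
   fix k assume "k \<in> set [0..<m]"
   hence k: "m - 1 - k < m" "m - (m - 1 - k) = 1 + k" by auto
   thus "id_of (to_cw (fst (h ! (m - 1 - k)))) = Y ((1 + k) mod m)" using sent[OF k(1)] by (simp only: k(2) id_of.simps)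
  qed
  also have "\<dots> = rotate 1 (map Y [0..<m])" by (rule ring_list_rotate)
  finally have "map (\<lambda>k. id_of (to_cw (fst (h ! (m - 1 - k))))) [0..<m] = rotate 1 (map Y [0..<m])" .
  moreover have Yd: "distinct (map Y [0..<m])" "map Y [0..<m] \<noteq> []" using Y_inj m3 by (auto simp: distinct_map lessThan_atLeast0)
  ultimately show ?thesis using from_max_rotate[OF Yd, of 1] by (simp only: V_def)
 qed
 define R' where "R' k = the (share2 (from_ccw h (t1 + (n - k))))" for k
 define X' where "X' k = the (share1 (from_cw h (t1 + k)))" for k
 define y1 where "y1 = (if m + 1 < 2 * n then 0 else (z + (\<Sum>k\<in>{1..<n}. xor (R' k) (X' k))) mod 2)"
 define yf where "yf k = val (from_ccw h (t1 + (m + 1 + (n - k))))" for k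
 define yb where "yb k = val (from_cw h (t1 + (m + 1 + k)))" for k
 have c: "cheat f p0 z (trace_view n x pr sact 0 t) =
  (if t < t1 then Act [] None (Ids V) (Ids V)
   else if t < t1 + 2 * m then
    Act [] None (share_front m (fake_value n y1 R') (fake_value n 0 R') (fake_value n y1 yf) 0 (t - t1))
     (share_back m (fake_value n 0 X') (fake_value n y1 yb) n (t - t1))
   else Act [] None Silent Silent)"
  using ex n1(3) unfolding cheat_def Let_def trace_view_simps h_def[symmetric] size real V t1_def[symmetric]
   R'_def X'_def y1_def yf_def yb_def
  by (simp add: h_def)
 consider "t < t1" | "t1 \<le> t" "t < t1 + 2 * m" | "t1 + 2 * m \<le> t" by linarith
 thus ?thesis
 proof cases
  case 1
  thus ?thesis using c t n1 by (simp add: sact_def srt_def slt_def)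
 next
  case 3
  hence "\<not> t < t1" "\<not> t < t1 + 2 * m" "\<not> t < m" using t by linarith+
  thus ?thesis using c n1(3) by (simp add: sact_def srt_def slt_def)
 next
  case 2
  define s where "s = t - t1"
  have s: "t = t1 + s" "s < 2 * m" using 2 by (auto simp: s_def)
  have arr: "from_ccw h (t1 + k) = share_front m R1v Rv yv (n - 1) (k - 1)" "from_cw h (t1 + k) = share_back m Xv yv 1 (k - 1)"
   if "1 \<le> k" "k \<le> s" for k
  proof -
   have "1 \<le> t1 + k" "t1 + k \<le> t" "k \<le> 2 * m" using that s by linarith+
   thus "from_ccw h (t1 + k) = share_front m R1v Rv yv (n - 1) (k - 1)" "from_cw h (t1 + k) = share_back m Xv yv 1 (k - 1)"
    using cheater_receives[of "t1 + k" t] shares_in[OF that(1)] by (simp_all add: h_def)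
  qed
  have R': "R' k = R k" if k: "1 \<le> k" "k < n" "n - k \<le> s" "n - k < dist2 m" for k
  proof -
   have "1 \<le> n - k" using k by linarith
   have "share2 (share_front m R1v Rv yv (n - 1) (n - k - 1)) = Some (Rv ((n - 1 + (m - (n - k - 1))) mod m))"
    using share2_share_front[of "n - k - 1" m R1v Rv yv "n - 1"] k m3 by simp
   moreover have "n - 1 + (m - (n - k - 1)) = k + m" using k nm by linarith
   moreover have "(k + m) mod m = k" using k nm by simp
   ultimately show ?thesis using arr(1)[OF \<open>1 \<le> n - k\<close> k(3)] k by (simp add: R'_def Rv_def fake_value_def)
  qed
  have X': "X' k = xor (R k) (y k)" if k: "1 \<le> k" "k < n" "k \<le> s" "k < m - 1" for k
  proof -
   have "share1 (share_back m Xv yv 1 (k - 1)) = Some (Xv ((1 + (k - 1)) mod m))"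
    using k by (intro share1_share_back) linarith
   moreover have "1 + (k - 1) = k" "k mod m = k" using k nm by simp_all
   ultimately show ?thesis using arr(2)[OF k(1,3)] k by (simp add: X'_def Xv_def fake_value_def)
  qed
  \<comment> \<open>In the case of many fake agents \<open>n \<le> dist2 m\<close> holds, so both
    shares of each real agent pass agent \<open>0\<close> in time, and their \<open>xor\<close> is
    the input.\<close>
  have y1: "y1 = y0" if "m - 1 \<le> s"
  proof (cases "m + 1 < 2 * n")
   case False
   have "xor (R' k) (X' k) = y k" if k: "k \<in> {1..<n}" for k
   proof -
    have "n - k \<le> s" "n - k < dist2 m" "k \<le> s" "k < m - 1" using False k \<open>m - 1 \<le> s\<close> n3 by (auto simp: dist2_def)
    thus ?thesis using R'[of k] X'[of k] k by (simp flip: xor.assoc)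
   qed
   thus ?thesis using False by (simp add: y1_def y0_def)
  qed (simp add: y1_def y0_def)
  have yf: "yf k = y k" if k: "1 \<le> k" "k < n" "m + 1 + (n - k) \<le> s" for k
  proof -
   have "1 \<le> m + 1 + (n - k)" "\<not> m + 1 + (n - k) - 1 < m" "m + 1 + (n - k) - 1 \<noteq> m" "m + 1 + (n - k) - 1 - (m + 1) = n - k - 1"
    using k by linarith+
   hence "yf k = yv ((n - 1 + (m - (n - k - 1))) mod m)"
    using arr(1)[OF _ k(3)] unfolding yf_def by (simp add: share_front_def)
   moreover have "n - 1 + (m - (n - k - 1)) = k + m" using k nm by linarith
   moreover have "(k + m) mod m = k" using k nm by simp
   ultimately show ?thesis using k by (simp add: yv_def fake_value_def)
  qed
  have yb: "yb k = y k" if k: "1 \<le> k" "k < n" "m + 1 + k \<le> s" for k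
  proof -
   have "1 \<le> m + 1 + k" "\<not> m + 1 + k - 1 < m" "m + 1 + k - 1 \<noteq> m" "m + 1 + k - 1 - (m + 1) = k - 1"
    using k by linarith+
   hence "yb k = yv ((1 + (k - 1)) mod m)"
    using arr(2)[OF _ k(3)] unfolding yb_def by (simp add: share_back_def)
   moreover have "1 + (k - 1) = k" "k mod m = k" using k nm by simp_all
   ultimately show ?thesis using k by (simp add: yv_def fake_value_def)
  qed
  have "share_front m (fake_value n y1 R') (fake_value n 0 R') (fake_value n y1 yf) 0 s = share_front m R1v Rv yv 0 s"
  proof (rule share_front_zero_cong[OF s(2)])
   show "fake_value n y1 R' 0 = R1v 0" if "s + 1 = m" using y1 that by (simp add: fake_value_def R1v_def)
   show "fake_value n 0 R' ((m - k) mod m) = Rv ((m - k) mod m)" if k: "k \<le> s" "k < dist2 m" for k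
   proof (cases "1 \<le> (m - k) mod m \<and> (m - k) mod m < n")
    case True
    have "k \<le> m" using k dist2_bounds[OF m3] by linarith
    thus ?thesis using R'[of "(m - k) mod m"] wrap_position(1)[OF _ True] True k by (simp add: fake_value_def Rv_def)
   qed (auto simp: fake_value_def Rv_def)
   show "fake_value n y1 yf ((m - k) mod m) = yv ((m - k) mod m)" if k: "m + 1 + k \<le> s" for k
   proof (cases "1 \<le> (m - k) mod m \<and> (m - k) mod m < n")
    case True
    have "k \<le> m" using k s by linarith
    hence "m + 1 + (n - (m - k) mod m) \<le> s" using wrap_position(1)[OF _ True] k by linarith
    thus ?thesis using yf[of "(m - k) mod m"] True by (simp add: fake_value_def yv_def)
   next
    case False
    have "y1 = y0" using k by (intro y1) linarith
    thus ?thesis using False by (simp add: fake_value_def yv_def)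
   qed
  qed
  moreover have "share_back m (fake_value n 0 X') (fake_value n y1 yb) n s = share_back m Xv yv n s"
  proof (rule share_back_cong[OF s(2)])
   show "fake_value n 0 X' ((n + k) mod m) = Xv ((n + k) mod m)" if k: "k \<le> s" "k < m - 1" for k
   proof (cases "1 \<le> (n + k) mod m \<and> (n + k) mod m < n")
    case True
    have "k \<le> m" using k by linarith
    hence "(n + k) mod m \<le> k" using wrap_position(2)[OF _ True] by simp
    thus ?thesis using X'[of "(n + k) mod m"] True k by (simp add: fake_value_def Xv_def)
   qed (auto simp: fake_value_def Xv_def)
   show "fake_value n y1 yb ((n + k) mod m) = yv ((n + k) mod m)" if k: "m + 1 + k \<le> s" for k
   proof (cases "1 \<le> (n + k) mod m \<and> (n + k) mod m < n")
    case True
    have "k \<le> m" using k s by linarith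
    hence "m + 1 + (n + k) mod m \<le> s" using wrap_position(2)[OF _ True] k by linarith
    thus ?thesis using yb[of "(n + k) mod m"] True by (simp add: fake_value_def yv_def)
   next
    case False
    have "y1 = y0" using k by (intro y1) linarith
    thus ?thesis using False by (simp add: fake_value_def yv_def)
   qed
  qed
  moreover have "\<not> t < t1" "\<not> t < m" "t < t1 + 2 * m" using 2 t by linarith+
  ultimately show ?thesis using c s_def n1(3) by (simp add: sact_def srt_def slt_def)
 qed
qed

lemma cheat_sact: "cheat f p0 z (trace_view n x pr sact 0 t) = sact 0 t"
 using cheat_early cheat_late by (meson not_le)

lemma sharing_outputs:
 assumes "t1 + 2 * m < T"
 shows "final_output (trace_view n x pr sact 0 T) = Some z"
  and "1 \<le> i ==> i < n ==> final_output (trace_view n x pr sact i T) = Some out"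
 unfolding final_output_trace using assms by (auto simp: sact_def intro: exI[of _ 0] exI[of _ "t1 + 2 * m"])

end

section \<open>Uniform random tapes\<close>

definition lists_of :: "nat => 'a set => 'a list set" where
 "lists_of n C = {xs. length xs = n \<and> set xs \<subseteq> C}"

lemma lists_of_0 [simp]: "lists_of 0 C = {[]}"
 by (auto simp: lists_of_def)

lemma lists_of_Suc: "lists_of (Suc n) C = (\<lambda>(c, xs). c # xs) ` (C \<times> lists_of n C)"
 by (fastforce simp: lists_of_def length_Suc_conv)

lemma lists_of_snoc: "lists_of (Suc n) C = (\<lambda>(xs, c). xs @ [c]) ` (lists_of n C \<times> C)"
proof -
 have "xs \<in> (\<lambda>(xs, c). xs @ [c]) ` (lists_of n C \<times> C)" if "xs \<in> lists_of (Suc n) C" for xs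
  using that by (cases xs rule: rev_cases) (auto simp: lists_of_def)
 thus ?thesis by (auto simp: lists_of_def)
qed

lemma card_lists_of: "finite C ==> card (lists_of n C) = card C ^ n"
 using card_lists_length_eq[of C n] by (simp add: lists_of_def conj_commute)

lemma finite_lists_of: "finite C ==> finite (lists_of n C)"
 using finite_lists_length_eq[of C n] by (simp add: lists_of_def conj_commute)

lemma lists_of_nonempty: "C \<noteq> {} ==> lists_of n C \<noteq> {}"
 by (induction n) (auto simp: lists_of_Suc)

lemma bind_uniform:
 assumes "finite A" "A \<noteq> {}" "finite B" "B \<noteq> {}" "inj_on (\<lambda>(a, b). f a b) (A \<times> B)"
 shows "bind_pmf (pmf_of_set A) (\<lambda>a. map_pmf (f a) (pmf_of_set B)) = pmf_of_set ((\<lambda>(a, b). f a b) ` (A \<times> B))"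
proof -
 have "pair_pmf (pmf_of_set A) (pmf_of_set B) = pmf_of_set (A \<times> B)"
 proof (rule pmf_eqI)
  fix ab
  show "pmf (pair_pmf (pmf_of_set A) (pmf_of_set B)) ab = pmf (pmf_of_set (A \<times> B)) ab"
   using assms(1-4) by (cases ab) (simp add: pmf_pair indicator_def)
 qed
 moreover have "bind_pmf (pmf_of_set A) (\<lambda>a. map_pmf (f a) (pmf_of_set B)) = map_pmf (\<lambda>(a, b). f a b) (pair_pmf (pmf_of_set A) (pmf_of_set B))"
  by (simp add: pair_pmf_def map_pmf_def bind_assoc_pmf bind_return_pmf)
 ultimately show ?thesis using assms by (simp add: map_pmf_of_set_inj)
qed

lemma independent_uniform:
 assumes "finite C" "C \<noteq> {}"
 shows "independent (replicate n (pmf_of_set C)) = pmf_of_set (lists_of n C)"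
proof (induction n)
 case (Suc n)
 have "bind_pmf (pmf_of_set C) (\<lambda>a. map_pmf ((#) a) (pmf_of_set (lists_of n C)))
  = pmf_of_set ((\<lambda>(a, b). a # b) ` (C \<times> lists_of n C))"
  using assms by (intro bind_uniform finite_lists_of lists_of_nonempty) (auto simp: inj_on_def)
 thus ?case by (simp add: Suc lists_of_Suc)
qed (simp add: pmf_of_set_singleton)

lemma independent_map:
 "independent (map (\<lambda>i. map_pmf (g i) p) is) = map_pmf (\<lambda>cs. map2 g is cs) (independent (replicate (length is) p))"
 by (induction "is") (simp_all add: map_bind_pmf bind_map_pmf pmf.map_comp o_def)

lemma map2_nth: "length xs = n ==> map2 g [0..<n] xs = map (\<lambda>i. g i (xs ! i)) [0..<n]"
 by (rule nth_equalityI) auto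

lemma finite_independent: "(\<And>p. p \<in> set ps ==> finite (set_pmf p)) ==> finite (set_pmf (independent ps))"
 by (induction ps) auto

section \<open>Executions driven by a tape\<close>

lemma length_deliver [simp]: "length (deliver vs as) = length vs"
 by (simp add: deliver_def Let_def)

lemma nth_deliver:
 "i < length vs ==> deliver vs as ! i = View (own_id (vs ! i)) (priv (vs ! i)) (hist (vs ! i) @
   [(as ! i, to_cw (as ! ((i + length vs - 1) mod length vs)), to_ccw (as ! ((i + 1) mod length vs)))])"
 by (simp add: deliver_def Let_def)

lemma exec_Suc': "exec D A (Suc k) vs = bind_pmf (exec D A k vs) (one_round D A)"
proof (induction k arbitrary: vs)
 case (Suc k)
 have "exec D A (Suc (Suc k)) vs = bind_pmf (one_round D A vs) (\<lambda>w. bind_pmf (exec D A k w) (one_round D A))"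
  unfolding exec.simps(2)[of D A "Suc k"] by (intro bind_pmf_cong refl Suc)
 thus ?case by (simp add: bind_assoc_pmf)
next
 case 0
 have "exec D A 0 = return_pmf" by (rule ext) simp
 thus ?case by (simp add: bind_return_pmf bind_return_pmf')
qed

definition start :: "nat => (nat => nat) => (nat => 'p) => 'p view list" where
 "start n x p = map (\<lambda>i. View (x i) (p i) []) [0..<n]"

primrec conf ::
  "(nat => 'p view => 'c => action) => 'p view list => (nat => nat => 'c) => nat => 'p view list" where
 "conf s vs cell 0 = vs"
| "conf s vs cell (Suc t) = deliver (conf s vs cell t) (map (\<lambda>i. s i (conf s vs cell t ! i) (cell i t)) [0..<length vs])"

definition run_act ::
  "(nat => 'p view => 'c => action) => nat => (nat => nat) => (nat => 'p) => (nat => nat => 'c) => nat => nat => action" where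
 "run_act s n x p cell i t = s i (conf s (start n x p) cell t ! i) (cell i t)"

lemma length_start [simp]: "length (start n x p) = n"
 by (simp add: start_def)

lemma length_conf [simp]: "length (conf s vs cell t) = length vs"
 by (induction t) simp_all

lemma conf_run:
 assumes "0 < n"
 shows "conf s (start n x p) cell t = map (\<lambda>i. trace_view n x p (run_act s n x p cell) i t) [0..<n]"
proof (induction t)
 case 0
 thus ?case by (simp add: start_def trace_view_def trace_hist_def)
next
 case (Suc t)
 let ?a = "run_act s n x p cell"
 let ?as = "map (\<lambda>i. s i (conf s (start n x p) cell t ! i) (cell i t)) [0..<n]"
 have a: "?as ! i = ?a i t" if "i < n" for i using that by (simp add: run_act_def)
 show ?case
 proof (rule nth_equalityI)
  fix i assume "i < length (conf s (start n x p) cell (Suc t))"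
  hence i: "i < n" by simp
  moreover have "(i + n - 1) mod n < n" "(i + 1) mod n < n" using assms by (auto intro: mod_less_divisor)
  ultimately have "conf s (start n x p) cell (Suc t) ! i = View (own_id (conf s (start n x p) cell t ! i)) (priv (conf s (start n x p) cell t ! i))
   (hist (conf s (start n x p) cell t ! i) @ [(?a i t, to_cw (?a ((i + n - 1) mod n) t), to_ccw (?a ((i + 1) mod n) t))])"
   unfolding conf.simps length_start by (subst nth_deliver) (simp_all only: a length_conf length_start)
  thus "conf s (start n x p) cell (Suc t) ! i = map (\<lambda>i. trace_view n x p ?a i (Suc t)) [0..<n] ! i"
   unfolding Suc using i by (simp add: trace_view_def trace_hist_def)
 qed simp
qed

lemma run_act_eq:
 "i < n ==> run_act s n x p cell i t = s i (trace_view n x p (run_act s n x p cell) i t) (cell i t)"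
 by (subst (1) run_act_def) (simp add: conf_run)

lemma run_act_unique:
 assumes "\<And>i t. i < n ==> act i t = s i (trace_view n x p act i t) (cell i t)" "i < n"
 shows "run_act s n x p cell i t = act i t"
 using assms(2)
proof (induction t arbitrary: i rule: less_induct)
 case (less t)
 have "trace_view n x p (run_act s n x p cell) i t = trace_view n x p act i t"
  unfolding trace_view_def trace_hist_def
  using less by (auto intro!: less.IH mod_less_divisor)
 thus ?case using assms(1)[OF less.prems] run_act_eq[OF less.prems] by metis
qed

lemma conf_cong: "(\<And>i s. i < length vs ==> s < t ==> cell i s = cell' i s) ==> conf st vs cell t = conf st vs cell' t"
 by (induction t) (auto intro!: arg_cong2[of _ _ _ _ deliver])

text \<open>\<open>e ! t ! i\<close> is the cell of agent \<open>i\<close> in round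
  \<open>t\<close>.\<close>

definition tapes :: "nat => nat => 'c set => 'c list list set" where
 "tapes n k C = lists_of k (lists_of n C)"

lemma finite_tapes: "finite C ==> finite (tapes n k C)"
 by (simp add: tapes_def finite_lists_of)

lemma tapes_nonempty: "C \<noteq> {} ==> tapes n k C \<noteq> {}"
 by (simp add: tapes_def lists_of_nonempty)

lemma hd_map_tl: "vs \<noteq> [] ==> f (hd vs) # map g (tl vs) = map (\<lambda>i. (if i = 0 then f else g) (vs ! i)) [0..<length vs]"
 by (cases vs) (auto intro!: nth_equalityI simp: nth_Cons' simp del: upt_Suc)

text \<open>A cell is drawn for each agent in each round, whether it is read or not, so that a whole
  run becomes a function of one uniform tape. A set of cells serves the rounds below a horizon only,
  whence the restriction to histories shorter than \<open>k\<close>.\<close>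

lemma exec_tape:
 assumes C: "finite C" "C \<noteq> {}" and n: "0 < n"
  and D: "\<And>v. length (hist v) < k ==> D v = map_pmf (s 0 v) (pmf_of_set C)"
  and A: "\<And>v i. length (hist v) < k ==> 0 < i ==> A v = map_pmf (s i v) (pmf_of_set C)"
 shows "exec D A k (start n x p) = map_pmf (\<lambda>e. conf s (start n x p) (\<lambda>i t. e ! t ! i) k) (pmf_of_set (tapes n k C))"
 using D A
proof (induction k)
 case 0
 thus ?case by (simp add: tapes_def pmf_of_set_singleton)
next
 case (Suc k)
 let ?c = "\<lambda>e j. conf s (start n x p) (\<lambda>i t. e ! t ! i) j"
 have "one_round D A (?c e k) = map_pmf (\<lambda>row. ?c (e @ [row]) (Suc k)) (pmf_of_set (lists_of n C))" if e: "e \<in> tapes n k C" for e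
 proof -
  define ws where "ws = ?c e k"
  have l: "length ws = n" "length e = k" using e by (simp_all add: ws_def tapes_def lists_of_def)
  have "length (hist (ws ! i)) = k" if "i < n" for i using that n by (simp add: ws_def conf_run)
  hence m: "D (hd ws) # map A (tl ws) = map (\<lambda>i. map_pmf (s i (ws ! i)) (pmf_of_set C)) [0..<n]"
   using Suc.prems l n by (subst hd_map_tl) auto
  have c: "?c (e @ [row]) k = ws" for row
   unfolding ws_def using l by (intro conf_cong) (simp add: nth_append)
  have e: "(e @ [row]) ! k = row" for row using l(2) by (simp add: nth_append)
  have "one_round D A ws = map_pmf (\<lambda>row. deliver ws (map (\<lambda>i. s i (ws ! i) (row ! i)) [0..<n])) (pmf_of_set (lists_of n C))"
  proof -
   have "map2 (\<lambda>i. s i (ws ! i)) [0..<n] row = map (\<lambda>i. s i (ws ! i) (row ! i)) [0..<n]"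
    if "row \<in> set_pmf (pmf_of_set (lists_of n C))" for row
    using that set_pmf_of_set[OF lists_of_nonempty[OF C(2)] finite_lists_of[OF C(1)]]
    by (intro map2_nth) (auto simp: lists_of_def)
   thus ?thesis
    unfolding one_round_def m independent_map pmf.map_comp o_def length_upt diff_zero independent_uniform[OF C]
    by (intro map_pmf_cong refl) simp
  qed
  also have "\<dots> = map_pmf (\<lambda>row. ?c (e @ [row]) (Suc k)) (pmf_of_set (lists_of n C))"
   by (simp only: conf.simps c e length_start)
  finally show ?thesis by (simp add: ws_def)
 qed
 moreover have "exec D A k (start n x p) = map_pmf (\<lambda>e. ?c e k) (pmf_of_set (tapes n k C))"
  using Suc by simp
 ultimately have "exec D A (Suc k) (start n x p) =
   bind_pmf (pmf_of_set (tapes n k C)) (\<lambda>e. map_pmf (\<lambda>row. ?c (e @ [row]) (Suc k)) (pmf_of_set (lists_of n C)))"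
  unfolding exec_Suc' using set_pmf_of_set[OF tapes_nonempty[OF C(2)] finite_tapes[OF C(1)]]
  by (simp only: bind_map_pmf) (intro bind_pmf_cong refl, simp)
 also have "\<dots> = map_pmf (\<lambda>e. ?c e (Suc k)) (bind_pmf (pmf_of_set (tapes n k C)) (\<lambda>e. map_pmf (\<lambda>row. e @ [row]) (pmf_of_set (lists_of n C))))"
  by (simp only: map_bind_pmf pmf.map_comp o_def)
 also have "bind_pmf (pmf_of_set (tapes n k C)) (\<lambda>e. map_pmf (\<lambda>row. e @ [row]) (pmf_of_set (lists_of n C))) = pmf_of_set (tapes n (Suc k) C)"
  unfolding tapes_def lists_of_snoc[of k]
  using C by (intro bind_uniform finite_lists_of lists_of_nonempty) (auto simp: inj_on_def)
 finally show ?case .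
qed

section \<open>Expectations\<close>

abbreviation "expect M \<equiv> measure_pmf.expectation M"

lemma expect_bind:
 fixes g :: "'a => real"
 assumes "\<And>x. 0 \<le> g x \<and> g x \<le> 1"
 shows "expect (bind_pmf M K) g = expect M (\<lambda>x. expect (K x) g)"
 unfolding measure_pmf_bind
 using assms measurable_measure_pmf[of K] by (intro integral_bind[where K = "count_space UNIV" and B = 1 and B' = 1])
  (auto simp: measure_pmf.emeasure_space_1 abs_le_iff intro: order_trans[of _ 0] measure_pmf.finite_measure_axioms)

lemma expect_cong: "(\<And>x. x \<in> set_pmf M ==> f x = g x) ==> expect M f = expect M (g :: 'a => real)"
 by (intro integral_cong_AE) (auto simp: AE_measure_pmf_iff)

lemma expect_range:
 fixes g :: "'a => real"
 assumes "\<And>x. 0 \<le> g x \<and> g x \<le> 1"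
 shows "0 \<le> expect M g \<and> expect M g \<le> 1"
 using assms by (intro conjI Bochner_Integration.integral_nonneg measure_pmf.integral_le_const measure_pmf.integrable_const_bound[where B = 1])
  (auto simp: abs_le_iff intro: order_trans[of _ 0])

lemma expect_finite:
 fixes g :: "'a => real"
 assumes "finite (set_pmf M)"
 shows "expect M g = (\<Sum>x\<in>set_pmf M. pmf M x * g x)"
 using assms by (subst integral_measure_pmf[of "set_pmf M"]) auto

lemma expect_attained:
 fixes \<psi> :: "'a => real"
 assumes "integrable (measure_pmf M) \<psi>"
 shows "\<exists>a\<in>set_pmf M. expect M \<psi> \<le> \<psi> a"
proof (rule ccontr)
 assume "\<not> ?thesis"
 hence "AE a in measure_pmf M. \<psi> a < expect M \<psi>" by (auto simp: AE_measure_pmf_iff)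
 thus False using measure_pmf.expectation_less[OF assms] by blast
qed

text \<open>The factor removes the normalisation of the conditional distribution and leaves an
  indicator.\<close>

lemma expect_cond:
 fixes g :: "'b => real"
 assumes "finite (set_pmf M)" "set_pmf M \<inter> S \<noteq> {}" "\<And>x. 0 \<le> g x \<and> g x \<le> 1"
 shows "measure_pmf.prob M S * expect (bind_pmf (cond_pmf M S) K) g = expect M (\<lambda>x. if x \<in> S then expect (K x) g else 0)"
  and "0 < measure_pmf.prob M S"
proof -
 show pos: "0 < measure_pmf.prob M S"
  using assms(2) by (meson measure_pmf_posI disjoint_iff)
 have "expect (bind_pmf (cond_pmf M S) K) g = (\<Sum>x\<in>set_pmf M \<inter> S. pmf M x / measure_pmf.prob M S * expect (K x) g)"
  using assms by (subst expect_bind) (auto simp: expect_finite pmf_cond set_cond_pmf)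
 hence "measure_pmf.prob M S * expect (bind_pmf (cond_pmf M S) K) g = (\<Sum>x\<in>set_pmf M \<inter> S. pmf M x * expect (K x) g)"
  using pos by (simp add: sum_distrib_left field_simps)
 also have "\<dots> = (\<Sum>x\<in>set_pmf M. pmf M x * (if x \<in> S then expect (K x) g else 0))"
  using assms(1) by (simp add: sum.inter_restrict if_distrib cong: if_cong)
 finally show "measure_pmf.prob M S * expect (bind_pmf (cond_pmf M S) K) g = expect M (\<lambda>x. if x \<in> S then expect (K x) g else 0)"
  using assms(1) by (simp add: expect_finite)
qed

lemma exec_add: "exec D A (j + k) vs = bind_pmf (exec D A j vs) (exec D A k)"
 by (induction j arbitrary: vs) (auto simp: bind_return_pmf bind_assoc_pmf intro!: bind_pmf_cong)

lemma one_round_hd: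
 assumes "w \<in> set_pmf (one_round D A vs)" "vs \<noteq> []"
 shows "length w = length vs" "\<exists>e. hd w = View (own_id (hd vs)) (priv (hd vs)) (hist (hd vs) @ [e])"
proof -
 obtain as where w: "w = deliver vs as" using assms(1) by (auto simp: one_round_def)
 thus "length w = length vs" by simp
 hence "hd w = w ! 0" "hd vs = vs ! 0" using assms(2) by (auto intro: hd_conv_nth)
 thus "\<exists>e. hd w = View (own_id (hd vs)) (priv (hd vs)) (hist (hd vs) @ [e])" using w assms(2) by (simp add: nth_deliver)
qed

definition cut :: "nat => 'p view => 'p view" where
 "cut r v = View (own_id v) (priv v) (take r (hist v))"

lemma exec_hd:
 assumes "w \<in> set_pmf (exec D A k vs)" "vs \<noteq> []"
 shows "length w = length vs" "length (hist (hd w)) = length (hist (hd vs)) + k" "cut (length (hist (hd vs))) (hd w) = hd vs"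
proof -
 have "length w = length vs \<and> (\<exists>es. length es = k \<and> hd w = View (own_id (hd vs)) (priv (hd vs)) (hist (hd vs) @ es))"
  using assms
 proof (induction k arbitrary: vs)
  case (Suc k)
  then obtain u where u: "u \<in> set_pmf (one_round D A vs)" "w \<in> set_pmf (exec D A k u)" by auto
  note h = one_round_hd[OF u(1) Suc.prems(2)]
  hence "u \<noteq> []" using Suc.prems(2) by auto
  from Suc.IH[OF u(2) this] obtain es where
   "length w = length u" "length es = k" "hd w = View (own_id (hd u)) (priv (hd u)) (hist (hd u) @ es)" by blast
  moreover obtain e where "hd u = View (own_id (hd vs)) (priv (hd vs)) (hist (hd vs) @ [e])" using h(2) by blast
  ultimately show ?case using h(1) by (auto intro!: exI[of _ "e # es"])
 qed simp
 thus "length w = length vs" "length (hist (hd w)) = length (hist (hd vs)) + k" "cut (length (hist (hd vs))) (hd w) = hd vs"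
  by (auto simp: cut_def)
qed

lemma exec_cong:
 fixes D D' A :: "'p strategy"
 assumes "vs \<noteq> []" "\<And>v. length (hist (hd vs)) \<le> length (hist v) ==> length (hist v) < length (hist (hd vs)) + k ==> D v = D' v"
 shows "exec D A k vs = exec D' A k vs"
 using assms
proof (induction k arbitrary: vs)
 case (Suc k)
 have "D (hd vs) = D' (hd vs)" using Suc.prems(2) by simp
 hence o: "one_round D A vs = one_round D' A vs" by (simp add: one_round_def)
 have "exec D A k u = exec D' A k u" if u: "u \<in> set_pmf (one_round D' A vs)" for u
 proof (rule Suc.IH)
  note h = one_round_hd[OF u Suc.prems(1)]
  thus "u \<noteq> []" using Suc.prems(1) by auto
  fix v :: "'p view" assume "length (hist (hd u)) \<le> length (hist v)" "length (hist v) < length (hist (hd u)) + k"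
  thus "D v = D' v" using h(2) by (intro Suc.prems(2)) auto
 qed
 thus ?case by (auto simp: o intro: bind_pmf_cong)
qed simp

lemma finite_exec: "(\<And>v. finite (set_pmf (D v))) ==> (\<And>v. finite (set_pmf (A v))) ==> finite (set_pmf (exec D A k vs))"
 by (induction k arbitrary: vs) (auto simp: one_round_def intro!: finite_UN_I finite_imageI finite_independent)

section \<open>Deterministic deviations suffice\<close>

definition play :: "'p strategy => 'p view list => action => 'p view list pmf" where
 "play A vs b = map_pmf (\<lambda>as. deliver vs (b # as)) (independent (map A (tl vs)))"

lemma one_round_play: "one_round D A vs = bind_pmf (D (hd vs)) (play A vs)"
 by (simp add: one_round_def play_def[abs_def] map_bind_pmf pmf.map_comp o_def)

text \<open>An average over actions is at most its value at some action of the support. The choice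
  may depend on the view of agent \<open>0\<close> only, so all configurations with the same view
  are pooled in \<open>\<psi>\<close> before it is made. Staying in the support of \<open>D\<close>
  preserves \<open>no_collision\<close>.\<close>

lemma deterministic_deviation:
 fixes g :: "'p view list => real"
 assumes "finite (set_pmf M)" "\<And>v. finite (set_pmf (A v))" "\<And>w. 0 \<le> g w \<and> g w \<le> 1"
  and "\<And>vs. vs \<in> set_pmf M ==> vs \<noteq> [] \<and> length (hist (hd vs)) = L"
 shows "\<exists>f. (\<forall>v. f v \<in> set_pmf (D v))
  \<and> expect (bind_pmf M (exec D A k)) g \<le> expect (bind_pmf M (exec (\<lambda>v. return_pmf (f v)) A k)) g"
 using assms(1,4)
proof (induction k arbitrary: M L)
 case 0
 have "\<forall>v. (SOME a. a \<in> set_pmf (D v)) \<in> set_pmf (D v)"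
  using set_pmf_not_empty by (metis some_in_eq)
 moreover have "exec D A 0 = return_pmf" "exec D' A 0 = return_pmf" for D' by auto
 ultimately show ?case by (intro exI[of _ "\<lambda>v. SOME a. a \<in> set_pmf (D v)"]) (simp add: bind_return_pmf')
next
 case (Suc k)
 define \<phi> where "\<phi> vs b = expect (bind_pmf (play A vs b) (exec D A k)) g" for vs b
 define \<psi> where "\<psi> v b = (\<Sum>vs\<in>{vs\<in>set_pmf M. hd vs = v}. pmf M vs * \<phi> vs b)" for v b
 have \<phi>: "0 \<le> \<phi> vs b \<and> \<phi> vs b \<le> 1" for vs b unfolding \<phi>_def by (rule expect_range[OF assms(3)])
 have i\<phi>: "integrable (measure_pmf (D v)) (\<phi> vs)" for v vs
  using \<phi> by (intro measure_pmf.integrable_const_bound[where B = 1]) auto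
 have "\<exists>b\<in>set_pmf (D v). expect (D v) (\<psi> v) \<le> \<psi> v b" for v
  unfolding \<psi>_def by (intro expect_attained Bochner_Integration.integrable_sum integrable_mult_right i\<phi>)
 then obtain f1 where f1: "\<And>v. f1 v \<in> set_pmf (D v)" "\<And>v. expect (D v) (\<psi> v) \<le> \<psi> v (f1 v)" by metis
 define M' where "M' = bind_pmf M (\<lambda>vs. play A vs (f1 (hd vs)))"
 have fin: "finite (set_pmf M')"
  using Suc.prems(1) assms(2) by (auto simp: M'_def play_def intro!: finite_UN_I finite_imageI finite_independent)
 have supp: "w \<noteq> [] \<and> length (hist (hd w)) = Suc L" if w: "w \<in> set_pmf M'" for w
 proof -
  obtain vs where vs: "vs \<in> set_pmf M" "w \<in> set_pmf (play A vs (f1 (hd vs)))" using w by (auto simp: M'_def)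
  hence "w \<in> set_pmf (one_round D A vs)" using f1(1) by (auto simp: one_round_play)
  from one_round_hd[OF this] show ?thesis using Suc.prems(2)[OF vs(1)] by auto
 qed
 have by_view: "(\<Sum>vs\<in>set_pmf M. pmf M vs * F (hd vs) vs) = (\<Sum>v\<in>hd ` set_pmf M. \<Sum>vs\<in>{vs\<in>set_pmf M. hd vs = v}. pmf M vs * F v vs)"
  for F :: "'p view => 'p view list => real"
  unfolding sum.image_gen[OF Suc.prems(1), of _ hd] by (intro sum.cong refl) auto
 have "expect (bind_pmf M (exec D A (Suc k))) g = (\<Sum>vs\<in>set_pmf M. pmf M vs * expect (D (hd vs)) (\<phi> vs))"
  using Suc.prems(1) by (simp add: expect_bind[OF assms(3)] one_round_play bind_assoc_pmf \<phi>_def[abs_def] expect_finite[of M])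
 also have "\<dots> = (\<Sum>v\<in>hd ` set_pmf M. expect (D v) (\<psi> v))"
  unfolding by_view[of "\<lambda>v vs. expect (D v) (\<phi> vs)"] \<psi>_def using i\<phi> by (intro sum.cong refl) (simp add: Bochner_Integration.integral_sum)
 also have "\<dots> \<le> (\<Sum>v\<in>hd ` set_pmf M. \<psi> v (f1 v))" by (intro sum_mono f1)
 also have "\<dots> = (\<Sum>vs\<in>set_pmf M. pmf M vs * \<phi> vs (f1 (hd vs)))" unfolding by_view[of "\<lambda>v vs. \<phi> vs (f1 v)"] \<psi>_def ..
 also have "\<dots> = expect (bind_pmf M' (exec D A k)) g"
  using Suc.prems(1) by (simp add: M'_def bind_assoc_pmf expect_bind[OF assms(3)] \<phi>_def expect_finite[of M])
 finally have le: "expect (bind_pmf M (exec D A (Suc k))) g \<le> expect (bind_pmf M' (exec D A k)) g" .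
 obtain f2 where f2: "\<And>v. f2 v \<in> set_pmf (D v)"
  "expect (bind_pmf M' (exec D A k)) g \<le> expect (bind_pmf M' (exec (\<lambda>v. return_pmf (f2 v)) A k)) g"
  using Suc.IH[OF fin supp] by blast
 \<comment> \<open>All configurations of \<open>M\<close> have history length \<open>L\<close> and
   all later ones a greater length, so the length tells which of the two choices is meant.\<close>
 define f where "f v = (if length (hist v) = L then f1 v else f2 v)" for v
 have "exec (\<lambda>v. return_pmf (f v)) A (Suc k) vs = bind_pmf (play A vs (f1 (hd vs))) (exec (\<lambda>v. return_pmf (f2 v)) A k)"
  if vs: "vs \<in> set_pmf M" for vs
 proof -
  have "one_round (\<lambda>v. return_pmf (f v)) A vs = play A vs (f1 (hd vs))"
   using Suc.prems(2)[OF vs] by (simp add: one_round_play bind_return_pmf f_def)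
  moreover have "exec (\<lambda>v. return_pmf (f v)) A k u = exec (\<lambda>v. return_pmf (f2 v)) A k u"
   if u: "u \<in> set_pmf (play A vs (f1 (hd vs)))" for u
  proof (rule exec_cong)
   have "u \<in> set_pmf M'" using u vs by (auto simp: M'_def)
   note u' = supp[OF this]
   thus "u \<noteq> []" by simp
   show "return_pmf (f v) = return_pmf (f2 v)" if "length (hist (hd u)) \<le> length (hist v)" for v
    using that u' by (simp add: f_def)
  qed
  ultimately show ?thesis by (auto intro: bind_pmf_cong)
 qed
 hence "bind_pmf M (exec (\<lambda>v. return_pmf (f v)) A (Suc k)) = bind_pmf M' (exec (\<lambda>v. return_pmf (f2 v)) A k)"
  unfolding M'_def bind_assoc_pmf by (intro bind_pmf_cong refl)
 moreover have "f v \<in> set_pmf (D v)" for v using f1(1) f2(1) by (simp add: f_def)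
 ultimately show ?case using order_trans[OF le f2(2)] by (intro exI[of _ f]) (simp only: simp_thms)
qed

section \<open>Expected utilities as averages\<close>

definition mean :: "'a set => ('a => real) => real" where
 "mean S \<phi> = (\<Sum>s\<in>S. \<phi> s) / card S"

definition id_lists :: "nat set => nat => nat list set" where
 "id_lists ID n = {xs. length xs = n \<and> distinct xs \<and> set xs \<subseteq> ID}"

definition outputs :: "nat => (nat => nat => action) => nat => nat option list" where
 "outputs n act T = map (\<lambda>i. final_output (trace_view n (\<lambda>i. 0) (\<lambda>i. 0::nat) act i T)) [0..<n]"

lemma outputs_nth: "i < n ==> outputs n act T ! i = final_output (trace_view n x p act i T)"
 by (simp add: outputs_def final_output_def)

lemma length_outputs: "length (outputs n act T) = n"
 by (simp add: outputs_def)

lemma hd_outputs: "0 < n ==> hd (outputs n act T) = final_output (trace_view n x p act 0 T)"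
 using outputs_nth[of 0 n act T x p] by (simp add: outputs_def hd_map)

lemma utility_one: "utility legal z os = 1 \<longleftrightarrow> hd os = Some z \<and> legal os"
 by (simp add: utility_def)

lemma final_output_outputs: "final_output (trace_view n x p act i T) = final_output (trace_view n x' p' act i T)"
 by (simp add: final_output_def)

definition wins ::
  "(nat => 'p view => 'c => action) => 'c set => (nat option list => bool) => nat => nat => 'p view => nat
   => nat => (nat => nat) => (nat => 'p) => 'c list list set" where
 "wins s C legal z r h T n x p = {e \<in> tapes n T C.
   let act = run_act s n x p (\<lambda>i t. e ! t ! i) in
   trace_view n x p act 0 r = h \<and> utility legal z (outputs n act T) = 1}"

text \<open>The cells depend on the horizon since, for the coloring algorithm, the numbers for the
  sink need a range that is divisible by every size that can be seen by then.\<close>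

locale tape_game =
 fixes ID :: "nat set" and P :: "'p set" and \<sigma> :: "nat pmf" and \<beta> :: nat
  and A :: "'p strategy" and a :: "'p view => 'c => action" and C :: "nat => 'c set"
 assumes sizes: "set_pmf \<sigma> \<subseteq> {1..\<beta>}" and ID: "finite ID" "\<beta> \<le> card ID"
  and P: "finite P" "P \<noteq> {}" and C: "\<And>T. finite (C T)" "\<And>T. C T \<noteq> {}"
  and A: "\<And>v T. length (hist v) < T ==> A v = map_pmf (a v) (pmf_of_set (C T))"
begin

lemma finite_A: "finite (set_pmf (A v))"
 using A[of v "Suc (length (hist v))"] C by simp

lemma finite_sizes: "finite (set_pmf \<sigma>)"
 using sizes by (rule finite_subset) simp

lemma id_lists: "finite (id_lists ID n)" "n \<in> set_pmf \<sigma> ==> id_lists ID n \<noteq> {}"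
proof -
 show "finite (id_lists ID n)"
  by (rule finite_subset[OF _ finite_lists_of[OF ID(1), of n]]) (auto simp: id_lists_def lists_of_def)
 assume "n \<in> set_pmf \<sigma>"
 hence "n \<le> card ID" using sizes ID(2) by auto
 then obtain B where "B \<subseteq> ID" "card B = n" by (meson obtain_subset_with_card_n)
 moreover obtain xs where "set xs = B" "distinct xs"
  using finite_distinct_list[of B] finite_subset[OF \<open>B \<subseteq> ID\<close> ID(1)] by blast
 ultimately show "id_lists ID n \<noteq> {}" by (auto simp: id_lists_def distinct_card)
qed

lemma prior_eq:
 "prior ID P \<sigma> = bind_pmf \<sigma> (\<lambda>n. bind_pmf (pmf_of_set (id_lists ID n)) (\<lambda>xs.
   map_pmf (\<lambda>ps. map2 (\<lambda>x p. View x p []) xs ps) (pmf_of_set (lists_of n P))))"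
 by (simp add: prior_def id_lists_def lists_of_def map_pmf_def)

lemma map2_start: "length xs = n ==> length ps = n ==> map2 (\<lambda>x p. View x p []) xs ps = start n ((!) xs) ((!) ps)"
 by (auto intro!: nth_equalityI simp: start_def)

lemma set_prior:
 "set_pmf (prior ID P \<sigma>) = {start n ((!) xs) ((!) ps) | n xs ps. n \<in> set_pmf \<sigma> \<and> xs \<in> id_lists ID n \<and> ps \<in> lists_of n P}"
proof -
 have l: "set_pmf (pmf_of_set (lists_of n P)) = lists_of n P" for n
  using P by (intro set_pmf_of_set lists_of_nonempty finite_lists_of)
 have i: "n \<in> set_pmf \<sigma> ==> set_pmf (pmf_of_set (id_lists ID n)) = id_lists ID n" for n
  using id_lists by (intro set_pmf_of_set)
 have "map2 (\<lambda>x p. View x p []) xs ps = start n ((!) xs) ((!) ps)" if "xs \<in> id_lists ID n" "ps \<in> lists_of n P" for n xs ps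
  using that by (intro map2_start) (auto simp: id_lists_def lists_of_def)
 thus ?thesis by (fastforce simp: prior_eq l i)
qed

lemma finite_prior: "finite (set_pmf (prior ID P \<sigma>))"
 using finite_sizes id_lists P finite_lists_of[OF P(1)] lists_of_nonempty[OF P(2)] by (auto simp: prior_eq)

lemma expect_prior:
 fixes \<phi> :: "'p view list => real"
 assumes "\<And>w. 0 \<le> \<phi> w \<and> \<phi> w \<le> 1"
 shows "expect (prior ID P \<sigma>) \<phi> =
  (\<Sum>n\<in>set_pmf \<sigma>. pmf \<sigma> n * mean (id_lists ID n) (\<lambda>xs. mean (lists_of n P) (\<lambda>ps. \<phi> (start n ((!) xs) ((!) ps)))))"
proof -
 have "expect (bind_pmf (pmf_of_set (id_lists ID n)) (\<lambda>xs. map_pmf (\<lambda>ps. map2 (\<lambda>x p. View x p []) xs ps) (pmf_of_set (lists_of n P)))) \<phi>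
  = mean (id_lists ID n) (\<lambda>xs. mean (lists_of n P) (\<lambda>ps. \<phi> (start n ((!) xs) ((!) ps))))" if n: "n \<in> set_pmf \<sigma>" for n
 proof -
  have "map2 (\<lambda>x p. View x p []) xs ps = start n ((!) xs) ((!) ps)" if "xs \<in> id_lists ID n" "ps \<in> lists_of n P" for xs ps
   using that by (intro map2_start) (auto simp: id_lists_def lists_of_def)
  thus ?thesis
   using id_lists(1) id_lists(2)[OF n] finite_lists_of[OF P(1)] lists_of_nonempty[OF P(2)]
   by (simp add: expect_bind[OF assms] integral_pmf_of_set mean_def sum_divide_distrib)
 qed
 thus ?thesis using finite_sizes by (simp add: prior_eq expect_bind[OF assms] expect_finite)
qed

definition deviation :: "nat => ('p view => 'c => action) => nat => 'p view => 'c => action" where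
 "deviation r d i v c = (if i = 0 \<and> r \<le> length (hist v) then d v c else a v c)"

definition total :: "(nat => nat list => 'p list => real) => real" where
 "total \<phi> = (\<Sum>n\<in>set_pmf \<sigma>. pmf \<sigma> n * mean (id_lists ID n) (\<lambda>xs. mean (lists_of n P) (\<phi> n xs)))"

text \<open>The factor does not depend on \<open>D\<close>, so two strategies at the view
  \<open>h\<close> are compared through the right-hand sides, in which nothing is conditional.
  Having had the view \<open>h\<close> at round \<open>r\<close> is read off the final view by
  \<open>cut\<close>, so that it becomes a property of the tape.\<close>

lemma expected_utility_total:
 assumes h: "\<exists>vs\<in>set_pmf (honest_run ID P \<sigma> A r). hd vs = h"
  and D: "\<And>v. length (hist v) < r + T ==> D v = map_pmf (d v) (pmf_of_set (C (r + T)))"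
 shows "measure_pmf.prob (honest_run ID P \<sigma> A r) {vs. hd vs = h} * expected_utility legal z (output_dist ID P \<sigma> A r h D T)
  = total (\<lambda>n xs ps. real (card (wins (deviation r d) (C (r + T)) legal z r h (r + T) n ((!) xs) ((!) ps))) / card (tapes n (r + T) (C (r + T))))"
  and "0 < measure_pmf.prob (honest_run ID P \<sigma> A r) {vs. hd vs = h}"
proof -
 let ?S = "{vs. hd vs = h}" and ?M = "honest_run ID P \<sigma> A r"
 define g where "g w = utility legal z (map final_output w)" for w :: "'p view list"
 define \<phi> where "\<phi> e = expect (exec (\<lambda>v. if length (hist v) < r then A v else D v) A (r + T) e) (\<lambda>w. if cut r (hd w) = h then g w else 0)" for e
 have g: "0 \<le> g w \<and> g w \<le> 1" for w by (simp add: g_def utility_def)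
 have fin: "finite (set_pmf ?M)" unfolding honest_run_def using finite_prior finite_A by (auto intro!: finite_UN_I finite_exec)
 have S: "set_pmf ?M \<inter> ?S \<noteq> {}" using h by auto
 show "0 < measure_pmf.prob ?M ?S" by (rule expect_cond(2)[OF fin S g])
 have \<phi>_range: "0 \<le> \<phi> e \<and> \<phi> e \<le> 1" for e unfolding \<phi>_def using g by (intro expect_range) auto
 have "expected_utility legal z (output_dist ID P \<sigma> A r h D T) = expect (bind_pmf (cond_pmf ?M ?S) (exec D A T)) g"
  unfolding expected_utility_def output_dist_def belief_def integral_map_pmf g_def ..
 hence "measure_pmf.prob ?M ?S * expected_utility legal z (output_dist ID P \<sigma> A r h D T) =
   expect ?M (\<lambda>vs. if vs \<in> ?S then expect (exec D A T vs) g else 0)"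
  using expect_cond(1)[OF fin S g] by simp
 also have "\<dots> = expect (prior ID P \<sigma>) (\<lambda>e. expect (exec A A r e) (\<lambda>vs. if vs \<in> ?S then expect (exec D A T vs) g else 0))"
  unfolding honest_run_def using expect_range[of g, OF g] by (intro expect_bind) auto
 also have "\<dots> = expect (prior ID P \<sigma>) \<phi>"
 proof (rule expect_cong)
  fix e assume e: "e \<in> set_pmf (prior ID P \<sigma>)"
  show "expect (exec A A r e) (\<lambda>vs. if vs \<in> ?S then expect (exec D A T vs) g else 0) = \<phi> e"
  proof -
   obtain n xs ps where ne: "e = start n ((!) xs) ((!) ps)" "n \<in> set_pmf \<sigma>" using e unfolding set_prior by blast
   moreover have "0 < n" using sizes ne(2) by fastforce
   ultimately have e0: "e \<noteq> []" "hist (hd e) = []" by (auto simp: start_def hd_map)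
   let ?D = "\<lambda>v. if length (hist v) < r then A v else D v"
   have "exec ?D A (r + T) e = bind_pmf (exec A A r e) (exec ?D A T)"
    unfolding exec_add using e0 by (intro arg_cong2[of _ _ _ _ bind_pmf] refl exec_cong) auto
   also have "\<dots> = bind_pmf (exec A A r e) (exec D A T)"
   proof (intro bind_pmf_cong refl exec_cong)
    fix vs assume "vs \<in> set_pmf (exec A A r e)"
    from exec_hd[OF this e0(1)] show "vs \<noteq> []" using e0 by auto
    show "(if length (hist v) < r then A v else D v) = D v" if "length (hist (hd vs)) \<le> length (hist v)" for v
     using that exec_hd(2)[OF \<open>vs \<in> set_pmf (exec A A r e)\<close> e0(1)] e0(2) by simp
   qed
   finally have "\<phi> e = expect (exec A A r e) (\<lambda>vs. expect (exec D A T vs) (\<lambda>w. if cut r (hd w) = h then g w else 0))"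
    unfolding \<phi>_def using g by (simp add: expect_bind)
   also have "\<dots> = expect (exec A A r e) (\<lambda>vs. if vs \<in> ?S then expect (exec D A T vs) g else 0)"
   proof (rule expect_cong)
    fix vs assume vs: "vs \<in> set_pmf (exec A A r e)"
    have "vs \<noteq> []" "length (hist (hd vs)) = r" using exec_hd[OF vs e0(1)] e0 by auto
    hence "expect (exec D A T vs) (\<lambda>w. if cut r (hd w) = h then g w else 0) = expect (exec D A T vs) (\<lambda>w. if hd vs = h then g w else 0)"
     using exec_hd(3)[of _ D A T vs] by (intro expect_cong) auto
    thus "expect (exec D A T vs) (\<lambda>w. if cut r (hd w) = h then g w else 0) = (if vs \<in> ?S then expect (exec D A T vs) g else 0)" by simp
   qed
   finally show ?thesis by simp
  qed
 qed
 also have "\<dots> = total (\<lambda>n xs ps. \<phi> (start n ((!) xs) ((!) ps)))"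
  unfolding total_def by (rule expect_prior[OF \<phi>_range])
 also have "\<dots> = total (\<lambda>n xs ps. real (card (wins (deviation r d) (C (r + T)) legal z r h (r + T) n ((!) xs) ((!) ps))) / card (tapes n (r + T) (C (r + T))))"
 proof -
  have "\<phi> (start n x p) = real (card (wins (deviation r d) (C (r + T)) legal z r h (r + T) n x p)) / card (tapes n (r + T) (C (r + T)))"
   if n: "n \<in> set_pmf \<sigma>" for n x p
  proof -
   have n0: "0 < n" using n sizes by fastforce
   let ?\<Omega> = "tapes n (r + T) (C (r + T))"
   define act where "act e = run_act (deviation r d) n x p (\<lambda>i t. e ! t ! i)" for e
   define c where "c e = conf (deviation r d) (start n x p) (\<lambda>i t. e ! t ! i) (r + T)" for e
   have e: "exec (\<lambda>v. if length (hist v) < r then A v else D v) A (r + T) (start n x p) = map_pmf c (pmf_of_set ?\<Omega>)"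
    unfolding c_def using D A[of _ "r + T"] by (intro exec_tape C n0) (auto simp: deviation_def[abs_def])
   have c: "c e = map (\<lambda>i. trace_view n x p (act e) i (r + T)) [0..<n]" for e
    unfolding c_def act_def by (rule conf_run[OF n0])
   have "cut r (trace_view n x p (act e) 0 (r + T)) = trace_view n x p (act e) 0 r" for e
    by (simp add: cut_def trace_view_def trace_hist_def take_map)
   hence "cut r (hd (c e)) = trace_view n x p (act e) 0 r" for e using n0 by (simp add: c hd_map)
   moreover have "map final_output (c e) = outputs n (act e) (r + T)" for e
    unfolding c outputs_def by (auto intro: final_output_outputs)
   ultimately have "(if cut r (hd (c e)) = h then g (c e) else 0) =
     (if trace_view n x p (act e) 0 r = h \<and> utility legal z (outputs n (act e) (r + T)) = 1 then 1 else 0)" for e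
    by (simp add: g_def) (simp add: utility_def)
   hence "\<phi> (start n x p) = (\<Sum>e\<in>?\<Omega>. if trace_view n x p (act e) 0 r = h \<and> utility legal z (outputs n (act e) (r + T)) = 1 then 1 else 0) / card ?\<Omega>"
    unfolding \<phi>_def e integral_map_pmf using C by (simp add: integral_pmf_of_set finite_tapes tapes_nonempty)
   also have "\<dots> = real (card (wins (deviation r d) (C (r + T)) legal z r h (r + T) n x p)) / card ?\<Omega>"
    using finite_tapes[OF C(1)] by (simp add: wins_def Let_def act_def sum.If_cases Int_def)
   finally show ?thesis .
  qed
  thus ?thesis by (simp add: total_def)
 qed
 finally show "measure_pmf.prob ?M ?S * expected_utility legal z (output_dist ID P \<sigma> A r h D T) = \<dots>" .
qed

end

section \<open>The protocols as functions of random cells\<close>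

lemma mod_class:
 assumes "0 < m" "a < (m::nat)"
 shows "{u \<in> {..<m * k}. u mod m = a} = (\<lambda>j. a + m * j) ` {..<k}"
proof (intro equalityI subsetI)
 fix u assume u: "u \<in> {u \<in> {..<m * k}. u mod m = a}"
 hence "u = a + m * (u div m)" by (metis (mono_tags) mem_Collect_eq mod_mult_div_eq add.commute)
 moreover have "u div m < k" using u assms(1) by (simp add: less_mult_imp_div_less mult.commute)
 ultimately show "u \<in> (\<lambda>j. a + m * j) ` {..<k}" by blast
next
 fix u assume "u \<in> (\<lambda>j. a + m * j) ` {..<k}"
 then obtain j where j: "j < k" "u = a + m * j" by blast
 have "a + m * j < m * Suc j" using assms(2) by simp
 also have "\<dots> \<le> m * k" using j(1) by (intro mult_le_mono2) simp
 finally show "u \<in> {u \<in> {..<m * k}. u mod m = a}" using j assms(2) by simp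
qed

lemma card_mod_class:
 assumes "0 < m" "a < (m::nat)" "m dvd L"
 shows "card {u \<in> {..<L}. u mod m = a} = L div m"
proof -
 obtain k where k: "L = m * k" using assms(3) by blast
 have "inj_on (\<lambda>j. a + m * j) {..<k}" using assms(1) by (simp add: inj_on_def)
 thus ?thesis using mod_class[OF assms(1,2), of k] assms(1) by (simp add: k card_image)
qed

lemma uniform_mod:
 assumes "0 < m" "m dvd L" "0 < L"
 shows "map_pmf (\<lambda>u. u mod m) (pmf_of_set {..<L}) = pmf_of_set {..<m::nat}"
proof (rule pmf_eqI)
 fix a
 have L: "{..<L} \<noteq> {}" "{..<m} \<noteq> {}" using assms by auto
 have "pmf (map_pmf (\<lambda>u. u mod m) (pmf_of_set {..<L})) a = real (card {u \<in> {..<L}. u mod m = a}) / L"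
  using L(1) by (simp add: pmf_map measure_pmf_of_set Int_def vimage_def conj_commute)
 also have "\<dots> = pmf (pmf_of_set {..<m}) a"
 proof (cases "a < m")
  case True
  have "real (L div m) / L = 1 / m" using assms by (simp add: real_of_nat_div field_simps)
  thus ?thesis using card_mod_class[OF assms(1) True assms(2)] L True by simp
 next
  case False
  hence "{u \<in> {..<L}. u mod m = a} = {}" using assms(1) by auto
  thus ?thesis using False L by (simp only: card.empty) simp
 qed
 finally show "pmf (map_pmf (\<lambda>u. u mod m) (pmf_of_set {..<L})) a = pmf (pmf_of_set {..<m}) a" .
qed

lemma uniform_product:
 assumes "finite A" "A \<noteq> {}" "finite B" "B \<noteq> {}"
 shows "map_pmf (\<lambda>c. F (fst c)) (pmf_of_set (A \<times> B)) = map_pmf F (pmf_of_set A)"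
  and "map_pmf (\<lambda>c. G (snd c)) (pmf_of_set (A \<times> B)) = map_pmf G (pmf_of_set B)"
proof -
 have e: "pmf_of_set (A \<times> B) = pair_pmf (pmf_of_set A) (pmf_of_set B)"
  using bind_uniform[OF assms, of Pair] by (simp add: pair_pmf_def map_pmf_def inj_on_def)
 show "map_pmf (\<lambda>c. F (fst c)) (pmf_of_set (A \<times> B)) = map_pmf F (pmf_of_set A)"
  unfolding e using pmf.map_comp[of F fst "pair_pmf (pmf_of_set A) (pmf_of_set B)"] by (simp only: o_def map_fst_pair_pmf)
 show "map_pmf (\<lambda>c. G (snd c)) (pmf_of_set (A \<times> B)) = map_pmf G (pmf_of_set B)"
  unfolding e using pmf.map_comp[of G snd "pair_pmf (pmf_of_set A) (pmf_of_set B)"] by (simp only: o_def map_snd_pair_pmf)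
qed

lemma draw_cell:
 "bind_pmf (draw_at h t (map_pmf F M)) (\<lambda>cs. return_pmf (G cs))
  = map_pmf (\<lambda>c. G (if length h = t then F c else coins (fst (h ! t)))) M"
 by (simp add: draw_at_def map_pmf_def bind_assoc_pmf bind_return_pmf)

lemma map_pmf_if: "map_pmf (\<lambda>c. if b then f c else g c) M = (if b then map_pmf f M else map_pmf g M)"
 by simp

lemma ring_size_bounds:
 assumes "ring_size x h = Some m"
 shows "1 \<le> m" "m \<le> length h"
proof -
 have "returned x h m" using assms LeastI_ex[of "returned x h"] by (auto simp: ring_size_def split: if_splits)
 thus "1 \<le> m" "m \<le> length h" by (auto simp: returned_def from_ccw_def from_cw_def split: if_splits)
qed

text \<open>Every size \<open>m\<close> seen by round \<open>T\<close> divides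
  \<open>fact T\<close>, so \<open>u mod m\<close> is uniform for \<open>u\<close> below
  \<open>fact T\<close>, although \<open>m\<close> is not known when the tape is drawn.\<close>

definition col_cells :: "nat => (nat \<times> nat \<times> nat) set" where
 "col_cells T = {..<fact T} \<times> {0, 1} \<times> {0, 1}"

lemma fact_interval: "{..<fact T :: nat} \<noteq> {}"
 by (metis fact_gt_zero lessThan_iff empty_iff)

lemma col_cells: "finite (col_cells T)" "col_cells T \<noteq> {}"
 using fact_interval by (auto simp: col_cells_def)

lemma coloring_algorithm_cell:
 assumes "length (hist v) < T"
 shows "coloring_algorithm \<beta> ncol v = map_pmf (col_act \<beta> ncol v) (pmf_of_set (col_cells T))"
proof (cases "ring_size (own_id v) (hist v)")
 case None
 thus ?thesis by (simp add: coloring_algorithm_def col_act_def[abs_def] Let_def map_pmf_const)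
next
 case (Some m)
 note m = ring_size_bounds[OF Some]
 have dvd: "m dvd fact T" using m assms by (intro dvd_fact) auto
 let ?M = "pmf_of_set (col_cells T)"
 have X1: "map_pmf (\<lambda>w. [w]) (pmf_of_set {..<m}) = map_pmf (\<lambda>c. [fst c mod m]) ?M"
 proof -
  have "map_pmf (\<lambda>c. [fst c mod m]) ?M = map_pmf (\<lambda>u. [u mod m]) (pmf_of_set {..<fact T})"
   unfolding col_cells_def by (rule uniform_product(1)[of _ _ "\<lambda>u. [u mod m]"]) (use fact_interval in auto)
  also have "\<dots> = map_pmf (\<lambda>w. [w]) (map_pmf (\<lambda>u. u mod m) (pmf_of_set {..<fact T}))"
   by (simp add: pmf.map_comp o_def)
  finally show ?thesis using uniform_mod[OF _ dvd] m by simp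
 qed
 have X2: "map_pmf (\<lambda>(i, R). [i, R]) (pmf_of_set ({0, 1} \<times> {0, 1})) = map_pmf (\<lambda>c. [fst (snd c), snd (snd c)]) ?M"
  unfolding col_cells_def
  by (subst uniform_product(2)[of _ _ "\<lambda>c. [fst c, snd c]"]) (use fact_interval in \<open>auto simp: case_prod_unfold\<close>)
 show ?thesis
  unfolding coloring_algorithm_def Let_def Some option.case X1 X2
  unfolding col_act_def[abs_def] Let_def Some option.case draw_cell map_pmf_if
  by (simp only: map_pmf_const map_pmf_if)
qed

lemma sharing_protocol_cell:
 assumes "0 < T"
 shows "sharing_protocol \<beta> bits S q v = map_pmf (sharing_act \<beta> bits S q v) (pmf_of_set {..<2 ^ bits})"
proof (cases "ring_size (own_id v) (hist v)")
 case None
 thus ?thesis by (simp add: sharing_protocol_def sharing_act_def[abs_def] Let_def map_pmf_const)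
next
 case (Some m)
 show ?thesis
  unfolding sharing_protocol_def sharing_act_def[abs_def] Let_def Some option.case draw_cell map_pmf_if
  by (simp only: map_pmf_const map_pmf_if)
qed

section \<open>Changing the random choices of one agent\<close>

text \<open>The change is made in all rounds, so that it can be defined without knowing the round in
  which the cell is read.\<close>

definition retouch :: "nat => ('c => 'c) => 'c list list => 'c list list" where
 "retouch j \<phi> e = map (\<lambda>row. row[j := \<phi> (row ! j)]) e"

lemma lists_ofD: "xs \<in> lists_of n C ==> length xs = n" "xs \<in> lists_of n C ==> i < n ==> xs ! i \<in> C"
 by (auto simp: lists_of_def)

lemma tapesD:
 assumes "e \<in> tapes n T C"
 shows "length e = T" "t < T ==> length (e ! t) = n" "t < T ==> i < n ==> e ! t ! i \<in> C"
 using assms lists_ofD[of "e ! t" n C] lists_ofD[of e T "lists_of n C"] by (auto simp: tapes_def)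

lemma retouch_tapes:
 assumes "e \<in> tapes n T C" "\<And>c. c \<in> C ==> \<phi> c \<in> C" "j < n"
 shows "retouch j \<phi> e \<in> tapes n T C"
proof -
 have "row[j := \<phi> (row ! j)] \<in> lists_of n C" if "row \<in> lists_of n C" for row
 proof -
  have "set (row[j := \<phi> (row ! j)]) \<subseteq> insert (\<phi> (row ! j)) (set row)" by (rule set_update_subset_insert)
  moreover have "\<phi> (row ! j) \<in> C" using assms(2,3) lists_ofD[OF that] by simp
  ultimately show ?thesis using that by (auto simp: lists_of_def)
 qed
 thus ?thesis using assms(1) by (auto simp: tapes_def lists_of_def[of T] retouch_def)
qed

lemma retouch_nth:
 assumes "e \<in> tapes n T C" "t < T" "i < n" "j < n"
 shows "retouch j \<phi> e ! t ! i = (if i = j then \<phi> (e ! t ! i) else e ! t ! i)"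
 using assms tapesD(1,2)[OF assms(1)] by (auto simp: retouch_def nth_list_update)

lemma tapes_eqI:
 assumes "e \<in> tapes n T C" "e' \<in> tapes n T C" "\<And>t i. t < T ==> i < n ==> e ! t ! i = e' ! t ! i"
 shows "e = e'"
 using assms(3) tapesD[OF assms(1)] tapesD[OF assms(2)] by (auto intro!: nth_equalityI)

lemma retouch_inj:
 assumes "inj_on \<phi> C" "\<And>c. c \<in> C ==> \<phi> c \<in> C" "j < n"
 shows "inj_on (retouch j \<phi>) (tapes n T C)"
proof (rule inj_onI)
 fix e e' assume o: "e \<in> tapes n T C" "e' \<in> tapes n T C" "retouch j \<phi> e = retouch j \<phi> e'"
 show "e = e'"
 proof (rule tapes_eqI[OF o(1,2)])
  fix t i assume t: "t < T" "i < n"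
  thus "e ! t ! i = e' ! t ! i"
   using retouch_nth[OF o(1) t assms(3), of \<phi>] retouch_nth[OF o(2) t assms(3), of \<phi>] o(3)
    tapesD(3)[OF o(1) t] tapesD(3)[OF o(2) t] assms(1) by (auto simp: inj_on_def split: if_splits)
 qed
qed

lemma retouch_bij:
 assumes "finite C" "inj_on \<phi> C" "\<And>c. c \<in> C ==> \<phi> c \<in> C" "j < n"
 shows "bij_betw (retouch j \<phi>) (tapes n T C) (tapes n T C)"
proof -
 have "retouch j \<phi> ` tapes n T C \<subseteq> tapes n T C" using retouch_tapes[of _ n T C \<phi> j] assms(3,4) by blast
 thus ?thesis
  using retouch_inj[OF assms(2-4), of T] endo_inj_surj[OF finite_tapes[OF assms(1), of n T]] by (simp add: bij_betw_def)
qed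

lemma sum_of_bool: "finite S ==> (\<Sum>s\<in>S. of_bool (Q s)) = (card {s \<in> S. Q s} :: nat)"
 by (simp add: sum.inter_filter[symmetric] of_bool_def)

lemma sum_of_bool_card: "finite S ==> W \<subseteq> S ==> (\<Sum>s\<in>S. of_bool (s \<in> W)) = (card W :: nat)"
 by (simp add: sum_of_bool Int_absorb1 flip: Int_def)

lemma card_pairs:
 assumes "finite S" "bij_betw J S S" "W \<subseteq> S"
 shows "(\<Sum>s\<in>S. of_bool (s \<in> W) + of_bool (J s \<in> W)) = 2 * (card W :: nat)"
proof -
 have "(\<Sum>s\<in>S. of_bool (J s \<in> W)) = (\<Sum>s\<in>S. of_bool (s \<in> W) :: nat)"
  by (rule sum.reindex_bij_betw[OF assms(2)])
 thus ?thesis using sum_of_bool_card[OF assms(1,3)] by (simp add: sum.distrib)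
qed

text \<open>Double counting of the pairs of \<open>k\<close> and \<open>s\<close> with
  \<open>J k s \<in> W\<close>: each \<open>k\<close> contributes \<open>card W\<close>, each
  \<open>s\<close> at most \<open>B\<close>.\<close>

lemma card_translates:
 assumes "finite S" "\<And>k. k < L ==> bij_betw (J k) S S" "W \<subseteq> S" "\<And>s. s \<in> S ==> card {k \<in> {..<L}. J k s \<in> W} \<le> B"
 shows "L * card W \<le> B * card S"
proof -
 have "(\<Sum>s\<in>S. \<Sum>k<L. of_bool (J k s \<in> W)) = (\<Sum>k<L. \<Sum>s\<in>S. of_bool (J k s \<in> W) :: nat)" by (rule sum.swap)
 also have "\<dots> = (\<Sum>k<L. card W)"
 proof (rule sum.cong[OF refl])
  fix k assume "k \<in> {..<L}"
  hence "bij_betw (J k) S S" using assms(2) by simp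
  hence "(\<Sum>s\<in>S. of_bool (J k s \<in> W)) = (\<Sum>s\<in>S. of_bool (s \<in> W) :: nat)"
   by (rule sum.reindex_bij_betw)
  thus "(\<Sum>s\<in>S. of_bool (J k s \<in> W)) = card W" using sum_of_bool_card[OF assms(1,3)] by simp
 qed
 also have "\<dots> = L * card W" by simp
 finally have "L * card W = (\<Sum>s\<in>S. \<Sum>k<L. of_bool (J k s \<in> W))" ..
 also have "\<dots> = (\<Sum>s\<in>S. card {k \<in> {..<L}. J k s \<in> W})"
  by (intro sum.cong refl sum_of_bool) simp
 also have "\<dots> \<le> (\<Sum>s\<in>S. B)" using assms(4) by (intro sum_mono)
 finally show ?thesis by (simp add: mult.commute)
qed

lemma card_shift_class:
 assumes "0 < m" "m dvd L" "A \<subseteq> {..<m::nat}"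
 shows "card {k \<in> {..<L}. (c + k) mod m \<in> A} = card A * (L div m)"
proof -
 have one: "card {k \<in> {..<L}. (c + k) mod m = a} = L div m" if "a \<in> A" for a
 proof -
  have a: "a < m" using that assms(3) by auto
  have "(c + k) mod m = a \<longleftrightarrow> k mod m = (a + (m - c mod m)) mod m" for k
  proof
   assume "(c + k) mod m = a"
   hence "(a + (m - c mod m)) mod m = (c mod m + k + (m - c mod m)) mod m" by (metis mod_add_left_eq)
   also have "c mod m + k + (m - c mod m) = k + m" using mod_less_divisor[OF assms(1), of c] by linarith
   finally show "k mod m = (a + (m - c mod m)) mod m" by simp
  next
   assume "k mod m = (a + (m - c mod m)) mod m"
   hence "(c + k) mod m = (c mod m + (a + (m - c mod m))) mod m" by (metis mod_add_eq mod_add_left_eq mod_add_right_eq)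
   also have "c mod m + (a + (m - c mod m)) = a + m" using mod_less_divisor[OF assms(1), of c] by linarith
   finally show "(c + k) mod m = a" using a by simp
  qed
  thus ?thesis using card_mod_class[OF assms(1) _ assms(2), of "(a + (m - c mod m)) mod m"] assms(1) by simp
 qed
 have "{k \<in> {..<L}. (c + k) mod m \<in> A} = (\<Union>a\<in>A. {k \<in> {..<L}. (c + k) mod m = a})" by auto
 moreover have "card (\<Union>a\<in>A. {k \<in> {..<L}. (c + k) mod m = a}) = (\<Sum>a\<in>A. card {k \<in> {..<L}. (c + k) mod m = a})"
  using assms(3) finite_subset by (intro card_UN_disjoint) auto
 ultimately show ?thesis using one by simp
qed

definition flip_bits :: "nat \<times> nat \<times> nat => nat \<times> nat \<times> nat" where
 "flip_bits c = (fst c, 1 - fst (snd c), 1 - snd (snd c))"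

definition shift_weight :: "nat => nat => nat \<times> nat \<times> nat => nat \<times> nat \<times> nat" where
 "shift_weight L k c = ((fst c + k) mod L, snd c)"

lemma flip_bits_cells: "c \<in> col_cells T ==> flip_bits c \<in> col_cells T \<and> flip_bits (flip_bits c) = c"
 by (auto simp: flip_bits_def col_cells_def)

lemma xor_flip_bits: "c \<in> col_cells T ==> xor (snd (snd (flip_bits c))) (fst (snd (flip_bits c))) = xor (snd (snd c)) (fst (snd c))"
 by (auto simp: flip_bits_def col_cells_def)

lemma inj_flip_bits: "inj_on flip_bits (col_cells T)"
 using flip_bits_cells by (metis inj_onI)

lemma shift_weight_cells:
 "c \<in> col_cells T ==> shift_weight (fact T) k c \<in> col_cells T" "inj_on (shift_weight (fact T) k) (col_cells T)"
proof -
 have inverse: "((a + k) mod L + (L - k mod L)) mod L = a" if "a < L" for a L :: nat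
 proof -
  have "((a + k) mod L + (L - k mod L)) mod L = (a + k mod L + (L - k mod L)) mod L" by (metis mod_add_left_eq mod_add_right_eq)
  moreover have "a + k mod L + (L - k mod L) = a + L" using that mod_less_divisor[of L k] by linarith
  ultimately show ?thesis using that by simp
 qed
 show "inj_on (shift_weight (fact T) k) (col_cells T)"
 proof (rule inj_onI)
  fix c d assume c: "c \<in> col_cells T" "d \<in> col_cells T" "shift_weight (fact T) k c = shift_weight (fact T) k d"
  hence "fst c < fact T" "fst d < fact T" by (auto simp: col_cells_def)
  moreover have "(fst c + k) mod fact T = (fst d + k) mod fact T" "snd c = snd d"
   using c(3) by (simp_all only: shift_weight_def prod.inject)
  ultimately show "c = d" using inverse[of "fst c" "fact T"] inverse[of "fst d" "fact T"] by (metis prod_eqI)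
 qed
 show "c \<in> col_cells T ==> shift_weight (fact T) k c \<in> col_cells T"
  by (auto simp: shift_weight_def col_cells_def)
qed

section \<open>Runs of the coloring algorithm given by a tape\<close>

lemma run_act_cong:
 assumes "\<And>i s. i < n ==> s < T ==> cell i s = cell' i s" "i < n" "t < T"
 shows "run_act s n x p cell i t = run_act s n x p cell' i t"
 unfolding run_act_def using assms conf_cong[of "start n x p" t cell cell' s] by simp

lemma col_act_start: "col_act \<beta> ncol (View a b []) c = learn_ids \<beta> a []"
proof -
 have "ring_size a [] = None" "\<not> decided []"
  by (auto simp: decided_def ring_size_def returned_def from_ccw_def from_cw_def)
 thus ?thesis by (simp only: col_act_def Let_def view.sel option.case if_False)
qed

text \<open>With a sink the coin flip ends at round \<open>8 * n - 5\<close> and the last turn is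
  \<open>3\<close>; this is the origin of the bound on \<open>T\<close>.\<close>

locale coloring_ring =
 fixes \<beta> ncol n :: nat and x p :: "nat => nat" and T :: nat
 assumes n3: "3 \<le> n" and n_le: "n \<le> \<beta>"
  and inj: "inj_on x {..<n}"
  and pref: "\<And>i. i < n ==> p i < ncol"
  and colors: "3 \<le> ncol"
  and long: "8 * n \<le> T"
begin

abbreviation "\<Omega> \<equiv> tapes n T (col_cells T)"

definition cell :: "(nat \<times> nat \<times> nat) list list => nat => nat => nat \<times> nat \<times> nat" where
 "cell e i t = (if t < T \<and> i < n then e ! t ! i else (0, 0, 0))"

definition hon :: "(nat \<times> nat \<times> nat) list list => nat => nat => action" where
 "hon e = run_act (\<lambda>i. col_act \<beta> ncol) n x p (cell e)"

definition same_prefs :: bool where "same_prefs \<longleftrightarrow> odd n \<and> (\<forall>i<n. p i = p 0)"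

lemma cell_in: "e \<in> \<Omega> ==> cell e i t \<in> col_cells T"
 using tapesD(3)[of e n T "col_cells T" t i] by (auto simp: cell_def col_cells_def fact_gt_zero)

lemma hon_eq: "i < n ==> hon e i t = col_act \<beta> ncol (trace_view n x p (hon e) i t) (cell e i t)"
 unfolding hon_def by (rule run_act_eq)

lemma hon_start: "i < n ==> hon e i 0 = Act [] None (Id (x i)) (Id (x i))"
proof -
 assume "i < n"
 hence "hon e i 0 = learn_ids \<beta> (x i) []"
  by (subst hon_eq) (simp_all add: trace_view_def trace_hist_def col_act_start)
 thus ?thesis using n3 n_le by (simp add: learn_ids_def send_def flood_def)
qed

lemma tapes_finite: "finite \<Omega>"
 by (rule finite_tapes[OF col_cells(1)])

lemma cell_retouch:
 assumes "e \<in> \<Omega>" "j < n"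
 shows "cell (retouch j \<phi> e) i t = (if i = j \<and> t < T then \<phi> (cell e i t) else cell e i t)"
 using retouch_nth[OF assms(1) _ _ assms(2), of t i \<phi>] assms(2) by (auto simp: cell_def)

end

locale honest_tape = coloring_ring +
 fixes e
 assumes tape: "e \<in> \<Omega>"
begin

sublocale h: honest_coloring \<beta> ncol n x p "cell e"
proof
 fix i t assume "i < n"
 show "fst (snd (cell e i t)) \<in> {0, 1} \<and> snd (snd (cell e i t)) \<in> {0, 1}"
  using cell_in[OF tape, of i t] by (auto simp: col_cells_def)
qed (use n3 n_le inj pref colors in auto)

lemma hon_table: "i < n ==> hon e i t = h.hact i t"
 unfolding hon_def using h.act_hact[symmetric] by (intro run_act_unique)

lemma hon_view: "i < n ==> trace_view n x p (hon e) i t = trace_view n x p h.hact i t"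
 using hon_table by (intro trace_view_cong)

lemma horizon: "h.t6 + 3 < T"
 using long n3 h.t_order(8-14) by (cases h.ns) linarith+

lemma final_color: "i < n ==> final_output (trace_view n x p (hon e) i T) = Some (h.color (h.pos i))"
 using hon_view h.final_hact[OF horizon] by simp

lemma legal: "coloring_legal (outputs n (hon e) T)"
proof -
 have o: "outputs n (hon e) T ! i = Some (h.color (h.pos i))" if "i < n" for i
  using final_color[OF that] outputs_nth[OF that, of "hon e" T x p] by simp
 have "h.color (h.pos i) \<noteq> h.color (h.pos ((i + 1) mod n))" if i: "i < n" for i
 proof (cases h.fwd)
  case True
  thus ?thesis using h.colors_differ[OF h.pos_less, of i] h.pos_next[OF i] by simp
 next
  case False
  have "((h.pos i + (n - 1)) mod n + 1) mod n = (h.pos i + n) mod n"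
   using n3 by (simp add: mod_add_left_eq mod_Suc_eq)
  hence "((h.pos i + (n - 1)) mod n + 1) mod n = h.pos i" using h.pos_less[of i] by simp
  thus ?thesis using h.colors_differ[OF h.pos_less[of "(i + 1) mod n"]] h.pos_next[OF i] False by auto
 qed
 moreover have "(i + 1) mod n < n" for i using n3 by simp
 ultimately show ?thesis unfolding coloring_legal_def length_outputs
  by (metis o option.distinct(1) option.inject)
qed

sublocale a: coloring_run \<beta> ncol n x p "hon e" T "cell e"
proof
 fix i assume i: "1 \<le> i" "i < n"
 show "hon e i t = col_act \<beta> ncol (trace_view n x p (hon e) i t) (cell e i t)" for t using hon_eq i by blast
 show "final_output (trace_view n x p (hon e) i T) \<noteq> None" using final_color i by simp
 have "x 0 \<noteq> x i" using inj i by (auto simp: inj_on_def)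
 thus "to_cw (hon e 0 0) \<noteq> Id (x i) \<and> to_ccw (hon e 0 0) \<noteq> Id (x i)" using i by (simp add: hon_start)
qed (use n3 inj in auto)

lemma m_eq: "a.m = n"
 using n3 by (intro a.one_id[of "x 0"]) (simp_all add: hon_start)

lemma view_T6:
 assumes "i < n"
 defines "v \<equiv> trace_view n x p (hon e) i h.t6" and "W \<equiv> trace_view n x p (hon e) i T"
 shows "col_prefs v n = h.ps" "col_sink v n = h.sk" "col_coin v n = h.coin" "col_ids v n = h.V" "col_cw v n = h.fwd"
  and "col_prefs W n = h.ps" "col_sink W n = h.sk" "col_coin W n = h.coin" "col_ids W n = h.V" "col_cw W n = h.fwd"
  and "col_needs_sink W n = h.ns" "col_t5 W n = h.t5"
proof -
 have le: "h.t6 \<le> h.t6 + h.tn (h.pos i)" "n \<le> h.t6" "h.t2 \<le> h.t6" "h.t5 \<le> h.t6" "h.t6 \<le> T" "1 < n"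
  using h.t_order horizon n3 by linarith+
 have v: "v = trace_view n x p h.hact i h.t6" unfolding v_def by (rule hon_view[OF assms(1)])
 show 1: "col_prefs v n = h.ps" unfolding v by (rule h.prefs_h[OF assms(1) le(1) le(2) le(3)])
 show 2: "col_sink v n = h.sk" unfolding v by (rule h.sink_h[OF assms(1) le(1) le(2) le(4)])
 show 3: "col_coin v n = h.coin" unfolding v by (rule h.coin_h[OF assms(1) le(1) le(2) order_refl])
 show 4: "col_ids v n = h.V" "col_cw v n = h.fwd" unfolding v using h.geometry_h[OF assms(1) le(1) le(2)] by auto
 have 5: "col_needs_sink v n = h.ns" "col_t5 v n = h.t5" unfolding v
  using h.needs_sink_h[OF assms(1) le(1) le(2) le(3)] h.t5_h(1)[OF assms(1) le(1) le(2) le(3)] by auto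
 note pre = le(5) le(2)
 show "col_ids W n = h.V" "col_cw W n = h.fwd" using 4 col_ids_prefix[OF pre] by (auto simp: v_def W_def)
 show "col_prefs W n = h.ps" using 1 col_prefs_prefix[OF pre le(3)] by (simp add: v_def W_def)
 show ns: "col_needs_sink W n = h.ns" using 5 col_needs_sink_prefix[OF pre le(3)] by (simp add: v_def W_def)
 show t5: "col_t5 W n = h.t5" using 5 col_t56_prefix[OF pre le(3)] by (simp add: v_def W_def)
 show "col_sink W n = h.sk" using 2 col_sink_prefix[OF pre le(6)] t5 le(4) by (simp add: v_def W_def)
 have "col_t6 W n = h.t6" using t5 by (simp add: col_t6_def h.t6_def)
 thus "col_coin W n = h.coin" using 3 col_coin_prefix[OF pre le(6)] by (simp add: v_def W_def)
qed

text \<open>The honest run is described in two ways: by the explicit table \<open>h\<close>, which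
  yields its outputs, and as an instance \<open>a\<close> of the runs in which deviations are
  studied. Results can be transferred because the derived data coincide.\<close>

lemma same_data: "a.ps = h.ps" "a.sk = h.sk" "a.coin = h.coin" "a.V = h.V" "a.fwd = h.fwd" "a.ns = h.ns" "a.T5 = h.t5" "a.q = h.pos 0"
proof -
 have one: "1 \<le> (1::nat)" "1 < n" using n3 by auto
 note g = a.ag(1)[OF one]
 note W = view_T6(6-12)[of "a.ag 1"]
 show "a.ps = h.ps" "a.sk = h.sk" "a.coin = h.coin" "a.V = h.V" "a.fwd = h.fwd" "a.ns = h.ns" "a.T5 = h.t5"
  using W a.prefs_eq[OF one] a.sink_eq[OF one] a.coin_eq[OF one] a.orientation[of "a.ag 1"] a.needs_sink_eq[OF one] a.t5_eq[OF one] g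
  by (simp_all add: m_eq)
 have fwd: "a.fwd = h.fwd" and V: "a.V = h.V"
  using W a.orientation[of "a.ag 1"] g by (simp_all add: m_eq)
 have "h.pos (a.ag 1) = (h.pos 0 + 1) mod n"
  using h.pos_next[of 0] h.pos_prev[of 0] n3 by (auto simp: a.ag_def fwd)
 moreover have "(a.q + 1) mod n = h.pos (a.ag 1)"
  using a.q(2)[OF one] h.V_pos[of "a.ag 1"] h.V_props h.pos_less[of "a.ag 1"] g n3
   nth_eq_iff_index_eq[of h.V "(a.q + 1) mod n" "h.pos (a.ag 1)"] by (simp add: m_eq V)
 ultimately have "(a.q + 1) mod n = (h.pos 0 + 1) mod n" by simp
 thus "a.q = h.pos 0"
  using a.q(1) h.pos_less[of 0] mod_pred_succ[of a.q n] mod_pred_succ[of "h.pos 0" n] by (simp add: m_eq)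
qed

lemma P_own: "a.P 0 = p 0"
proof -
 have "a.P 0 = h.ps ! h.pos 0" using a.ps_nth[of 0] n3 h.pos_less[of 0] by (simp add: m_eq same_data)
 also have "\<dots> = p 0" using h.ps_nth[OF h.pos_less] h.agt(3)[of 0] n3 by (simp add: h.P_def)
 finally show ?thesis .
qed

lemma ns_eq: "a.ns = same_prefs"
proof -
 have "(\<forall>j<n. h.P j = h.P 0) \<longleftrightarrow> (\<forall>i<n. p i = p 0)"
 proof
  assume *: "\<forall>j<n. h.P j = h.P 0"
  show "\<forall>i<n. p i = p 0"
  proof (intro allI impI)
   fix i assume "i < n"
   thus "p i = p 0" using *[rule_format, OF h.pos_less, of i] *[rule_format, OF h.pos_less, of 0] h.agt(3)[of i] h.agt(3)[of 0] n3
    by (simp add: h.P_def)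
  qed
 next
  assume "\<forall>i<n. p i = p 0"
  moreover have "h.agt j < n" if "j < n" for j using that by (rule h.agt(1))
  moreover have "0 < n" using n3 by simp
  ultimately show "\<forall>j<n. h.P j = h.P 0" unfolding h.P_def by metis
 qed
 thus ?thesis by (simp add: same_data h.ns_def same_prefs_def)
qed

lemma T5_eq: "a.T5 = (if same_prefs then col_t4 n + (n - 1) else col_t3 n)"
 unfolding a.T5_def ns_eq m_eq ..

lemma win: "turn a.ps a.sk a.coin a.q = 0 ==> final_output (trace_view n x p (hon e) 0 T) = Some (p 0)"
 using final_color[of 0] n3 h.color_eq[of "h.pos 0"] h.agt(3)[of 0] by (simp add: same_data h.tn_def h.P_def)

end

section \<open>The deviating agent does not win more often than an honest one\<close>

lemma (in coloring_run) ag_neighbour: "i = 1 \<or> i = n - 1 ==> ag i = 1 \<or> ag i = n - 1"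
 using n3 by (auto simp: ag_def)

text \<open>If there is a sink, all preferences agree and both neighbours qualify, but at most one
  of them is the sink.\<close>

lemma (in coloring_run) free_neighbour:
 assumes "p 1 = p 0 \<or> p (n - 1) = p 0"
 shows "\<exists>i. (i = 1 \<or> i = n - 1) \<and> p (ag i) = p 0 \<and> sk \<noteq> Some ((q + i) mod m)"
proof (cases sk)
 case None
 have "ag 1 = 1 \<and> ag (n - 1) = n - 1 \<or> ag 1 = n - 1 \<and> ag (n - 1) = 1" using n3 by (auto simp: ag_def)
 hence "\<exists>i. (i = 1 \<or> i = n - 1) \<and> p (ag i) = p 0" using assms by metis
 thus ?thesis using None by auto
next
 case (Some s)
 hence ns by (auto simp: sk_def split: if_splits)
 moreover have "n - 1 < m" using n3 n_le_m by simp
 ultimately have "P (n - 1) = P 1" unfolding ns_def by blast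
 hence e: "p (ag (n - 1)) = p (ag 1)" using P_real[of 1] P_real[of "n - 1"] n3 by simp
 moreover have "ag 1 = 1 \<and> ag (n - 1) = n - 1 \<or> ag 1 = n - 1 \<and> ag (n - 1) = 1" using n3 by (auto simp: ag_def)
 ultimately have "p (ag 1) = p 0" "p (ag (n - 1)) = p 0" using assms by auto
 moreover have "(q + 1) mod m \<noteq> (q + (n - 1)) mod m"
 proof
  assume e: "(q + 1) mod m = (q + (n - 1)) mod m"
  have inv: "((q + i) mod m + (m - q)) mod m = i" if "i < m" for i
  proof -
   have "q + i + (m - q) = i + m" using q(1) by linarith
   thus ?thesis using that by (metis mod_add_left_eq mod_add_self2 mod_less)
  qed
  have "1 < m" "n - 1 < m" using n3 n_le_m by auto
  hence "1 = n - 1" using inv[of 1] inv[of "n - 1"] e by metis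
  thus False using n3 by simp
 qed
 then consider "s \<noteq> (q + 1) mod m" | "s \<noteq> (q + (n - 1)) mod m" by metis
 thus ?thesis
 proof cases
  case 1
  thus ?thesis using Some \<open>p (ag 1) = p 0\<close> by (intro exI[of _ 1]) simp
 next
  case 2
  thus ?thesis using Some \<open>p (ag (n - 1)) = p 0\<close> by (intro exI[of _ "n - 1"]) simp
 qed
qed

locale coloring_deviation = coloring_ring +
 fixes r :: nat and f :: "nat view => action" and h :: "nat view"
 assumes no_steal: "\<And>i. 1 \<le> i ==> i < n ==> r = 0 ==>
   to_cw (f (View (x 0) (p 0) [])) \<noteq> Id (x i) \<and> to_ccw (f (View (x 0) (p 0) [])) \<noteq> Id (x i)"
  and r_le: "r \<le> T"
begin

definition dev :: "(nat \<times> nat \<times> nat) list list => nat => nat => action" where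
 "dev e = run_act (\<lambda>i v c. if i = 0 \<and> r \<le> length (hist v) then f v else col_act \<beta> ncol v c) n x p (cell e)"

text \<open>Before round \<open>r\<close> the deviating and the honest run coincide, so the same
  tapes lead both to the view \<open>h\<close>, and two subsets of one set are compared.\<close>

definition at_h where "at_h = {e \<in> \<Omega>. trace_view n x p (hon e) 0 r = h}"
definition wins_dev where "wins_dev = {e \<in> at_h. utility coloring_legal (p 0) (outputs n (dev e) T) = 1}"
definition wins_hon where "wins_hon = {e \<in> at_h. utility coloring_legal (p 0) (outputs n (hon e) T) = 1}"

lemma dev_eq:
 "i < n ==> dev e i t = (if i = 0 \<and> r \<le> t then f (trace_view n x p (dev e) i t)
   else col_act \<beta> ncol (trace_view n x p (dev e) i t) (cell e i t))"
 unfolding dev_def by (subst run_act_eq) simp_all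

lemma dev_before: "i < n ==> t < r ==> dev e i t = hon e i t"
proof (induction t arbitrary: i rule: less_induct)
 case (less t)
 hence "trace_view n x p (dev e) i t = trace_view n x p (hon e) i t" by (intro trace_view_cong) auto
 thus ?case using dev_eq[of i e t] hon_eq[of i e t] less.prems by simp
qed

lemma dev_view: "i < n ==> t \<le> r ==> trace_view n x p (dev e) i t = trace_view n x p (hon e) i t"
 using dev_before by (intro trace_view_cong) auto

lemma dev_start:
 assumes "1 \<le> i" "i < n"
 shows "to_cw (dev e 0 0) \<noteq> Id (x i) \<and> to_ccw (dev e 0 0) \<noteq> Id (x i)"
proof (cases "r = 0")
 case True
 hence "dev e 0 0 = f (View (x 0) (p 0) [])"
  using dev_eq[of 0 e 0] n3 by (simp add: trace_view_def trace_hist_def)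
 thus ?thesis using no_steal[OF assms True] by simp
next
 case False
 hence "dev e 0 0 = Act [] None (Id (x 0)) (Id (x 0))" using dev_before[of 0 0] hon_start[of 0] n3 by simp
 moreover have "x 0 \<noteq> x i" using inj assms by (auto simp: inj_on_def)
 ultimately show ?thesis by simp
qed

lemma dev_run:
 assumes "e \<in> wins_dev"
 shows "winning_run \<beta> ncol n x p (dev e) T (cell e)"
proof
 have n0: "0 < n" using n3 by simp
 have u: "final_output (trace_view n x p (dev e) 0 T) = Some (p 0)" "coloring_legal (outputs n (dev e) T)"
  using assms by (auto simp: wins_dev_def utility_one hd_outputs[OF n0, of _ _ x p])
 have some: "final_output (trace_view n x p (dev e) i T) \<noteq> None" if "i < n" for i
  using u(2) that outputs_nth[OF that, of "dev e" T x p] unfolding coloring_legal_def length_outputs by metis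
 have diff: "final_output (trace_view n x p (dev e) i T) \<noteq> final_output (trace_view n x p (dev e) ((i + 1) mod n) T)" if i: "i < n" for i
 proof -
  have "(i + 1) mod n < n" using n3 by simp
  thus ?thesis using u(2) i outputs_nth[OF i, of "dev e" T x p] outputs_nth[of "(i + 1) mod n" n "dev e" T x p]
   unfolding coloring_legal_def length_outputs by metis
 qed
 show "3 \<le> n" "inj_on x {..<n}" by (fact n3 inj)+
 show "final_output (trace_view n x p (dev e) 1 T) \<noteq> Some (p 0)" using diff[of 0] u(1) n3 by simp
 have "(n - 1 + 1) mod n = 0" using n3 by simp
 thus "final_output (trace_view n x p (dev e) (n - 1) T) \<noteq> Some (p 0)" using diff[of "n - 1"] u(1) n3 by simp
 fix i assume i: "1 \<le> i" "i < n"
 show "dev e i t = col_act \<beta> ncol (trace_view n x p (dev e) i t) (cell e i t)" for t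
  using dev_eq[of i e t] i by simp
 show "final_output (trace_view n x p (dev e) i T) \<noteq> None" using some i by blast
 show "to_cw (dev e 0 0) \<noteq> Id (x i) \<and> to_ccw (dev e 0 0) \<noteq> Id (x i)" by (rule dev_start[OF i])
qed

lemma in_tapes: "e \<in> wins_dev ==> e \<in> \<Omega>" "e \<in> at_h ==> e \<in> \<Omega>" "e \<in> wins_dev ==> e \<in> at_h"
 by (auto simp: wins_dev_def at_h_def)

lemma honest_tape: "e \<in> \<Omega> ==> honest_tape \<beta> ncol n x p T e"
 by unfold_locales

lemma dev_pair:
 assumes "e \<in> wins_dev" "e' \<in> wins_dev"
 shows "two_coloring_runs \<beta> ncol n x p (dev e) T (cell e) (dev e') (cell e') T"
proof (intro two_coloring_runs.intro two_coloring_runs_axioms.intro)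
 show "coloring_run \<beta> ncol n x p (dev e) T (cell e)" "coloring_run \<beta> ncol n x p (dev e') T (cell e')"
  using dev_run[OF assms(1)] dev_run[OF assms(2)] by (simp_all add: winning_run_def)
 fix t assume v: "trace_view n x p (dev e) 0 t = trace_view n x p (dev e') 0 t"
 show "dev e 0 t = dev e' 0 t"
 proof (cases "r \<le> t")
  case True
  thus ?thesis using dev_eq[of 0 e t] dev_eq[of 0 e' t] v n3 by simp
 next
  case False
  have "trace_hist n (dev e) 0 r = trace_hist n (dev e') 0 r"
   using in_tapes(3)[OF assms(1)] in_tapes(3)[OF assms(2)] dev_view[of 0 r e] dev_view[of 0 r e'] n3
   by (auto simp: at_h_def trace_view_def)
  thus ?thesis using fst_trace_hist[of t r n "dev e" 0] fst_trace_hist[of t r n "dev e'" 0] False by simp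
 qed
qed simp

lemma dev_hon:
 assumes "e \<in> wins_dev"
 shows "two_coloring_runs \<beta> ncol n x p (dev e) T (cell e) (hon e) (cell e) r"
proof (intro two_coloring_runs.intro two_coloring_runs_axioms.intro r_le)
 interpret H: honest_tape \<beta> ncol n x p T e by (rule honest_tape[OF in_tapes(1)[OF assms]])
 show "coloring_run \<beta> ncol n x p (dev e) T (cell e)" using dev_run[OF assms] by (simp add: winning_run_def)
 show "coloring_run \<beta> ncol n x p (hon e) T (cell e)" by (rule H.a.coloring_run_axioms)
 show "dev e 0 t = hon e 0 t" if "t < r" for t using dev_before that n3 by simp
qed

lemma hon_pair:
 assumes "e \<in> \<Omega>" "e' \<in> \<Omega>" "\<And>t. cell e 0 t = cell e' 0 t"
 shows "two_coloring_runs \<beta> ncol n x p (hon e) T (cell e) (hon e') (cell e') T"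
proof (intro two_coloring_runs.intro two_coloring_runs_axioms.intro)
 interpret H: honest_tape \<beta> ncol n x p T e by (rule honest_tape[OF assms(1)])
 interpret H': honest_tape \<beta> ncol n x p T e' by (rule honest_tape[OF assms(2)])
 show "coloring_run \<beta> ncol n x p (hon e) T (cell e)" by (rule H.a.coloring_run_axioms)
 show "coloring_run \<beta> ncol n x p (hon e') T (cell e')" by (rule H'.a.coloring_run_axioms)
 show "hon e 0 t = hon e' 0 t" if "trace_view n x p (hon e) 0 t = trace_view n x p (hon e') 0 t" for t
  using hon_eq[of 0 e t] hon_eq[of 0 e' t] that assms(3)[of t] n3 by simp
qed simp

abbreviation "flip j \<equiv> retouch j flip_bits"

lemma flip:
 assumes "e \<in> \<Omega>" "j < n"
 shows "flip j e \<in> \<Omega>" "flip j (flip j e) = e"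
  and "i \<noteq> j ==> cell (flip j e) i t = cell e i t"
  and "fst (cell (flip j e) i t) = fst (cell e i t)
    \<and> xor (snd (snd (cell (flip j e) i t))) (fst (snd (cell (flip j e) i t))) = xor (snd (snd (cell e i t))) (fst (snd (cell e i t)))"
  and "t < T ==> fst (snd (cell e j t)) + fst (snd (cell (flip j e) j t)) = 1"
proof -
 show 1: "flip j e \<in> \<Omega>" using flip_bits_cells assms by (intro retouch_tapes) auto
 have 2: "flip j (flip j e) \<in> \<Omega>" using flip_bits_cells assms 1 by (intro retouch_tapes) auto
 show "flip j (flip j e) = e"
 proof (rule tapes_eqI[OF 2 assms(1)])
  fix t i assume t: "t < T" "i < n"
  have "flip_bits (flip_bits (e ! t ! i)) = e ! t ! i" using flip_bits_cells[OF tapesD(3)[OF assms(1) t]] by blast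
  thus "flip j (flip j e) ! t ! i = e ! t ! i"
   unfolding retouch_nth[OF 1 t assms(2)] retouch_nth[OF assms(1) t assms(2)] by (cases "i = j") (simp_all only: if_True if_False simp_thms)
 qed
 show "i \<noteq> j ==> cell (flip j e) i t = cell e i t" by (simp add: cell_retouch[OF assms])
 show "fst (cell (flip j e) i t) = fst (cell e i t)
    \<and> xor (snd (snd (cell (flip j e) i t))) (fst (snd (cell (flip j e) i t))) = xor (snd (snd (cell e i t))) (fst (snd (cell e i t)))"
 proof (cases "i = j \<and> t < T")
  case True
  thus ?thesis
   using xor_flip_bits[OF cell_in[OF assms(1), of i t]] unfolding cell_retouch[OF assms] if_P[OF True]
   by (simp only: simp_thms) (simp add: flip_bits_def)
 qed (simp only: cell_retouch[OF assms] if_False simp_thms)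
 show "t < T ==> fst (snd (cell e j t)) + fst (snd (cell (flip j e) j t)) = 1"
  using cell_in[OF assms(1), of j t] by (auto simp: cell_retouch[OF assms] flip_bits_def col_cells_def)
qed

lemma other_coin:
 fixes S S' y y' :: nat
 assumes "S + y' = S' + y" "y + y' = 1"
 shows "S mod 2 \<noteq> S' mod 2"
 using assms by presburger

text \<open>The flip changes the coin but neither the preferences nor the sink. One of the two coins
  therefore serves a neighbour with the preference of agent \<open>0\<close> in the first round, and
  on that tape agent \<open>0\<close> does not win.\<close>

lemma not_both_win:
 assumes alone: "p 1 = p 0 \<or> p (n - 1) = p 0"
  and w: "e \<in> wins_dev" "e' \<in> wins_dev"
  and e': "e' = flip (coloring_run.ag n x (dev e) T 1) e"
  and few: "coloring_run.m n x (dev e) T + 2 \<le> 2 * n"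
 shows False
proof -
 interpret W: winning_run \<beta> ncol n x p "dev e" T "cell e" by (rule dev_run[OF w(1)])
 let ?j = "W.ag 1"
 interpret W': winning_run \<beta> ncol n x p "dev e'" T "cell e'" by (rule dev_run[OF w(2)])
 have j: "1 \<le> ?j" "?j < n" using W.ag(1)[of 1] n3 by auto
 note F = flip[OF in_tapes(1)[OF w(1)] j(2), folded e']
 interpret C: coin_flip_runs \<beta> ncol n x p "dev e" T "cell e" "dev e'" "cell e'" T
 proof (intro coin_flip_runs.intro coin_flip_runs_axioms.intro dev_pair w few)
  show "W.T5 + W.m \<le> T" using W.late_enough(2) by linarith
  show "cell e' i t = cell e i t" if "i \<noteq> ?j" for i t using F(3)[OF that] .
  show "fst (cell e' ?j t) = fst (cell e ?j t)
    \<and> xor (snd (snd (cell e' ?j t))) (fst (snd (cell e' ?j t))) = xor (snd (snd (cell e ?j t))) (fst (snd (cell e ?j t)))" for t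
   using F(4)[of ?j t] .
 qed
 note same = C.m_same[OF C.early] C.geometry_same[OF C.early] C.ps_same[OF C.early]
 have "W.y 1 + W'.y 1 = 1"
  using F(5)[of W.T5] W.late_enough(2) by (simp add: W.y_def W'.y_def same)
 hence c: "W.coin \<noteq> W'.coin"
  using other_coin[OF C.inputs_sum] by (simp add: W.coin_def W'.coin_def same)
 obtain i where i: "i = 1 \<or> i = n - 1" "p (W.ag i) = p 0" "W.sk \<noteq> Some ((W.q + i) mod W.m)"
  using W.free_neighbour[OF alone] by blast
 have "turn W.ps W.sk W.coin ((W.q + i) mod W.m) \<noteq> 0" using W.neighbour_turn[OF i(1,2)] .
 moreover have "turn W.ps W.sk W'.coin ((W.q + i) mod W.m) \<noteq> 0"
  using W'.neighbour_turn[OF i(1)] i(2) by (simp add: same C.sink_same)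
 ultimately show False using turn_zero_some_coin[OF i(3) W.coin_less W'.coin_less c, of W.ps] by (metis (no_types))
qed

lemma hon_in_wins:
 assumes "e \<in> at_h" "final_output (trace_view n x p (hon e) 0 T) = Some (p 0)"
 shows "e \<in> wins_hon"
 using assms honest_tape.legal[OF honest_tape[OF in_tapes(2)[OF assms(1)]]]
  hd_outputs[of n "hon e" T x p] n3 by (simp add: wins_hon_def utility_one)

lemma hon_flips:
 assumes "e \<in> \<Omega>"
 defines "e' \<equiv> flip (coloring_run.ag n x (hon e) T 1) e"
 shows "coin_flip_runs \<beta> ncol n x p (hon e) T (cell e) (hon e') (cell e') T"
proof -
 interpret H: honest_tape \<beta> ncol n x p T e by (rule honest_tape[OF assms(1)])
 let ?j = "H.a.ag 1"
 have j: "1 \<le> ?j" "?j < n" using H.a.ag(1)[of 1] n3 by auto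
 note F = flip[OF assms(1) j(2)]
 show ?thesis
 proof (intro coin_flip_runs.intro coin_flip_runs_axioms.intro hon_pair assms(1))
  show "e' \<in> \<Omega>" unfolding e'_def by (rule F(1))
  show "cell e 0 t = cell e' 0 t" for t unfolding e'_def using F(3)[of 0 t] j by simp
  show "H.a.m + 2 \<le> 2 * n" using H.m_eq n3 by simp
  show "H.a.T5 + H.a.m \<le> T" using H.a.late_enough(2) by linarith
  show "cell e' i t = cell e i t" if "i \<noteq> ?j" for i t unfolding e'_def using F(3)[OF that] .
  show "fst (cell e' ?j t) = fst (cell e ?j t)
    \<and> xor (snd (snd (cell e' ?j t))) (fst (snd (cell e' ?j t))) = xor (snd (snd (cell e ?j t))) (fst (snd (cell e ?j t)))" for t
   unfolding e'_def using F(4)[of ?j t] .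
 qed
qed

text \<open>The counterpart of \<open>not_both_win\<close>: unless it is the sink, the honest agent
  is itself served by one of the two coins.\<close>

lemma hon_wins_once:
 assumes "e \<in> \<Omega>" and sk: "coloring_run.sk n x p (hon e) T (cell e) \<noteq> Some (coloring_run.q n x (hon e) T)"
 defines "e' \<equiv> flip (coloring_run.ag n x (hon e) T 1) e"
 shows "final_output (trace_view n x p (hon e) 0 T) = Some (p 0) \<or> final_output (trace_view n x p (hon e') 0 T) = Some (p 0)"
proof -
 interpret H: honest_tape \<beta> ncol n x p T e by (rule honest_tape[OF assms(1)])
 let ?j = "H.a.ag 1"
 have j: "1 \<le> ?j" "?j < n" using H.a.ag(1)[of 1] n3 by auto
 note F = flip[OF assms(1) j(2)]
 interpret H': honest_tape \<beta> ncol n x p T e' unfolding e'_def by (rule honest_tape[OF F(1)])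
 interpret C: coin_flip_runs \<beta> ncol n x p "hon e" T "cell e" "hon e'" "cell e'" T
  unfolding e'_def by (rule hon_flips[OF assms(1)])
 note same = C.m_same[OF C.early] C.geometry_same[OF C.early] C.ps_same[OF C.early]
 have "H.a.y 1 + H'.a.y 1 = 1"
  using F(5)[of H.a.T5] H.a.late_enough(2) by (simp add: H.a.y_def H'.a.y_def same) (simp add: e'_def)
 hence c: "H.a.coin \<noteq> H'.a.coin"
  using other_coin[OF C.inputs_sum] by (simp add: H.a.coin_def H'.a.coin_def same)
 have "turn H.a.ps H.a.sk H.a.coin H.a.q = 0 \<or> turn H'.a.ps H'.a.sk H'.a.coin H'.a.q = 0"
  using turn_zero_some_coin[OF sk H.a.coin_less H'.a.coin_less c, of H.a.ps] by (simp add: same C.sink_same)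
 thus ?thesis using H.win H'.win by blast
qed

lemma hon_wins_alone:
 assumes "e \<in> \<Omega>" "p 1 \<noteq> p 0" "p (n - 1) \<noteq> p 0"
 shows "final_output (trace_view n x p (hon e) 0 T) = Some (p 0)"
proof -
 interpret H: honest_tape \<beta> ncol n x p T e by (rule honest_tape[OF assms(1)])
 note m = H.m_eq
 have one: "1 \<le> (1::nat)" "1 < n" "1 \<le> n - 1" "n - 1 < n" using n3 by auto
 have q: "H.a.ps ! H.a.q = p 0" "H.a.q < n" using H.a.ps_nth[of 0] H.P_own n3 H.a.q(1) by (simp_all add: m)
 have nb: "H.a.ps ! ((H.a.q + i) mod n) \<noteq> p 0" if "i = 1 \<or> i = n - 1" for i
 proof -
  have "1 \<le> i" "i < n" using that one by auto
  hence "H.a.ps ! ((H.a.q + i) mod n) = p (H.a.ag i)" using H.a.ps_nth[of i] H.a.P_real[of i] by (simp add: m)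
  moreover have "H.a.ag i = 1 \<or> H.a.ag i = n - 1" by (rule H.a.ag_neighbour[OF that])
  ultimately show ?thesis using assms(2,3) by auto
 qed
 have "\<not> same_prefs" unfolding same_prefs_def using assms(2) one(2) by blast
 hence "H.a.sk = None" using H.ns_eq by (simp add: H.a.sk_def)
 moreover have "H.a.q + n - 1 = H.a.q + (n - 1)" using n3 by simp
 ultimately have "turn H.a.ps H.a.sk H.a.coin H.a.q = 0"
  using q nb[of 1] nb[of "n - 1"] n3 by (intro turn_zero_alone) (simp_all add: H.a.length_ps m)
 thus ?thesis by (rule H.win)
qed

end

lemma mod_balance:
 fixes A B a b n :: nat
 assumes "A mod n = B mod n" "B + a mod n = A + b mod n"
 shows "a mod n = b mod n"
proof -
 have "int A mod int n = int B mod int n" using assms(1) by (metis zmod_int)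
 hence "int n dvd int A - int B" by (simp add: mod_eq_dvd_iff)
 moreover have "int A - int B = int (a mod n) - int (b mod n)" using assms(2) by linarith
 ultimately have "int (a mod n) mod int n = int (b mod n) mod int n" by (simp add: mod_eq_dvd_iff)
 hence "int (a mod n) = int (b mod n)" by (simp add: zmod_int)
 thus ?thesis by (simp only: of_nat_eq_iff)
qed

lemma card_bound_divide:
 assumes "0 < m" "m dvd fact T" "fact T * a \<le> b * (fact T div m) * c"
 shows "m * a \<le> b * (c :: nat)"
proof -
 obtain d where d: "fact T = m * d" using assms(2) by blast
 hence "0 < d" using fact_gt_zero[of T, where ?'a = nat] by (cases d) auto
 moreover have "d * (m * a) \<le> d * (b * c)" using assms(1,3) by (simp add: d mult_ac)
 ultimately show ?thesis by simp
qed

context coloring_deviation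
begin

lemma wins_le: "finite wins_hon" "wins_dev \<subseteq> \<Omega>" "wins_hon \<subseteq> \<Omega>"
 using finite_subset[OF _ tapes_finite, of wins_hon] by (auto simp: wins_hon_def wins_dev_def at_h_def)

lemma late_size:
 assumes "0 < r" "e \<in> wins_dev"
 shows "coloring_run.m n x (dev e) T = n"
proof -
 interpret W: winning_run \<beta> ncol n x p "dev e" T "cell e" by (rule dev_run[OF assms(2)])
 have "dev e 0 0 = Act [] None (Id (x 0)) (Id (x 0))" using dev_before[of 0 0] hon_start[of 0] n3 assms(1) by simp
 thus ?thesis by (intro W.one_id[of "x 0"]) simp_all
qed

lemma alone_le:
 assumes "p 1 \<noteq> p 0" "p (n - 1) \<noteq> p 0"
 shows "wins_dev \<subseteq> wins_hon"
 using in_tapes(1,3) hon_in_wins hon_wins_alone[OF _ assms] by blast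

definition coin_start where "coin_start = (if same_prefs then col_t4 n + (n - 1) else col_t3 n)"

lemma coin_start: "col_t3 n \<le> coin_start" "0 < col_t3 n"
 using n3 by (auto simp: coin_start_def col_t4_def col_t3_def col_t2_def col_t1_def)

text \<open>By round \<open>r\<close> agent \<open>0\<close> has sent all shares of its input, so
  the deviating and the honest run on the same tape have the same coin, and \<open>own_turn\<close>
  applies.\<close>

lemma late_le:
 assumes "coin_start + n \<le> r"
 shows "wins_dev \<subseteq> wins_hon"
proof
 fix e assume w: "e \<in> wins_dev"
 interpret W: winning_run \<beta> ncol n x p "dev e" T "cell e" by (rule dev_run[OF w])
 interpret H: honest_tape \<beta> ncol n x p T e by (rule honest_tape[OF in_tapes(1)[OF w]])
 have m: "W.m = n" using late_size[OF _ w] assms n3 by simp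
 interpret C0: two_coloring_runs \<beta> ncol n x p "dev e" T "cell e" "hon e" "cell e" r by (rule dev_hon[OF w])
 have early: "W.t3 \<le> r" using coin_start(1) assms m by simp
 have T5: "W.T5 = coin_start" using C0.ps_same(3)[OF early] H.T5_eq by (simp add: coin_start_def)
 interpret C: coin_flip_runs \<beta> ncol n x p "dev e" T "cell e" "hon e" "cell e" r
  by (intro coin_flip_runs.intro coin_flip_runs_axioms.intro dev_hon w) (use m n3 T5 assms in auto)
 note same = C0.m_same[OF early] C0.geometry_same[OF early] C0.ps_same[OF early]
 have "H.a.y 1 = W.y 1" by (simp add: H.a.y_def W.y_def same)
 hence coin: "H.a.coin = W.coin" using C.inputs_sum by (simp add: H.a.coin_def W.coin_def same)
 have "W.P 0 = p 0" using C0.P_same[OF early, of 0] H.P_own n3 m by simp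
 hence "turn W.ps W.sk W.coin W.q = 0" by (rule W.own_turn[OF m])
 hence "turn H.a.ps H.a.sk H.a.coin H.a.q = 0" by (simp only: same C.sink_same coin)
 thus "e \<in> wins_hon" by (intro hon_in_wins in_tapes(3)[OF w] H.win)
qed

definition front where "front = (if oriented_cw (map x [0..<n]) then 1 else n - 1)"

lemma front: "1 \<le> front" "front < n"
 using n3 by (auto simp: front_def)

lemma hon_front: "e \<in> \<Omega> ==> coloring_run.ag n x (hon e) T 1 = front"
proof -
 assume o: "e \<in> \<Omega>"
 interpret H: honest_tape \<beta> ncol n x p T e by (rule honest_tape[OF o])
 show ?thesis using n3 by (simp add: H.a.ag_def H.same_data(5) H.h.fwd_def front_def)
qed

lemma flip_bij: "j < n ==> bij_betw (flip j) \<Omega> \<Omega>"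
 using flip_bits_cells by (intro retouch_bij col_cells inj_flip_bits) auto

text \<open>The number of agent \<open>0\<close> for the choice of the sink is already sent, so the
  sink can no longer be influenced, and the coin is still hidden, so flipping preserves
  \<open>at_h\<close>. On each pair of tapes the deviation wins at most once, and if it does, the
  honest agent wins at least once.\<close>

lemma middle_le:
 assumes r: "col_t3 n < r" "r < coin_start + n" and alone: "p 1 = p 0 \<or> p (n - 1) = p 0"
 shows "card wins_dev \<le> card wins_hon"
proof -
 let ?J = "flip front"
 have J: "?J e \<in> at_h \<and> ?J (?J e) = e" if o: "e \<in> at_h" for e
 proof -
  have t: "e \<in> \<Omega>" using in_tapes(2)[OF o] .
  interpret H: honest_tape \<beta> ncol n x p T e by (rule honest_tape[OF t])
  interpret C: coin_flip_runs \<beta> ncol n x p "hon e" T "cell e" "hon (?J e)" "cell (?J e)" T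
   using hon_flips[OF t] hon_front[OF t] by simp
  have "r < H.a.T5 + H.a.m" using r(2) H.T5_eq H.m_eq by (simp add: coin_start_def)
  hence "trace_view n x p (hon (?J e)) 0 r = h" using C.view_0_until_secret[of r] o by (simp add: at_h_def)
  thus ?thesis using flip[OF t front(2)] by (simp add: at_h_def)
 qed
 have not_sink: "e \<in> wins_hon \<or> ?J e \<in> wins_hon" "?J e \<notin> wins_dev" if w: "e \<in> wins_dev" for e
 proof -
  have t: "e \<in> \<Omega>" "e \<in> at_h" using in_tapes(1,3)[OF w] .
  interpret W: winning_run \<beta> ncol n x p "dev e" T "cell e" by (rule dev_run[OF w])
  interpret H: honest_tape \<beta> ncol n x p T e by (rule honest_tape[OF t(1)])
  have m: "W.m = n" using late_size[OF _ w] r(1) by simp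
  interpret C: two_coloring_runs \<beta> ncol n x p "dev e" T "cell e" "hon e" "cell e" r by (rule dev_hon[OF w])
  have early: "W.t3 \<le> r" using r(1) m by simp
  note same = C.geometry_same[OF early] C.ps_same[OF early]
  have sk: "H.a.sk = W.sk"
  proof (rule C.sk_same[OF early])
   show "dev e 0 (W.t3 + s) = hon e 0 (W.t3 + s)" if "s \<le> W.m - n" for s
    using that m r(1) dev_before[of 0 "W.t3 + s"] n3 by simp
  qed simp
  \<comment> \<open>The sink of a winning run with equal preferences is some other agent by
    \<open>sink_is_real\<close>; the honest run has the same sink.\<close>
  have "W.sk \<noteq> Some W.q"
  proof
   assume *: "W.sk = Some W.q"
   hence "W.ns" by (auto simp: W.sk_def split: if_splits)
   hence "same_prefs" using H.ns_eq same by simp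
   then obtain i where i: "1 \<le> i" "i < n" "W.sk = Some ((W.q + i) mod W.m)"
    using W.sink_is_real unfolding same_prefs_def by blast
   hence "(W.q + i) mod n = W.q" "W.q < n" using * m W.q(1) by auto
   thus False using i(1,2) by (cases "W.q + i < n") (auto simp: le_mod_geq)
  qed
  hence "H.a.sk \<noteq> Some H.a.q" by (simp only: sk same) simp
  from hon_wins_once[OF t(1) this] hon_front[OF t(1)]
  show "e \<in> wins_hon \<or> ?J e \<in> wins_hon" using hon_in_wins t(2) J[OF t(2)] by metis
  show "?J e \<notin> wins_dev"
  proof
   assume J': "?J e \<in> wins_dev"
   have "W.ag 1 = front" using hon_front[OF t(1)] same by simp
   thus False using not_both_win[OF alone w J'] m n3 by simp
  qed
 qed
 have fin: "finite at_h" using finite_subset[OF _ tapes_finite, of at_h] by (auto simp: at_h_def)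
 have bij: "bij_betw ?J at_h at_h" using J by (intro bij_betwI[where g = ?J]) auto
 have sub: "wins_dev \<subseteq> at_h" "wins_hon \<subseteq> at_h" by (auto simp: wins_dev_def wins_hon_def)
 have "2 * card wins_dev = (\<Sum>e\<in>at_h. of_bool (e \<in> wins_dev) + of_bool (?J e \<in> wins_dev))"
  by (rule card_pairs[OF fin bij sub(1), symmetric])
 also have "\<dots> \<le> (\<Sum>e\<in>at_h. of_bool (e \<in> wins_hon) + of_bool (?J e \<in> wins_hon))"
 proof (rule sum_mono)
  fix e assume o: "e \<in> at_h"
  show "of_bool (e \<in> wins_dev) + of_bool (?J e \<in> wins_dev) \<le> (of_bool (e \<in> wins_hon) + of_bool (?J e \<in> wins_hon) :: nat)"
   using not_sink[of e] not_sink[of "?J e"] J[OF o] by (auto simp: of_bool_def)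
 qed
 also have "\<dots> = 2 * card wins_hon" by (rule card_pairs[OF fin bij sub(2)])
 finally show ?thesis by simp
qed

text \<open>Nothing is drawn before round \<open>col_t3 n\<close>, so the view of agent
  \<open>0\<close> is the same on all tapes.\<close>

lemma early_views:
 assumes "r \<le> col_t3 n" "at_h \<noteq> {}"
 shows "at_h = \<Omega>"
proof -
 obtain e where w: "e \<in> at_h" using assms(2) by blast
 have "trace_view n x p (hon e') 0 r = trace_view n x p (hon e) 0 r" if t': "e' \<in> \<Omega>" for e'
 proof -
  have t: "e \<in> \<Omega>" using in_tapes(2)[OF w] .
  interpret H: honest_tape \<beta> ncol n x p T e by (rule honest_tape[OF t])
  interpret H': honest_tape \<beta> ncol n x p T e' by (rule honest_tape[OF t'])
  have no_coins: "coins (hon e i s) = []" if "i < n" "s < col_t3 n" for i s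
  proof -
   have "s \<noteq> H.h.t5" using that(2) H.h.t_order by linarith
   thus ?thesis using that by (simp add: H.hon_table H.h.hact_def Let_def H.h.drawn_coins_def)
  qed
  have le: "col_t3 n \<le> T" using H.h.t_order H.horizon by linarith
  interpret C: two_coloring_runs \<beta> ncol n x p "hon e" T "cell e" "hon e'" "cell e'" "col_t3 n"
  proof (intro two_coloring_runs.intro two_coloring_runs_axioms.intro H.a.coloring_run_axioms H'.a.coloring_run_axioms le)
   fix s assume s: "s < col_t3 n" "trace_view n x p (hon e) 0 s = trace_view n x p (hon e') 0 s"
   have "hon e' 0 s = col_act \<beta> ncol (trace_view n x p (hon e) 0 s) (cell e' 0 s)" using hon_eq[of 0 e' s] s(2) n3 by simp
   also have "\<dots> = col_act \<beta> ncol (trace_view n x p (hon e) 0 s) (cell e 0 s)"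
    using no_coins[of 0 s] s(1) hon_eq[of 0 e s] n3 by (intro col_act_no_coins) simp
   also have "\<dots> = hon e 0 s" using hon_eq[of 0 e s] n3 by simp
   finally show "hon e 0 s = hon e' 0 s" ..
  qed
  have "hon e' i s = hon e i s" if "i < n" "s < r" for i s
   using C.early_same[unfolded H.m_eq, of s i] that assms(1) by simp
  thus ?thesis using n3 by (intro trace_view_cong) auto
 qed
 thus ?thesis using w by (auto simp: at_h_def)
qed

lemma half_honest:
 assumes "at_h = \<Omega>" "\<not> same_prefs"
 shows "card \<Omega> \<le> 2 * card wins_hon"
proof -
 have once: "e \<in> wins_hon \<or> flip front e \<in> wins_hon" if o: "e \<in> \<Omega>" for e
 proof -
  interpret H: honest_tape \<beta> ncol n x p T e by (rule honest_tape[OF o])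
  have "H.a.sk = None" using H.ns_eq assms(2) by (simp add: H.a.sk_def)
  hence "H.a.sk \<noteq> Some H.a.q" by simp
  from hon_wins_once[OF o this] hon_front[OF o] show ?thesis using hon_in_wins o flip(1)[OF o front(2)] assms(1) by metis
 qed
 have "card \<Omega> = (\<Sum>e\<in>\<Omega>. 1)" by simp
 also have "\<dots> \<le> (\<Sum>e\<in>\<Omega>. of_bool (e \<in> wins_hon) + of_bool (flip front e \<in> wins_hon))"
  using once by (intro sum_mono) (auto simp: of_bool_def)
 also have "\<dots> = 2 * card wins_hon" by (rule card_pairs[OF tapes_finite flip_bij[OF front(2)] wins_le(3)])
 finally show ?thesis .
qed

abbreviation "reweight j k \<equiv> retouch j (shift_weight (fact T) k)"

lemma shift_bij: "j < n ==> bij_betw (reweight j k) \<Omega> \<Omega>"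
 using shift_weight_cells by (intro retouch_bij col_cells) auto

lemma shift_cell:
 assumes "e \<in> \<Omega>" "j < n"
 shows "i \<noteq> j ==> cell (reweight j k e) i t = cell e i t"
  and "t < T ==> fst (cell (reweight j k e) j t) = (fst (cell e j t) + k) mod fact T"
 by (simp_all add: cell_retouch[OF assms] shift_weight_def)

text \<open>Agent \<open>0\<close> is the sink on at most a fraction \<open>1 / n\<close> of the
  tapes, since of all rotations of the number of another agent only one residue makes it so. Of any
  other tape and its flip at least one is won.\<close>

lemma honest_sink:
 assumes "at_h = \<Omega>" same_prefs
 shows "(n - 1) * card \<Omega> \<le> 2 * n * card wins_hon"
proof -
 define own where "own e \<longleftrightarrow> coloring_run.sk n x p (hon e) T (cell e) = Some (coloring_run.q n x (hon e) T)" for e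
 define S where "S = {e \<in> \<Omega>. own e}"
 have n0: "0 < n" "n dvd fact T" using n3 long by (auto intro: dvd_fact)
 have "fact T * card S \<le> (fact T div n) * card \<Omega>"
 proof (rule card_translates[OF tapes_finite, where J = "reweight front"])
  show "bij_betw (reweight front k) \<Omega> \<Omega>" for k by (rule shift_bij[OF front(2)])
  show "S \<subseteq> \<Omega>" by (auto simp: S_def)
  fix e assume o: "e \<in> \<Omega>"
  show "card {k \<in> {..<fact T}. reweight front k e \<in> S} \<le> fact T div n"
  proof (cases "\<exists>k0. reweight front k0 e \<in> S")
   case True
   \<comment> \<open>The sum of the numbers is not computed. One shift that makes agent
     \<open>0\<close> the sink serves as reference, and every other such shift is congruent to it
     modulo \<open>n\<close>.\<close>
   then obtain k0 where k0: "reweight front k0 e \<in> S" by blast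
   define u where "u = fst (cell e front (col_t3 n))"
   have "(u + k) mod n = (u + k0) mod n" if k: "reweight front k e \<in> S" for k
   proof -
    define e0 where "e0 = reweight front k0 e"
    define ek where "ek = reweight front k e"
    have t: "e0 \<in> \<Omega>" "ek \<in> \<Omega>" "own e0" "own ek" using k k0 by (auto simp: S_def e0_def ek_def)
    interpret H0: honest_tape \<beta> ncol n x p T e0 by (rule honest_tape[OF t(1)])
    interpret Hk: honest_tape \<beta> ncol n x p T ek by (rule honest_tape[OF t(2)])
    interpret C: two_coloring_runs \<beta> ncol n x p "hon e0" T "cell e0" "hon ek" "cell ek" T
     using front shift_cell(1)[OF o front(2), of 0] by (intro hon_pair t) (simp add: e0_def ek_def)
    have lt: "col_t3 n < T" "col_t3 n \<le> T" using H0.h.t_order H0.horizon by linarith+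
    hence early: "H0.a.t3 \<le> T" by (simp add: H0.m_eq)
    note same = C.geometry_same[OF early]
    have f: "H0.a.ag 1 = front" "Hk.a.ag 1 = front" using hon_front[OF t(1)] hon_front[OF t(2)] .
    have w: "H0.a.w 1 = (u + k0) mod n" "Hk.a.w 1 = (u + k) mod n"
     using shift_cell(2)[OF o front(2) lt(1)] n0(2)
     by (simp_all add: H0.a.w_def Hk.a.w_def f H0.m_eq Hk.m_eq u_def mod_mod_cancel del: One_nat_def)
      (simp_all add: e0_def ek_def mod_mod_cancel)
    have ns: "H0.a.ns" "Hk.a.ns" using H0.ns_eq Hk.ns_eq assms(2) by auto
    have sum: "(\<Sum>j<n. Hk.a.Wt j) + (u + k0) mod n = (\<Sum>j<n. H0.a.Wt j) + (u + k) mod n"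
    proof -
     have "(\<Sum>j<H0.a.m. Hk.a.Wt j) + H0.a.w 1 = (\<Sum>j<H0.a.m. H0.a.Wt j) + Hk.a.w 1"
     proof (rule C.weights_shift[OF early ns(1)])
      show "H0.a.m + 2 \<le> 2 * n" "H0.a.t3 + (H0.a.m - n) < T" using n3 lt(1) by (simp_all add: H0.m_eq)
      show "fst (cell ek i H0.a.t3) = fst (cell e0 i H0.a.t3)" if "i \<noteq> H0.a.ag 1" for i
      proof -
       have "i \<noteq> front" using that f by simp
       thus ?thesis unfolding e0_def ek_def by (simp only: shift_cell(1)[OF o front(2) \<open>i \<noteq> front\<close>])
      qed
     qed
     thus ?thesis by (simp only: w H0.m_eq)
    qed
    have "H0.a.sk = Some H0.a.q" "Hk.a.sk = Some Hk.a.q" using t(3,4) unfolding own_def by blast+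
    hence "index_of H0.a.V (rev (sort H0.a.V) ! ((\<Sum>j<H0.a.m. H0.a.Wt j) mod H0.a.m)) = H0.a.q"
     "index_of Hk.a.V (rev (sort Hk.a.V) ! ((\<Sum>j<Hk.a.m. Hk.a.Wt j) mod Hk.a.m)) = Hk.a.q"
     unfolding H0.a.sk_def Hk.a.sk_def if_P[OF ns(1)] if_P[OF ns(2)] option.inject .
    hence e: "index_of H0.a.V (rev (sort H0.a.V) ! ((\<Sum>j<n. H0.a.Wt j) mod n)) =
      index_of H0.a.V (rev (sort H0.a.V) ! ((\<Sum>j<n. Hk.a.Wt j) mod n))"
     unfolding same H0.m_eq Hk.m_eq by (rule trans[OF _ sym])
    have lt: "z mod n < H0.a.m" for z unfolding H0.m_eq using n0(1) by (rule mod_less_divisor)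
    have "(\<Sum>j<n. H0.a.Wt j) mod n = (\<Sum>j<n. Hk.a.Wt j) mod n" by (rule H0.a.length_V_index[OF lt lt e])
    thus ?thesis using sum by (rule mod_balance[THEN sym])
   qed
   hence "{k \<in> {..<fact T}. reweight front k e \<in> S} \<subseteq> {k \<in> {..<fact T}. (u + k) mod n \<in> {(u + k0) mod n}}" by auto
   hence "card {k \<in> {..<fact T}. reweight front k e \<in> S} \<le> card {k \<in> {..<fact T}. (u + k) mod n \<in> {(u + k0) mod n}}"
    by (intro card_mono) auto
   also have "\<dots> = fact T div n" using card_shift_class[OF n0, of "{(u + k0) mod n}" u] n0(1) by simp
   finally show ?thesis .
  qed simp
 qed
 hence S: "n * card S \<le> card \<Omega>" using card_bound_divide[OF n0, of "card S" 1 "card \<Omega>"] by simp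
 have once: "e \<in> wins_hon \<or> flip front e \<in> wins_hon" if o: "e \<in> \<Omega>" "e \<notin> S" for e
 proof -
  have "\<not> own e" using o by (simp add: S_def)
  from hon_wins_once[OF o(1) this[unfolded own_def]] hon_front[OF o(1)]
  show ?thesis using hon_in_wins o(1) flip(1)[OF o(1) front(2)] assms(1) by metis
 qed
 have "card \<Omega> = card (\<Omega> - S) + card S"
  using card_Diff_subset[of S \<Omega>] card_mono[OF tapes_finite, of S] finite_subset[OF _ tapes_finite, of S] by (auto simp: S_def)
 moreover have "card (\<Omega> - S) \<le> 2 * card wins_hon"
 proof -
  have "card (\<Omega> - S) = (\<Sum>e\<in>\<Omega>. of_bool (e \<notin> S))" by (simp add: sum_of_bool[OF tapes_finite] set_diff_eq)
  also have "\<dots> \<le> (\<Sum>e\<in>\<Omega>. of_bool (e \<in> wins_hon) + of_bool (flip front e \<in> wins_hon))"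
   using once by (intro sum_mono) (auto simp: of_bool_def)
  also have "\<dots> = 2 * card wins_hon" by (rule card_pairs[OF tapes_finite flip_bij[OF front(2)] wins_le(3)])
  finally show ?thesis .
 qed
 ultimately have "n * card \<Omega> \<le> n * (2 * card wins_hon) + card \<Omega>" using S by (metis add_mono distrib_left mult_le_mono2)
 thus ?thesis using n3 by (simp add: diff_mult_distrib mult.assoc mult.left_commute[of 2])
qed

context
 assumes few: "\<And>e. e \<in> wins_dev ==> coloring_run.m n x (dev e) T + 2 \<le> 2 * n"
  and alone: "p 1 = p 0 \<or> p (n - 1) = p 0"
begin

lemma dev_ag:
 assumes "e \<in> wins_dev" "e' \<in> wins_dev"
 shows "coloring_run.ag n x (dev e') T = coloring_run.ag n x (dev e) T"
  and "coloring_run.m n x (dev e') T = coloring_run.m n x (dev e) T"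
proof -
 interpret C: two_coloring_runs \<beta> ncol n x p "dev e" T "cell e" "dev e'" "cell e'" T by (rule dev_pair[OF assms])
 have early: "C.a.t3 \<le> T" using C.a.T5_order(1) C.a.late_enough(2) by linarith
 show "coloring_run.ag n x (dev e') T = coloring_run.ag n x (dev e) T" using C.geometry_same[OF early] by simp
 show "coloring_run.m n x (dev e') T = coloring_run.m n x (dev e) T" using C.m_same[OF early] by simp
qed

lemma dev_ag_real: "e \<in> wins_dev ==> 1 \<le> coloring_run.ag n x (dev e) T 1 \<and> coloring_run.ag n x (dev e) T 1 < n"
proof -
 assume w: "e \<in> wins_dev"
 interpret W: winning_run \<beta> ncol n x p "dev e" T "cell e" by (rule dev_run[OF w])
 show ?thesis using W.ag(1)[of 1] n3 by simp
qed

lemma pairs_dev: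
 assumes "e0 \<in> wins_dev"
 defines "j \<equiv> coloring_run.ag n x (dev e0) T 1"
 shows "2 * card wins_dev = card {e \<in> \<Omega>. e \<in> wins_dev \<or> flip j e \<in> wins_dev}"
proof -
 have j: "j < n" using dev_ag_real[OF assms(1)] by (simp add: j_def)
 have "2 * card wins_dev = (\<Sum>e\<in>\<Omega>. of_bool (e \<in> wins_dev) + of_bool (flip j e \<in> wins_dev))"
  by (rule card_pairs[OF tapes_finite flip_bij[OF j] wins_le(2), symmetric])
 also have "\<dots> = (\<Sum>e\<in>\<Omega>. of_bool (e \<in> wins_dev \<or> flip j e \<in> wins_dev))"
 proof (rule sum.cong[OF refl])
  fix e
  have "\<not> (e \<in> wins_dev \<and> flip j e \<in> wins_dev)"
  proof
   assume w: "e \<in> wins_dev \<and> flip j e \<in> wins_dev"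
   hence "flip j e = flip (coloring_run.ag n x (dev e) T 1) e"
    using dev_ag(1)[OF assms(1)] by (simp add: j_def)
   thus False using not_both_win[OF alone _ _ _ few] w by blast
  qed
  thus "of_bool (e \<in> wins_dev) + of_bool (flip j e \<in> wins_dev) = (of_bool (e \<in> wins_dev \<or> flip j e \<in> wins_dev) :: nat)"
   by (auto simp: of_bool_def)
 qed
 also have "\<dots> = card {e \<in> \<Omega>. e \<in> wins_dev \<or> flip j e \<in> wins_dev}" by (rule sum_of_bool[OF tapes_finite])
 finally show ?thesis .
qed

lemma half_dev: "2 * card wins_dev \<le> card \<Omega>"
proof (cases "wins_dev = {}")
 case False
 then obtain e0 where "e0 \<in> wins_dev" by blast
 thus ?thesis using pairs_dev[of e0] card_mono[OF tapes_finite, of "{e \<in> \<Omega>. e \<in> wins_dev \<or> flip (coloring_run.ag n x (dev e0) T 1) e \<in> wins_dev}"] by auto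
qed simp

text \<open>A win needs a sum of numbers in the set \<open>A\<close> of at most \<open>n - 1\<close>
  residues modulo \<open>m\<close>, those that make a real agent the sink. Rotating the number of
  one real agent, unseen by agent \<open>0\<close> until the fake numbers are sent, runs through all
  residues equally often. The pairing by the coin gives the factor \<open>2\<close>, and
  \<open>n \<le> m\<close> the final form.\<close>

lemma dev_sink:
 assumes same_prefs
 shows "2 * n * card wins_dev \<le> (n - 1) * card \<Omega>"
proof (cases "wins_dev = {}")
 case False
 then obtain e0 where w0: "e0 \<in> wins_dev" by blast
 define j where "j = coloring_run.ag n x (dev e0) T 1"
 define m where "m = coloring_run.m n x (dev e0) T"
 define S where "S = {e \<in> \<Omega>. e \<in> wins_dev \<or> flip j e \<in> wins_dev}"
 have j: "1 \<le> j" "j < n" using dev_ag_real[OF w0] by (auto simp: j_def)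
 interpret W0: winning_run \<beta> ncol n x p "dev e0" T "cell e0" by (rule dev_run[OF w0])
 have nm: "n \<le> m" "m \<le> T" using W0.n_le_m W0.m_less by (auto simp: m_def)
 hence m0: "0 < m" "m dvd fact T" using n3 by (auto intro: dvd_fact)
 define A where "A = {a. a < m \<and> (\<exists>i. 1 \<le> i \<and> i < n \<and> index_of W0.V (rev (sort W0.V) ! a) = (W0.q + i) mod m)}"
 have "card A \<le> card ((\<lambda>i. (W0.q + i) mod m) ` {1..<n})"
 proof (rule card_inj_on_le)
  show "inj_on (\<lambda>a. index_of W0.V (rev (sort W0.V) ! a)) A"
   using W0.length_V_index by (auto simp: inj_on_def A_def m_def)
  show "(\<lambda>a. index_of W0.V (rev (sort W0.V) ! a)) ` A \<subseteq> (\<lambda>i. (W0.q + i) mod m) ` {1..<n}" by (auto simp: A_def)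
 qed simp
 also have "\<dots> \<le> n - 1" using card_image_le[of "{1..<n}"] by simp
 finally have A: "card A \<le> n - 1" .
 have "fact T * card S \<le> ((n - 1) * (fact T div m)) * card \<Omega>"
 proof (rule card_translates[OF tapes_finite, where J = "reweight j"])
  show "bij_betw (reweight j k) \<Omega> \<Omega>" for k by (rule shift_bij[OF j(2)])
  show "S \<subseteq> \<Omega>" by (auto simp: S_def)
  fix e assume o: "e \<in> \<Omega>"
  show "card {k \<in> {..<fact T}. reweight j k e \<in> S} \<le> (n - 1) * (fact T div m)"
  proof (cases "\<exists>k1. reweight j k1 e \<in> S")
   case True
   then obtain k1 where k1: "reweight j k1 e \<in> S" by blast
   define u where "u = fst (cell e j (col_t3 m))"
   \<comment> \<open>Membership in \<open>S\<close> means a win on the tape or on its flip, and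
     flipping does not touch the numbers for the sink.\<close>
   have witness: "\<exists>e'\<in>wins_dev. \<forall>i t. fst (cell e' i t) = fst (cell (reweight j k e) i t)" if k: "reweight j k e \<in> S" for k
   proof -
    have "reweight j k e \<in> \<Omega>" using k by (simp add: S_def)
    hence "fst (cell (flip j (reweight j k e)) i t) = fst (cell (reweight j k e) i t)" for i t using flip(4)[OF _ j(2)] by blast
    thus ?thesis using k unfolding S_def by blast
   qed
   from witness[OF k1] obtain e1 where w1: "e1 \<in> wins_dev" "\<And>i t. fst (cell e1 i t) = fst (cell (reweight j k1 e) i t)" by blast
   \<comment> \<open>Chosen such that \<open>c + k\<close> is congruent to the sum of the numbers on
     the tape shifted by \<open>k\<close>. It is computed from the winning run on \<open>e1\<close>
     by replacing its number \<open>u + k1\<close> with \<open>u\<close>; adding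
     \<open>m - (u + k1) mod m\<close> is the subtraction modulo \<open>m\<close>.\<close>
   define c where "c = (\<Sum>i<m. coloring_run.Wt n x (dev e1) T (cell e1) i) + (m - (u + k1) mod m) + u"
   have "(c + k) mod m \<in> A" if k: "reweight j k e \<in> S" for k
   proof -
    from witness[OF k] obtain e2 where w2: "e2 \<in> wins_dev" "\<And>i t. fst (cell e2 i t) = fst (cell (reweight j k e) i t)" by blast
    interpret W1: winning_run \<beta> ncol n x p "dev e1" T "cell e1" by (rule dev_run[OF w1(1)])
    interpret W2: winning_run \<beta> ncol n x p "dev e2" T "cell e2" by (rule dev_run[OF w2(1)])
    interpret C: two_coloring_runs \<beta> ncol n x p "dev e1" T "cell e1" "dev e2" "cell e2" T by (rule dev_pair[OF w1(1) w2(1)])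
    interpret C0: two_coloring_runs \<beta> ncol n x p "dev e0" T "cell e0" "dev e2" "cell e2" T by (rule dev_pair[OF w0 w2(1)])
    have m12: "W1.m = m" "W2.m = m" using dev_ag(2)[OF w0 w1(1)] dev_ag(2)[OF w0 w2(1)] by (auto simp: m_def)
    have ag: "W1.ag 1 = j" "W2.ag 1 = j" using dev_ag(1)[OF w0 w1(1)] dev_ag(1)[OF w0 w2(1)] by (auto simp: j_def)
    have early: "W1.t3 \<le> T" "W0.t3 \<le> T" using W1.T5_order(1) W1.late_enough(2) W0.T5_order(1) W0.late_enough(2) by linarith+
    have t3: "col_t3 m < T" using W1.T5_order(1) W1.late_enough(2) by (simp add: m12)
    have sp: "odd n" "\<And>i. 1 \<le> i ==> i < n ==> p i = p 0" using assms unfolding same_prefs_def by blast+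
    obtain i1 where "W1.sk = Some i1" using W1.sink_is_real[OF sp] by blast
    hence ns: "W1.ns" by (auto simp: W1.sk_def split: if_splits)
    have w: "W1.w 1 = (u + k1) mod m" "W2.w 1 = (u + k) mod m"
     using shift_cell(2)[OF o j(2) t3] m0(2)
     by (simp_all only: W1.w_def W2.w_def ag m12 u_def mod_mod_cancel w1(2) w2(2))
    have bal: "(\<Sum>i<m. W2.Wt i) + (u + k1) mod m = (\<Sum>i<m. W1.Wt i) + (u + k) mod m"
    proof -
     have "(\<Sum>i<W1.m. W2.Wt i) + W1.w 1 = (\<Sum>i<W1.m. W1.Wt i) + W2.w 1"
     proof (rule C.weights_shift[OF early(1) ns few[OF w1(1)]])
      show "W1.t3 + (W1.m - n) < T" using W1.T5_order(1) W1.late_enough(2) W1.m3 by linarith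
      show "fst (cell e2 i W1.t3) = fst (cell e1 i W1.t3)" if "i \<noteq> W1.ag 1" for i
      proof -
       have "i \<noteq> j" using that ag by simp
       thus ?thesis by (simp only: w1(2) w2(2) shift_cell(1)[OF o j(2) \<open>i \<noteq> j\<close>])
      qed
     qed
     thus ?thesis by (simp only: w m12)
    qed
    have "(c + k) mod m = ((\<Sum>i<m. W1.Wt i) + (u + k) mod m + (m - (u + k1) mod m)) mod m"
    proof -
     have "c + k = (\<Sum>i<m. W1.Wt i) + (m - (u + k1) mod m) + (u + k)" by (simp add: c_def)
     hence "(c + k) mod m = ((\<Sum>i<m. W1.Wt i) + (m - (u + k1) mod m) + (u + k) mod m) mod m"
      by (simp only: mod_add_right_eq)
     thus ?thesis by (simp only: add.commute add.left_commute)
    qed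
    also have "(\<Sum>i<m. W1.Wt i) + (u + k) mod m + (m - (u + k1) mod m) = (\<Sum>i<m. W2.Wt i) + m"
     using bal mod_less_divisor[OF m0(1), of "u + k1"] by linarith
    finally have ck: "(c + k) mod m = (\<Sum>i<m. W2.Wt i) mod m" by simp
    obtain i where i: "1 \<le> i" "i < n" "W2.sk = Some ((W2.q + i) mod W2.m)" using W2.sink_is_real[OF sp] by blast
    hence "index_of W2.V (rev (sort W2.V) ! ((\<Sum>i<W2.m. W2.Wt i) mod W2.m)) = (W2.q + i) mod W2.m"
     by (auto simp: W2.sk_def split: if_splits)
    thus ?thesis unfolding A_def ck using i(1,2) m0(1) C0.geometry_same[OF early(2)] by (auto simp: m12)
   qed
   hence "{k \<in> {..<fact T}. reweight j k e \<in> S} \<subseteq> {k \<in> {..<fact T}. (c + k) mod m \<in> A}" by auto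
   hence "card {k \<in> {..<fact T}. reweight j k e \<in> S} \<le> card {k \<in> {..<fact T}. (c + k) mod m \<in> A}"
    by (intro card_mono) auto
   also have "\<dots> = card A * (fact T div m)" by (rule card_shift_class[OF m0]) (auto simp: A_def)
   also have "\<dots> \<le> (n - 1) * (fact T div m)" using A by simp
   finally show ?thesis .
  qed simp
 qed
 hence "m * card S \<le> (n - 1) * card \<Omega>" by (rule card_bound_divide[OF m0])
 moreover have "card S = 2 * card wins_dev" unfolding S_def j_def by (rule pairs_dev[OF w0, symmetric])
 ultimately have "m * (2 * card wins_dev) \<le> (n - 1) * card \<Omega>" by simp
 moreover have "n * (2 * card wins_dev) \<le> m * (2 * card wins_dev)" using nm(1) by (rule mult_le_mono1)
 ultimately show ?thesis by (simp only: mult.assoc mult.left_commute[of 2 n])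
qed simp

end

text \<open>For \<open>r \<le> col_t3 n\<close> the two sets are not matched tape by tape. Both are
  compared with the same fraction of all tapes: \<open>(n - 1) / (2 * n)\<close> if a sink is
  chosen, and \<open>1 / 2\<close> if not.\<close>

theorem deviation_count:
 assumes few: "r = 0 ==> (\<And>e. e \<in> wins_dev ==> coloring_run.m n x (dev e) T + 2 \<le> 2 * n)"
 shows "card wins_dev \<le> card wins_hon"
proof (cases "p 1 = p 0 \<or> p (n - 1) = p 0")
 case False
 thus ?thesis using alone_le wins_le(1) by (simp add: card_mono)
next
 case True
 have few': "coloring_run.m n x (dev e) T + 2 \<le> 2 * n" if "e \<in> wins_dev" for e
  using few[OF _ that] late_size[OF _ that] n3 by (cases "r = 0") auto
 consider "coin_start + n \<le> r" | "col_t3 n < r" "r < coin_start + n" | "r \<le> col_t3 n" by linarith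
 thus ?thesis
 proof cases
  case 1
  thus ?thesis using late_le wins_le(1) by (simp add: card_mono)
 next
  case 2
  thus ?thesis by (rule middle_le[OF _ _ True])
 next
  case 3
  show ?thesis
  proof (cases "at_h = {}")
   case True
   thus ?thesis by (simp add: wins_dev_def)
  next
   case False
   hence o: "at_h = \<Omega>" by (rule early_views[OF 3])
   show ?thesis
   proof (cases same_prefs)
    case True
    have "2 * n * card wins_dev \<le> 2 * n * card wins_hon"
     using dev_sink[OF few' \<open>p 1 = p 0 \<or> p (n - 1) = p 0\<close> True] honest_sink[OF o True] by linarith
    thus ?thesis using n3 by simp
   next
    case False
    thus ?thesis using half_dev[OF few' True] half_honest[OF o] by linarith
   qed
  qed
 qed
qed

end

section \<open>The sharing game\<close>

text \<open>\<open>no_collision\<close> speaks about all views, including those that never occur.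
  The guard ensures it everywhere; on the views that do occur it has no effect by
  \<open>guard\<close>.\<close>

definition guarded :: "nat set => 'p view => action => action" where
 "guarded ID v b = (if (msg_ids (to_cw b) \<union> msg_ids (to_ccw b)) \<inter> ID \<subseteq> known_ids v then b else idle)"

lemma no_collision_guarded: "no_collision ID (\<lambda>v. return_pmf (guarded ID v (g v)))"
 by (auto simp: no_collision_def guarded_def idle_def)

lemma known_ids_inbox: "known_ids v = insert (own_id v) (\<Union>(m, m')\<in>set (map snd (hist v)). msg_ids m \<union> msg_ids m')"
 by (auto simp: known_ids_def)

lemma known_ids_mono: "t \<le> t' ==> known_ids (trace_view n x p act i t) \<subseteq> known_ids (trace_view n x p act i t')"
 by (auto simp: known_ids_def trace_hist_def)

lemma msg_ids_share: "msg_ids (share_front m R1 R2 y j s) = {}" "msg_ids (share_back m X y j s) = {}"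
 by (simp_all add: share_front_def share_back_def)

context sharing_cheat
begin

text \<open>In the first \<open>m\<close> rounds the ids are those that \<open>f\<close> itself
  sends. The vector \<open>V\<close> sent later consists of ids that agent \<open>0\<close> has sent
  before; those of them in \<open>ID\<close> were known to it then.\<close>

lemma guard:
 assumes "no_collision ID (\<lambda>v. return_pmf (f v))"
 shows "guarded ID (trace_view n x pr sact 0 t) (sact 0 t) = sact 0 t"
proof -
 let ?K = "\<lambda>t. known_ids (trace_view n x pr sact 0 t)"
 have early: "msg_ids (to_cw (sact 0 t)) \<inter> ID \<subseteq> ?K t \<and> msg_ids (to_ccw (sact 0 t)) \<inter> ID \<subseteq> ?K t" if t: "t < m" for t
 proof -
  let ?v = "View (x 0) p0 (map (\<lambda>s. (g s, Id (Y ((n - 1 + (m - s)) mod m)), Id (Y ((1 + s) mod m)))) [0..<t])"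
  have "(Suc 0) mod n = 1" "(n - Suc 0) mod n = n - 1" using n3 by simp_all
  hence "map snd (trace_hist n sact 0 t) = map (\<lambda>s. (Id (Y ((n - 1 + (m - s)) mod m)), Id (Y ((1 + s) mod m)))) [0..<t]"
   using t n3 by (simp add: trace_hist_def sact_def srt_def slt_def)
  hence k: "known_ids ?v = ?K t" unfolding known_ids_inbox by (simp add: o_def)
  have "(msg_ids (to_cw (f ?v)) \<union> msg_ids (to_ccw (f ?v))) \<inter> ID \<subseteq> known_ids ?v"
   using assms by (simp add: no_collision_def)
  hence "(msg_ids (to_cw (g t)) \<union> msg_ids (to_ccw (g t))) \<inter> ID \<subseteq> ?K t" unfolding k g_eq[OF t, symmetric] .
  moreover have "to_cw (sact 0 t) = to_cw (g t)" "to_ccw (sact 0 t) = to_ccw (g t)"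
   using g_out[OF t] t by (simp_all add: sact_def srt_def slt_def)
  ultimately show ?thesis by auto
 qed
 have V: "set V \<inter> ID \<subseteq> ?K t" if t: "m \<le> t"
 proof
  fix z assume z: "z \<in> set V \<inter> ID"
  have "set V = Y ` {..<m}"
   using from_max_rotate[of "map Y [0..<m]" 0] Y_inj m3 unfolding V_def from_max_def by (auto simp: Let_def lessThan_atLeast0)
  then obtain k where k: "k < m" "z = Y k" using z by auto
  define s where "s = (m - k) mod m"
  have s: "s < m" "(m - s) mod m = k" using k m3 by (auto simp: s_def mod_if)
  have "z \<in> msg_ids (to_cw (sact 0 s)) \<inter> ID" using s k z by (simp add: sact_def srt_def)
  hence "z \<in> ?K s" using early[OF s(1)] by blast
  thus "z \<in> ?K t" using known_ids_mono[of s t n x pr sact 0] s t by auto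
 qed
 have "(msg_ids (to_cw (sact 0 t)) \<union> msg_ids (to_ccw (sact 0 t))) \<inter> ID \<subseteq> ?K t"
 proof (cases "t < m")
  case True
  thus ?thesis using early by blast
 next
  case False
  hence "msg_ids (to_cw (sact 0 t)) \<subseteq> set V" "msg_ids (to_ccw (sact 0 t)) \<subseteq> set V"
   by (auto simp: sact_def srt_def slt_def msg_ids_share)
  thus ?thesis using V False by auto
 qed
 thus ?thesis by (simp add: guarded_def)
qed

end

lemma sharing_act_oblivious:
 assumes "own_id v = own_id v'" "fst (priv v) = fst (priv v')" "hist v = hist v'"
 shows "sharing_act \<beta> bits S q v c = sharing_act \<beta> bits S q v' c"
 using assms by (simp add: sharing_act_def)

lemma sharing_run_oblivious:
 assumes "\<And>i. i < n ==> fst (pr i) = fst (pr' i)" "i < n"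
 shows "run_act (\<lambda>i. sharing_act \<beta> bits S q) n x pr cell i t = run_act (\<lambda>i. sharing_act \<beta> bits S q) n x pr' cell i t"
proof (rule run_act_unique)
 let ?a = "run_act (\<lambda>i. sharing_act \<beta> bits S q) n x pr' cell"
 fix i t assume i: "i < n"
 have "?a i t = sharing_act \<beta> bits S q (trace_view n x pr' ?a i t) (cell i t)" by (rule run_act_eq[OF i])
 also have "\<dots> = sharing_act \<beta> bits S q (trace_view n x pr ?a i t) (cell i t)"
  by (rule sharing_act_oblivious) (use assms(1)[OF i] in auto)
 finally show "?a i t = sharing_act \<beta> bits S q (trace_view n x pr ?a i t) (cell i t)" .
qed (rule assms)

lemma outputs_cong: "(\<And>i t. i < n ==> t < T ==> act i t = act' i t) ==> outputs n act T = outputs n act' T"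
 unfolding outputs_def by (intro map_cong refl arg_cong[of _ _ final_output] trace_view_cong) auto

text \<open>The preferred output influences the evaluation of an honest run but not the run, so a
  tape is won for at most one of the two preferences.\<close>

lemma honest_sharing_wins:
 assumes "0 < n" "e \<in> wins (\<lambda>i. sharing_act \<beta> bits S q) C sharing_legal z 0 (View x0 (0, z) []) T n x pr"
  and "e \<in> wins (\<lambda>i. sharing_act \<beta> bits S q) C sharing_legal z' 0 (View x0 (0, z') []) T n x pr'"
  and "\<And>i. i < n ==> fst (pr i) = fst (pr' i)"
 shows "z = z'"
proof -
 have "outputs n (run_act (\<lambda>i. sharing_act \<beta> bits S q) n x pr (\<lambda>i t. e ! t ! i)) T
  = outputs n (run_act (\<lambda>i. sharing_act \<beta> bits S q) n x pr' (\<lambda>i t. e ! t ! i)) T"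
  using sharing_run_oblivious[OF assms(4)] by (intro outputs_cong) auto
 thus ?thesis using assms(2,3) by (simp add: wins_def Let_def utility_one)
qed

context sharing_cheat
begin

lemma cheat_wins:
 assumes f: "no_collision ID (\<lambda>v. return_pmf (f v))" and e: "e \<in> tapes n T {..<2}" "4 * m \<le> T"
  and R: "\<And>i. i < n ==> R i = e ! t1 ! i" and pr: "pr 0 = (0, z)" and z': "out = z"
 shows "e \<in> wins (\<lambda>i v c. if i = 0 \<and> 0 \<le> length (hist v) then guarded ID v (cheat f p0 z v) else sharing_act \<beta> 1 {0, 1} parity v c)
  {..<2} sharing_legal z 0 (View (x 0) (0, z) []) T n x pr"
proof -
 let ?s = "\<lambda>i v c. if i = 0 \<and> 0 \<le> length (hist v) then guarded ID v (cheat f p0 z v) else sharing_act \<beta> 1 {0, 1} parity v c"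
 have run: "run_act ?s n x pr (\<lambda>i t. e ! t ! i) i t = sact i t" if "i < n" for i t
 proof (rule run_act_unique[OF _ that])
  fix i t assume i: "i < n"
  show "sact i t = ?s i (trace_view n x pr sact i t) (e ! t ! i)"
  proof (cases "i = 0")
   case True
   thus ?thesis using cheat_sact guard[OF f] by simp
  next
   case False
   thus ?thesis using sharing_act_sact[of i t "e ! t ! i"] R[OF i] i by simp
  qed
 qed
 have "t1 + 2 * m < T" using e(2) m3 by (simp add: t1_def)
 note out = sharing_outputs[OF this]
 have "outputs n sact T ! i = Some z" if "i < n" for i
  using outputs_nth[OF that, of sact T x pr] out that z' by (cases "i = 0") auto
 hence "sharing_legal (outputs n sact T)" by (auto simp: sharing_legal_def outputs_def)
 moreover have "hd (outputs n sact T) = Some z" using hd_outputs[of n sact T x pr] out(1) n3 by simp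
 moreover have "outputs n (run_act ?s n x pr (\<lambda>i t. e ! t ! i)) T = outputs n sact T" using run by (intro outputs_cong)
 ultimately show ?thesis using e(1) pr by (simp add: wins_def Let_def utility_one trace_view_def trace_hist_def)
qed

end

text \<open>The bridge between the games: waking up works alike in both protocols until the ids are
  known, so the ids and the first messages of agent \<open>0\<close> can be taken over.\<close>

lemma (in coloring_run) sharing_cheat:
 assumes f: "\<And>t. t < T ==> act 0 t = f (trace_view n x p act 0 t)"
  and "z \<in> {0, 1}" "\<And>i. 1 \<le> i ==> i < n ==> fst (pr i) \<in> {0, 1} \<and> rnd i \<in> {0, 1}"
 shows "sharing_cheat \<beta> n m x Y (\<lambda>i. fst (pr i)) rnd z (p 0) f (act 0) pr"
proof
 show "3 \<le> n" "n \<le> m" "m \<le> \<beta>" "inj_on Y {..<m}" "z \<in> {0, 1}" by (fact n3 n_le_m m3 Y_inj assms)+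
 show "Y i = x i" if "1 \<le> i" "i < n" for i by (rule Y_real[OF that])
 show "fst (pr i) \<in> {0, 1} \<and> rnd i \<in> {0, 1}" if "1 \<le> i" "i < n" for i by (rule assms(3)[OF that])
 fix t assume t: "t < m"
 show "to_cw (act 0 t) = Id (Y ((m - t) mod m)) \<and> to_ccw (act 0 t) = Id (Y ((n + t) mod m))"
  using id_messages(1)[OF t, of 0] id_messages(2)[OF t, of n] n3 by simp
 have "trace_view n x p act 0 t = View (x 0) (p 0) (map (\<lambda>s. (act 0 s, Id (Y ((n - 1 + (m - s)) mod m)), Id (Y ((1 + s) mod m)))) [0..<t])"
 proof -
  have e: "(0 + n - 1) mod n = n - 1" "(0 + 1) mod n = 1" "1 mod n = 1" using n3 by simp_all
  have "to_cw (act (n - 1) s) = Id (Y ((n - 1 + (m - s)) mod m))" "to_ccw (act 1 s) = Id (Y ((1 + s) mod m))" if "s < t" for s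
   using id_messages(1)[of s "n - 1"] id_messages(2)[of s 1] that t n3 e(3) by auto
  thus ?thesis unfolding trace_view_def trace_hist_def e by simp
 qed
 thus "act 0 t = f (View (x 0) (p 0) (map (\<lambda>s. (act 0 s, Id (Y ((n - 1 + (m - s)) mod m)), Id (Y ((1 + s) mod m)))) [0..<t]))"
  using f[of t] t m_less by simp
qed simp

section \<open>Comparison of the two games\<close>

lemma mean_mono: "(\<And>s. s \<in> S ==> \<phi> s \<le> \<psi> s) ==> mean S \<phi> \<le> mean S \<psi>"
 by (simp add: mean_def divide_right_mono sum_mono)

lemma mean_add: "mean S (\<lambda>s. \<phi> s + \<psi> s) = mean S \<phi> + mean S \<psi>"
 by (simp add: mean_def sum.distrib add_divide_distrib)

lemma mean_cmult: "mean S (\<lambda>s. c * \<phi> s) = c * mean S \<phi>"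
 by (simp add: mean_def sum_distrib_left)

lemma mean_const: "finite S ==> S \<noteq> {} ==> mean S (\<lambda>s. c) = c"
 by (simp add: mean_def)

text \<open>A view of agent \<open>0\<close> in round \<open>0\<close> fixes its private
  information, so only lists with this first entry contribute; hence the factor
  \<open>1 / card C\<close>.\<close>

lemma mean_first:
 assumes C: "finite C" "c \<in> C" and n: "0 < n" and zero: "\<And>ps. ps \<in> lists_of n C ==> ps ! 0 \<noteq> c ==> \<phi> ps = 0"
 shows "mean (lists_of n C) \<phi> = mean (lists_of (n - 1) C) (\<lambda>qs. \<phi> (c # qs)) / card C"
proof -
 obtain k where k: "n = Suc k" using n by (cases n) auto
 have "sum \<phi> (lists_of n C) = (\<Sum>(b, qs)\<in>C \<times> lists_of k C. \<phi> (b # qs))"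
  unfolding k lists_of_Suc by (subst sum.reindex) (auto simp: inj_on_def o_def case_prod_unfold)
 also have "\<dots> = (\<Sum>b\<in>C. \<Sum>qs\<in>lists_of k C. \<phi> (b # qs))" by (simp add: sum.cartesian_product)
 also have "\<dots> = (\<Sum>b\<in>C. if b = c then (\<Sum>qs\<in>lists_of k C. \<phi> (c # qs)) else 0)"
 proof (rule sum.cong[OF refl])
  fix b assume b: "b \<in> C"
  have "\<phi> (b # qs) = 0" if "qs \<in> lists_of k C" "b \<noteq> c" for qs
   using that b zero[of "b # qs"] by (auto simp: k lists_of_def)
  thus "(\<Sum>qs\<in>lists_of k C. \<phi> (b # qs)) = (if b = c then (\<Sum>qs\<in>lists_of k C. \<phi> (c # qs)) else 0)" by auto
 qed
 also have "\<dots> = (\<Sum>qs\<in>lists_of k C. \<phi> (c # qs))" using C by simp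
 finally show ?thesis using C(1) by (simp add: mean_def card_lists_of k)
qed

definition average :: "nat set => nat pmf => (nat => nat list => real) => real" where
 "average ID \<sigma> \<phi> = (\<Sum>n\<in>set_pmf \<sigma>. pmf \<sigma> n * mean (id_lists ID n) (\<phi> n))"

lemma average_mono:
 "(\<And>n xs. n \<in> set_pmf \<sigma> ==> xs \<in> id_lists ID n ==> \<phi> n xs \<le> \<psi> n xs) ==> average ID \<sigma> \<phi> \<le> average ID \<sigma> \<psi>"
 unfolding average_def by (intro sum_mono mult_left_mono mean_mono) auto

lemma average_add: "average ID \<sigma> (\<lambda>n xs. \<phi> n xs + \<psi> n xs) = average ID \<sigma> \<phi> + average ID \<sigma> \<psi>"
 by (simp add: average_def mean_add distrib_left sum.distrib)

lemma average_cmult: "average ID \<sigma> (\<lambda>n xs. c * \<phi> n xs) = c * average ID \<sigma> \<phi>"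
 by (simp add: average_def mean_cmult sum_distrib_left mult.left_commute)

lemma (in tape_game) total_average: "total \<phi> = average ID \<sigma> (\<lambda>n xs. mean (lists_of n P) (\<phi> n xs))"
 by (simp add: total_def average_def)

lemma (in tape_game) deviation_self: "deviation r a = (\<lambda>i. a)"
 by (intro ext) (simp add: deviation_def)

lemma output_space_parity: "output_space {0, 1} parity = {0, 1}"
proof
 show "output_space {0, 1} parity \<subseteq> {0, 1}" by (auto simp: output_space_def parity_def)
 have "parity [0] = 0" "parity [1] = 1" by (auto simp: parity_def)
 thus "{0, 1} \<subseteq> output_space {0, 1} parity"
  unfolding output_space_def by (force intro: image_eqI[of _ _ "[0]"] image_eqI[of _ _ "[1]"])
qed

lemma full_knowledge_parity: "full_knowledge {0, 1} parity"
 unfolding full_knowledge_def output_space_parity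
proof (intro allI impI ballI)
 fix xs :: "nat list" and j z z' :: nat
 assume a: "set xs \<subseteq> {0, 1} \<and> j < length xs" and z: "z \<in> {0, 1}" "z' \<in> {0, 1}"
 define s where "s = sum_list (xs[j := 0])"
 have p: "parity (xs[j := b]) = (s + b) mod 2" for b
  using a by (simp add: parity_def s_def upd_conv_take_nth_drop ac_simps)
 have "{b \<in> {0, 1}. parity (xs[j := b]) = y} = {(s + y) mod 2}" if "y \<in> {0, 1}" for y
  using that unfolding p by auto presburger+
 hence "card {b \<in> {0, 1}. parity (xs[j := b]) = y} = 1" if "y \<in> {0, 1}" for y using that by simp
 thus "card {b \<in> {0, 1}. parity (xs[j := b]) = z} = card {b \<in> {0, 1}. parity (xs[j := b]) = z'}" using z by simp
qed

lemma (in coloring_deviation) wins_eq: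
 "wins (\<lambda>i v c. if i = 0 \<and> r \<le> length (hist v) then f v else col_act \<beta> ncol v c) (col_cells T) coloring_legal (p 0) r h T n x p = wins_dev"
 "wins (\<lambda>i. col_act \<beta> ncol) (col_cells T) coloring_legal (p 0) r h T n x p = wins_hon"
proof -
 have c: "cell e i t = e ! t ! i" if "i < n" "t < T" for e i t using that by (simp add: cell_def)
 have d: "run_act (\<lambda>i v c. if i = 0 \<and> r \<le> length (hist v) then f v else col_act \<beta> ncol v c) n x p (\<lambda>i t. e ! t ! i) i t = dev e i t"
  if "i < n" "t < T" for e i t unfolding dev_def by (rule run_act_cong[OF _ that]) (simp add: c)
 have e: "run_act (\<lambda>i. col_act \<beta> ncol) n x p (\<lambda>i t. e ! t ! i) i t = hon e i t"
  if "i < n" "t < T" for e i t unfolding hon_def by (rule run_act_cong[OF _ that]) (simp add: c)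
 have n0: "0 < n" using n3 by simp
 have v: "trace_view n x p (run_act (\<lambda>i v c. if i = 0 \<and> r \<le> length (hist v) then f v else col_act \<beta> ncol v c) n x p (\<lambda>i t. e ! t ! i)) 0 r
   = trace_view n x p (hon e) 0 r"
  "trace_view n x p (run_act (\<lambda>i. col_act \<beta> ncol) n x p (\<lambda>i t. e ! t ! i)) 0 r = trace_view n x p (hon e) 0 r" for e
  using r_le d e dev_before n0 by (auto intro!: trace_view_cong)
 have o: "outputs n (run_act (\<lambda>i v c. if i = 0 \<and> r \<le> length (hist v) then f v else col_act \<beta> ncol v c) n x p (\<lambda>i t. e ! t ! i)) T = outputs n (dev e) T"
  "outputs n (run_act (\<lambda>i. col_act \<beta> ncol) n x p (\<lambda>i t. e ! t ! i)) T = outputs n (hon e) T" for e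
  using d e by (auto intro!: outputs_cong)
 show "wins (\<lambda>i v c. if i = 0 \<and> r \<le> length (hist v) then f v else col_act \<beta> ncol v c) (col_cells T) coloring_legal (p 0) r h T n x p = wins_dev"
  "wins (\<lambda>i. col_act \<beta> ncol) (col_cells T) coloring_legal (p 0) r h T n x p = wins_hon"
  unfolding wins_def Let_def v o by (auto simp: wins_dev_def wins_hon_def at_h_def)
qed

locale coloring_game =
 fixes ID :: "nat set" and \<sigma> :: "nat pmf" and \<beta> ncol :: nat
 assumes sizes: "set_pmf \<sigma> \<subseteq> {3..\<beta>}" and ID: "finite ID" "\<beta> \<le> card ID" and ncol: "3 \<le> ncol"
begin

sublocale G: tape_game ID "{..<ncol}" \<sigma> \<beta> "coloring_algorithm \<beta> ncol" "col_act \<beta> ncol" col_cells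
proof
 show "set_pmf \<sigma> \<subseteq> {1..\<beta>}" using sizes by auto
 have "0 \<in> {..<ncol}" using ncol by simp
 thus "{..<ncol} \<noteq> {}" by blast
qed (use ID col_cells coloring_algorithm_cell in auto)

sublocale S: tape_game ID "{0, 1} \<times> {0, 1}" \<sigma> \<beta> "sharing_protocol \<beta> 1 {0, 1} parity" "sharing_act \<beta> 1 {0, 1} parity" "\<lambda>T. {..<2}"
proof
 show "set_pmf \<sigma> \<subseteq> {1..\<beta>}" using sizes by auto
 show "sharing_protocol \<beta> 1 {0, 1} parity v = map_pmf (sharing_act \<beta> 1 {0, 1} parity v) (pmf_of_set {..<2})" if "length (hist v) < T" for v T
  using sharing_protocol_cell[of T \<beta> 1 "{0, 1}" parity v] that by simp
 show "{..<2::nat} \<noteq> {}" by (metis lessThan_iff empty_iff zero_less_numeral)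
qed (use ID in auto)

lemma ring_instance:
 assumes "n \<in> set_pmf \<sigma>" "xs \<in> id_lists ID n" "ps \<in> lists_of n {..<ncol}" "8 * \<beta> \<le> T"
 shows "coloring_ring \<beta> ncol n ((!) xs) ((!) ps) T"
proof
 show "3 \<le> n" "n \<le> \<beta>" using assms(1) sizes by auto
 thus "8 * n \<le> T" using assms(4) by simp
 show "inj_on ((!) xs) {..<n}" using assms(2) by (auto simp: id_lists_def intro!: inj_on_nth)
 show "ps ! i < ncol" if "i < n" for i using lists_ofD(2)[OF assms(3) that] by simp
qed (rule ncol)

lemma deviation_instance:
 assumes "n \<in> set_pmf \<sigma>" "xs \<in> id_lists ID n" "ps \<in> lists_of n {..<ncol}" "8 * \<beta> \<le> T" "r \<le> T"
  and f: "no_collision ID (\<lambda>v. return_pmf (f v))"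
 shows "coloring_deviation \<beta> ncol n ((!) xs) ((!) ps) T r f"
proof (intro coloring_deviation.intro coloring_deviation_axioms.intro ring_instance assms(1-5))
 fix i assume i: "1 \<le> i" "i < n"
 let ?b = "f (View (xs ! 0) (ps ! 0) [])"
 have "(msg_ids (to_cw ?b) \<union> msg_ids (to_ccw ?b)) \<inter> ID \<subseteq> known_ids (View (xs ! 0) (ps ! 0) [])"
  using f by (simp add: no_collision_def)
 hence "(msg_ids (to_cw ?b) \<union> msg_ids (to_ccw ?b)) \<inter> ID \<subseteq> {xs ! 0}" by (simp add: known_ids_def)
 moreover have "xs ! i \<in> ID" "xs ! i \<noteq> xs ! 0"
  using assms(2) i by (auto simp: id_lists_def nth_eq_iff_index_eq)
 ultimately show "to_cw ?b \<noteq> Id (xs ! i) \<and> to_ccw ?b \<noteq> Id (xs ! i)" by auto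
qed

abbreviation dev_wins where
 "dev_wins r h f T n xs ps \<equiv> wins (G.deviation r (\<lambda>v c. f v)) (col_cells T) coloring_legal (priv h) r h T n ((!) xs) ((!) ps)"
abbreviation hon_wins where
 "hon_wins r h T n xs ps \<equiv> wins (\<lambda>i. col_act \<beta> ncol) (col_cells T) coloring_legal (priv h) r h T n ((!) xs) ((!) ps)"

lemma wins_empty:
 assumes "x 0 \<noteq> own_id h \<or> p 0 \<noteq> priv h"
 shows "wins s C legal z r h T n x p = {}"
proof -
 have "trace_view n x p act 0 r \<noteq> h" for act
 proof
  assume "trace_view n x p act 0 r = h"
  hence "own_id h = x 0" "priv h = p 0" by auto
  thus False using assms by simp
 qed
 thus ?thesis by (auto simp: wins_def Let_def)
qed

lemma wins_tapes: "wins s C legal z r h T n x p \<subseteq> tapes n T C"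
 by (auto simp: wins_def)

lemma deviation_eq: "G.deviation r (\<lambda>v c. f v) = (\<lambda>i v c. if i = 0 \<and> r \<le> length (hist v) then f v else col_act \<beta> ncol v c)"
 by (intro ext) (simp add: G.deviation_def)

lemma later_round:
 assumes "n \<in> set_pmf \<sigma>" "xs \<in> id_lists ID n" "ps \<in> lists_of n {..<ncol}" "8 * \<beta> \<le> T" "r \<le> T"
  and f: "no_collision ID (\<lambda>v. return_pmf (f v))" and "0 < r"
 shows "card (dev_wins r h f T n xs ps) \<le> card (hon_wins r h T n xs ps)"
proof (cases "ps ! 0 = priv h")
 case True
 interpret coloring_deviation \<beta> ncol n "(!) xs" "(!) ps" T r f h by (rule deviation_instance[OF assms(1-6)])
 show ?thesis using wins_eq deviation_count assms(7) True by (simp add: deviation_eq)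
qed (simp add: wins_empty)

text \<open>The existential form, here and in \<open>large\<close>, serves both games: one winning
  run is enough to be replayed against Knowledge Sharing, and the negation says something about all
  runs at coloring.\<close>

definition winnable where
 "winnable h f T n xs \<longleftrightarrow> (\<exists>ps\<in>lists_of n {..<ncol}. dev_wins 0 h f T n xs ps \<noteq> {})"

definition large where
 "large h f T n xs \<longleftrightarrow> (\<exists>ps\<in>lists_of n {..<ncol}. \<exists>e\<in>dev_wins 0 h f T n xs ps.
   2 * n \<le> coloring_run.m n ((!) xs) (coloring_deviation.dev \<beta> ncol n ((!) xs) ((!) ps) T 0 f e) T + 1)"

lemma large_winnable: "large h f T n xs ==> winnable h f T n xs"
 by (auto simp: large_def winnable_def)

text \<open>If all others share the preference \<open>c\<close>, the possibility of being the sink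
  spoils the bound by half of the tapes. The deficit is covered by the case that all others prefer
  one color \<open>b\<close> different from \<open>c\<close>, where every tape is won; all further
  cases give at least half.\<close>

lemma sum_wins_half:
 assumes n: "n \<in> set_pmf \<sigma>" "xs \<in> id_lists ID n" "8 * \<beta> \<le> T" and h: "h = View (xs ! 0) c []" "c < ncol"
 shows "ncol ^ (n - 1) * card (tapes n T (col_cells T)) \<le> 2 * (\<Sum>qs\<in>lists_of (n - 1) {..<ncol}. card (hon_wins 0 h T n xs (c # qs)))"
proof -
 let ?L = "lists_of (n - 1) {..<ncol}" and ?\<Omega> = "tapes n T (col_cells T)"
 let ?w = "\<lambda>qs. card (hon_wins 0 h T n xs (c # qs))"
 have n3: "3 \<le> n" using n sizes by auto
 have L: "c # qs \<in> lists_of n {..<ncol}" if "qs \<in> ?L" for qs using that h n3 by (auto simp: lists_of_def)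
 define b where "b = (if c = 0 then 1 else (0::nat))"
 have b: "b \<noteq> c" "b < ncol" using ncol by (auto simp: b_def)
 define X where "X = replicate (n - 1) c"
 define Y where "Y = replicate (n - 1) b"
 have XY: "X \<in> ?L" "Y \<in> ?L" "X \<noteq> Y" using b h n3 by (auto simp: X_def Y_def lists_of_def replicate_eq_replicate)
 have dev: "coloring_deviation \<beta> ncol n ((!) xs) ((!) (c # qs)) T 0 (\<lambda>v. idle)" if "qs \<in> ?L" for qs
  using L[OF that] n by (intro deviation_instance) (auto simp: no_collision_def idle_def)
 have view: "trace_view n ((!) xs) ((!) (c # qs)) act 0 0 = h" for act qs
  by (simp add: h trace_view_def trace_hist_def)
 have half: "card ?\<Omega> \<le> 2 * ?w qs" if qs: "qs \<in> ?L" "qs \<noteq> X" for qs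
 proof -
  interpret D: coloring_deviation \<beta> ncol n "(!) xs" "(!) (c # qs)" T 0 "\<lambda>v. idle" h by (rule dev[OF qs(1)])
  have at: "D.at_h = ?\<Omega>" by (simp add: D.at_h_def view)
  have "\<not> D.same_prefs"
  proof
   assume "D.same_prefs"
   hence "(c # qs) ! Suc i = c" if "Suc i < n" for i unfolding D.same_prefs_def using that by (metis nth_Cons_0)
   hence "qs = X" using qs(1) n3 by (intro nth_equalityI) (auto simp: X_def lists_of_def)
   thus False using qs(2) by simp
  qed
  thus ?thesis using D.half_honest[OF at] D.wins_eq(2) by (simp add: h)
 qed
 have all: "?w Y = card ?\<Omega>"
 proof -
  interpret D: coloring_deviation \<beta> ncol n "(!) xs" "(!) (c # Y)" T 0 "\<lambda>v. idle" h by (rule dev[OF XY(2)])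
  have at: "D.at_h = ?\<Omega>" by (simp add: D.at_h_def view)
  have "(c # Y) ! i = b" if "1 \<le> i" "i < n" for i using that by (cases i) (auto simp: Y_def)
  from this[of 1] this[of "n - 1"] have "(c # Y) ! 1 = b" "(c # Y) ! (n - 1) = b" using n3 by auto
  hence "(c # Y) ! 1 \<noteq> (c # Y) ! 0" "(c # Y) ! (n - 1) \<noteq> (c # Y) ! 0" using b(1) by (simp_all only: nth_Cons_0) simp_all
  hence "D.wins_hon = ?\<Omega>" using D.hon_in_wins D.hon_wins_alone at D.wins_le(3) by blast
  thus ?thesis using D.wins_eq(2) by (simp add: h)
 qed
 have fin: "finite ?L" by (intro finite_lists_of) simp
 have "ncol ^ (n - 1) = card ?L" by (simp add: card_lists_of)
 also have "\<dots> = 2 + card (?L - {X, Y})" using XY fin card_Diff_subset[of "{X, Y}" ?L] card_mono[OF fin, of "{X, Y}"] by auto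
 finally have "ncol ^ (n - 1) * card ?\<Omega> = 2 * card ?\<Omega> + (\<Sum>qs\<in>?L - {X, Y}. card ?\<Omega>)" by (simp add: add_mult_distrib)
 also have "\<dots> \<le> 2 * ?w Y + (\<Sum>qs\<in>?L - {X, Y}. 2 * ?w qs)"
  using half all by (intro add_mono sum_mono) auto
 also have "\<dots> \<le> (\<Sum>qs\<in>{Y} \<union> (?L - {X, Y}). 2 * ?w qs)" using XY fin by (subst sum.union_disjoint) auto
 also have "\<dots> \<le> (\<Sum>qs\<in>?L. 2 * ?w qs)" using XY fin by (intro sum_mono2) auto
 finally show ?thesis by (simp add: sum_distrib_left)
qed

text \<open>Let \<open>k\<close> be the number of properties among \<open>winnable\<close> and
  \<open>large\<close> that hold. In units of \<open>1 / ncol\<close> the honest agent gets at least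
  \<open>1 / 2\<close>. The deviation gets at most \<open>1\<close> for \<open>k = 2\<close>, no
  more than the honest agent for \<open>k = 1\<close>, and \<open>0\<close> for
  \<open>k = 0\<close>. In each case the gain is at most \<open>(k - 1) / 2\<close>.\<close>

lemma first_round:
 assumes n: "n \<in> set_pmf \<sigma>" "xs \<in> id_lists ID n" "8 * \<beta> \<le> T" and h: "h = View y c []" "c < ncol"
  and f: "no_collision ID (\<lambda>v. return_pmf (f v))"
 shows "mean (lists_of n {..<ncol}) (\<lambda>ps. card (dev_wins 0 h f T n xs ps) / card (tapes n T (col_cells T)))
  \<le> mean (lists_of n {..<ncol}) (\<lambda>ps. card (hon_wins 0 h T n xs ps) / card (tapes n T (col_cells T)))
   + (if xs ! 0 = y then of_bool (winnable h f T n xs) + of_bool (large h f T n xs) - 1 else 0) / (2 * ncol)"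
  (is "mean ?L ?F \<le> mean ?L ?G + _")
proof (cases "xs ! 0 = y")
 case False
 thus ?thesis by (simp add: wins_empty h)
next
 case True
 let ?Q = "lists_of (n - 1) {..<ncol}" and ?\<Omega> = "tapes n T (col_cells T)"
 have n3: "3 \<le> n" using n sizes by auto
 have card_pos: "0 < card ?\<Omega>" using finite_tapes[OF col_cells(1)] tapes_nonempty[OF col_cells(2)] by (simp add: card_gt_0_iff)
 have Q: "finite ?Q" "?Q \<noteq> {}" using h by (auto intro!: finite_lists_of lists_of_nonempty)
 have first: "mean ?L (\<lambda>ps. card (wins s (col_cells T) coloring_legal (priv h) 0 h T n ((!) xs) ((!) ps)) / card ?\<Omega>)
   = mean ?Q (\<lambda>qs. card (wins s (col_cells T) coloring_legal (priv h) 0 h T n ((!) xs) ((!) (c # qs))) / card ?\<Omega>) / ncol" for s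
  using mean_first[of "{..<ncol}" c n "\<lambda>ps. card (wins s (col_cells T) coloring_legal (priv h) 0 h T n ((!) xs) ((!) ps)) / card ?\<Omega>"] h n3
  by (simp add: wins_empty)
 have G: "1 / 2 \<le> mean ?Q (\<lambda>qs. card (hon_wins 0 h T n xs (c # qs)) / card ?\<Omega>)"
 proof -
  have "real (ncol ^ (n - 1) * card ?\<Omega>) \<le> real (2 * (\<Sum>qs\<in>?Q. card (hon_wins 0 h T n xs (c # qs))))"
   using sum_wins_half[OF n, of h c] h True by (subst of_nat_le_iff) simp
  hence "real (ncol ^ (n - 1)) * card ?\<Omega> \<le> 2 * (\<Sum>qs\<in>?Q. real (card (hon_wins 0 h T n xs (c # qs))))" by simp
  moreover have "0 < real (ncol ^ (n - 1))" using h by simp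
  ultimately show ?thesis
   using card_pos by (simp add: mean_def card_lists_of sum_divide_distrib[symmetric] field_simps)
 qed
 consider "large h f T n xs" | "\<not> large h f T n xs" "winnable h f T n xs" | "\<not> winnable h f T n xs" by blast
 thus ?thesis
 proof cases
  case 1
  have "mean ?Q (\<lambda>qs. card (dev_wins 0 h f T n xs (c # qs)) / card ?\<Omega>) \<le> mean ?Q (\<lambda>qs. 1)"
   using card_pos card_mono[OF finite_tapes[OF col_cells(1)] wins_tapes] by (intro mean_mono) simp
  hence F: "mean ?Q (\<lambda>qs. card (dev_wins 0 h f T n xs (c # qs)) / card ?\<Omega>) \<le> 1" using Q by (simp add: mean_const)
  show ?thesis unfolding first using 1 large_winnable[OF 1] True F G h(2) by (simp add: field_simps)
 next
  case 2
  have "?F ps \<le> ?G ps" if ps: "ps \<in> ?L" for ps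
  proof (cases "ps ! 0 = priv h")
   case True
   interpret coloring_deviation \<beta> ncol n "(!) xs" "(!) ps" T 0 f h by (rule deviation_instance[OF n(1,2) ps n(3) _ f]) simp
   have "coloring_run.m n ((!) xs) (dev e) T + 2 \<le> 2 * n" if "e \<in> wins_dev" for e
    using 2(1) ps that wins_eq(1) True unfolding large_def deviation_eq by fastforce
   thus ?thesis using wins_eq deviation_count True by (simp add: deviation_eq divide_right_mono)
  qed (simp add: wins_empty)
  hence "mean ?L ?F \<le> mean ?L ?G" by (rule mean_mono)
  thus ?thesis using 2 True by simp
 next
  case 3
  hence "\<not> large h f T n xs" using large_winnable by blast
  moreover have "mean ?L ?F = 0" using 3 by (simp add: winnable_def mean_def)
  ultimately show ?thesis unfolding first[of "\<lambda>i. col_act \<beta> ncol"] using G 3 True h(2) by (simp add: field_simps)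
 qed
qed

abbreviation share_cheat where
 "share_cheat f c z \<equiv> (\<lambda>v. guarded ID v (cheat f c z v))"
abbreviation share_wins where
 "share_wins y f c z T n xs pr \<equiv> wins (S.deviation 0 (\<lambda>v b. share_cheat f c z v)) {..<2} sharing_legal z 0 (View y (0, z) []) T n ((!) xs) ((!) pr)"
abbreviation share_hon where
 "share_hon y z T n xs pr \<equiv> wins (\<lambda>i. sharing_act \<beta> 1 {0, 1} parity) {..<2} sharing_legal z 0 (View y (0, z) []) T n ((!) xs) ((!) pr)"

text \<open>If the run is \<open>large\<close>, the cheat reaches both outcomes on every tape.
  Otherwise it still reaches the parity of the inputs of the real agents, which is the preference of
  agent \<open>0\<close> in one of the two cases.\<close>

lemma share_win:
 assumes n: "n \<in> set_pmf \<sigma>" "xs \<in> id_lists ID n" "8 * \<beta> \<le> T" and h: "h = View (xs ! 0) c []"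
  and f: "no_collision ID (\<lambda>v. return_pmf (f v))"
  and qs: "qs \<in> lists_of (n - 1) ({0, 1} \<times> {0, 1})" and T': "8 * \<beta> \<le> T'" and e: "e \<in> tapes n T' {..<2}"
 shows "of_bool (winnable h f T n xs) + of_bool (large h f T n xs)
  \<le> (of_bool (e \<in> share_wins (xs ! 0) f c 0 T' n xs ((0, 0) # qs)) + of_bool (e \<in> share_wins (xs ! 0) f c 1 T' n xs ((0, 1) # qs)) :: nat)"
proof (cases "winnable h f T n xs")
 case False
 thus ?thesis using large_winnable by (auto simp: of_bool_def)
next
 case True
 let ?m = "\<lambda>ps e. coloring_run.m n ((!) xs) (coloring_deviation.dev \<beta> ncol n ((!) xs) ((!) ps) T 0 f e) T"
 obtain ps e1 where w: "ps \<in> lists_of n {..<ncol}" "e1 \<in> dev_wins 0 h f T n xs ps" "large h f T n xs ==> 2 * n \<le> ?m ps e1 + 1"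
  using True unfolding winnable_def large_def by blast
 have n3: "3 \<le> n" "n \<le> \<beta>" using n sizes by auto
 have c: "ps ! 0 = c"
 proof (rule ccontr)
  assume "ps ! 0 \<noteq> c"
  thus False using w(2) by (simp add: wins_empty h)
 qed
 interpret D: coloring_deviation \<beta> ncol n "(!) xs" "(!) ps" T 0 f h by (rule deviation_instance[OF n(1,2) w(1) n(3) _ f]) simp
 have "e1 \<in> D.wins_dev" using w(2) D.wins_eq(1) c by (simp add: deviation_eq h)
 then interpret W: winning_run \<beta> ncol n "(!) xs" "(!) ps" "D.dev e1" T "D.cell e1" by (rule D.dev_run)
 define R where "R i = e ! (2 * W.m - 1) ! i" for i
 define pr where "pr z = (!) ((0::nat, z::nat) # qs)" for z
 have bits: "fst (pr z i) \<in> {0, 1} \<and> R i \<in> {0, 1}" if "1 \<le> i" "i < n" for i z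
 proof -
  have "i - 1 < n - 1" using that by simp
  hence "qs ! (i - 1) \<in> {0, 1} \<times> {0, 1}" by (rule lists_ofD(2)[OF qs])
  moreover have "2 * W.m - 1 < T'" using W.m3 T' by linarith
  hence "R i < 2" using tapesD(3)[OF e, of "2 * W.m - 1" i] that by (simp add: R_def)
  ultimately show ?thesis using that by (auto simp: pr_def nth_Cons')
 qed
 have f0: "D.dev e1 0 t = f (trace_view n ((!) xs) ((!) ps) (D.dev e1) 0 t)" for t
  using D.dev_eq[of 0 e1 t] n3 by simp
 have sc: "sharing_cheat \<beta> n W.m ((!) xs) W.Y (\<lambda>i. fst (pr z i)) R z c f (D.dev e1 0) (pr z)" if "z \<in> {0, 1}" for z
  using W.sharing_cheat[where f = f and z = z and pr = "pr z" and rnd = R] f0 that bits c by simp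
 have T4: "4 * W.m \<le> T'" using W.m3 T' by linarith
 have win: "e \<in> share_wins (xs ! 0) f c z T' n xs ((0, z) # qs)"
  if z: "z \<in> {0, 1}" and ok: "W.m + 1 < 2 * n ==> z = (\<Sum>k\<in>{1..<n}. fst (pr 0 k)) mod 2" for z
 proof -
  interpret C: sharing_cheat \<beta> n W.m "(!) xs" W.Y "\<lambda>i. fst (pr z i)" R z c f "D.dev e1 0" "pr z" by (rule sc[OF z])
  have "(\<Sum>k\<in>{1..<n}. fst (pr z k)) = (\<Sum>k\<in>{1..<n}. fst (pr 0 k))"
   by (intro sum.cong) (auto simp: pr_def nth_Cons')
  hence "C.out = z" using C.out_eq ok by (cases "W.m + 1 < 2 * n") auto
  hence "e \<in> wins (\<lambda>i v b. if i = 0 \<and> 0 \<le> length (hist v) then guarded ID v (cheat f c z v) else sharing_act \<beta> 1 {0, 1} parity v b)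
    {..<2} sharing_legal z 0 (View (xs ! 0) (0, z) []) T' n ((!) xs) (pr z)"
   by (intro C.cheat_wins[OF f e T4]) (simp_all add: R_def C.t1_def pr_def)
  thus ?thesis unfolding S.deviation_def[abs_def] pr_def .
 qed
 show ?thesis
 proof (cases "large h f T n xs")
  case True
  hence "\<not> W.m + 1 < 2 * n" using w(3) by simp
  thus ?thesis using win[of 0] win[of 1] by simp
 next
  case False
  define z where "z = (\<Sum>k\<in>{1..<n}. fst (pr 0 k)) mod 2"
  have z: "z = 0 \<or> z = 1" by (auto simp: z_def)
  hence "e \<in> share_wins (xs ! 0) f c z T' n xs ((0, z) # qs)" by (intro win z_def) auto
  with z have "e \<in> share_wins (xs ! 0) f c 0 T' n xs ((0, 0) # qs) \<or> e \<in> share_wins (xs ! 0) f c 1 T' n xs ((0, 1) # qs)"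
   by (elim disjE) (simp_all only: simp_thms)
  thus ?thesis using False by (auto simp: of_bool_def)
 qed
qed

end

lemma (in tape_game) deterministic_best:
 assumes h: "\<exists>vs\<in>set_pmf (honest_run ID P \<sigma> A r). hd vs = h"
 shows "\<exists>f. (\<forall>v. f v \<in> set_pmf (D v)) \<and> expected_utility legal z (output_dist ID P \<sigma> A r h D T)
  \<le> expected_utility legal z (output_dist ID P \<sigma> A r h (\<lambda>v. return_pmf (f v)) T)"
proof -
 let ?M = "belief ID P \<sigma> A r h" and ?H = "honest_run ID P \<sigma> A r"
 have set: "set_pmf ?M = set_pmf ?H \<inter> {vs. hd vs = h}"
  unfolding belief_def using h by (intro set_cond_pmf) auto
 have "finite (set_pmf ?H)" unfolding honest_run_def using finite_prior finite_A by (auto intro!: finite_UN_I finite_exec)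
 hence fin: "finite (set_pmf ?M)" by (simp add: set)
 have supp: "vs \<noteq> [] \<and> length (hist (hd vs)) = r" if w: "vs \<in> set_pmf ?M" for vs
 proof -
  obtain e where e: "e \<in> set_pmf (prior ID P \<sigma>)" "vs \<in> set_pmf (exec A A r e)"
   using w by (auto simp: set honest_run_def)
  then obtain n xs ps where ne: "e = start n ((!) xs) ((!) ps)" "n \<in> set_pmf \<sigma>" unfolding set_prior by blast
  moreover have "0 < n" using sizes ne(2) by fastforce
  ultimately have e0: "e \<noteq> []" "hist (hd e) = []" by (auto simp: start_def hd_map)
  thus ?thesis using exec_hd[OF e(2) e0(1)] by auto
 qed
 have g: "0 \<le> utility legal z (map final_output w) \<and> utility legal z (map final_output w) \<le> 1" for w :: "'p view list"
  by (simp add: utility_def)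
 have "expected_utility legal z (output_dist ID P \<sigma> A r h D' T) = expect (bind_pmf ?M (exec D' A T)) (\<lambda>w. utility legal z (map final_output w))" for D'
  by (simp add: expected_utility_def output_dist_def)
 thus ?thesis using deterministic_deviation[OF fin finite_A g supp, where D = D and k = T] by simp
qed

context coloring_game
begin

text \<open>Per tape the honest agent wins for at most one of the two preferences and the cheat for
  at least \<open>winnable\<close> plus \<open>large\<close> many. The divisor \<open>4\<close> is
  the number of possible values of the private information of agent \<open>0\<close>, one of which
  is fixed by each view.\<close>

lemma share_mean:
 assumes n: "n \<in> set_pmf \<sigma>" "xs \<in> id_lists ID n" "8 * \<beta> \<le> T" and h: "h = View y c []"
  and f: "no_collision ID (\<lambda>v. return_pmf (f v))" and T': "8 * \<beta> \<le> T'"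
 defines "L \<equiv> lists_of n ({0, 1} \<times> {0, 1})" and "\<Omega>' \<equiv> tapes n T' {..<2::nat}"
 shows "(if xs ! 0 = y then of_bool (winnable h f T n xs) + of_bool (large h f T n xs) - 1 else 0) / 4
   + (mean L (\<lambda>pr. card (share_hon y 0 T' n xs pr) / card \<Omega>') + mean L (\<lambda>pr. card (share_hon y 1 T' n xs pr) / card \<Omega>'))
  \<le> mean L (\<lambda>pr. card (share_wins y f c 0 T' n xs pr) / card \<Omega>') + mean L (\<lambda>pr. card (share_wins y f c 1 T' n xs pr) / card \<Omega>')"
proof (cases "xs ! 0 = y")
 case False
 thus ?thesis by (simp add: wins_empty)
next
 case True
 let ?Q = "lists_of (n - 1) ({0, 1} \<times> {0, 1})"
 have n3: "3 \<le> n" using n sizes by auto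
 have fin: "finite \<Omega>'" and card_pos: "0 < card \<Omega>'"
  using S.C finite_tapes[of "{..<2::nat}" n T'] tapes_nonempty[of "{..<2::nat}" n T'] by (auto simp: \<Omega>'_def card_gt_0_iff)
 have first: "mean L (\<lambda>pr. card (wins s {..<2} sharing_legal z 0 (View y (0, z) []) T' n ((!) xs) ((!) pr)) / card \<Omega>')
   = mean ?Q (\<lambda>qs. card (wins s {..<2} sharing_legal z 0 (View y (0, z) []) T' n ((!) xs) ((!) ((0, z) # qs))) / card \<Omega>') / 4"
  if "z \<in> {0, 1}" for s z
  using mean_first[of "{0, 1} \<times> {0, 1}" "(0, z)" n "\<lambda>pr. card (wins s {..<2} sharing_legal z 0 (View y (0, z) []) T' n ((!) xs) ((!) pr)) / card \<Omega>'"]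
   that n3 by (auto simp: wins_empty L_def)
 let ?h = "\<lambda>z qs. share_hon y z T' n xs ((0, z) # qs)" and ?w = "\<lambda>z qs. share_wins y f c z T' n xs ((0, z) # qs)"
 have sub: "?h z qs \<subseteq> \<Omega>'" "?w z qs \<subseteq> \<Omega>'" for z qs unfolding \<Omega>'_def by (rule wins_tapes)+
 have scaled: "a - 1 + (h0 / C + h1 / C) \<le> w0 / C + w1 / C" if "0 < C" "h0 + h1 \<le> C" "a * C \<le> w0 + w1" for a h0 h1 w0 w1 C :: real
 proof -
  have "(h0 + h1) / C \<le> 1" "a \<le> (w0 + w1) / C" using that by (simp_all add: field_simps)
  thus ?thesis by (simp add: add_divide_distrib)
 qed
 define k :: nat where "k = of_bool (winnable h f T n xs) + of_bool (large h f T n xs)"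
 have le: "real k - 1 + (card (?h 0 qs) / card \<Omega>' + card (?h 1 qs) / card \<Omega>')
   \<le> card (?w 0 qs) / card \<Omega>' + card (?w 1 qs) / card \<Omega>'" if qs: "qs \<in> ?Q" for qs
 proof -
  have "?h 0 qs \<inter> ?h 1 qs = {}"
  proof (rule ccontr)
   assume "?h 0 qs \<inter> ?h 1 qs \<noteq> {}"
   then obtain e where e: "e \<in> ?h 0 qs" "e \<in> ?h 1 qs" by blast
   have "(0::nat) = 1" using n3 by (intro honest_sharing_wins[OF _ e]) (auto simp: nth_Cons')
   thus False by simp
  qed
  hence "card (?h 0 qs) + card (?h 1 qs) = card (?h 0 qs \<union> ?h 1 qs)"
   using finite_subset[OF sub(1) fin] by (intro card_Un_disjoint[symmetric]) auto
  also have "\<dots> \<le> card \<Omega>'" using sub by (intro card_mono fin) auto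
  finally have hon: "real (card (?h 0 qs)) + card (?h 1 qs) \<le> card \<Omega>'" by linarith
  have "k * card \<Omega>' = (\<Sum>e\<in>\<Omega>'. k)" by simp
  also have "\<dots> \<le> (\<Sum>e\<in>\<Omega>'. of_bool (e \<in> ?w 0 qs) + of_bool (e \<in> ?w 1 qs))"
  proof (rule sum_mono)
   fix e assume "e \<in> \<Omega>'"
   hence "e \<in> tapes n T' {..<2}" by (simp only: \<Omega>'_def)
   from share_win[OF n _ f qs T' this, of h c]
   show "k \<le> of_bool (e \<in> ?w 0 qs) + of_bool (e \<in> ?w 1 qs)" unfolding k_def True using h by blast
  qed
  also have "\<dots> = card (?w 0 qs) + card (?w 1 qs)"
   by (simp only: sum.distrib sum_of_bool_card[OF fin sub(2)])
  finally have "real (k * card \<Omega>') \<le> real (card (?w 0 qs) + card (?w 1 qs))" by (rule of_nat_mono)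
  hence "real k * real (card \<Omega>') \<le> real (card (?w 0 qs)) + real (card (?w 1 qs))" by (simp only: of_nat_add of_nat_mult)
  thus ?thesis using card_pos by (intro scaled hon) simp_all
 qed
 have Q: "finite ?Q" "?Q \<noteq> {}" by (rule finite_lists_of, simp) (rule lists_of_nonempty, simp)
 have "real k - 1 + (mean ?Q (\<lambda>qs. card (?h 0 qs) / card \<Omega>') + mean ?Q (\<lambda>qs. card (?h 1 qs) / card \<Omega>'))
   = mean ?Q (\<lambda>qs. real k - 1 + (card (?h 0 qs) / card \<Omega>' + card (?h 1 qs) / card \<Omega>'))"
  by (simp only: mean_add mean_const[OF Q])
 also have "\<dots> \<le> mean ?Q (\<lambda>qs. card (?w 0 qs) / card \<Omega>' + card (?w 1 qs) / card \<Omega>')" by (rule mean_mono[OF le])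
 also have "\<dots> = mean ?Q (\<lambda>qs. card (?w 0 qs) / card \<Omega>') + mean ?Q (\<lambda>qs. card (?w 1 qs) / card \<Omega>')" by (rule mean_add)
 finally have all: "real k - 1 + (mean ?Q (\<lambda>qs. card (?h 0 qs) / card \<Omega>') + mean ?Q (\<lambda>qs. card (?h 1 qs) / card \<Omega>'))
   \<le> mean ?Q (\<lambda>qs. card (?w 0 qs) / card \<Omega>') + mean ?Q (\<lambda>qs. card (?w 1 qs) / card \<Omega>')" .
 have k: "of_bool (winnable h f T n xs) + of_bool (large h f T n xs) = real k" by (simp add: k_def)
 have z: "(0::nat) \<in> {0, 1}" "(1::nat) \<in> {0, 1}" by simp_all
 have quarter: "t / 4 + (h0 / 4 + h1 / 4) \<le> w0 / 4 + w1 / 4" if "t + (h0 + h1) \<le> w0 + w1" for t h0 h1 w0 w1 :: real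
  using that by linarith
 show ?thesis unfolding if_P[OF True] first[OF z(1)] first[OF z(2)] k by (rule quarter[OF all])
qed

text \<open>The inequalities of the equilibrium for the preferences \<open>0\<close> and
  \<open>1\<close> are added and compared with \<open>share_mean\<close>, whereby the honest terms
  cancel. The prior of sizes and ids is that of the coloring game, so the average is the very one
  that \<open>first_round\<close> leads to.\<close>

lemma sharing_bound:
 assumes sharing: "sharing_equilibrium ID \<sigma> \<beta> N" and N: "N \<in> set_pmf \<sigma>" "xs0 \<in> id_lists ID N"
  and h: "h = View (xs0 ! 0) c []" and T: "8 * \<beta> \<le> T" and f: "no_collision ID (\<lambda>v. return_pmf (f v))"
 shows "average ID \<sigma> (\<lambda>n xs. if xs ! 0 = xs0 ! 0 then of_bool (winnable h f T n xs) + of_bool (large h f T n xs) - 1 else 0) \<le> 0"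
proof -
 let ?P = "{0, 1} \<times> {0, 1} :: (nat \<times> nat) set" and ?A = "sharing_protocol \<beta> 1 {0, 1} parity" and ?y = "xs0 ! 0"
 let ?D = "\<lambda>z v. return_pmf (share_cheat f c z v)"
 have n0: "0 < N" using N sizes by auto
 have eq: "equilibrium ID ?P \<sigma> sharing_legal snd ?A N"
 proof -
  have "{0, 1::nat} \<noteq> {} \<and> {0, 1::nat} \<subseteq> {..<2 ^ 1} \<and> card (output_space {0, 1} parity) = 2 \<and> full_knowledge {0, 1} parity"
   using full_knowledge_parity unfolding output_space_parity by simp
  thus ?thesis using sharing output_space_parity unfolding sharing_equilibrium_def by metis
 qed
 have start: "\<exists>vs\<in>set_pmf (honest_run ID ?P \<sigma> ?A 0). length vs = N \<and> hd vs = View ?y (0, z) []" if z: "z \<in> {0, 1}" for z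
 proof -
  have "exec ?A ?A 0 = return_pmf" by (rule ext) simp
  hence "honest_run ID ?P \<sigma> ?A 0 = prior ID ?P \<sigma>" by (simp add: honest_run_def bind_return_pmf')
  moreover have "replicate N (0, z) \<in> lists_of N ?P" using z by (auto simp: lists_of_def)
  hence "start N ((!) xs0) ((!) (replicate N (0, z))) \<in> set_pmf (prior ID ?P \<sigma>)" unfolding S.set_prior using N by blast
  moreover have "hd (start N ((!) xs0) ((!) (replicate N (0, z)))) = View ?y (0, z) []" using n0 by (simp add: start_def hd_map)
  ultimately show ?thesis by (intro bexI[of _ "start N ((!) xs0) ((!) (replicate N (0, z)))"]) simp_all
 qed
 have "\<forall>\<^sub>F T' in sequentially. expected_utility sharing_legal z (output_dist ID ?P \<sigma> ?A 0 (View ?y (0, z) []) (?D z) T')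
   \<le> expected_utility sharing_legal z (output_dist ID ?P \<sigma> ?A 0 (View ?y (0, z) []) ?A T')" if z: "z \<in> {0, 1}" for z
  using eq start[OF z] no_collision_guarded[of ID "cheat f c z"] unfolding equilibrium_def by fastforce
 \<comment> \<open>Both inequalities hold from some horizon on, so one horizon can be chosen for
   both of them that also lies beyond the end of all runs.\<close>
 from eventually_conj[OF eventually_conj[OF this[of 0] this[of 1]] eventually_ge_at_top[of "8 * \<beta>"]]
 obtain T' where T': "8 * \<beta> \<le> T'"
  and eu: "\<And>z. z \<in> {0, 1} ==> expected_utility sharing_legal z (output_dist ID ?P \<sigma> ?A 0 (View ?y (0, z) []) (?D z) T')
   \<le> expected_utility sharing_legal z (output_dist ID ?P \<sigma> ?A 0 (View ?y (0, z) []) ?A T')"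
  using eventually_happens'[OF sequentially_bot] by fastforce
 let ?w = "\<lambda>z n xs. mean (lists_of n ?P) (\<lambda>pr. card (share_wins ?y f c z T' n xs pr) / card (tapes n T' {..<2::nat}))"
 let ?h = "\<lambda>z n xs. mean (lists_of n ?P) (\<lambda>pr. card (share_hon ?y z T' n xs pr) / card (tapes n T' {..<2::nat}))"
 have le: "average ID \<sigma> (?w z) \<le> average ID \<sigma> (?h z)" if z: "z \<in> {0, 1}" for z
 proof -
  let ?p = "measure_pmf.prob (honest_run ID ?P \<sigma> ?A 0) {vs. hd vs = View ?y (0, z) []}"
  have ex: "\<exists>vs\<in>set_pmf (honest_run ID ?P \<sigma> ?A 0). hd vs = View ?y (0, z) []" using start[OF z] by blast
  have const: "?D z v = map_pmf (\<lambda>b. share_cheat f c z v) (pmf_of_set {..<2::nat})" for v by simp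
  have D: "?p * expected_utility sharing_legal z (output_dist ID ?P \<sigma> ?A 0 (View ?y (0, z) []) (?D z) T') = average ID \<sigma> (?w z)"
   using S.expected_utility_total(1)[OF ex, of T' "?D z" "\<lambda>v b. share_cheat f c z v" sharing_legal z, OF const]
   unfolding S.total_average add_0 .
  have A: "?p * expected_utility sharing_legal z (output_dist ID ?P \<sigma> ?A 0 (View ?y (0, z) []) ?A T') = average ID \<sigma> (?h z)"
   using S.expected_utility_total(1)[OF ex, of T' ?A "sharing_act \<beta> 1 {0, 1} parity" sharing_legal z, OF S.A[of _ "0 + T'"]]
   unfolding S.total_average S.deviation_self add_0 .
  have "0 \<le> ?p" by simp
  thus ?thesis using mult_left_mono[OF eu[OF z], of ?p] unfolding D A by blast
 qed
 let ?c = "\<lambda>n xs. if xs ! 0 = ?y then of_bool (winnable h f T n xs) + of_bool (large h f T n xs) - 1 else (0::real)"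
 have "average ID \<sigma> (\<lambda>n xs. 1 / 4 * ?c n xs + (?h 0 n xs + ?h 1 n xs)) \<le> average ID \<sigma> (\<lambda>n xs. ?w 0 n xs + ?w 1 n xs)"
  using share_mean[OF _ _ T h f T'] by (intro average_mono) simp
 hence "1 / 4 * average ID \<sigma> ?c + (average ID \<sigma> (?h 0) + average ID \<sigma> (?h 1)) \<le> average ID \<sigma> (?w 0) + average ID \<sigma> (?w 1)"
  by (simp only: average_add average_cmult)
 thus ?thesis using le[of 0] le[of 1] by simp
qed

text \<open>For \<open>r > 0\<close> the deviation loses in every single ring, by
  \<open>later_round\<close>. For \<open>r = 0\<close> it may gain in some rings, and only the mean
  over sizes and ids, which enters through the belief of the agent, is controlled.\<close>

lemma no_gain:
 assumes sharing: "sharing_equilibrium ID \<sigma> \<beta> N" and N: "N \<in> set_pmf \<sigma>"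
  and vs: "vs \<in> set_pmf (honest_run ID {..<ncol} \<sigma> (coloring_algorithm \<beta> ncol) r)" "length vs = N" "hd vs = h"
  and D: "no_collision ID D" and T: "8 * \<beta> \<le> T"
 shows "expected_utility coloring_legal (priv h) (output_dist ID {..<ncol} \<sigma> (coloring_algorithm \<beta> ncol) r h D T)
  \<le> expected_utility coloring_legal (priv h) (output_dist ID {..<ncol} \<sigma> (coloring_algorithm \<beta> ncol) r h (coloring_algorithm \<beta> ncol) T)"
proof -
 let ?A = "coloring_algorithm \<beta> ncol" and ?p = "measure_pmf.prob (honest_run ID {..<ncol} \<sigma> (coloring_algorithm \<beta> ncol) r) {vs. hd vs = h}"
 have ex: "\<exists>vs\<in>set_pmf (honest_run ID {..<ncol} \<sigma> ?A r). hd vs = h" using vs by blast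
 obtain f where f: "\<And>v. f v \<in> set_pmf (D v)"
  and better: "expected_utility coloring_legal (priv h) (output_dist ID {..<ncol} \<sigma> ?A r h D T)
   \<le> expected_utility coloring_legal (priv h) (output_dist ID {..<ncol} \<sigma> ?A r h (\<lambda>v. return_pmf (f v)) T)"
  using G.deterministic_best[OF ex] by blast
 have nc: "no_collision ID (\<lambda>v. return_pmf (f v))" using D f by (fastforce simp: no_collision_def)
 let ?F = "\<lambda>n xs. mean (lists_of n {..<ncol}) (\<lambda>ps. card (dev_wins r h f (r + T) n xs ps) / card (tapes n (r + T) (col_cells (r + T))))"
 let ?G = "\<lambda>n xs. mean (lists_of n {..<ncol}) (\<lambda>ps. card (hon_wins r h (r + T) n xs ps) / card (tapes n (r + T) (col_cells (r + T))))"
 have const: "return_pmf (f v) = map_pmf (\<lambda>b. f v) (pmf_of_set (col_cells (r + T)))" for v by simp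
 have F: "?p * expected_utility coloring_legal (priv h) (output_dist ID {..<ncol} \<sigma> ?A r h (\<lambda>v. return_pmf (f v)) T) = average ID \<sigma> ?F"
  using G.expected_utility_total(1)[OF ex, of T "\<lambda>v. return_pmf (f v)" "\<lambda>v b. f v" coloring_legal "priv h", OF const]
  by (simp add: G.total_average)
 have H: "?p * expected_utility coloring_legal (priv h) (output_dist ID {..<ncol} \<sigma> ?A r h ?A T) = average ID \<sigma> ?G"
  using G.expected_utility_total(1)[OF ex, of T ?A "col_act \<beta> ncol" coloring_legal "priv h", OF G.A]
  by (simp add: G.total_average G.deviation_self)
 have pos: "0 < ?p"
  using G.expected_utility_total(2)[OF ex, of T ?A "col_act \<beta> ncol", OF G.A] .
 have "average ID \<sigma> ?F \<le> average ID \<sigma> ?G"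
 proof (cases "r = 0")
  case False
  thus ?thesis
   using later_round[OF _ _ _ _ _ nc, of _ _ _ "r + T" r h] T
   by (intro average_mono mean_mono divide_right_mono) auto
 next
  case True
  have "exec ?A ?A 0 = return_pmf" by (rule ext) simp
  hence "vs \<in> set_pmf (prior ID {..<ncol} \<sigma>)" using vs(1) True by (simp add: honest_run_def bind_return_pmf')
  then obtain n xs0 ps where v: "vs = start n ((!) xs0) ((!) ps)" "n \<in> set_pmf \<sigma>" "xs0 \<in> id_lists ID n" "ps \<in> lists_of n {..<ncol}"
   unfolding G.set_prior by blast
  have n: "n = N" "0 < n" using v vs(2) sizes by auto
  have h: "h = View (xs0 ! 0) (ps ! 0) []" "ps ! 0 < ncol"
   using vs(3) v(1) n(2) lists_ofD(2)[OF v(4) n(2)] by (simp_all add: start_def hd_map)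
  let ?c = "\<lambda>n xs. if xs ! 0 = xs0 ! 0 then of_bool (winnable h f T n xs) + of_bool (large h f T n xs) - 1 else (0::real)"
  have "average ID \<sigma> ?F \<le> average ID \<sigma> (\<lambda>n xs. ?G n xs + 1 / (2 * ncol) * ?c n xs)"
   using first_round[OF _ _ T h nc] True by (intro average_mono) simp
  also have "\<dots> = average ID \<sigma> ?G + 1 / (2 * ncol) * average ID \<sigma> ?c" by (simp only: average_add average_cmult)
  also have "\<dots> \<le> average ID \<sigma> ?G"
  proof -
   have "average ID \<sigma> ?c \<le> 0" using sharing_bound[OF sharing _ _ h(1) T nc] N v(3) n(1) by simp
   hence "1 / (2 * ncol) * average ID \<sigma> ?c \<le> 0" by (intro mult_nonneg_nonpos) simp_all
   thus ?thesis by linarith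
  qed
  finally show ?thesis .
 qed
 hence "?p * expected_utility coloring_legal (priv h) (output_dist ID {..<ncol} \<sigma> ?A r h (\<lambda>v. return_pmf (f v)) T)
   \<le> ?p * expected_utility coloring_legal (priv h) (output_dist ID {..<ncol} \<sigma> ?A r h ?A T)" unfolding F H .
 thus ?thesis using better mult_le_cancel_left_pos[OF pos] order_trans by blast
qed

end

theorem theorem5p2:
  fixes \<sigma> :: "nat pmf" and \<alpha> \<beta> N ncol :: nat and ID :: "nat set"
  assumes finite_support: "set_pmf \<sigma> \<subseteq> {\<alpha>..\<beta>}"
    and ring_sizes: "\<forall>n\<in>set_pmf \<sigma>. n \<ge> 3"
    and ring: "N \<in> set_pmf \<sigma>"
    and ids: "finite ID" "card ID \<ge> \<beta>"
    and colors: "ncol \<ge> 3"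
    and sharing: "sharing_equilibrium ID \<sigma> \<beta> N"
  shows "coloring_equilibrium ID \<sigma> \<beta> ncol N"
proof -
  interpret coloring_game ID \<sigma> \<beta> ncol
    using finite_support ring_sizes ids colors by unfold_locales auto
  show ?thesis
    unfolding coloring_equilibrium_def equilibrium_def
    using no_gain[OF sharing ring] by (blast intro: eventually_sequentiallyI[of "8 * \<beta>"])
qed

end
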